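(* Let $T>0$, $x_0\in\mathbb{R}^n$, and let $b,h_{ij},\sigma_j:[0,T]\times\mathbb{R}^n\times\mathcal{D}\to\mathbb{R}^n$ ($1\le i,j\le d$) satisfy: (H1) there exists $K>0$ such that for all $t\in[0,T]$, $x,y\in\mathbb{R}^n$, $f^1,f^2\in\mathcal{D}$ and all $i,j$, $$|b(t,x,f^1)-b(t,y,f^2)|+|h_{ij}(t,x,f^1)-h_{ij}(t,y,f^2)|+|\sigma_j(t,x,f^1)-\sigma_j(t,y,f^2)|\le K\big(|x-y|+d_1(f^1,f^2)\big);$$ (H2) for each $x\in\mathbb{R}^n$, each $F\in\mathcal{D}^T$ and all $i,j$, the functions $b(\cdot,x,F_\cdot)$, $h_{ij}(\cdot,x,F_\cdot)$, $\sigma_j(\cdot,x,F_\cdot)$ belong to $L^2(0,T;\mathbb{R}^n)$. Then there exists a unique solution $(X_t)_{t\in[0,T]}\in\bar M_G^2(0,T;\mathbb{R}^n)$ of the distribution dependent $G$-SDE $$X_t=x_0+\int_0^t b(s,X_s,\mathbb{F}_s^X)\,ds+\sum_{i,j=1}^d\int_0^t h_{ij}(s,X_s,\mathbb{F}_s^X)\,d\langle B\rangle_s^{ij}+\sum_{j=1}^d\int_0^t\sigma_j(s,X_s,\mathbb{F}_s^X)\,dB_s^j,\quad t\in[0,T].$$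
   Context: Fix $n,d\in\mathbb{N}$. Lipschitz functions. $C_{Lip}(\mathbb{R}^n)$ is the linear space of Lipschitz functions $\varphi:\mathbb{R}^n\to\mathbb{R}$; $C_\varphi$ denotes the minimal Lipschitz constant of $\varphi$. $C_{b.Lip}$ denotes the bounded functions in $C_{Lip}$. Spaces $\mathcal{D}$, $\mathcal{D}^T$. $\mathcal{D}$ is the set of functionals $f:C_{Lip}(\mathbb{R}^n)\to\mathbb{R}$ that are monotone ($\varphi\ge\psi\Rightarrow f(\varphi)\ge f(\psi)$), constant preserving ($f(c)=c$ for $c\in\mathbb{R}$), sub-additive ($f(\varphi+\psi)\le f(\varphi)+f(\psi)$) and positively homogeneous ($f(\lambda\varphi)=\lambda f(\varphi)$, $\lambda\ge0$), and satisfy $\sup_{C_\varphi\le1}|f(\varphi)-\varphi(\mathbf{0})|<\infty$. Its metric is $d_1(f^1,f^2)=\sup_{C_\varphi\le1}|f^1(\varphi)-f^2(\varphi)|$. $\mathcal{D}^T$ is the set of families $F=(F_t)_{t\in[0,T]}$ with $F_t\in\mathcal{D}$ for all $t$ and $\sup_{t\in[0,T]}\sup_{C_\varphi\le1}|F_t(\varphi)-\varphi(\mathbf{0})|<\infty$. $G$-framework (Peng). $\Omega$ is the space of continuous paths $\omega:[0,\infty)\to\mathbb{R}^d$ with $\omega_0=\mathbf{0}$, $B_t(\omega)=\omega_t$, $\Omega_T=\{\omega_{\cdot\wedge T}:\omega\in\Omega\}$, and $Lip(\Omega_T)=\{\varphi(B_{t_1},\dots,B_{t_m}): m\ge1,\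 t_1,\dots,t_m\in[0,T],\ \varphi\in C_{b.Lip}(\mathbb{R}^{d\times m})\}$. $\hat{\mathbb{E}}$ is Peng's $G$-expectation, the consistent sublinear expectation (monotone, constant preserving, sub-additive, positively homogeneous) under which $B$ is a $G$-Brownian motion: increments $B_{t+s}-B_t$ are distributed as $\sqrt{s}B_1$, are independent (in Peng's sense) from $(B_{t_1},\dots,B_{t_m})$, $t_i\le t$, and $B_1$ is $G$-normally distributed, with $G(A)=\frac12\hat{\mathbb{E}}[\langle AB_1,B_1\rangle]$ for symmetric $d\times d$ matrices $A$. $L_G^p(\Omega_T)$ is the completion of $Lip(\Omega_T)$ under $(\hat{\mathbb{E}}[|X|^p])^{1/p}$, and $\hat{\mathbb{E}}$ extends continuously to it. $M_G^{p,0}(0,T)$ is the set of simple processes $\eta_t=\sum_{k=0}^{N-1}\xi_k\mathbf{1}_{[t_k,t_{k+1})}(t)$, $0=t_0<\dots<t_N=T$, $\xi_k\in Lip(\Omega_{t_k})$. $M_G^p(0,T)$ is its completion under $(\hat{\mathbb{E}}[\int_0^T|\eta_t|^pdt])^{1/p}$ and $\bar M_G^p(0,T)\subset M_G^p(0,T)$ its completion under $(\int_0^T\hat{\mathbb{E}}[|\eta_t|^p]dt)^{1/p}$; $M_G^p(0,T;\mathbb{R}^n)$, $\bar M_G^p(0,T;\mathbb{R}^n)$ are the $\mathbb{R}^n$-valued versions. Integrals. $(\mathbf{e}_1,\dots,\mathbf{e}_d)$ is a given orthonormal basis of $\mathbb{R}^d$. For $\mathbf{a}\in\mathbb{R}^d$,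 $B^{\mathbf{a}}_t=\langle\mathbf{a},B_t\rangle$ and $B^j=B^{\mathbf{e}_j}$. $\int_0^T\eta_tdB_t^{\mathbf{a}}=\sum_k\xi_k(B^{\mathbf{a}}_{t_{k+1}}-B^{\mathbf{a}}_{t_k})$ for simple $\eta$, extended continuously to $M_G^2(0,T)\to L_G^2(\Omega_T)$. $\langle B^{\mathbf{a}}\rangle_t=(B_t^{\mathbf{a}})^2-2\int_0^tB_s^{\mathbf{a}}dB_s^{\mathbf{a}}$, and $\int_0^T\eta_t\,d\langle B^{\mathbf{a}}\rangle_t$ is the continuous extension to $M_G^1(0,T)\to L_G^1(\Omega_T)$ of $\sum_k\xi_k(\langle B^{\mathbf{a}}\rangle_{t_{k+1}}-\langle B^{\mathbf{a}}\rangle_{t_k})$. $\langle B^{\mathbf{a}},B^{\bar{\mathbf{a}}}\rangle=\frac14(\langle B^{\mathbf{a}+\bar{\mathbf{a}}}\rangle-\langle B^{\mathbf{a}-\bar{\mathbf{a}}}\rangle)$, with integrals defined accordingly, and $\langle B\rangle^{ij}=\langle B^i,B^j\rangle$. Distribution. For an $\mathbb{R}^n$-valued process $X$, $\mathbb{F}_t^X(\varphi)=\hat{\mathbb{E}}[\varphi(X_t)]$ for $\varphi\in C_{Lip}(\mathbb{R}^n)$; $(\mathbb{F}_t^X)_{t\in[0,T]}$ is the distribution of $X$. A solution is a process $X\in\bar M_G^2(0,T;\mathbb{R}^n)$ satisfying the equation. *)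

theory Defs
  imports "HOL-Analysis.Analysis"
begin

section \<open>Lipschitz functions\<close>

definition C_Lip :: "('a::metric_space \<Rightarrow> real) set" where
  "C_Lip = {\<phi>. \<exists>L. L-lipschitz_on UNIV \<phi>}"

definition C_bLip :: "('a::metric_space \<Rightarrow> real) set" where
  "C_bLip = {\<phi> \<in> C_Lip. bounded (range \<phi>)}"

definition lip_const :: "('a::metric_space \<Rightarrow> real) \<Rightarrow> real" where
  "lip_const \<phi> = Inf {L. L-lipschitz_on UNIV \<phi>}"

text \<open>
  Bounded Lipschitz functions on \<open>(\<real>\<^sup>d)\<^sup>m\<close> with its Euclidean distance.  As \<open>m\<close> varies inside
  the definitions below, an \<open>m\<close>-tuple is a list of length \<open>m\<close>; values at lists of other
  lengths are irrelevant.
\<close>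

definition C_bLip_tuple :: "nat \<Rightarrow> ('a::metric_space list \<Rightarrow> 'v::real_normed_vector) set" where
  "C_bLip_tuple m = {\<phi>.
     (\<exists>C. \<forall>xs. length xs = m \<longrightarrow> norm (\<phi> xs) \<le> C) \<and>
     (\<exists>L. \<forall>xs ys. length xs = m \<longrightarrow> length ys = m \<longrightarrow>
        dist (\<phi> xs) (\<phi> ys) \<le> L * L2_set (\<lambda>i. dist (xs ! i) (ys ! i)) {..<m})}"


section \<open>The spaces of sublinear distributions\<close>

text \<open>
  A functional on \<open>C_Lip\<close> is an extensional function, so that elements of \<open>\<D>\<close> are
  determined by their values on \<open>C_Lip\<close>.
\<close>

definition lip_ball :: "(real^'n \<Rightarrow> real) set" where
  "lip_ball = {\<phi> \<in> C_Lip. lip_const \<phi> \<le> 1}"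

definition distr_space :: "((real^'n \<Rightarrow> real) \<Rightarrow> real) set" ("\<D>") where
  "\<D> = {f \<in> extensional C_Lip.
     (\<forall>\<phi>\<in>C_Lip. \<forall>\<psi>\<in>C_Lip. (\<forall>x. \<psi> x \<le> \<phi> x) \<longrightarrow> f \<psi> \<le> f \<phi>) \<and>
     (\<forall>c. f (\<lambda>x. c) = c) \<and>
     (\<forall>\<phi>\<in>C_Lip. \<forall>\<psi>\<in>C_Lip. f (\<lambda>x. \<phi> x + \<psi> x) \<le> f \<phi> + f \<psi>) \<and>
     (\<forall>\<phi>\<in>C_Lip. \<forall>r\<ge>0. f (\<lambda>x. r * \<phi> x) = r * f \<phi>) \<and>
     bdd_above ((\<lambda>\<phi>. \<bar>f \<phi> - \<phi> 0\<bar>) ` lip_ball)}"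

definition d\<^sub>1 :: "((real^'n \<Rightarrow> real) \<Rightarrow> real) \<Rightarrow> ((real^'n \<Rightarrow> real) \<Rightarrow> real) \<Rightarrow> real" where
  "d\<^sub>1 f g = (SUP \<phi>\<in>lip_ball. \<bar>f \<phi> - g \<phi>\<bar>)"

definition distr_flow :: "real \<Rightarrow> (real \<Rightarrow> (real^'n \<Rightarrow> real) \<Rightarrow> real) set" where
  "distr_flow T = {F. (\<forall>t\<in>{0..T}. F t \<in> \<D>) \<and>
     bdd_above ((\<lambda>(t, \<phi>). \<bar>F t \<phi> - \<phi> 0\<bar>) ` ({0..T} \<times> lip_ball))}"


section \<open>Completion of a pseudometric space\<close>

text \<open>
  The completion of a set \<open>S\<close> with pseudometric \<open>d\<close> is the set of equivalence classes of
  Cauchy sequences in \<open>S\<close>.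
\<close>

definition cauchy_seqs :: "'a set \<Rightarrow> ('a \<Rightarrow> 'a \<Rightarrow> real) \<Rightarrow> (nat \<Rightarrow> 'a) set" where
  "cauchy_seqs S d = {u. (\<forall>k. u k \<in> S) \<and>
     (\<forall>\<epsilon>>0. \<exists>M. \<forall>k\<ge>M. \<forall>l\<ge>M. d (u k) (u l) < \<epsilon>)}"

definition cauchy_rel :: "'a set \<Rightarrow> ('a \<Rightarrow> 'a \<Rightarrow> real) \<Rightarrow> ((nat \<Rightarrow> 'a) \<times> (nat \<Rightarrow> 'a)) set" where
  "cauchy_rel S d = {(u, v). u \<in> cauchy_seqs S d \<and> v \<in> cauchy_seqs S d \<and>
     (\<lambda>k. d (u k) (v k)) \<longlonglongrightarrow> 0}"

definition completion :: "'a set \<Rightarrow> ('a \<Rightarrow> 'a \<Rightarrow> real) \<Rightarrow> (nat \<Rightarrow> 'a) set set" where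
  "completion S d = cauchy_seqs S d // cauchy_rel S d"

definition cauchy_class :: "'a set \<Rightarrow> ('a \<Rightarrow> 'a \<Rightarrow> real) \<Rightarrow> (nat \<Rightarrow> 'a) \<Rightarrow> (nat \<Rightarrow> 'a) set" where
  "cauchy_class S d u = cauchy_rel S d `` {u}"

definition completion_dist ::
  "('a \<Rightarrow> 'a \<Rightarrow> real) \<Rightarrow> (nat \<Rightarrow> 'a) set \<Rightarrow> (nat \<Rightarrow> 'a) set \<Rightarrow> real" where
  "completion_dist d U V = (THE r. \<forall>u\<in>U. \<forall>v\<in>V. (\<lambda>k. d (u k) (v k)) \<longlonglongrightarrow> r)"

text \<open>
  The continuous extension to a completion of a map \<open>f\<close> with values in a complete metric
  space with carrier \<open>C\<close> and metric \<open>D\<close>.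
\<close>

definition cont_extension ::
  "'b set \<Rightarrow> ('b \<Rightarrow> 'b \<Rightarrow> real) \<Rightarrow> ('a \<Rightarrow> 'b) \<Rightarrow> (nat \<Rightarrow> 'a) set \<Rightarrow> 'b" where
  "cont_extension C D f U = (THE V. V \<in> C \<and> (\<forall>u\<in>U. (\<lambda>k. D (f (u k)) V) \<longlonglongrightarrow> 0))"


section \<open>Path space and cylinder random variables\<close>

text \<open>Paths are extended by \<open>0\<close> to negative times, so that they are determined by their
  restriction to \<open>[0,\<infinity>)\<close>.\<close>

typedef ('d::finite) path =
  "{\<omega> :: real \<Rightarrow> real^'d. continuous_on {0..} \<omega> \<and> (\<forall>t\<le>0. \<omega> t = 0)}"
  by (rule exI[of _ "\<lambda>_. 0"]) simp

definition B :: "real \<Rightarrow> ('d::finite) path \<Rightarrow> real^'d" where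
  "B t \<omega> = Rep_path \<omega> t"

definition Lip :: "real \<Rightarrow> (('d::finite) path \<Rightarrow> 'v::real_normed_vector) set" where
  "Lip T = {X. \<exists>ts \<phi>. ts \<noteq> [] \<and> set ts \<subseteq> {0..T} \<and> \<phi> \<in> C_bLip_tuple (length ts) \<and>
     X = (\<lambda>\<omega>. \<phi> (map (\<lambda>t. B t \<omega>) ts))}"

definition Lip_all :: "(('d::finite) path \<Rightarrow> 'v::real_normed_vector) set" where
  "Lip_all = (\<Union>T\<in>{0..}. Lip T)"

text \<open>
  A simple process \<open>\<Sum>k<N. \<xi> k * indicator {\<tau> k..<\<tau> (k + 1)}\<close> is given by the triple
  \<open>(N, \<tau>, \<xi>)\<close>.  Triples describing the same process have distance \<open>0\<close> in all
  pseudometrics used below and are thus identified in the completions.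
\<close>

type_synonym ('d, 'v) simple_process = "nat \<times> (nat \<Rightarrow> real) \<times> (nat \<Rightarrow> 'd path \<Rightarrow> 'v)"

definition simple_processes ::
  "real \<Rightarrow> ('d::finite, 'v::real_normed_vector) simple_process set" where
  "simple_processes T = {(N, \<tau>, \<xi>). \<tau> 0 = 0 \<and> \<tau> N = T \<and>
     (\<forall>k<N. \<tau> k < \<tau> (Suc k) \<and> \<xi> k \<in> Lip (\<tau> k))}"

definition process_at ::
  "('d::finite, 'v::real_normed_vector) simple_process \<Rightarrow> real \<Rightarrow> 'd path \<Rightarrow> 'v" where
  "process_at = (\<lambda>(N, \<tau>, \<xi>) t \<omega>. \<Sum>k<N. indicator {\<tau> k..<\<tau> (Suc k)} t *\<^sub>R \<xi> k \<omega>)"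


section \<open>Spaces of random variables and processes, stochastic integrals\<close>

context
  fixes E :: "(('d::finite) path \<Rightarrow> real) \<Rightarrow> real"
    and T :: real
begin

subsection \<open>Random variables\<close>

definition lg_pdist ::
  "real \<Rightarrow> ('d path \<Rightarrow> 'v::real_normed_vector) \<Rightarrow> ('d path \<Rightarrow> 'v) \<Rightarrow> real" where
  "lg_pdist p X Y = E (\<lambda>\<omega>. norm (X \<omega> - Y \<omega>) powr p) powr (1 / p)"

text \<open>\<open>LG p\<close> is \<open>L\<^sub>G\<^sup>p(\<Omega>\<^sub>T)\<close>, for random variables with values in \<open>'v\<close>.\<close>

definition LG :: "real \<Rightarrow> (nat \<Rightarrow> 'd path \<Rightarrow> 'v::real_normed_vector) set set" where
  "LG p = completion (Lip T) (lg_pdist p)"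

definition lg_class ::
  "real \<Rightarrow> (nat \<Rightarrow> 'd path \<Rightarrow> 'v::real_normed_vector) \<Rightarrow> (nat \<Rightarrow> 'd path \<Rightarrow> 'v) set" where
  "lg_class p u = cauchy_class (Lip T) (lg_pdist p) u"

definition lg_embed ::
  "real \<Rightarrow> ('d path \<Rightarrow> 'v::real_normed_vector) \<Rightarrow> (nat \<Rightarrow> 'd path \<Rightarrow> 'v) set" where
  "lg_embed p X = lg_class p (\<lambda>k. X)"

definition lg_dist :: "real \<Rightarrow> (nat \<Rightarrow> 'd path \<Rightarrow> 'v::real_normed_vector) set \<Rightarrow>
    (nat \<Rightarrow> 'd path \<Rightarrow> 'v) set \<Rightarrow> real" where
  "lg_dist p = completion_dist (lg_pdist p)"

definition lg_expectation :: "(nat \<Rightarrow> 'd path \<Rightarrow> real) set \<Rightarrow> real" where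
  "lg_expectation U = cont_extension UNIV dist E U"

text \<open>
  The extension of \<open>X \<mapsto> (\<omega> \<mapsto> f \<omega> (X \<omega>))\<close> to a map into \<open>L\<^sub>G\<^sup>p(\<Omega>\<^sub>T)\<close>.  It is used for
  multiplication by bounded random variables, for composition with Lipschitz functions and,
  with \<open>f \<omega> x = x\<close>, for the inclusion of \<open>L\<^sub>G\<^sup>2(\<Omega>\<^sub>T)\<close> in \<open>L\<^sub>G\<^sup>1(\<Omega>\<^sub>T)\<close>.
\<close>

definition lg_map :: "real \<Rightarrow> ('d path \<Rightarrow> 'v::real_normed_vector \<Rightarrow> 'w::real_normed_vector) \<Rightarrow>
    (nat \<Rightarrow> 'd path \<Rightarrow> 'v) set \<Rightarrow> (nat \<Rightarrow> 'd path \<Rightarrow> 'w) set" where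
  "lg_map p f U = cont_extension (LG p) (lg_dist p) (\<lambda>X. lg_embed p (\<lambda>\<omega>. f \<omega> (X \<omega>))) U"

definition lg_sum :: "real \<Rightarrow> ('i \<Rightarrow> (nat \<Rightarrow> 'd path \<Rightarrow> 'v::real_normed_vector) set) \<Rightarrow> 'i set \<Rightarrow>
    (nat \<Rightarrow> 'd path \<Rightarrow> 'v) set" where
  "lg_sum p U I = (\<Union>u \<in> {u. \<forall>i\<in>I. u i \<in> U i}. lg_class p (\<lambda>k \<omega>. \<Sum>i\<in>I. u i k \<omega>))"

definition lg_add :: "real \<Rightarrow> (nat \<Rightarrow> 'd path \<Rightarrow> 'v::real_normed_vector) set \<Rightarrow>
    (nat \<Rightarrow> 'd path \<Rightarrow> 'v) set \<Rightarrow> (nat \<Rightarrow> 'd path \<Rightarrow> 'v) set" where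
  "lg_add p U V = (\<Union>u\<in>U. \<Union>v\<in>V. lg_class p (\<lambda>k \<omega>. u k \<omega> + v k \<omega>))"

definition lg_diff :: "real \<Rightarrow> (nat \<Rightarrow> 'd path \<Rightarrow> 'v::real_normed_vector) set \<Rightarrow>
    (nat \<Rightarrow> 'd path \<Rightarrow> 'v) set \<Rightarrow> (nat \<Rightarrow> 'd path \<Rightarrow> 'v) set" where
  "lg_diff p U V = (\<Union>u\<in>U. \<Union>v\<in>V. lg_class p (\<lambda>k \<omega>. u k \<omega> - v k \<omega>))"


subsection \<open>Processes\<close>

definition mg_pdist :: "real \<Rightarrow> ('d, 'v::real_normed_vector) simple_process \<Rightarrow>
    ('d, 'v) simple_process \<Rightarrow> real" where
  "mg_pdist p \<eta> \<zeta> =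
     E (\<lambda>\<omega>. LINT t:{0..T}|lebesgue. norm (process_at \<eta> t \<omega> - process_at \<zeta> t \<omega>) powr p) powr (1 / p)"

text \<open>\<open>MG p\<close> is \<open>M\<^sub>G\<^sup>p(0,T)\<close>, for processes with values in \<open>'v\<close>.\<close>

definition MG :: "real \<Rightarrow> (nat \<Rightarrow> ('d, 'v::real_normed_vector) simple_process) set set" where
  "MG p = completion (simple_processes T) (mg_pdist p)"

text \<open>
  The completion \<open>MG_bar p\<close> of the simple processes under \<open>(\<integral>\<^sub>0\<^sup>T E[|\<eta>\<^sub>t|\<^sup>p] dt)\<^sup>1\<^sup>/\<^sup>p\<close> is realised
  as a space of \<open>L\<^sub>G\<^sup>p(\<Omega>\<^sub>T)\<close>-valued functions of time (the closure of the simple processes in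
  the corresponding Bochner space), because the values \<open>X\<^sub>t\<close> and their distributions are
  needed.  Its elements are functions, not classes modulo equality for almost every \<open>t\<close>.
\<close>

definition mg_bar_approx :: "real \<Rightarrow> (nat \<Rightarrow> ('d, 'v::real_normed_vector) simple_process) \<Rightarrow>
    (real \<Rightarrow> (nat \<Rightarrow> 'd path \<Rightarrow> 'v) set) \<Rightarrow> bool" where
  "mg_bar_approx p \<eta> X \<longleftrightarrow>
     (\<forall>k. \<eta> k \<in> simple_processes T) \<and>
     (\<forall>k. set_integrable lebesgue {0..T} (\<lambda>t. lg_dist p (lg_embed p (process_at (\<eta> k) t)) (X t) powr p)) \<and>
     (\<lambda>k. LINT t:{0..T}|lebesgue. lg_dist p (lg_embed p (process_at (\<eta> k) t)) (X t) powr p) \<longlonglongrightarrow> 0"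

definition MG_bar :: "real \<Rightarrow> (real \<Rightarrow> (nat \<Rightarrow> 'd path \<Rightarrow> 'v::real_normed_vector) set) set" where
  "MG_bar p = {X. (\<forall>t\<in>{0..T}. X t \<in> LG p) \<and> (\<exists>\<eta>. mg_bar_approx p \<eta> X)}"

text \<open>The inclusion of \<open>MG_bar p\<close> in \<open>MG p\<close>, which extends the identity on simple processes.\<close>

definition mg_incl :: "real \<Rightarrow> (real \<Rightarrow> (nat \<Rightarrow> 'd path \<Rightarrow> 'v::real_normed_vector) set) \<Rightarrow>
    (nat \<Rightarrow> ('d, 'v) simple_process) set" where
  "mg_incl p X = (\<Union>\<eta> \<in> {\<eta>. mg_bar_approx p \<eta> X}. cauchy_class (simple_processes T) (mg_pdist p) \<eta>)"


subsection \<open>Integrals\<close>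

text \<open>
  \<open>integral_simple p A t\<close> is \<open>\<integral>\<^sub>0\<^sup>t \<eta> dA = \<Sum>k<N. \<xi> k * (A (\<tau> (k + 1) \<and> t) - A (\<tau> k \<and> t))\<close> for
  an integrator \<open>A\<close> with values in the scalar space \<open>L\<^sub>G\<^sup>p(\<Omega>\<^sub>T)\<close>, and \<open>integral_upto\<close> is its
  extension to \<open>M\<^sub>G\<^sup>p(0,T)\<close>.
\<close>

definition integral_simple :: "real \<Rightarrow> (real \<Rightarrow> (nat \<Rightarrow> 'd path \<Rightarrow> real) set) \<Rightarrow> real \<Rightarrow>
    ('d, 'v::real_normed_vector) simple_process \<Rightarrow> (nat \<Rightarrow> 'd path \<Rightarrow> 'v) set" where
  "integral_simple p A t = (\<lambda>(N, \<tau>, \<xi>).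
     lg_sum p (\<lambda>k. lg_map p (\<lambda>\<omega> y. y *\<^sub>R \<xi> k \<omega>)
        (lg_diff p (A (min (\<tau> (Suc k)) t)) (A (min (\<tau> k) t)))) {..<N})"

definition integral_upto :: "real \<Rightarrow> (real \<Rightarrow> (nat \<Rightarrow> 'd path \<Rightarrow> real) set) \<Rightarrow> real \<Rightarrow>
    (nat \<Rightarrow> ('d, 'v::real_normed_vector) simple_process) set \<Rightarrow> (nat \<Rightarrow> 'd path \<Rightarrow> 'v) set" where
  "integral_upto p A t = cont_extension (LG p) (lg_dist p) (integral_simple p A t)"

definition time :: "real \<Rightarrow> (nat \<Rightarrow> 'd path \<Rightarrow> real) set" where
  "time t = lg_embed 1 (\<lambda>\<omega>. t)"

text \<open>
  \<open>\<langle>a, B\<^sub>t\<rangle>\<close> is unbounded and hence not in \<open>Lip T\<close>; as an element of \<open>L\<^sub>G\<^sup>2(\<Omega>\<^sub>T)\<close> it is the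
  limit of its truncations.  Likewise for its square in \<open>L\<^sub>G\<^sup>1(\<Omega>\<^sub>T)\<close>.
\<close>

definition B_dir :: "real^'d \<Rightarrow> real \<Rightarrow> (nat \<Rightarrow> 'd path \<Rightarrow> real) set" where
  "B_dir a t = lg_class 2 (\<lambda>N \<omega>. clamp (- real N) (real N) (a \<bullet> B t \<omega>))"

definition B_dir_sq :: "real^'d \<Rightarrow> real \<Rightarrow> (nat \<Rightarrow> 'd path \<Rightarrow> real) set" where
  "B_dir_sq a t = lg_class 1 (\<lambda>N \<omega>. (clamp (- real N) (real N) (a \<bullet> B t \<omega>))\<^sup>2)"

definition quad_var :: "real^'d \<Rightarrow> real \<Rightarrow> (nat \<Rightarrow> 'd path \<Rightarrow> real) set" where
  "quad_var a t = lg_diff 1 (B_dir_sq a t)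
     (lg_map 1 (\<lambda>\<omega> y. 2 * y) (integral_upto 2 (B_dir a) t (mg_incl 2 (B_dir a))))"

definition mutual_var :: "real^'d \<Rightarrow> real^'d \<Rightarrow> real \<Rightarrow> (nat \<Rightarrow> 'd path \<Rightarrow> real) set" where
  "mutual_var a a' t = lg_map 1 (\<lambda>\<omega> y. y / 4) (lg_diff 1 (quad_var (a + a') t) (quad_var (a - a') t))"


subsection \<open>The distribution dependent equation\<close>

definition law :: "(real \<Rightarrow> (nat \<Rightarrow> 'd path \<Rightarrow> real^'n) set) \<Rightarrow> real \<Rightarrow> (real^'n \<Rightarrow> real) \<Rightarrow> real" where
  "law X t = (\<lambda>\<phi>\<in>C_Lip. lg_expectation (lg_map 1 (\<lambda>\<omega> x. \<phi> x) (X t)))"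

text \<open>The process \<open>c(t, X\<^sub>t, F\<^sub>t\<^sup>X)\<close>, where \<open>F\<^sup>X = law X\<close>, with values in \<open>L\<^sub>G\<^sup>p(\<Omega>\<^sub>T;\<real>\<^sup>n)\<close>.\<close>

definition coeff_process ::
  "real \<Rightarrow> (real \<Rightarrow> real^'n \<Rightarrow> ((real^'n \<Rightarrow> real) \<Rightarrow> real) \<Rightarrow> real^'n) \<Rightarrow>
    (real \<Rightarrow> (nat \<Rightarrow> 'd path \<Rightarrow> real^'n) set) \<Rightarrow> real \<Rightarrow> (nat \<Rightarrow> 'd path \<Rightarrow> real^'n) set" where
  "coeff_process p c X t = lg_map p (\<lambda>\<omega> x. c t x (law X t)) (X t)"

text \<open>
  The equation is an identity in \<open>L\<^sub>G\<^sup>1(\<Omega>\<^sub>T;\<real>\<^sup>n)\<close>, which contains the values of all three kinds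
  of integrals.  The integrands have to lie in the domains of the integrals.
\<close>

definition is_solution ::
  "('d \<Rightarrow> real^'d) \<Rightarrow> real^'n \<Rightarrow>
   (real \<Rightarrow> real^'n \<Rightarrow> ((real^'n \<Rightarrow> real) \<Rightarrow> real) \<Rightarrow> real^'n) \<Rightarrow>
   ('d \<Rightarrow> 'd \<Rightarrow> real \<Rightarrow> real^'n \<Rightarrow> ((real^'n \<Rightarrow> real) \<Rightarrow> real) \<Rightarrow> real^'n) \<Rightarrow>
   ('d \<Rightarrow> real \<Rightarrow> real^'n \<Rightarrow> ((real^'n \<Rightarrow> real) \<Rightarrow> real) \<Rightarrow> real^'n) \<Rightarrow>
   (real \<Rightarrow> (nat \<Rightarrow> 'd path \<Rightarrow> real^'n) set) \<Rightarrow> bool" where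
  "is_solution e x\<^sub>0 b h \<sigma> X \<longleftrightarrow>
     X \<in> MG_bar 2 \<and>
     coeff_process 1 b X \<in> MG_bar 1 \<and>
     (\<forall>i j. coeff_process 1 (h i j) X \<in> MG_bar 1) \<and>
     (\<forall>j. coeff_process 2 (\<sigma> j) X \<in> MG_bar 2) \<and>
     (\<forall>t\<in>{0..T}.
        lg_map 1 (\<lambda>\<omega> x. x) (X t) =
        lg_add 1 (lg_embed 1 (\<lambda>\<omega>. x\<^sub>0))
        (lg_add 1 (integral_upto 1 time t (mg_incl 1 (coeff_process 1 b X)))
        (lg_add 1
          (lg_sum 1 (\<lambda>(i, j). integral_upto 1 (mutual_var (e i) (e j)) t
                       (mg_incl 1 (coeff_process 1 (h i j) X))) UNIV)
          (lg_sum 1 (\<lambda>j. lg_map 1 (\<lambda>\<omega> x. x)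
                       (integral_upto 2 (B_dir (e j)) t
                         (mg_incl 2 (coeff_process 2 (\<sigma> j) X)))) UNIV))))"

end


section \<open>The \<open>G\<close>-expectation\<close>

definition ident_distributed :: "(('d::finite path \<Rightarrow> real) \<Rightarrow> real) \<Rightarrow>
    ('d path \<Rightarrow> real^'d) \<Rightarrow> ('d path \<Rightarrow> real^'d) \<Rightarrow> bool" where
  "ident_distributed E X Y \<longleftrightarrow> (\<forall>\<phi>\<in>C_bLip. E (\<lambda>\<omega>. \<phi> (X \<omega>)) = E (\<lambda>\<omega>. \<phi> (Y \<omega>)))"

text \<open>Independence of \<open>Y\<close> from \<open>(X\<^sub>1, \<dots>, X\<^sub>m)\<close> in the sense of Peng, which is not symmetric.\<close>

definition independent_from :: "(('d::finite path \<Rightarrow> real) \<Rightarrow> real) \<Rightarrow>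
    ('d path \<Rightarrow> real^'d) \<Rightarrow> ('d path \<Rightarrow> real^'d) list \<Rightarrow> bool" where
  "independent_from E Y Xs \<longleftrightarrow> (\<forall>\<phi>\<in>C_bLip_tuple (Suc (length Xs)).
     E (\<lambda>\<omega>. \<phi> (map (\<lambda>X. X \<omega>) Xs @ [Y \<omega>])) =
     E (\<lambda>\<omega>. E (\<lambda>\<omega>'. \<phi> (map (\<lambda>X. X \<omega>) Xs @ [Y \<omega>']))))"

definition G_normal :: "(('d::finite path \<Rightarrow> real) \<Rightarrow> real) \<Rightarrow> ('d path \<Rightarrow> real^'d) \<Rightarrow> bool" where
  "G_normal E X \<longleftrightarrow> (\<exists>X'. ident_distributed E X' X \<and> independent_from E X' [X] \<and>
     (\<forall>a\<ge>0. \<forall>b\<ge>0. ident_distributed E (\<lambda>\<omega>. a *\<^sub>R X \<omega> + b *\<^sub>R X' \<omega>) (\<lambda>\<omega>. sqrt (a\<^sup>2 + b\<^sup>2) *\<^sub>R X \<omega>)))"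

text \<open>\<open>\<langle>A B\<^sub>1, B\<^sub>1\<rangle>\<close> as an element of \<open>L\<^sub>G\<^sup>1(\<Omega>\<^sub>1)\<close>, again by truncation.\<close>

definition quad_form_B\<^sub>1 :: "(('d::finite path \<Rightarrow> real) \<Rightarrow> real) \<Rightarrow> real^'d^'d \<Rightarrow>
    (nat \<Rightarrow> 'd path \<Rightarrow> real) set" where
  "quad_form_B\<^sub>1 E A = lg_class E 1 1
     (\<lambda>N \<omega>. let x = clamp (- real N *\<^sub>R One) (real N *\<^sub>R One) (B 1 \<omega>) in (A *v x) \<bullet> x)"

text \<open>
  Only the values of \<open>E\<close> on \<open>Lip_all\<close> matter.  The last assumption says that the quadratic
  forms in \<open>B\<^sub>1\<close> belong to \<open>L\<^sub>G\<^sup>1\<close>, without which \<open>G\<close> would be undefined; Peng's setting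
  contains it implicitly.  It excludes for instance \<open>E X = sup X\<close>, which satisfies all other
  assumptions.
\<close>

locale G_expectation =
  fixes E :: "(('d::finite) path \<Rightarrow> real) \<Rightarrow> real"
    and G :: "real^'d^'d \<Rightarrow> real"
  assumes monotone: "X \<in> Lip_all \<Longrightarrow> Y \<in> Lip_all \<Longrightarrow> (\<And>\<omega>. X \<omega> \<le> Y \<omega>) \<Longrightarrow> E X \<le> E Y"
    and constant_preserving: "E (\<lambda>\<omega>. c) = c"
    and sub_additive: "X \<in> Lip_all \<Longrightarrow> Y \<in> Lip_all \<Longrightarrow> E (\<lambda>\<omega>. X \<omega> + Y \<omega>) \<le> E X + E Y"
    and positively_homogeneous: "X \<in> Lip_all \<Longrightarrow> 0 \<le> r \<Longrightarrow> E (\<lambda>\<omega>. r * X \<omega>) = r * E X"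
    and increments_distributed: "0 \<le> t \<Longrightarrow> 0 \<le> s \<Longrightarrow>
      ident_distributed E (\<lambda>\<omega>. B (t + s) \<omega> - B t \<omega>) (\<lambda>\<omega>. sqrt s *\<^sub>R B 1 \<omega>)"
    and increments_independent: "0 \<le> t \<Longrightarrow> 0 \<le> s \<Longrightarrow> ts \<noteq> [] \<Longrightarrow> set ts \<subseteq> {0..t} \<Longrightarrow>
      independent_from E (\<lambda>\<omega>. B (t + s) \<omega> - B t \<omega>) (map B ts)"
    and normal: "G_normal E (B 1)"
    and G_eq: "transpose A = A \<Longrightarrow>
      quad_form_B\<^sub>1 E A \<in> LG E 1 1 \<and> G A = lg_expectation E (quad_form_B\<^sub>1 E A) / 2"


section \<open>Assumptions on the coefficients\<close>

definition L2_fun :: "real \<Rightarrow> (real \<Rightarrow> 'v::euclidean_space) set" where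
  "L2_fun T = {f. set_borel_measurable lebesgue {0..T} f \<and>
     set_integrable lebesgue {0..T} (\<lambda>t. (norm (f t))\<^sup>2)}"

end

theory Submission
  imports Defs
begin

text \<open>
  Classes in \<open>L\<^sub>G\<^sup>p\<close> are handled through representing sequences of cylinder functions.  Since
  \<open>|B\<^sub>1|\<^sup>2\<close> belongs to \<open>L\<^sub>G\<^sup>1\<close>, the squared increments of \<open>B\<close> are uniformly integrable; together
  with their independence this gives the second moment estimate for \<open>dB\<close>, where \<open>E[B\<^sub>1] = 0\<close> because
  \<open>E[B\<^sub>2]\<close> equals both \<open>2 E[B\<^sub>1]\<close> and \<open>sqrt 2 E[B\<^sub>1]\<close>.  A law of large numbers for squared
  increments shows that the quadratic variations grow at most at a constant rate.  Hence all three
  kinds of integrals satisfy \<open>E|\<integral>\<^sub>0\<^sup>t \<eta> dA|\<^sup>2 \<le> C \<integral>\<^sub>0\<^sup>t E|\<eta>\<^sub>s|\<^sup>2 ds\<close>.  The map that sends a process to its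
  distribution is \<open>1\<close>-Lipschitz at each time, so the right-hand side of the equation is a contraction
  in a norm with an exponential weight in time, and Picard iteration applies.  For uniqueness, the
  equation itself bounds the first moments of a solution, so that its distribution lies in
  \<open>distr_flow T\<close> and the second assumption on the coefficients can be used.
\<close>

text \<open>There is no sample space measure to argue on. \<open>E\<close> is controlled only on
  bounded Lipschitz cylinder functions, so \<open>B_t\<close>, its square and every integral exist
  merely as classes of Cauchy sequences. Estimates are therefore proved for the \<open>k\<close>-th
  term of a representing sequence, with truncation errors that vanish as \<open>k\<close> grows. A
  second obstacle is that the equation is an identity in \<open>L_G^1\<close>, where the integrals
  against \<open>dt\<close> and \<open>d<B>\<close> live, whereas the contraction takes place in
  \<open>L_G^2\<close>. Each integral thus gets a version with values in \<open>L_G^2\<close>, and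
  identities are carried back along the inclusion into \<open>L_G^1\<close>, whose injectivity is
  not automatic for a map between completions. Finally, \<open>M_G^p\<close> is normed by the
  expectation of a time integral, its subspace by the time integral of expectations. Simple
  integrals must be bounded in the first norm to be extended as the definitions prescribe, and in
  the second to enter the fixed point argument.\<close>

notation LIMSEQ ("((_)/ ----> (_))" [60, 60] 60)

section \<open>Cylinder functions\<close>

text \<open>Describes \<open>Lip T\<close> (for \<open>I = {0..T}\<close>) and
  \<open>Lip_all\<close> without choosing a list of times or a function on tuples, so that closure
  under operations needs no bookkeeping of lists. The sum of distances replaces the Euclidean
  distance at the cost of a constant.\<close>

definition cyl :: "real set => ('d::finite path => 'v::real_normed_vector) set" where
  "cyl I = {X. (\<exists>C. \<forall>w. norm (X w) <= C) \<and>
     (\<exists>L S. finite S \<and> S \<subseteq> I \<and> (\<forall>w w'. dist (X w) (X w') <= L * (\<Sum>t\<in>S. dist (B t w) (B t w'))))}"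

lemma B_nonpos: "t <= 0 ==> B t w = 0"
  using Rep_path[of w] by (auto simp: B_def)

text \<open>\<open>{..0}\<close> together with finitely many points is closed, and every function is
  continuous on a finite set, so an extension theorem of Tietze type applies. The lemma provides the
  paths on which functions of tuples are defined in \<open>cyl_subset_Lip\<close>.\<close>

lemma ex_path_through:
  fixes f :: "real => real^'d::finite"
  assumes "finite S"
  shows "\<exists>w. \<forall>t\<in>S. t > 0 --> B t w = f t"
proof -
  let ?C = "{..0} \<union> {t\<in>S. t > 0}"
  let ?g = "%t. if t <= 0 then 0 else f t"
  have cont: "continuous_on ?C ?g"
  proof (rule continuous_on_closed_Un)
    show "closed {t \<in> S. 0 < t}" using assms by (intro finite_imp_closed) auto
    show "continuous_on {..0} ?g" by (rule continuous_on_eq[of _ "%_. 0"]) auto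
    show "continuous_on {t \<in> S. 0 < t} ?g" using assms by (intro continuous_on_finite) auto
  qed auto
  have clo: "closedin (top_of_set UNIV) ?C"
    using assms closed_Un[OF closed_atMost finite_imp_closed, of "{t\<in>S. t > 0}" 0] by simp
  have "\<exists>g. continuous_on UNIV g \<and> (\<forall>t\<in>?C. g t = ?g t)"
    by (rule Dugundji[OF convex_UNIV UNIV_not_empty clo cont subset_UNIV]) blast
  then obtain g where g: "continuous_on UNIV g" "!!t. t \<in> ?C ==> g t = ?g t" by blast
  have "continuous_on {0..} g \<and> (\<forall>t\<le>0. g t = 0)"
    using g(2) continuous_on_subset[OF g(1), of "{0..}"] by simp
  then have "B t (Abs_path g) = g t" for t by (simp add: B_def Abs_path_inverse)
  then have "\<forall>t\<in>S. t > 0 --> B t (Abs_path g) = f t" using g(2) by auto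
  then show ?thesis by blast
qed

lemma cylI:
  assumes "!!w. norm (X w) <= C" "finite S" "S \<subseteq> I"
    "!!w w'. dist (X w) (X w') <= L * (\<Sum>t\<in>S. dist (B t w) (B t w'))"
  shows "X \<in> cyl I"
  unfolding cyl_def using assms by blast

lemma cylE:
  assumes "X \<in> cyl I"
  obtains C L S where "!!w. norm (X w) <= C" "finite S" "S \<subseteq> I" "0 <= C" "0 <= L"
    "!!w w'. dist (X w) (X w') <= L * (\<Sum>t\<in>S. dist (B t w) (B t w'))"
proof -
  obtain C L S where *: "!!w. norm (X w) <= C" "finite S" "S \<subseteq> I"
    "!!w w'. dist (X w) (X w') <= L * (\<Sum>t\<in>S. dist (B t w) (B t w'))"
    using assms by (auto simp: cyl_def)
  have "dist (X w) (X w') <= \<bar>L\<bar> * (\<Sum>t\<in>S. dist (B t w) (B t w'))" for w w'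
    by (rule order_trans[OF *(4)]) (auto intro!: mult_right_mono sum_nonneg)
  moreover have "0 <= C" using *(1) norm_ge_zero order_trans by blast
  ultimately show thesis using that *(1,2,3) abs_ge_zero by blast
qed

lemma Lip_subset_cyl: "(Lip T :: ('d::finite path => 'v::real_normed_vector) set) \<subseteq> cyl {0..T}"
proof
  fix X :: "'d path => 'v" assume "X \<in> Lip T"
  then obtain ts \<phi> where ts: "ts \<noteq> []" "set ts \<subseteq> {0..T}" "\<phi> \<in> C_bLip_tuple (length ts)"
    and X: "X = (%w. \<phi> (map (%t. B t w) ts))" by (auto simp: Lip_def)
  obtain C L where C: "!!xs. length xs = length ts ==> norm (\<phi> xs) <= C"
    and L: "!!xs ys. length xs = length ts ==> length ys = length ts ==>
        dist (\<phi> xs) (\<phi> ys) <= L * L2_set (%i. dist (xs ! i) (ys ! i)) {..<length ts}"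
    using ts(3) unfolding C_bLip_tuple_def by blast
  have "dist (X w) (X w') <= (\<bar>L\<bar> * length ts) * (\<Sum>t\<in>set ts. dist (B t w) (B t w'))" for w w'
  proof -
    let ?s = "\<Sum>t\<in>set ts. dist (B t w) (B t w')"
    have "dist (X w) (X w') <= L * L2_set (%i. dist (map (%t. B t w) ts ! i) (map (%t. B t w') ts ! i)) {..<length ts}"
      unfolding X by (rule L) auto
    also have "... <= \<bar>L\<bar> * (\<Sum>i<length ts. dist (map (%t. B t w) ts ! i) (map (%t. B t w') ts ! i))"
      by (intro mult_mono L2_set_le_sum) (auto intro: L2_set_nonneg)
    also have "... <= \<bar>L\<bar> * (\<Sum>i<length ts. ?s)"
    proof (intro mult_left_mono sum_mono)
      fix i assume "i \<in> {..<length ts}"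
      then have i: "i < length ts" by simp
      then have "dist (B (ts!i) w) (B (ts!i) w') <= ?s"
        by (intro member_le_sum[where f="%t. dist (B t w) (B t w')"]) auto
      then show "dist (map (%t. B t w) ts ! i) (map (%t. B t w') ts ! i) <= ?s" using i by simp
    qed auto
    finally show ?thesis by (simp add: mult.assoc)
  qed
  moreover have "norm (X w) <= C" for w unfolding X by (rule C) auto
  ultimately show "X \<in> cyl {0..T}" using ts by (intro cylI[where S="set ts"]) auto
qed

text \<open>A function on tuples arises by evaluating \<open>X\<close> on some path through the
  given values; the Lipschitz bound makes the result independent of the path. The list of times has
  no repetitions, so prescribed values never conflict, and the entry at time \<open>0\<close> is
  ignored because every path vanishes there.\<close>

lemma cyl_subset_Lip:
  assumes "0 <= T" shows "(cyl {0..T} :: ('d::finite path => 'v::real_normed_vector) set) \<subseteq> Lip T"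
proof
  fix X :: "'d path => 'v" assume "X \<in> cyl {0..T}"
  then obtain C L S where C: "!!w. norm (X w) <= C" "finite S" "S \<subseteq> {0..T}" "0 <= L"
    and L: "!!w w'. dist (X w) (X w') <= L * (\<Sum>t\<in>S. dist (B t w) (B t w'))" by (rule cylE) blast
  \<comment> \<open>Time \<open>0\<close> is added because \<open>Lip\<close> demands a nonempty
    list even when \<open>S\<close> is empty.\<close>
  obtain ts where ts: "set ts = insert 0 S" "distinct ts"
    using finite_distinct_list[of "insert 0 S"] C(2) by auto
  then have "ts \<noteq> []" by auto
  define idx where "idx t = (SOME i. i < length ts \<and> ts ! i = t)" for t
  have idx: "idx (ts ! i) = i" if "i < length ts" for i
    unfolding idx_def using that ts(2) by (intro some_equality) (auto simp: nth_eq_iff_index_eq)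
  define p where "p xs = (SOME w. \<forall>t\<in>S. t > 0 --> B t w = xs ! idx t)" for xs :: "(real^'d) list"
  have p: "\<forall>t\<in>S. t > 0 --> B t (p xs) = xs ! idx t" for xs
    unfolding p_def by (rule someI_ex) (rule ex_path_through[OF C(2)])
  define \<phi> where "\<phi> xs = X (p xs)" for xs
  have B0: "B t w = (0::real^'d)" if "\<not> t > 0" for t w by (rule B_nonpos) (use that in linarith)
  have "X w = \<phi> (map (%t. B t w) ts)" for w
  proof -
    have "dist (B t (p (map (%t. B t w) ts))) (B t w) = 0" if "t \<in> S" for t
    proof (cases "t > 0")
      case True
      obtain i where i: "i < length ts" "ts ! i = t" using \<open>t \<in> S\<close> ts(1) in_set_conv_nth[of t ts] by auto
      show ?thesis using p that True i idx[OF i(1)] by auto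
    qed (simp add: B0)
    then have "dist (\<phi> (map (%t. B t w) ts)) (X w) <= L * 0"
      unfolding \<phi>_def by (intro order_trans[OF L]) simp
    then show ?thesis by simp
  qed
  moreover have "\<phi> \<in> C_bLip_tuple (length ts)"
  proof -
    have "dist (\<phi> xs) (\<phi> ys) <= (L * card S) * L2_set (%i. dist (xs ! i) (ys ! i)) {..<length ts}" for xs ys
    proof -
      let ?l = "L2_set (%i. dist (xs ! i) (ys ! i)) {..<length ts}"
      have "dist (B t (p xs)) (B t (p ys)) <= ?l" if "t \<in> S" for t
      proof (cases "t > 0")
        case True
        obtain i where i: "i < length ts" "ts ! i = t" using \<open>t \<in> S\<close> ts(1) in_set_conv_nth[of t ts] by auto
        have "dist (xs ! i) (ys ! i) <= ?l" using i by (intro member_le_L2_set) auto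
        then show ?thesis using p that True i idx[OF i(1)] by auto
      qed (simp add: B0 L2_set_nonneg)
      then have "(\<Sum>t\<in>S. dist (B t (p xs)) (B t (p ys))) <= (\<Sum>t\<in>S. ?l)" by (rule sum_mono)
      then have "L * (\<Sum>t\<in>S. dist (B t (p xs)) (B t (p ys))) <= L * (card S * ?l)"
        using C(4) by (intro mult_left_mono) auto
      then show ?thesis unfolding \<phi>_def using L[of "p xs" "p ys"] by (simp add: mult.assoc)
    qed
    then show ?thesis using C(1) unfolding C_bLip_tuple_def \<phi>_def by blast
  qed
  moreover have "set ts \<subseteq> {0..T}" using ts(1) C(3) assms by auto
  ultimately show "X \<in> Lip T" using \<open>ts \<noteq> []\<close> unfolding Lip_def by blast
qed

lemma Lip_eq_cyl: "0 <= T ==> Lip T = cyl {0..T}"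
  using Lip_subset_cyl cyl_subset_Lip by blast

lemma cyl_mono: "I \<subseteq> J ==> X \<in> cyl I ==> X \<in> cyl J"
  unfolding cyl_def by blast

lemma Lip_all_eq_cyl: "(Lip_all :: ('d::finite path => 'v::real_normed_vector) set) = cyl {0..}"
proof
  show "(Lip_all :: ('d path => 'v) set) \<subseteq> cyl {0..}" unfolding Lip_all_def
    by (auto simp: Lip_eq_cyl intro: cyl_mono[rotated])
  show "(cyl {0..} :: ('d path => 'v) set) \<subseteq> Lip_all"
  proof
    fix X :: "'d path => 'v" assume X: "X \<in> cyl {0..}"
    then obtain C L S where C: "!!w. norm (X w) <= C" "finite S" "S \<subseteq> {0..}" "0 <= L"
      and L: "!!w w'. dist (X w) (X w') <= L * (\<Sum>t\<in>S. dist (B t w) (B t w'))" by (rule cylE) blast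
    define T where "T = Max (insert 0 S)"
    have T: "0 <= T" "S \<subseteq> {0..T}" using C by (auto simp: T_def)
    have "X \<in> cyl {0..T}" by (rule cylI[OF C(1,2) T(2) L])
    then show "X \<in> Lip_all" using T by (auto simp: Lip_all_def Lip_eq_cyl)
  qed
qed

section \<open>Operations on cylinder functions\<close>

lemma cyl_const: "(%w. c) \<in> cyl I"
  unfolding cyl_def by (auto intro!: exI[of _ "{}"])

lemma cyl_Pair:
  assumes "X \<in> cyl I" "Y \<in> cyl I" shows "(%w. (X w, Y w)) \<in> cyl I"
proof -
  obtain C L S where C: "!!w. norm (X w) <= C" "finite S" "S \<subseteq> I" "0 <= C" "0 <= L"
    and L: "!!w w'. dist (X w) (X w') <= L * (\<Sum>t\<in>S. dist (B t w) (B t w'))"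
    using assms(1) by (rule cylE) blast
  obtain C' L' S' where C': "!!w. norm (Y w) <= C'" "finite S'" "S' \<subseteq> I" "0 <= C'" "0 <= L'"
    and L': "!!w w'. dist (Y w) (Y w') <= L' * (\<Sum>t\<in>S'. dist (B t w) (B t w'))"
    using assms(2) by (rule cylE) blast
  have "dist (X w, Y w) (X w', Y w') <= (L + L') * (\<Sum>t\<in>S\<union>S'. dist (B t w) (B t w'))" for w w'
  proof -
    let ?s = "%S. \<Sum>t\<in>S. dist (B t w) (B t w')"
    have "dist (X w, Y w) (X w', Y w') <= dist (X w) (X w') + dist (Y w) (Y w')"
      unfolding dist_Pair_Pair by (rule sqrt_sum_squares_le_sum) auto
    also have "... <= L * ?s S + L' * ?s S'" by (intro add_mono L L')
    also have "... <= L * ?s (S \<union> S') + L' * ?s (S \<union> S')"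
      using C C' by (intro add_mono mult_left_mono sum_mono2) auto
    finally show ?thesis by (simp add: algebra_simps)
  qed
  moreover have "norm (X w, Y w) <= C + C'" for w
    unfolding norm_Pair by (rule order_trans[OF sqrt_sum_squares_le_sum]) (auto intro: add_mono C(1) C'(1))
  ultimately show ?thesis using C(2,3) C'(2,3) by (intro cylI[where S="S \<union> S'"]) auto
qed

text \<open>Lipschitz on every ball. Cylinder functions are bounded, so this suffices for
  composition, and unlike a global Lipschitz condition it covers products.\<close>

definition blip :: "('a::real_normed_vector => 'b::real_normed_vector) => bool" where
  "blip f \<longleftrightarrow> (\<forall>C. \<exists>L\<ge>0. \<forall>x y. norm x <= C --> norm y <= C --> dist (f x) (f y) <= L * dist x y)"

lemma blipI_lip: assumes "!!x y. dist (f x) (f y) <= L * dist x y" shows "blip f"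
  unfolding blip_def
proof (intro allI exI[of _ "\<bar>L\<bar>"] conjI impI)
  fix x y show "dist (f x) (f y) <= \<bar>L\<bar> * dist x y"
    by (rule order_trans[OF assms]) (simp add: mult_right_mono)
qed auto

lemma cyl_comp:
  assumes "X \<in> cyl I" "blip f" shows "(%w. f (X w)) \<in> cyl I"
proof -
  obtain C L S where C: "!!w. norm (X w) <= C" "finite S" "S \<subseteq> I" "0 <= C" "0 <= L"
    and L: "!!w w'. dist (X w) (X w') <= L * (\<Sum>t\<in>S. dist (B t w) (B t w'))"
    using assms(1) by (rule cylE) blast
  obtain K where K: "K \<ge> 0" "!!x y. norm x <= C ==> norm y <= C ==> dist (f x) (f y) <= K * dist x y"
    using assms(2) unfolding blip_def by blast
  have "dist (f (X w)) (f (X w')) <= (K * L) * (\<Sum>t\<in>S. dist (B t w) (B t w'))" for w w'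
    using K(2)[OF C(1) C(1), of w w'] mult_left_mono[OF L K(1), of w w'] by (simp add: mult.assoc)
  moreover have "norm (f (X w)) <= norm (f 0) + K * C" for w
  proof -
    have "norm (f (X w)) <= norm (f 0) + dist (f (X w)) (f 0)"
      unfolding dist_norm using norm_triangle_sub by blast
    also have "dist (f (X w)) (f 0) <= K * dist (X w) 0" using C by (intro K(2)) auto
    also have "... <= K * C" using K(1) C(1) by (intro mult_left_mono) auto
    finally show ?thesis by simp
  qed
  ultimately show ?thesis using C(2,3) by (intro cylI)
qed

lemma cyl_comp2:
  assumes "X \<in> cyl I" "Y \<in> cyl I" "blip (%z. f (fst z) (snd z))"
  shows "(%w. f (X w) (Y w)) \<in> cyl I"
  using cyl_comp[OF cyl_Pair[OF assms(1,2)] assms(3)] by simp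

lemma blip_bounded_linear: assumes "bounded_linear f" shows "blip f"
proof -
  obtain K where K: "!!x. norm (f x) <= norm x * K" using bounded_linear.bounded[OF assms] by blast
  show ?thesis
    by (rule blipI_lip[of _ K]) (metis K bounded_linear.axioms(1) assms linear_diff dist_norm mult.commute)
qed

lemma blip_bounded_bilinear: assumes "bounded_bilinear f" shows "blip (%z. f (fst z) (snd z))"
  unfolding blip_def
proof
  interpret bounded_bilinear f by fact
  fix C :: real
  obtain K where K: "!!x y. norm (f x y) <= norm x * norm y * K" and "K > 0" using pos_bounded by blast
  have "dist (f (fst x) (snd x)) (f (fst y) (snd y)) <= (2 * \<bar>C\<bar> * K) * dist x y"
    if "norm x <= C" "norm y <= C" for x y
  proof -
    have n: "norm (fst x) <= \<bar>C\<bar>" "norm (snd y) <= \<bar>C\<bar>"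
      using that norm_fst_le[of "fst x" "snd x"] norm_snd_le[of "snd y" "fst y"]
      by (simp_all only: prod.collapse)
    have d: "norm (snd x - snd y) <= dist x y" "norm (fst x - fst y) <= dist x y"
      using dist_fst_le[of x y] dist_snd_le[of x y] by (auto simp: dist_norm)
    have "f (fst x) (snd x) - f (fst y) (snd y) = f (fst x) (snd x - snd y) + f (fst x - fst y) (snd y)"
      by (simp add: diff_left diff_right)
    also have "norm ... <= norm (fst x) * norm (snd x - snd y) * K + norm (fst x - fst y) * norm (snd y) * K"
      by (rule norm_triangle_le) (intro add_mono K)
    also have "... <= \<bar>C\<bar> * dist x y * K + dist x y * \<bar>C\<bar> * K"
      using n d \<open>K > 0\<close> by (intro add_mono mult_mono) auto
    finally show ?thesis by (simp add: dist_norm algebra_simps)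
  qed
  then show "\<exists>L\<ge>0. \<forall>x y. norm x <= C --> norm y <= C --> dist (f (fst x) (snd x)) (f (fst y) (snd y)) <= L * dist x y"
    using \<open>K > 0\<close> by (intro exI[of _ "2 * \<bar>C\<bar> * K"]) auto
qed

lemma cyl_add: "X \<in> cyl I ==> Y \<in> cyl I ==> (%w. X w + Y w) \<in> cyl I"
  by (intro cyl_comp2[where f="%x y. x + y"] blip_bounded_linear bounded_linear_add bounded_linear_fst bounded_linear_snd)

lemma cyl_diff: "X \<in> cyl I ==> Y \<in> cyl I ==> (%w. X w - Y w) \<in> cyl I"
  by (intro cyl_comp2[where f="%x y. x - y"] blip_bounded_linear bounded_linear_sub bounded_linear_fst bounded_linear_snd)

lemma cyl_uminus: "X \<in> cyl I ==> (%w. - X w) \<in> cyl I"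
  by (intro cyl_comp[where f=uminus] blip_bounded_linear bounded_linear_minus bounded_linear_ident)

lemma cyl_scaleR: "X \<in> cyl I ==> Y \<in> cyl I ==> (%w. X w *\<^sub>R Y w) \<in> cyl I"
  by (intro cyl_comp2[where f="%x y. x *\<^sub>R y"] blip_bounded_bilinear bounded_bilinear_scaleR)

lemma cyl_mult: "X \<in> cyl I ==> Y \<in> cyl I ==> (%w. X w * Y w :: real) \<in> cyl I"
  by (intro cyl_comp2[where f="%x y. x * y"] blip_bounded_bilinear bounded_bilinear_mult)

lemma cyl_inner: "X \<in> cyl I ==> Y \<in> cyl I ==> (%w. X w \<bullet> Y w) \<in> cyl I"
  by (intro cyl_comp2[where f="%x y. x \<bullet> y"] blip_bounded_bilinear bounded_bilinear_inner)

lemma cyl_power2: "X \<in> cyl I ==> (%w. (X w)^2 :: real) \<in> cyl I"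
  unfolding power2_eq_square by (rule cyl_mult)

lemma cyl_norm: "X \<in> cyl I ==> (%w. norm (X w)) \<in> cyl I"
  by (rule cyl_comp, assumption, rule blipI_lip[of _ 1]) (simp add: dist_norm norm_triangle_ineq3)

lemma cyl_abs: "X \<in> cyl I ==> (%w. \<bar>X w :: real\<bar>) \<in> cyl I"
  using cyl_norm by fastforce

lemma cyl_max: "X \<in> cyl I ==> Y \<in> cyl I ==> (%w. max (X w) (Y w) :: real) \<in> cyl I"
proof (rule cyl_comp2[where f=max], assumption, assumption, rule blipI_lip[of _ 1])
  fix x y :: "real \<times> real"
  show "dist (max (fst x) (snd x)) (max (fst y) (snd y)) <= 1 * dist x y"
    using dist_fst_le[of x y] dist_snd_le[of x y] by (auto simp: dist_real_def max_def)
qed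

lemma cyl_min: "X \<in> cyl I ==> Y \<in> cyl I ==> (%w. min (X w) (Y w) :: real) \<in> cyl I"
proof (rule cyl_comp2[where f=min], assumption, assumption, rule blipI_lip[of _ 1])
  fix x y :: "real \<times> real"
  show "dist (min (fst x) (snd x)) (min (fst y) (snd y)) <= 1 * dist x y"
    using dist_fst_le[of x y] dist_snd_le[of x y] by (auto simp: dist_real_def min_def)
qed

lemma cyl_sum: "(!!i. i \<in> A ==> X i \<in> cyl I) ==> (%w. \<Sum>i\<in>A. X i w) \<in> cyl I"
  by (induction A rule: infinite_finite_induct) (auto intro: cyl_const cyl_add)

lemmas cyl_intros = cyl_const cyl_add cyl_diff cyl_uminus cyl_scaleR cyl_mult cyl_inner cyl_power2
  cyl_norm cyl_abs cyl_max cyl_min cyl_sum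

lemma cyl_C_bLip_increment:
  fixes \<phi> :: "real^'d::finite => 'v::real_normed_vector"
  assumes "s \<in> I" "t \<in> I" and C: "!!x. norm (\<phi> x) <= C" and L: "!!x y. dist (\<phi> x) (\<phi> y) <= L * dist x y"
  shows "(%w. \<phi> (B t w - B s w)) \<in> cyl I"
proof -
  have L': "dist (\<phi> x) (\<phi> y) <= \<bar>L\<bar> * dist x y" for x y
    by (rule order_trans[OF L]) (simp add: mult_right_mono)
  have "dist (\<phi> (B t w - B s w)) (\<phi> (B t w' - B s w')) <= (2 * \<bar>L\<bar>) * (\<Sum>t\<in>{s,t}. dist (B t w) (B t w'))" for w w'
  proof -
    have "dist (B t w - B s w) (B t w' - B s w') <= dist (B t w) (B t w') + dist (B s w) (B s w')"
      unfolding dist_norm using norm_triangle_ineq4[of "B t w - B t w'" "B s w - B s w'"]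
      by (simp add: algebra_simps)
    also have "... <= 2 * (\<Sum>t\<in>{s,t}. dist (B t w) (B t w'))" by (cases "s = t") auto
    finally have "\<bar>L\<bar> * dist (B t w - B s w) (B t w' - B s w') <= \<bar>L\<bar> * (2 * (\<Sum>t\<in>{s,t}. dist (B t w) (B t w')))"
      by (rule mult_left_mono) auto
    then show ?thesis using L'[of "B t w - B s w" "B t w' - B s w'"] by (simp add: algebra_simps)
  qed
  then show ?thesis using assms(1,2) C by (intro cylI[where S="{s, t}"]) auto
qed

abbreviation (input) LA :: "('d::finite path => 'v::real_normed_vector) set" where "LA \<equiv> cyl {0..}"

lemma cyl_LA: "X \<in> cyl {0..t} ==> X \<in> LA"
  by (rule cyl_mono[of "{0..t}"]) auto

text \<open>Exponents are real numbers in the definitions, but only \<open>1\<close> and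
  \<open>2\<close> occur; for these \<open>powr p\<close> reduces to the identity or the square on
  nonnegative numbers.\<close>

definition p12 :: "real => bool" where "p12 p \<longleftrightarrow> p = 1 \<or> p = 2"

lemma p12_simps [simp]: "p12 1" "p12 2" by (simp_all add: p12_def)
lemmas p12_1 = p12_simps(1) and p12_2 = p12_simps(2)

section \<open>Sublinear expectations and their norms\<close>

definition nE :: "(('d::finite path => real) => real) => real => ('d path => 'v::real_normed_vector) => real" where
  "nE E p X = E (%w. norm (X w) powr p) powr (1 / p)"

lemma lg_pdist_eq_nE: "lg_pdist E p X Y = nE E p (%w. X w - Y w)"
  by (simp add: lg_pdist_def nE_def)

locale sublinear_expectation =
  fixes E :: "('d::finite path => real) => real"
  assumes E_mono: "X \<in> LA ==> Y \<in> LA ==> (!!w. X w <= Y w) ==> E X <= E Y"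
    and E_const: "E (%w. c) = c"
    and E_add: "X \<in> LA ==> Y \<in> LA ==> E (%w. X w + Y w) <= E X + E Y"
    and E_scale: "X \<in> LA ==> 0 <= r ==> E (%w. r * X w) = r * E X"
begin

lemma E_nonneg: "X \<in> LA ==> (!!w. 0 <= X w) ==> 0 <= E X"
  using E_mono[of "%w. 0" X] by (simp add: E_const cyl_const)

lemma E_diff: "X \<in> LA ==> Y \<in> LA ==> E X - E Y <= E (%w. X w - Y w)"
  using E_add[of "%w. X w - Y w" Y] by (simp add: cyl_diff)

lemma E_abs_diff:
  assumes "X \<in> LA" "Y \<in> LA" shows "\<bar>E X - E Y\<bar> <= E (%w. \<bar>X w - Y w\<bar>)"
proof -
  have "E (%w. X w - Y w) <= E (%w. \<bar>X w - Y w\<bar>)" "E (%w. Y w - X w) <= E (%w. \<bar>X w - Y w\<bar>)"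
    using assms by (auto intro!: E_mono cyl_intros)
  then show ?thesis using E_diff[OF assms] E_diff[OF assms(2,1)] by linarith
qed

text \<open>Sub-additivity is used twice, with \<open>c\<close> and with \<open>- c\<close>. This
  exact additivity later evaluates the inner expectation in \<open>indep_add\<close>.\<close>

lemma E_add_const: assumes "X \<in> LA" shows "E (%w. X w + c) = E X + c"
  using E_add[OF assms cyl_const, of c] E_add[of "%w. X w + c" "%w. - c"] assms
  by (auto simp: E_const cyl_intros)

lemma E_sum: "finite A ==> (!!i. i \<in> A ==> X i \<in> LA) ==> E (%w. \<Sum>i\<in>A. X i w) <= (\<Sum>i\<in>A. E (X i))"
proof (induction A rule: finite_induct)
  case (insert a A)
  then show ?case using E_add[of "X a" "%w. \<Sum>i\<in>A. X i w"] by (force simp: cyl_sum)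
qed (simp add: E_const)

text \<open>Monotonicity and sub-additivity apply to \<open>X Y <= r/2 X^2 + 1/(2r) Y^2\<close> for
  every \<open>r > 0\<close>; the best \<open>r\<close> gives the product of the norms.\<close>

lemma E_Cauchy_Schwarz:
  assumes "X \<in> LA" "Y \<in> LA"
  shows "E (%w. X w * Y w) <= sqrt (E (%w. (X w)^2)) * sqrt (E (%w. (Y w)^2))"
proof -
  define a b where "a = E (%w. (X w)^2)" and "b = E (%w. (Y w)^2)"
  have ab: "0 <= a" "0 <= b" using assms by (auto simp: a_def b_def intro!: E_nonneg cyl_intros)
  have *: "E (%w. X w * Y w) <= r / 2 * a + 1 / (2 * r) * b" if "r > 0" for r
  proof -
    have "X w * Y w <= r / 2 * (X w)^2 + 1 / (2 * r) * (Y w)^2" for w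
    proof -
      have "0 <= (r * X w - Y w)^2 / (2 * r)" using that by simp
      also have "... = r / 2 * (X w)^2 + 1 / (2 * r) * (Y w)^2 - X w * Y w"
        using that by (simp add: field_simps power2_eq_square)
      finally show ?thesis by simp
    qed
    then have "E (%w. X w * Y w) <= E (%w. r / 2 * (X w)^2 + 1 / (2 * r) * (Y w)^2)"
      using assms by (intro E_mono cyl_intros)
    also have "... <= E (%w. r / 2 * (X w)^2) + E (%w. 1 / (2 * r) * (Y w)^2)"
      using assms by (intro E_add cyl_intros)
    also have "... = r / 2 * a + 1 / (2 * r) * b"
      unfolding a_def b_def using assms that by (subst (1 2) E_scale) (auto intro!: cyl_intros)
    finally show ?thesis .
  qed
  \<comment> \<open>The optimal \<open>r\<close> is the quotient of the two norms. Adding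
    \<open>eps\<close> to both second moments keeps it defined and positive when one of them is
    \<open>0\<close>.\<close>
  have **: "E (%w. X w * Y w) <= sqrt (a + eps) * sqrt (b + eps)" if "eps > 0" for eps
  proof -
    let ?p = "sqrt (a + eps)" and ?q = "sqrt (b + eps)"
    have pq: "?p > 0" "?q > 0" "?p * ?p = a + eps" "?q * ?q = b + eps" using ab that by auto
    have "E (%w. X w * Y w) <= (?q / ?p) / 2 * a + 1 / (2 * (?q / ?p)) * b"
      using * pq by (metis divide_pos_pos)
    also have "... <= (?q / ?p) / 2 * (?p * ?p) + 1 / (2 * (?q / ?p)) * (?q * ?q)"
      using pq that by (intro add_mono mult_left_mono) auto
    also have "... = ?p * ?q"
    proof -
      have "(q / p) / 2 * (p * p) + 1 / (2 * (q / p)) * (q * q) = p * q" if "p > 0" "q > 0" for p q :: real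
        using that by (simp add: field_simps)
      then show ?thesis using pq(1,2) by blast
    qed
    finally show ?thesis .
  qed
  have "((%eps. sqrt (a + eps) * sqrt (b + eps)) \<longlongrightarrow> sqrt (a + 0) * sqrt (b + 0)) (at_right 0)"
    by (intro tendsto_intros)
  then have "E (%w. X w * Y w) <= sqrt (a + 0) * sqrt (b + 0)"
    by (rule tendsto_lowerbound) (auto simp: eventually_at_right_field intro!: exI[of _ 1] **)
  then show ?thesis by (simp add: a_def b_def)
qed

lemma nE_1: "nE E 1 X = \<bar>E (%w. norm (X w))\<bar>" by (simp add: nE_def)

lemma nE_1_LA: "X \<in> LA ==> nE E 1 X = E (%w. norm (X w))"
  by (simp add: nE_1 E_nonneg cyl_norm)

lemma nE_2: "X \<in> LA ==> nE E 2 X = sqrt (E (%w. (norm (X w))^2))"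
  by (simp add: nE_def powr_half_sqrt E_nonneg cyl_intros)

lemma nE_nonneg: "0 <= nE E p X" by (simp add: nE_def)

lemma nE_2_sq: "X \<in> LA ==> (nE E 2 X)^2 = E (%w. (norm (X w))^2)"
  by (simp add: nE_2 E_nonneg cyl_intros)

lemma nE_powr: "p12 p ==> X \<in> LA ==> (nE E p X) powr p = E (%w. norm (X w) powr p)"
  by (auto simp: p12_def nE_nonneg nE_1_LA nE_2_sq E_nonneg cyl_norm)

lemma nE_mono:
  assumes "p12 p" "X \<in> LA" "Y \<in> LA" "0 <= c" "!!w. norm (X w) <= c * norm (Y w)"
  shows "nE E p X <= c * nE E p Y"
proof (cases "p = 1")
  case True
  have "E (%w. norm (X w)) <= E (%w. c * norm (Y w))"
    using assms by (intro E_mono cyl_intros) auto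
  then show ?thesis using assms True by (simp add: nE_1_LA E_scale cyl_norm)
next
  case False
  then have p: "p = 2" using assms by (simp add: p12_def)
  have "E (%w. (norm (X w))^2) <= E (%w. c\<^sup>2 * (norm (Y w))^2)"
    using assms by (intro E_mono cyl_intros) (auto simp flip: power_mult_distrib intro!: power_mono)
  also have "... = c\<^sup>2 * E (%w. (norm (Y w))^2)" using assms by (intro E_scale cyl_intros) auto
  finally have "sqrt (E (%w. (norm (X w))^2)) <= sqrt (c\<^sup>2 * E (%w. (norm (Y w))^2))" by simp
  then show ?thesis using assms p by (simp add: nE_2 real_sqrt_mult)
qed

lemma nE_mono': "p12 p ==> X \<in> LA ==> Y \<in> LA ==> (!!w. norm (X w) <= norm (Y w)) ==> nE E p X <= nE E p Y"
  using nE_mono[of p X Y 1] by simp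

lemma nE_const: "p12 p ==> nE E p (%w. c) = norm c"
  by (auto simp: p12_def nE_1 nE_2 E_const cyl_const)

lemma nE_minus: "nE E p (%w. - X w) = nE E p X" by (simp add: nE_def)

lemma nE_minus_commute: "nE E p (%w. X w - Y w) = nE E p (%w. Y w - X w)"
  by (simp add: nE_def norm_minus_commute)

lemma nE_norm: "nE E p (%w. norm (X w)) = nE E p X" by (simp add: nE_def)

lemma nE_triangle:
  assumes "p12 p" "X \<in> LA" "Y \<in> LA"
  shows "nE E p (%w. X w + Y w) <= nE E p X + nE E p Y"
proof (cases "p = 1")
  case True
  have "E (%w. norm (X w + Y w)) <= E (%w. norm (X w) + norm (Y w))"
    using assms by (intro E_mono cyl_intros norm_triangle_ineq)
  also have "... <= E (%w. norm (X w)) + E (%w. norm (Y w))"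
    using assms by (intro E_add cyl_intros)
  finally show ?thesis using assms True by (simp add: nE_1_LA cyl_add)
next
  case False
  then have p: "p = 2" using assms by (simp add: p12_def)
  let ?X = "%w. norm (X w)" and ?Y = "%w. norm (Y w)"
  define a b where "a = E (%w. (?X w)^2)" and "b = E (%w. (?Y w)^2)"
  have ab: "0 <= a" "0 <= b" using assms by (auto simp: a_def b_def intro!: E_nonneg cyl_intros)
  have L: "?X \<in> LA" "?Y \<in> LA" using assms by (auto intro!: cyl_intros)
  have "E (%w. (norm (X w + Y w))^2) <= E (%w. ((?X w)^2 + (?Y w)^2) + 2 * (?X w * ?Y w))"
  proof (intro E_mono)
    fix w
    have "(norm (X w + Y w))^2 <= (?X w + ?Y w)^2" by (intro power_mono norm_triangle_ineq) auto
    then show "(norm (X w + Y w))^2 <= ((?X w)^2 + (?Y w)^2) + 2 * (?X w * ?Y w)"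
      by (simp add: power2_sum)
  qed (use assms in \<open>intro cyl_intros; auto\<close>)+
  also have "... <= E (%w. (?X w)^2 + (?Y w)^2) + E (%w. 2 * (?X w * ?Y w))"
    using assms by (intro E_add cyl_intros)
  also have "... <= (a + b) + 2 * E (%w. ?X w * ?Y w)"
    unfolding a_def b_def using assms by (subst E_scale) (auto intro!: cyl_intros E_add)
  also have "... <= (a + b) + 2 * (sqrt a * sqrt b)"
    using E_Cauchy_Schwarz[OF L] by (simp add: a_def b_def)
  also have "... = (sqrt a + sqrt b)^2" using ab by (simp add: power2_sum)
  finally have "sqrt (E (%w. (norm (X w + Y w))^2)) <= sqrt a + sqrt b"
    using ab by (intro real_le_lsqrt) auto
  then show ?thesis using assms p by (simp add: nE_2 cyl_add a_def b_def)
qed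

lemma nE_triangle_diff:
  assumes "p12 p" "X \<in> LA" "Y \<in> LA" "Z \<in> LA"
  shows "nE E p (%w. X w - Z w) <= nE E p (%w. X w - Y w) + nE E p (%w. Y w - Z w)"
  using nE_triangle[of p "%w. X w - Y w" "%w. Y w - Z w"] assms by (simp add: cyl_diff)

lemma nE_abs_diff:
  assumes "p12 p" "X \<in> LA" "Y \<in> LA"
  shows "\<bar>nE E p X - nE E p Y\<bar> <= nE E p (%w. X w - Y w)"
  using nE_triangle[of p "%w. X w - Y w" Y] nE_triangle[of p "%w. Y w - X w" X]
    nE_minus_commute[of p X Y] assms by (simp add: cyl_diff abs_le_iff)

lemma nE_sum:
  assumes p: "p12 p"
  shows "finite A ==> (!!i. i \<in> A ==> X i \<in> LA) ==> nE E p (%w. \<Sum>i\<in>A. X i w) <= (\<Sum>i\<in>A. nE E p (X i))"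
proof (induction A rule: finite_induct)
  case empty
  then show ?case by (simp add: nE_const[OF p])
next
  case (insert a A)
  then show ?case using nE_triangle[OF p, of "X a" "%w. \<Sum>i\<in>A. X i w"] by (force simp: cyl_sum)
qed

lemma nE_1_le_2: assumes "X \<in> LA" shows "nE E 1 X <= nE E 2 X"
  using E_Cauchy_Schwarz[of "%w. norm (X w)" "%w. 1"] assms
  by (simp add: nE_1_LA nE_2 cyl_norm cyl_const E_const)

lemma nE_1_mult:
  assumes "X \<in> LA" "Y \<in> LA" "Z \<in> LA" "!!w. norm (Z w) <= norm (X w) * norm (Y w)"
  shows "nE E 1 Z <= nE E 2 X * nE E 2 Y"
proof -
  have "E (%w. norm (Z w)) <= E (%w. norm (X w) * norm (Y w))"
    using assms by (intro E_mono cyl_intros)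
  also have "... <= nE E 2 X * nE E 2 Y"
    using E_Cauchy_Schwarz[of "%w. norm (X w)" "%w. norm (Y w)"] assms by (simp add: nE_2 cyl_norm)
  finally show ?thesis using assms by (simp add: nE_1_LA)
qed

end

section \<open>Completions\<close>

locale pseudo_metric =
  fixes S :: "'a set" and d :: "'a => 'a => real"
  assumes d_nonneg: "x \<in> S ==> y \<in> S ==> 0 <= d x y"
    and d_refl: "x \<in> S ==> d x x = 0"
    and d_sym: "x \<in> S ==> y \<in> S ==> d x y = d y x"
    and d_tri: "x \<in> S ==> y \<in> S ==> z \<in> S ==> d x z <= d x y + d y z"
begin

lemma cauchy_seqs_in: "u \<in> cauchy_seqs S d ==> u k \<in> S"
  by (simp add: cauchy_seqs_def)

lemma cauchy_seqs_const: "x \<in> S ==> (%k. x) \<in> cauchy_seqs S d"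
  by (simp add: cauchy_seqs_def d_refl)

lemma d_diff_le:
  "x \<in> S ==> y \<in> S ==> x' \<in> S ==> y' \<in> S ==> \<bar>d x y - d x' y'\<bar> <= d x x' + d y y'"
  using d_tri[of x x' y] d_tri[of x' y' y] d_tri[of x' x y'] d_tri[of x y y'] d_sym[of x x'] d_sym[of y y']
  by (simp add: abs_le_iff)

lemma cauchy_dist_convergent:
  assumes "u \<in> cauchy_seqs S d" "v \<in> cauchy_seqs S d"
  shows "convergent (%k. d (u k) (v k))"
proof (rule Cauchy_convergent, rule metric_CauchyI)
  fix eps :: real assume "eps > 0"
  then obtain M N where M: "!!k l. k \<ge> M ==> l \<ge> M ==> d (u k) (u l) < eps / 2"
    and N: "!!k l. k \<ge> N ==> l \<ge> N ==> d (v k) (v l) < eps / 2"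
    using assms unfolding cauchy_seqs_def by (smt (verit) half_gt_zero mem_Collect_eq)
  have "dist (d (u k) (v k)) (d (u l) (v l)) < eps" if "k \<ge> max M N" "l \<ge> max M N" for k l
    using d_diff_le[of "u k" "v k" "u l" "v l"] M[of k l] N[of k l] that assms
    by (simp add: cauchy_seqs_in dist_real_def)
  then show "\<exists>M. \<forall>k\<ge>M. \<forall>l\<ge>M. dist (d (u k) (v k)) (d (u l) (v l)) < eps" by blast
qed

lemma rel_trans:
  assumes "u \<in> cauchy_seqs S d" "v \<in> cauchy_seqs S d" "wt \<in> cauchy_seqs S d"
    "(%k. d (u k) (v k)) ----> 0" "(%k. d (v k) (wt k)) ----> 0"
  shows "(%k. d (u k) (wt k)) ----> 0"
proof (rule tendsto_sandwich)
  show "\<forall>\<^sub>F k in sequentially. d (u k) (wt k) <= d (u k) (v k) + d (v k) (wt k)"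
    using assms by (intro always_eventually allI d_tri cauchy_seqs_in)
  show "\<forall>\<^sub>F k in sequentially. 0 <= d (u k) (wt k)"
    using assms by (intro always_eventually allI d_nonneg cauchy_seqs_in)
  show "(%k. d (u k) (v k) + d (v k) (wt k)) ----> 0" using tendsto_add[OF assms(4,5)] by simp
qed simp

lemma class_iff:
  "u \<in> cauchy_seqs S d ==>
    v \<in> cauchy_class S d u \<longleftrightarrow> v \<in> cauchy_seqs S d \<and> (%k. d (u k) (v k)) ----> 0"
  by (auto simp: cauchy_class_def cauchy_rel_def)

lemma in_class: "u \<in> cauchy_seqs S d ==> u \<in> cauchy_class S d u"
  by (simp add: class_iff d_refl cauchy_seqs_in)

lemma class_in_completion: "u \<in> cauchy_seqs S d ==> cauchy_class S d u \<in> completion S d"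
  by (auto simp: completion_def cauchy_class_def quotient_def)

lemma class_eqI:
  assumes "u \<in> cauchy_seqs S d" "v \<in> cauchy_seqs S d" "(%k. d (u k) (v k)) ----> 0"
  shows "cauchy_class S d u = cauchy_class S d v"
proof -
  have "d (v k) (u k) = d (u k) (v k)" for k using assms(1,2) cauchy_seqs_in d_sym by blast
  then have vu: "(%k. d (v k) (u k)) ----> 0" using assms(3) by simp
  show ?thesis
  proof (intro set_eqI iffI)
    fix wt assume "wt \<in> cauchy_class S d u"
    then show "wt \<in> cauchy_class S d v"
      using rel_trans[OF assms(2,1) _ vu, of wt] assms(1,2) by (simp add: class_iff)
  next
    fix wt assume "wt \<in> cauchy_class S d v"
    then show "wt \<in> cauchy_class S d u"
      using rel_trans[OF assms(1,2) _ assms(3), of wt] assms(1,2) by (simp add: class_iff)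
  qed
qed

lemma completionD:
  assumes "U \<in> completion S d" "u \<in> U"
  shows "u \<in> cauchy_seqs S d" "U = cauchy_class S d u"
proof -
  obtain v where v: "v \<in> cauchy_seqs S d" "U = cauchy_class S d v"
    using assms(1) by (auto simp: completion_def cauchy_class_def quotient_def)
  then show u: "u \<in> cauchy_seqs S d" using assms(2) by (simp add: class_iff)
  show "U = cauchy_class S d u" using v class_eqI[OF v(1) u] assms(2) by (simp add: class_iff)
qed

lemma completion_nonempty: "U \<in> completion S d ==> \<exists>u. u \<in> U"
  using in_class by (fastforce simp: completion_def cauchy_class_def quotient_def)

text \<open>The definite description in \<open>completion_dist\<close> denotes something because the
  limit exists along one pair of representatives and is the same along all others.\<close>

lemma completion_dist_lim:
  assumes "U \<in> completion S d" "V \<in> completion S d" "u \<in> U" "v \<in> V"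
  shows "(%k. d (u k) (v k)) ----> completion_dist d U V"
proof -
  have uv: "u \<in> cauchy_seqs S d" "v \<in> cauchy_seqs S d" using assms completionD by auto
  obtain r where r: "(%k. d (u k) (v k)) ----> r"
    using cauchy_dist_convergent[OF uv] by (auto simp: convergent_def)
  have *: "(%k. d (u' k) (v' k)) ----> r" if "u' \<in> U" "v' \<in> V" for u' v'
  proof -
    have uv': "u' \<in> cauchy_seqs S d" "v' \<in> cauchy_seqs S d" using assms that completionD by auto
    have l: "(%k. d (u k) (u' k)) ----> 0" "(%k. d (v k) (v' k)) ----> 0"
      using that completionD(2)[OF assms(1,3)] completionD(2)[OF assms(2,4)] class_iff uv by auto
    have "(%k. d (u' k) (v' k) - d (u k) (v k)) ----> 0"
    proof (rule Lim_null_comparison)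
      show "\<forall>\<^sub>F k in sequentially. norm (d (u' k) (v' k) - d (u k) (v k)) <= d (u k) (u' k) + d (v k) (v' k)"
        unfolding real_norm_def using uv uv'
        by (intro always_eventually allI, subst abs_minus_commute) (intro d_diff_le cauchy_seqs_in)
      show "(%k. d (u k) (u' k) + d (v k) (v' k)) ----> 0" using tendsto_add[OF l] by simp
    qed
    from tendsto_add[OF this r] show ?thesis by simp
  qed
  have "completion_dist d U V = r" unfolding completion_dist_def
  proof (rule the_equality)
    fix r' assume "\<forall>u\<in>U. \<forall>v\<in>V. (%k. d (u k) (v k)) ----> r'"
    then show "r' = r" using assms r LIMSEQ_unique by blast
  qed (use * in blast)
  then show ?thesis using r by simp
qed

abbreviation "CD \<equiv> completion_dist d"

lemma CD_eqI: "U \<in> completion S d ==> V \<in> completion S d ==> u \<in> U ==> v \<in> V ==>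
    (%k. d (u k) (v k)) ----> r ==> CD U V = r"
  using completion_dist_lim LIMSEQ_unique by blast

lemma CD_nonneg: assumes "U \<in> completion S d" "V \<in> completion S d" shows "0 <= CD U V"
proof -
  obtain u v where uv: "u \<in> U" "v \<in> V" using assms completion_nonempty by blast
  have "0 <= d (u k) (v k)" for k using uv assms completionD(1) cauchy_seqs_in d_nonneg by blast
  then show ?thesis using LIMSEQ_le_const[OF completion_dist_lim[OF assms uv]] by blast
qed

lemma CD_refl: assumes "U \<in> completion S d" shows "CD U U = 0"
proof -
  obtain u where u: "u \<in> U" using assms completion_nonempty by blast
  then show ?thesis using assms completionD(1)[OF assms u] by (intro CD_eqI[OF assms assms u u]) (simp add: d_refl cauchy_seqs_in)
qed

lemma CD_sym: assumes "U \<in> completion S d" "V \<in> completion S d" shows "CD U V = CD V U"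
proof -
  obtain u v where uv: "u \<in> U" "v \<in> V" using assms completion_nonempty by blast
  have "d (u k) (v k) = d (v k) (u k)" for k using uv assms completionD(1) cauchy_seqs_in d_sym by blast
  then show ?thesis using completion_dist_lim[OF assms(2,1) uv(2,1)] by (intro CD_eqI[OF assms uv]) simp
qed

lemma CD_tri:
  assumes "U \<in> completion S d" "V \<in> completion S d" "W \<in> completion S d"
  shows "CD U W <= CD U V + CD V W"
proof -
  obtain u v wt where uv: "u \<in> U" "v \<in> V" "wt \<in> W" using assms completion_nonempty by meson
  have "d (u k) (wt k) <= d (u k) (v k) + d (v k) (wt k)" for k
    using uv assms completionD(1) cauchy_seqs_in d_tri by meson
  then show ?thesis
    using LIMSEQ_le[OF completion_dist_lim[of U W u wt] tendsto_add[OF completion_dist_lim[of U V u v]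
        completion_dist_lim[of V W v wt]]] assms uv by blast
qed

lemma CD_zero: assumes "U \<in> completion S d" "V \<in> completion S d" "CD U V = 0" shows "U = V"
proof -
  obtain u v where uv: "u \<in> U" "v \<in> V" using assms completion_nonempty by blast
  have "(%k. d (u k) (v k)) ----> 0" using completion_dist_lim[OF assms(1,2) uv] assms(3) by simp
  then show ?thesis using class_eqI completionD assms uv by metis
qed

lemma CD_diff_le:
  assumes "U \<in> completion S d" "V \<in> completion S d" "U' \<in> completion S d" "V' \<in> completion S d"
  shows "\<bar>CD U V - CD U' V'\<bar> <= CD U U' + CD V V'"
  using CD_tri[of U U' V] CD_tri[of U' V' V] CD_tri[of U' U V'] CD_tri[of U V V'] CD_sym[of U U'] CD_sym[of V V'] assms
  by (simp add: abs_le_iff)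

lemma CD_tendsto:
  assumes "!!k. U k \<in> completion S d" "!!k. V k \<in> completion S d" "U' \<in> completion S d" "V' \<in> completion S d"
    "(%k. CD (U k) U') ----> 0" "(%k. CD (V k) V') ----> 0"
  shows "(%k. CD (U k) (V k)) ----> CD U' V'"
proof -
  have "(%k. CD (U k) (V k) - CD U' V') ----> 0"
  proof (rule Lim_null_comparison)
    show "\<forall>\<^sub>F k in sequentially. norm (CD (U k) (V k) - CD U' V') <= CD (U k) U' + CD (V k) V'"
      using CD_diff_le assms by auto
    show "(%k. CD (U k) U' + CD (V k) V') ----> 0" using tendsto_add[OF assms(5,6)] by simp
  qed
  from tendsto_add[OF this tendsto_const[of "CD U' V'"]] show ?thesis by simp
qed

abbreviation "EM x \<equiv> cauchy_class S d (%k. x)"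

lemma EM_in: "x \<in> S ==> EM x \<in> completion S d" "x \<in> S ==> (%k. x) \<in> EM x"
  by (auto intro: class_in_completion in_class cauchy_seqs_const)

lemma CD_EM: "x \<in> S ==> y \<in> S ==> CD (EM x) (EM y) = d x y"
  using CD_eqI[of "EM x" "EM y" "%k. x" "%k. y"] EM_in by simp

lemma EM_tendsto:
  assumes "U \<in> completion S d" "u \<in> U"
  shows "(%k. CD (EM (u k)) U) ----> 0"
proof (rule LIMSEQ_I)
  fix eps :: real assume "eps > 0"
  have u: "u \<in> cauchy_seqs S d" using assms completionD by blast
  then obtain M where M: "!!k l. k \<ge> M ==> l \<ge> M ==> d (u k) (u l) < eps / 2"
    unfolding cauchy_seqs_def using \<open>eps > 0\<close> by (smt (verit) half_gt_zero mem_Collect_eq)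
  have "norm (CD (EM (u k)) U - 0) < eps" if "k \<ge> M" for k
  proof -
    have uk: "u k \<in> S" using u by (rule cauchy_seqs_in)
    have l: "(%l. d (u k) (u l)) ----> CD (EM (u k)) U"
      using completion_dist_lim[OF EM_in(1)[OF uk] assms(1) EM_in(2)[OF uk] assms(2)] .
    have "CD (EM (u k)) U <= eps / 2" using M[OF that] by (intro LIMSEQ_le_const2[OF l]) (meson less_imp_le)
    then show ?thesis using \<open>eps > 0\<close> CD_nonneg[OF EM_in(1)[OF uk] assms(1)] by simp
  qed
  then show "\<exists>M. \<forall>k\<ge>M. norm (CD (EM (u k)) U - 0) < eps" by blast
qed

lemma limit_unique:
  assumes "!!k. W k \<in> completion S d" "U \<in> completion S d" "V \<in> completion S d"
    "(%k. CD (W k) U) ----> 0" "(%k. CD (W k) V) ----> 0"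
  shows "U = V"
proof -
  have "(%k. CD (W k) (W k)) ----> CD U V" by (rule CD_tendsto[OF assms(1,1-5)])
  then show ?thesis using CD_refl[OF assms(1)] assms CD_zero by (simp add: LIMSEQ_const_iff)
qed

text \<open>A diagonal choice: the limit is represented by points that approximate
  \<open>W m\<close> up to \<open>1/(m+1)\<close>. The subset \<open>S'\<close> records where these
  points lie. With \<open>S'\<close> the cylinder functions up to time \<open>t\<close>, limits of
  adapted classes stay adapted.\<close>

lemma complete:
  assumes W: "!!m. W m \<in> completion S d" and "S' \<subseteq> S"
    and app: "!!m eps. eps > 0 ==> \<exists>wt\<in>S'. CD (EM wt) (W m) < eps"
    and cau: "!!eps. eps > 0 ==> \<exists>M. \<forall>k\<ge>M. \<forall>l\<ge>M. CD (W k) (W l) < eps"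
  obtains v where "v \<in> cauchy_seqs S d" "!!k. v k \<in> S'" "(%m. CD (W m) (cauchy_class S d v)) ----> 0"
proof -
  have "\<exists>wt. \<forall>m. wt m \<in> S' \<and> CD (EM (wt m)) (W m) < 1 / (real m + 1)"
    by (intro choice allI) (use app in \<open>auto simp: Bex_def\<close>)
  then obtain wt where wt: "!!m. wt m \<in> S'" "!!m. CD (EM (wt m)) (W m) < 1 / (real m + 1)" by blast
  then have wS: "wt m \<in> S" for m using assms(2) by blast
  have l0: "(%m. 1 / (real m + 1)) ----> 0"
    using LIMSEQ_inverse_real_of_nat by (simp add: inverse_eq_divide add.commute)
  have wl: "(%m. CD (W m) (EM (wt m))) ----> 0"
    by (rule tendsto_sandwich[OF _ _ tendsto_const l0])
      (use wt(2) CD_nonneg CD_sym W EM_in(1)[OF wS] in \<open>auto intro!: always_eventually simp: less_imp_le\<close>)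
  have w_cs: "wt \<in> cauchy_seqs S d" unfolding cauchy_seqs_def
  proof (safe intro!: wS)
    fix eps :: real assume "eps > 0"
    then have e3: "eps / 3 > 0" by simp
    obtain M where M: "!!k l. k \<ge> M ==> l \<ge> M ==> CD (W k) (W l) < eps / 3" using cau[OF e3] by blast
    obtain N where N: "!!k. k \<ge> N ==> CD (W k) (EM (wt k)) < eps / 3"
      using order_tendstoD(2)[OF wl e3] by (auto simp: eventually_sequentially)
    have "d (wt k) (wt l) < eps" if "k \<ge> max M N" "l \<ge> max M N" for k l
    proof -
      have "d (wt k) (wt l) = CD (EM (wt k)) (EM (wt l))" using wS by (simp add: CD_EM)
      also have "... <= CD (EM (wt k)) (W k) + (CD (W k) (W l) + CD (W l) (EM (wt l)))"
        using CD_tri[of "EM (wt k)" "W k" "EM (wt l)"] CD_tri[of "W k" "W l" "EM (wt l)"] W EM_in(1)[OF wS] by fastforce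
      also have "... < eps"
        using M[of k l] N[of k] N[of l] that CD_sym[OF W EM_in(1)[OF wS], of k k] by simp
      finally show ?thesis .
    qed
    then show "\<exists>M. \<forall>k\<ge>M. \<forall>l\<ge>M. d (wt k) (wt l) < eps" by blast
  qed
  have "(%m. CD (W m) (cauchy_class S d wt)) ----> 0"
  proof (rule tendsto_sandwich)
    show "\<forall>\<^sub>F m in sequentially. CD (W m) (cauchy_class S d wt) <= CD (W m) (EM (wt m)) + CD (EM (wt m)) (cauchy_class S d wt)"
      using W EM_in(1)[OF wS] class_in_completion[OF w_cs] by (intro always_eventually allI CD_tri)
    show "\<forall>\<^sub>F m in sequentially. 0 <= CD (W m) (cauchy_class S d wt)"
      using W class_in_completion[OF w_cs] by (intro always_eventually allI CD_nonneg)
    show "(%m. CD (W m) (EM (wt m)) + CD (EM (wt m)) (cauchy_class S d wt)) ----> 0"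
      using tendsto_add[OF wl EM_tendsto[OF class_in_completion[OF w_cs] in_class[OF w_cs]]] by simp
  qed simp
  then show thesis using that w_cs wt(1) by blast
qed

text \<open>The definite description asks for convergence along every representative of
  \<open>U\<close>, which is the last hypothesis; a single representative is enough for uniqueness
  of the limit.\<close>

lemma cont_extension_eqI:
  assumes "V \<in> completion S d" "u \<in> U" "!!k. f (u k) \<in> completion S d"
    and "!!u. u \<in> U ==> (%k. CD (f (u k)) V) ----> 0"
  shows "cont_extension (completion S d) CD f U = V"
  unfolding cont_extension_def
proof (rule the_equality)
  fix V' assume "V' \<in> completion S d \<and> (\<forall>u\<in>U. (%k. CD (f (u k)) V') ----> 0)"
  then show "V' = V" using limit_unique[of "%k. f (u k)" V' V] assms by blast
qed (use assms in blast)

end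

lemma null_le:
  fixes f g :: "nat => real"
  assumes "g ----> 0" "!!k. f k <= g k" "!!k. 0 <= f k" shows "f ----> 0"
  by (rule tendsto_sandwich[OF _ _ tendsto_const assms(1)]) (use assms in auto)

section \<open>The spaces \<open>L_G^p\<close> with horizon \<open>T\<close> and the maps between
  them\<close>

locale sublinear_T = sublinear_expectation E for E :: "('d::finite path => real) => real" +
  fixes T :: real
  assumes T0: "0 < T"
begin

lemma Lip_cyl: "t \<in> {0..T} ==> X \<in> cyl {0..t} ==> X \<in> cyl {0..T}"
  by (rule cyl_mono[of "{0..t}"]) auto

lemma LipT: "Lip T = cyl {0..T}" using T0 by (intro Lip_eq_cyl) auto

lemma pseudo_metric_lg: "p12 p ==> pseudo_metric (Lip T) (lg_pdist E p)"
proof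
  fix X Y Z :: "'d path => 'v::real_normed_vector"
  assume p: "p12 p" and L: "X \<in> Lip T" "Y \<in> Lip T"
  show "0 <= lg_pdist E p X Y" by (simp add: lg_pdist_eq_nE nE_nonneg)
  show "lg_pdist E p X X = 0" using nE_const[OF p, of 0] by (simp add: lg_pdist_eq_nE)
  show "lg_pdist E p X Y = lg_pdist E p Y X" unfolding lg_pdist_eq_nE by (rule nE_minus_commute)
  assume "Z \<in> Lip T"
  with L show "lg_pdist E p X Z <= lg_pdist E p X Y + lg_pdist E p Y Z"
    unfolding lg_pdist_eq_nE using p by (intro nE_triangle_diff) (auto simp: LipT cyl_LA)
qed

abbreviation CS :: "real => (nat => 'd path => 'v::real_normed_vector) set" where
  "CS p \<equiv> cauchy_seqs (Lip T) (lg_pdist E p)"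

abbreviation "LGs p \<equiv> LG E T p"
abbreviation "cls p \<equiv> lg_class E T p"
abbreviation "emb p \<equiv> lg_embed E T p"
abbreviation "ld p \<equiv> lg_dist E p"

lemma CS_iff: "u \<in> CS p \<longleftrightarrow> (\<forall>k. u k \<in> cyl {0..T}) \<and>
    (\<forall>eps>0. \<exists>M. \<forall>k\<ge>M. \<forall>l\<ge>M. nE E p (%w. u k w - u l w) < eps)"
  by (simp add: cauchy_seqs_def LipT lg_pdist_eq_nE)

lemma CS_cyl: "u \<in> CS p ==> u k \<in> cyl {0..T}" by (simp add: CS_iff)
lemma CS_LA: "u \<in> CS p ==> u k \<in> LA" using CS_cyl cyl_LA by blast

lemma cls_in: "p12 p ==> u \<in> CS p ==> cls p u \<in> LGs p" "p12 p ==> u \<in> CS p ==> u \<in> cls p u"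
  using pseudo_metric.class_in_completion[OF pseudo_metric_lg] pseudo_metric.in_class[OF pseudo_metric_lg]
  unfolding LG_def lg_class_def by blast+

lemma LG_D: "p12 p ==> U \<in> LGs p ==> u \<in> U ==> u \<in> CS p" "p12 p ==> U \<in> LGs p ==> u \<in> U ==> U = cls p u"
  using pseudo_metric.completionD[OF pseudo_metric_lg] unfolding LG_def lg_class_def by blast+

lemma LG_ne: "p12 p ==> U \<in> LGs p ==> \<exists>u. u \<in> U"
  using pseudo_metric.completion_nonempty[OF pseudo_metric_lg] by (auto simp: LG_def)

lemma ld_lim:
  "p12 p ==> U \<in> LGs p ==> V \<in> LGs p ==> u \<in> U ==> v \<in> V ==>
    (%k. nE E p (%w. u k w - v k w)) ----> ld p U V"
  using pseudo_metric.completion_dist_lim[OF pseudo_metric_lg] unfolding LG_def lg_dist_def lg_pdist_eq_nE[symmetric] by blast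

lemma ld_eqI: "p12 p ==> U \<in> LGs p ==> V \<in> LGs p ==> u \<in> U ==> v \<in> V ==>
    (%k. nE E p (%w. u k w - v k w)) ----> r ==> ld p U V = r"
  using ld_lim LIMSEQ_unique by blast

lemma ld_nonneg: "p12 p ==> U \<in> LGs p ==> V \<in> LGs p ==> 0 <= ld p U V"
  using pseudo_metric.CD_nonneg[OF pseudo_metric_lg] by (auto simp: LG_def lg_dist_def)
lemma ld_refl: "p12 p ==> U \<in> LGs p ==> ld p U U = 0"
  using pseudo_metric.CD_refl[OF pseudo_metric_lg] by (auto simp: LG_def lg_dist_def)
lemma ld_sym: "p12 p ==> U \<in> LGs p ==> V \<in> LGs p ==> ld p U V = ld p V U"
  using pseudo_metric.CD_sym[OF pseudo_metric_lg] unfolding LG_def lg_dist_def by blast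
lemma ld_tri: "p12 p ==> U \<in> LGs p ==> V \<in> LGs p ==> W \<in> LGs p ==> ld p U W <= ld p U V + ld p V W"
  using pseudo_metric.CD_tri[OF pseudo_metric_lg] unfolding LG_def lg_dist_def by blast
lemma ld_zero: "p12 p ==> U \<in> LGs p ==> V \<in> LGs p ==> ld p U V = 0 ==> U = V"
  using pseudo_metric.CD_zero[OF pseudo_metric_lg] unfolding LG_def lg_dist_def by blast
lemma ld_diff_le: "p12 p ==> U \<in> LGs p ==> V \<in> LGs p ==> U' \<in> LGs p ==> V' \<in> LGs p ==>
    \<bar>ld p U V - ld p U' V'\<bar> <= ld p U U' + ld p V V'"
  using pseudo_metric.CD_diff_le[OF pseudo_metric_lg] unfolding LG_def lg_dist_def by blast
lemma ld_tendsto: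
  "p12 p ==> (!!k. U k \<in> LGs p) ==> (!!k. V k \<in> LGs p) ==> U' \<in> LGs p ==> V' \<in> LGs p ==>
    (%k. ld p (U k) U') ----> 0 ==> (%k. ld p (V k) V') ----> 0 ==> (%k. ld p (U k) (V k)) ----> ld p U' V'"
  using pseudo_metric.CD_tendsto[OF pseudo_metric_lg] unfolding LG_def lg_dist_def by blast

lemma LG_eqI:
  "p12 p ==> U \<in> LGs p ==> V \<in> LGs p ==> u \<in> U ==> v \<in> V ==>
    (%k. nE E p (%w. u k w - v k w)) ----> 0 ==> U = V"
  using ld_eqI ld_zero by blast

lemma cls_eqI: "p12 p ==> u \<in> CS p ==> v \<in> CS p ==>
    (%k. nE E p (%w. u k w - v k w)) ----> 0 ==> cls p u = cls p v"
  using LG_eqI cls_in by blast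

lemma LG_null: "p12 p ==> U \<in> LGs p ==> u \<in> U ==> v \<in> U ==> (%k. nE E p (%w. u k w - v k w)) ----> 0"
  using ld_lim[of p U U u v] by (simp add: ld_refl)

lemma emb_in: "p12 p ==> X \<in> cyl {0..T} ==> emb p X \<in> LGs p" "p12 p ==> X \<in> cyl {0..T} ==> (%k. X) \<in> emb p X"
  using pseudo_metric.EM_in[OF pseudo_metric_lg] by (auto simp: LG_def lg_embed_def lg_class_def LipT)

lemma CS_const: "p12 p ==> X \<in> cyl {0..T} ==> (%k. X) \<in> CS p"
  using LG_D(1)[OF _ emb_in] by blast

lemma ld_emb: "p12 p ==> X \<in> cyl {0..T} ==> Y \<in> cyl {0..T} ==> ld p (emb p X) (emb p Y) = nE E p (%w. X w - Y w)"
  using ld_eqI[of p "emb p X" "emb p Y" "%k. X" "%k. Y"] emb_in by blast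

lemma emb_tendsto: "p12 p ==> U \<in> LGs p ==> u \<in> U ==> (%k. ld p (emb p (u k)) U) ----> 0"
  using pseudo_metric.EM_tendsto[OF pseudo_metric_lg] unfolding LG_def lg_dist_def lg_embed_def lg_class_def by blast

lemma LG_limit_unique:
  "p12 p ==> (!!k. W k \<in> LGs p) ==> U \<in> LGs p ==> V \<in> LGs p ==>
    (%k. ld p (W k) U) ----> 0 ==> (%k. ld p (W k) V) ----> 0 ==> U = V"
  using pseudo_metric.limit_unique[OF pseudo_metric_lg] unfolding LG_def lg_dist_def by blast

text \<open>Membership in \<open>L_G^p\<close> over the paths up to time \<open>t\<close>, seen
  inside the space with horizon \<open>T\<close>: some representing sequence consists of cylinder
  functions up to \<open>t\<close>.\<close>

definition adapted :: "real => (nat => 'd path => 'v::real_normed_vector) set => bool" where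
  "adapted t U \<longleftrightarrow> (\<exists>u\<in>U. \<forall>k. u k \<in> cyl {0..t})"

lemma LG_complete:
  assumes p: "p12 p" and W: "!!m. W m \<in> LGs p"
    and cau: "!!eps. eps > 0 ==> \<exists>M. \<forall>k\<ge>M. \<forall>l\<ge>M. ld p (W k) (W l) < eps"
    and t: "t \<in> {0..T}" "!!m. adapted t (W m)"
  obtains V where "V \<in> LGs p" "adapted t V" "(%m. ld p (W m) V) ----> 0"
proof -
  have app: "\<exists>wt\<in>cyl {0..t}. completion_dist (lg_pdist E p) (cauchy_class (Lip T) (lg_pdist E p) (%k. wt)) (W m) < eps"
    if "eps > 0" for m eps
  proof -
    obtain wt where wt: "wt \<in> W m" "!!k. wt k \<in> cyl {0..t}" using t(2)[of m] by (auto simp: adapted_def)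
    have "\<forall>\<^sub>F k in sequentially. ld p (emb p (wt k)) (W m) < eps"
      using order_tendstoD(2)[OF emb_tendsto[OF p W wt(1)] that] .
    then obtain k where "ld p (emb p (wt k)) (W m) < eps" by (auto simp: eventually_sequentially)
    then show ?thesis using wt(2) by (auto simp: lg_dist_def lg_embed_def lg_class_def)
  qed
  obtain v where v: "v \<in> CS p" "!!k. v k \<in> cyl {0..t}" "(%m. ld p (W m) (cls p v)) ----> 0"
    by (rule pseudo_metric.complete[OF pseudo_metric_lg[OF p], of W "cyl {0..t}"])
       (use W app cau t(1) in \<open>auto simp: LG_def LipT lg_dist_def lg_class_def Lip_cyl\<close>)
  show thesis using that[of "cls p v"] v cls_in[OF p v(1)] by (auto simp: adapted_def)
qed

lemma cont_extension_LG:
  assumes "p12 p" "V \<in> LGs p" "u \<in> U" "!!k. f (u k) \<in> LGs p"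
    and "!!u. u \<in> U ==> (%k. ld p (f (u k)) V) ----> 0"
  shows "cont_extension (LGs p) (ld p) f U = V"
  using pseudo_metric.cont_extension_eqI[OF pseudo_metric_lg[OF assms(1)], of V u U f] assms(2-)
  by (simp add: LG_def lg_dist_def)

lemma nE_p_le: assumes "p12 p" "p12 q" "p <= q" "X \<in> LA" shows "nE E p X <= nE E q X"
  using assms nE_1_le_2[OF assms(4)] by (auto simp: p12_def)

text \<open>The conditions under which \<open>X \<mapsto> f w (X w)\<close> extends to the
  completions: a Lipschitz constant that is uniform in the path, and stability of cylinder
  functions. Dependence on the path is needed for multiplication by the values of a simple
  process.\<close>

definition fadm :: "('d path => 'v::real_normed_vector => 'w::real_normed_vector) => real => bool" where
  "fadm f L \<longleftrightarrow> 0 <= L \<and> (\<forall>w x y. norm (f w x - f w y) <= L * norm (x - y)) \<and>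
     (\<forall>X\<in>cyl {0..T}. (%w. f w (X w)) \<in> cyl {0..T})"

lemma fadmD:
  assumes "fadm f L"
  shows "0 <= L" "norm (f w x - f w y) <= L * norm (x - y)" "X \<in> cyl {0..T} ==> (%w. f w (X w)) \<in> cyl {0..T}"
  using assms by (auto simp: fadm_def)

lemma fadm_nE:
  assumes "fadm f L" "p12 p" "p12 q" "p <= q" "X \<in> cyl {0..T}" "Y \<in> cyl {0..T}"
  shows "nE E p (%w. f w (X w) - f w (Y w)) <= L * nE E q (%w. X w - Y w)"
proof -
  have "nE E p (%w. f w (X w) - f w (Y w)) <= L * nE E p (%w. X w - Y w)"
    using fadmD[OF assms(1)] assms(2,5,6) by (intro nE_mono cyl_LA cyl_diff) auto
  also have "... <= L * nE E q (%w. X w - Y w)"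
    using fadmD(1)[OF assms(1)] assms by (intro mult_left_mono nE_p_le) (auto intro!: cyl_LA cyl_diff)
  finally show ?thesis .
qed

lemma fadm_CS:
  assumes "fadm f L" "p12 p" "p12 q" "p <= q" "u \<in> CS q"
  shows "(%k w. f w (u k w)) \<in> CS p"
  unfolding CS_iff
proof (safe intro!: fadmD(3)[OF assms(1)] CS_cyl[OF assms(5)])
  fix eps :: real assume e: "eps > 0"
  have L: "0 <= L" using fadmD(1)[OF assms(1)] .
  then have "eps / (L + 1) > 0" using e by simp
  then obtain M where M: "!!k l. k \<ge> M ==> l \<ge> M ==> nE E q (%w. u k w - u l w) < eps / (L + 1)"
    using assms(5) unfolding CS_iff by blast
  have "nE E p (%w. f w (u k w) - f w (u l w)) < eps" if "k \<ge> M" "l \<ge> M" for k l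
  proof -
    have "nE E p (%w. f w (u k w) - f w (u l w)) <= L * nE E q (%w. u k w - u l w)"
      using assms CS_cyl[OF assms(5)] by (intro fadm_nE)
    also have "... <= L * (eps / (L + 1))" using M[OF that] L by (intro mult_left_mono) auto
    also have "... < eps" using L e by (simp add: field_simps)
    finally show ?thesis .
  qed
  then show "\<exists>M. \<forall>k\<ge>M. \<forall>l\<ge>M. nE E p (%w. f w (u k w) - f w (u l w)) < eps" by blast
qed

text \<open>A sequence that is Cauchy in the stronger norm is Cauchy in the weaker one, so
  \<open>lg_map p\<close> may be fed with an \<open>L_G^q\<close> class for \<open>q\<close> above
  \<open>p\<close>. This covers the inclusion of \<open>L_G^2\<close> in \<open>L_G^1\<close> and
  coefficients at exponent \<open>1\<close> applied to an \<open>L_G^2\<close> process.\<close>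

lemma lg_map_rep:
  assumes f: "fadm f L" "p12 p" "p12 q" "p <= q" and U: "U \<in> LGs q" "u \<in> U"
  shows "lg_map E T p f U \<in> LGs p" "(%k w. f w (u k w)) \<in> lg_map E T p f U"
proof -
  have u: "u \<in> CS q" using LG_D U f by blast
  let ?wt = "%k w. f w (u k w)"
  have wt: "?wt \<in> CS p" using fadm_CS[OF f u] .
  have "lg_map E T p f U = cls p ?wt"
    unfolding lg_map_def
  proof (rule cont_extension_LG)
    fix v assume v: "v \<in> U"
    have vc: "v \<in> CS q" using LG_D U f v by blast
    have le: "ld p (emb p (%w. f w (v k w))) (cls p ?wt) <= L * ld q (emb q (v k)) U" for k
    proof (rule LIMSEQ_le)
      show "(%l. nE E p (%w. f w (v k w) - f w (u l w))) ----> ld p (emb p (%w. f w (v k w))) (cls p ?wt)"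
        using f(2) wt fadmD(3)[OF f(1) CS_cyl[OF vc]]
        by (intro ld_lim[of p "emb p (%w. f w (v k w))" _ "%_ w. f w (v k w)"]) (auto intro: emb_in cls_in)
      show "(%l. L * nE E q (%w. v k w - u l w)) ----> L * ld q (emb q (v k)) U"
        using f(3) U CS_cyl[OF vc]
        by (intro tendsto_mult_left ld_lim[of q "emb q (v k)" U "%_. v k"] emb_in) auto
      show "\<exists>N. \<forall>n\<ge>N. nE E p (%w. f w (v k w) - f w (u n w)) <= L * nE E q (%w. v k w - u n w)"
        using fadm_nE[OF f CS_cyl[OF vc] CS_cyl[OF u]] by blast
    qed
    show "(%k. ld p (emb p (%w. f w (v k w))) (cls p ?wt)) ----> 0"
    proof (rule tendsto_sandwich[OF _ always_eventually[OF allI[OF le]] tendsto_const])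
      show "(%k. L * ld q (emb q (v k)) U) ----> 0"
        using tendsto_mult_right_zero[OF emb_tendsto[OF f(3) U(1) v]] .
      show "\<forall>\<^sub>F k in sequentially. 0 <= ld p (emb p (%w. f w (v k w))) (cls p ?wt)"
        using f wt vc by (intro always_eventually allI ld_nonneg emb_in cls_in fadmD(3)[OF f(1)] CS_cyl)
    qed
  qed (use f wt U u in \<open>auto intro!: cls_in emb_in fadmD(3)[OF f(1)] CS_cyl\<close>)
  then show "lg_map E T p f U \<in> LGs p" "?wt \<in> lg_map E T p f U" using cls_in[OF f(2) wt] by auto
qed

lemma ld_lg_map:
  assumes f: "fadm f L" "p12 p" "p12 q" "p <= q" and U: "U \<in> LGs q" "V \<in> LGs q"
  shows "ld p (lg_map E T p f U) (lg_map E T p f V) <= L * ld q U V"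
proof -
  obtain u v where uv: "u \<in> U" "v \<in> V" using LG_ne[OF f(3)] U by blast
  have c: "u k \<in> cyl {0..T}" "v k \<in> cyl {0..T}" for k using LG_D(1)[OF f(3)] CS_cyl U uv by blast+
  show ?thesis
  proof (rule LIMSEQ_le)
    show "(%k. nE E p (%w. f w (u k w) - f w (v k w))) ----> ld p (lg_map E T p f U) (lg_map E T p f V)"
      using ld_lim[OF f(2) lg_map_rep(1)[OF f U(1) uv(1)] lg_map_rep(1)[OF f U(2) uv(2)]
          lg_map_rep(2)[OF f U(1) uv(1)] lg_map_rep(2)[OF f U(2) uv(2)]] .
    show "(%k. L * nE E q (%w. u k w - v k w)) ----> L * ld q U V"
      using ld_lim[OF f(3) U uv] by (rule tendsto_mult_left)
  qed (use fadm_nE[OF f c] in blast)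
qed

lemma lg_map_emb:
  assumes f: "fadm f L" "p12 p" "p12 q" "p <= q" and X: "X \<in> cyl {0..T}"
  shows "lg_map E T p f (emb q X) = emb p (%w. f w (X w))"
proof -
  have "(%k w. f w (X w)) \<in> lg_map E T p f (emb q X)" "lg_map E T p f (emb q X) \<in> LGs p"
    using lg_map_rep[OF f emb_in[OF f(3) X]] by auto
  then show ?thesis using LG_D(2)[OF f(2)] by (simp add: lg_embed_def)
qed

lemma fadm_id: "fadm (%w x. x) 1" by (simp add: fadm_def)

lemma fadm_lipschitz:
  assumes "0 <= L" "!!x y. norm (f x - f y) <= L * norm (x - y)" shows "fadm (%w. f) L"
  using assms cyl_comp[OF _ blipI_lip[of f L]] by (auto simp: fadm_def dist_norm)

lemma fadm_scaleR:
  assumes "\<xi> \<in> cyl {0..T}" shows "\<exists>L. fadm (%w y. y *\<^sub>R \<xi> w) L"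
proof -
  obtain C where "!!w. norm (\<xi> w) <= C" "0 <= C" using assms by (rule cylE) blast
  then have "fadm (%w y. y *\<^sub>R \<xi> w) C" using assms unfolding fadm_def
    by (auto simp flip: scaleR_left_diff_distrib simp: mult.commute intro!: mult_right_mono cyl_scaleR)
  then show ?thesis by blast
qed

lemma CS_bounded: assumes "p12 p" "u \<in> CS p" shows "\<exists>K\<ge>0. \<forall>k. nE E p (u k) <= K"
proof -
  have U: "cls p u \<in> LGs p" "u \<in> cls p u" using cls_in assms by auto
  have Z: "emb p (%w. 0) \<in> LGs p" "(%k w. 0) \<in> emb p (%w. 0)" using emb_in[OF assms(1) cyl_const] by auto
  have "(%k. nE E p (u k)) ----> ld p (cls p u) (emb p (%w. 0))" using ld_lim[OF assms(1) U(1) Z(1) U(2) Z(2)] by simp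
  then have "Bseq (%k. nE E p (u k))" by (intro convergent_imp_Bseq) (auto simp: convergent_def)
  then obtain K where "K > 0" "!!k. \<bar>nE E p (u k)\<bar> <= K" by (auto simp: Bseq_def)
  then show ?thesis using abs_le_D1 less_imp_le by meson
qed

lemma nE_2_sq_le:
  assumes "X \<in> LA" "!!w. norm (X w) <= C" shows "(nE E 2 X)^2 <= C * nE E 1 X"
proof -
  have C: "0 <= C" using assms(2) norm_ge_zero order_trans by blast
  have "E (%w. (norm (X w))^2) <= E (%w. C * norm (X w))"
    using assms by (intro E_mono cyl_intros) (auto simp: power2_eq_square intro: mult_right_mono)
  then show ?thesis using assms C by (simp add: nE_2_sq nE_1_LA E_scale cyl_norm)
qed

text \<open>With a bound \<open>C\<close> of a fixed term \<open>wt M\<close>, the square \<open>|wt k|\<^sup>2\<close> is at most \<open>|wt k| (|wt k - wt M| + C)\<close>.\<close>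

lemma CS_2_null:
  assumes wt: "wt \<in> CS 2" and l: "(%k. nE E 1 (wt k)) ----> 0"
  shows "(%k. nE E 2 (wt k)) ----> 0"
proof -
  obtain K where K: "K \<ge> 0" "!!k. nE E 2 (wt k) <= K" using CS_bounded[OF _ wt] by auto
  have "(%k. (nE E 2 (wt k))^2) ----> 0"
  proof (rule LIMSEQ_I)
    fix eps :: real assume e: "eps > 0"
    then have e': "eps / (2 * (K + 1)) > 0" using K by simp
    then obtain M where M: "!!k l. k \<ge> M ==> l \<ge> M ==> nE E 2 (%w. wt k w - wt l w) < eps / (2 * (K + 1))"
      using wt unfolding CS_iff by blast
    obtain C where C: "!!w. norm (wt M w) <= C" "0 <= C" using CS_cyl[OF wt, of M] by (rule cylE) blast
    have "(%k. C * nE E 1 (wt k)) ----> 0" using tendsto_mult_right_zero[OF l] .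
    then obtain N where N: "!!k. k \<ge> N ==> C * nE E 1 (wt k) < eps / 2"
      using order_tendstoD(2)[of "%k. C * nE E 1 (wt k)" 0 sequentially "eps/2"] e by (auto simp: eventually_sequentially)
    have "norm ((nE E 2 (wt k))^2 - 0) < eps" if k: "k \<ge> max M N" for k
    proof -
      have L: "wt k \<in> LA" "wt M \<in> LA" using CS_LA wt by auto
      let ?d = "%w. wt k w - wt M w"
      have "(nE E 2 (wt k))^2 = E (%w. (norm (wt k w))^2)" using L by (simp add: nE_2_sq)
      also have "... <= E (%w. norm (wt k w) * norm (?d w) + C * norm (wt k w))"
      proof (intro E_mono)
        fix w
        have "norm (wt k w) <= norm (?d w) + C" using norm_triangle_sub[of "wt k w" "wt M w"] C(1)[of w] by simp
        then show "(norm (wt k w))^2 <= norm (wt k w) * norm (?d w) + C * norm (wt k w)"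
          using mult_left_mono[of "norm (wt k w)" "norm (?d w) + C" "norm (wt k w)"] by (simp add: power2_eq_square algebra_simps)
      qed (use L in \<open>intro cyl_intros; auto\<close>)+
      also have "... <= E (%w. norm (wt k w) * norm (?d w)) + E (%w. C * norm (wt k w))"
        using L by (intro E_add cyl_intros)
      also have "... <= nE E 2 (wt k) * nE E 2 ?d + C * nE E 1 (wt k)"
        using E_Cauchy_Schwarz[of "%w. norm (wt k w)" "%w. norm (?d w)"] L C(2)
        by (simp add: nE_2 nE_1_LA E_scale cyl_norm cyl_diff)
      also have "... <= K * (eps / (2 * (K + 1))) + C * nE E 1 (wt k)"
        using K M[of k M] k by (intro add_mono[OF mult_mono order_refl]) (auto simp: nE_nonneg)
      also have "... < eps / 2 + eps / 2"
        using N[of k] k K e by (intro add_le_less_mono) (auto simp: field_simps)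
      finally show ?thesis by simp
    qed
    then show "\<exists>M. \<forall>k\<ge>M. norm ((nE E 2 (wt k))^2 - 0) < eps" by blast
  qed
  from tendsto_real_sqrt[OF this] show ?thesis by (simp add: nE_nonneg)
qed

text \<open>By \<open>nE_2_sq_le\<close>, the squared \<open>2\<close>-norm of a difference is at
  most \<open>2 * C\<close> times its \<open>1\<close>-norm. This moves integrals with cut
  increments from \<open>L_G^1\<close> to \<open>L_G^2\<close>.\<close>

lemma CS_1_bounded:
  assumes wt: "wt \<in> CS 1" and C: "!!k w. norm (wt k w) <= C"
  shows "wt \<in> CS 2"
  unfolding CS_iff
proof (safe intro!: CS_cyl[OF wt])
  fix eps :: real assume e: "eps > 0"
  have C_nonneg: "0 <= C" using C norm_ge_zero order_trans by blast
  have "eps\<^sup>2 / (2 * C + 1) > 0" using e C_nonneg by (simp add: add_nonneg_pos)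
  then obtain M where M: "!!k l. k \<ge> M ==> l \<ge> M ==> nE E 1 (%w. wt k w - wt l w) < eps\<^sup>2 / (2 * C + 1)"
    using wt unfolding CS_iff by blast
  have "nE E 2 (%w. wt k w - wt l w) < eps" if "k \<ge> M" "l \<ge> M" for k l
  proof -
    have "norm (wt k w - wt l w) <= 2 * C" for w
      using norm_triangle_ineq4[of "wt k w" "wt l w"] C[of k w] C[of l w] by simp
    then have "(nE E 2 (%w. wt k w - wt l w))^2 <= 2 * C * nE E 1 (%w. wt k w - wt l w)"
      using CS_LA[OF wt] by (intro nE_2_sq_le cyl_diff)
    also have "... <= 2 * C * (eps\<^sup>2 / (2 * C + 1))" using M[OF that] C_nonneg by (intro mult_left_mono) auto
    also have "... < eps\<^sup>2" using C_nonneg e by (simp add: field_simps)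
    finally show ?thesis using e by (simp add: power_less_imp_less_base)
  qed
  then show "\<exists>M. \<forall>k\<ge>M. \<forall>l\<ge>M. nE E 2 (%w. wt k w - wt l w) < eps" by blast
qed

lemma CS_2_1: "u \<in> CS 2 ==> u \<in> CS 1"
  using fadm_CS[OF fadm_id, of 1 2 u] by simp

abbreviation "inc \<equiv> lg_map E T 1 (%w x. x)"

lemma inc_rep: "p12 q ==> U \<in> LGs q ==> inc U \<in> LGs 1" "p12 q ==> U \<in> LGs q ==> u \<in> U ==> u \<in> inc U"
  using lg_map_rep[OF fadm_id, of 1 q U] LG_ne[of q U] by (auto simp: p12_def)

text \<open>A continuous map that is injective on a dense subset can lose injectivity on the
  completion. Here it does not, because an \<open>L_G^2\<close> Cauchy sequence that is null in
  \<open>L_G^1\<close> is null in \<open>L_G^2\<close> (\<open>CS_2_null\<close>). The lemma lifts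
  the equation from \<open>L_G^1\<close> back to \<open>L_G^2\<close>.\<close>

lemma inc_inj: assumes "U \<in> LGs 2" "V \<in> LGs 2" "inc U = inc V" shows "U = V"
proof -
  obtain u v where uv: "u \<in> U" "v \<in> V" using LG_ne[of 2] assms by force
  have c: "u \<in> CS 2" "v \<in> CS 2" using LG_D(1)[of 2] assms uv by auto
  have "(%k. nE E 1 (%w. u k w - v k w)) ----> 0"
    using LG_null[of 1 "inc U" u v] inc_rep[of 2] assms uv by auto
  moreover have "(%k w. u k w - v k w) \<in> CS 2"
    unfolding CS_iff
  proof (safe intro!: cyl_diff CS_cyl[OF c(1)] CS_cyl[OF c(2)])
    fix eps :: real assume "eps > 0"
    then have "eps / 2 > 0" by simp
    then obtain M N where M: "!!k l. k \<ge> M ==> l \<ge> M ==> nE E 2 (%w. u k w - u l w) < eps / 2"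
      and N: "!!k l. k \<ge> N ==> l \<ge> N ==> nE E 2 (%w. v k w - v l w) < eps / 2"
      using c unfolding CS_iff by metis
    have "nE E 2 (%w. u k w - v k w - (u l w - v l w)) < eps" if "k \<ge> max M N" "l \<ge> max M N" for k l
      using nE_triangle[of 2 "%w. u k w - u l w" "%w. v l w - v k w"] M[of k l] N[of l k] that CS_LA[OF c(1)] CS_LA[OF c(2)]
      by (simp add: cyl_diff algebra_simps)
    then show "\<exists>M. \<forall>k\<ge>M. \<forall>l\<ge>M. nE E 2 (%w. u k w - v k w - (u l w - v l w)) < eps" by blast
  qed
  ultimately have "(%k. nE E 2 (%w. u k w - v k w)) ----> 0" by (rule CS_2_null[rotated])
  then show ?thesis using LG_eqI[of 2 U V u v] assms uv by simp
qed

lemma CS_sum: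
  assumes p: "p12 p" shows "finite I ==> (!!i. i \<in> I ==> u i \<in> CS p) ==> (%k w. \<Sum>i\<in>I. u i k w) \<in> CS p"
proof (induction I rule: finite_induct)
  case empty
  then show ?case using CS_const[OF p cyl_const] by simp
next
  case (insert a A)
  let ?v = "%k w. \<Sum>i\<in>A. u i k w"
  have c: "u a \<in> CS p" "?v \<in> CS p" using insert by auto
  have "(%k w. u a k w + ?v k w) \<in> CS p"
    unfolding CS_iff
  proof (safe intro!: cyl_add CS_cyl[OF c(1)] CS_cyl[OF c(2)])
    fix eps :: real assume "eps > 0"
    then have e: "eps / 2 > 0" by simp
    then obtain M where M: "!!k l. k \<ge> M ==> l \<ge> M ==> nE E p (%w. u a k w - u a l w) < eps / 2"
      using c(1) unfolding CS_iff by blast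
    obtain N where N: "!!k l. k \<ge> N ==> l \<ge> N ==> nE E p (%w. ?v k w - ?v l w) < eps / 2"
      using e c(2) unfolding CS_iff by blast
    have "nE E p (%w. u a k w + ?v k w - (u a l w + ?v l w)) < eps" if "k \<ge> max M N" "l \<ge> max M N" for k l
    proof -
      have "nE E p (%w. (u a k w - u a l w) + (?v k w - ?v l w)) < eps"
        using nE_triangle[OF p, of "%w. u a k w - u a l w" "%w. ?v k w - ?v l w"] M[of k l] N[of k l] that CS_LA[OF c(1)] CS_LA[OF c(2)]
        by (simp add: cyl_diff)
      then show ?thesis by (simp add: algebra_simps)
    qed
    then show "\<exists>M. \<forall>k\<ge>M. \<forall>l\<ge>M. nE E p (%w. u a k w + ?v k w - (u a l w + ?v l w)) < eps" by blast
  qed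
  then show ?case using insert by simp
qed

lemma CS_add: assumes "p12 p" "u \<in> CS p" "v \<in> CS p" shows "(%k w. u k w + v k w) \<in> CS p"
  using CS_sum[OF assms(1), of "UNIV :: bool set" "%b. if b then u else v"] assms by (simp add: UNIV_bool add.commute)

lemma CS_uminus: "p12 p ==> u \<in> CS p ==> (%k w. - u k w) \<in> CS p"
  using fadm_CS[OF fadm_lipschitz[of 1 uminus], of p p u] by (simp add: norm_minus_commute)

lemma CS_diff: assumes "p12 p" "u \<in> CS p" "v \<in> CS p" shows "(%k w. u k w - v k w) \<in> CS p"
  using CS_add[OF assms(1,2) CS_uminus[OF assms(1,3)]] by simp

lemma CS_cong:
  assumes p: "p12 p" and u: "u \<in> CS p" and v: "!!k. v k \<in> cyl {0..T}" "(%k. nE E p (%w. u k w - v k w)) ----> 0"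
  shows "v \<in> CS p"
proof -
  have "(%k w. v k w - u k w) \<in> CS p"
    unfolding CS_iff
  proof (safe intro!: cyl_diff CS_cyl[OF u] v(1))
    fix eps :: real assume "eps > 0"
    then have "eps / 2 > 0" by simp
    then obtain M where M: "!!k. k \<ge> M ==> nE E p (%w. v k w - u k w) < eps / 2"
      using order_tendstoD(2)[OF v(2)] unfolding nE_minus_commute[of p "u _" "v _"] eventually_sequentially by blast
    have "nE E p (%w. v k w - u k w - (v l w - u l w)) < eps" if "k \<ge> M" "l \<ge> M" for k l
      using nE_triangle_diff[OF p, of "%w. v k w - u k w" "%w. 0" "%w. v l w - u l w"] M[OF that(1)] M[OF that(2)]
        cyl_LA[OF v(1)] CS_LA[OF u] nE_minus_commute[of p "v l" "u l"]
      by (simp add: cyl_diff cyl_const)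
    then show "\<exists>M. \<forall>k\<ge>M. \<forall>l\<ge>M. nE E p (%w. v k w - u k w - (v l w - u l w)) < eps" by blast
  qed
  from CS_add[OF p this u] show ?thesis by simp
qed

lemma nE_sum_null:
  assumes p: "p12 p" and "finite I" "!!i k. i \<in> I ==> wt i k \<in> LA" "!!i. i \<in> I ==> (%k. nE E p (wt i k)) ----> 0"
  shows "(%k. nE E p (%w. \<Sum>i\<in>I. wt i k w)) ----> 0"
proof (rule tendsto_sandwich[OF _ _ tendsto_const])
  show "\<forall>\<^sub>F k in sequentially. nE E p (%w. \<Sum>i\<in>I. wt i k w) <= (\<Sum>i\<in>I. nE E p (wt i k))"
    using assms by (intro always_eventually allI nE_sum)
  show "(%k. \<Sum>i\<in>I. nE E p (wt i k)) ----> 0" using tendsto_sum[OF assms(4)] by simp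
qed (auto simp: nE_nonneg)

text \<open>The union over all choices of representatives in \<open>lg_sum\<close> is a union of
  copies of one class, since different choices lead to sequences with null difference. The same
  holds for \<open>lg_add\<close> and \<open>lg_diff\<close> below.\<close>

lemma lg_sum_rep:
  assumes p: "p12 p" and I: "finite I" and U: "!!i. i \<in> I ==> U i \<in> LGs p" and u: "!!i. i \<in> I ==> u i \<in> U i"
  shows "lg_sum E T p U I \<in> LGs p" "(%k w. \<Sum>i\<in>I. u i k w) \<in> lg_sum E T p U I"
proof -
  let ?u = "%u k w. \<Sum>i\<in>I. u i k w"
  have c: "?u v \<in> CS p" if "!!i. i \<in> I ==> v i \<in> U i" for v
    using that U LG_D(1)[OF p] by (intro CS_sum[OF p I]) blast
  have "cls p (?u v) = cls p (?u u)" if v: "!!i. i \<in> I ==> v i \<in> U i" for v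
  proof (rule cls_eqI[OF p c[OF v] c[OF u]])
    have "(%k. nE E p (%w. \<Sum>i\<in>I. v i k w - u i k w)) ----> 0"
      using v u U LG_D(1)[OF p] LG_null[OF p]
      by (intro nE_sum_null[OF p I, where wt = "%i k w. v i k w - u i k w"] cyl_diff) (blast intro: CS_LA)+
    then show "(%k. nE E p (%w. (\<Sum>i\<in>I. v i k w) - (\<Sum>i\<in>I. u i k w))) ----> 0" by (simp add: sum_subtractf)
  qed auto
  then have "lg_sum E T p U I = cls p (?u u)" unfolding lg_sum_def using u by blast
  then show "lg_sum E T p U I \<in> LGs p" "?u u \<in> lg_sum E T p U I" using cls_in[OF p c[OF u]] by auto
qed

lemma lg_add_rep:
  assumes p: "p12 p" and U: "U \<in> LGs p" "V \<in> LGs p" "u \<in> U" "v \<in> V"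
  shows "lg_add E T p U V \<in> LGs p" "(%k w. u k w + v k w) \<in> lg_add E T p U V"
proof -
  have c: "(%k w. u k w + v k w) \<in> CS p" if "u \<in> U" "v \<in> V" for u v
    using that U LG_D(1)[OF p] by (intro CS_add[OF p])
  have "cls p (%k w. u' k w + v' k w) = cls p (%k w. u k w + v k w)" if v: "u' \<in> U" "v' \<in> V" for u' v'
  proof (rule cls_eqI[OF p c[OF v] c[OF U(3,4)]])
    have L: "u k \<in> LA" "v k \<in> LA" "u' k \<in> LA" "v' k \<in> LA" for k using U v LG_D(1)[OF p] CS_LA by blast+
    have le: "nE E p (%w. u' k w + v' k w - (u k w + v k w)) <= nE E p (%w. u' k w - u k w) + nE E p (%w. v' k w - v k w)" for k
      using nE_triangle[OF p, of "%w. u' k w - u k w" "%w. v' k w - v k w"] L by (simp add: cyl_diff algebra_simps)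
    have lim: "(%k. nE E p (%w. u' k w - u k w) + nE E p (%w. v' k w - v k w)) ----> 0"
      using tendsto_add[OF LG_null[OF p U(1) v(1) U(3)] LG_null[OF p U(2) v(2) U(4)]] by simp
    show "(%k. nE E p (%w. u' k w + v' k w - (u k w + v k w))) ----> 0"
      by (rule null_le[OF lim le nE_nonneg])
  qed
  then have "lg_add E T p U V = cls p (%k w. u k w + v k w)" unfolding lg_add_def using U(3,4) by blast
  then show "lg_add E T p U V \<in> LGs p" "(%k w. u k w + v k w) \<in> lg_add E T p U V" using cls_in[OF p c[OF U(3,4)]] by auto
qed

lemma lg_diff_rep:
  assumes p: "p12 p" and U: "U \<in> LGs p" "V \<in> LGs p" "u \<in> U" "v \<in> V"
  shows "lg_diff E T p U V \<in> LGs p" "(%k w. u k w - v k w) \<in> lg_diff E T p U V"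
proof -
  have c: "(%k w. u k w - v k w) \<in> CS p" if "u \<in> U" "v \<in> V" for u v
    using that U LG_D(1)[OF p] by (intro CS_diff[OF p])
  have "cls p (%k w. u' k w - v' k w) = cls p (%k w. u k w - v k w)" if v: "u' \<in> U" "v' \<in> V" for u' v'
  proof (rule cls_eqI[OF p c[OF v] c[OF U(3,4)]])
    have L: "u k \<in> LA" "v k \<in> LA" "u' k \<in> LA" "v' k \<in> LA" for k using U v LG_D(1)[OF p] CS_LA by blast+
    have le: "nE E p (%w. u' k w - v' k w - (u k w - v k w)) <= nE E p (%w. u' k w - u k w) + nE E p (%w. v k w - v' k w)" for k
      using nE_triangle[OF p, of "%w. u' k w - u k w" "%w. v k w - v' k w"] L by (simp add: cyl_diff algebra_simps)
    have lim: "(%k. nE E p (%w. u' k w - u k w) + nE E p (%w. v k w - v' k w)) ----> 0"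
      using tendsto_add[OF LG_null[OF p U(1) v(1) U(3)] LG_null[OF p U(2) U(4) v(2)]] by simp
    show "(%k. nE E p (%w. u' k w - v' k w - (u k w - v k w))) ----> 0"
      by (rule null_le[OF lim le nE_nonneg])
  qed
  then have "lg_diff E T p U V = cls p (%k w. u k w - v k w)" unfolding lg_diff_def using U(3,4) by blast
  then show "lg_diff E T p U V \<in> LGs p" "(%k w. u k w - v k w) \<in> lg_diff E T p U V" using cls_in[OF p c[OF U(3,4)]] by auto
qed

end

section \<open>Simple processes\<close>

text \<open>Projection of the time \<open>r\<close> onto \<open>[s,t]\<close>. An integral over
  \<open>[s,t]\<close> is formed by projecting all partition points, so that intervals outside
  collapse and contribute zero.\<close>

definition clip :: "real => real => real => real" where "clip s t r = max s (min r t)"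

definition grid :: "real => nat => (nat => real) => bool" where
  "grid T M p \<longleftrightarrow> p 0 = 0 \<and> p M = T \<and> (\<forall>k<M. p k < p (Suc k))"

lemma sp_iff: "(N, \<tau>, \<xi>) \<in> simple_processes T \<longleftrightarrow> grid T N \<tau> \<and> (\<forall>k<N. \<xi> k \<in> Lip (\<tau> k))"
  by (auto simp: simple_processes_def grid_def)

lemma grid_less: assumes "grid T M p" "i < j" "j <= M" shows "p i < p j"
  using assms(2,3)
proof (induction j)
  case (Suc j)
  have "p j < p (Suc j)" using Suc.prems assms(1) by (simp add: grid_def)
  then show ?case using Suc by (cases "i = j") auto
qed simp

lemma grid_le: "grid T M p ==> i <= j ==> j <= M ==> p i <= p j"
  using grid_less[of T M p i j] by (cases "i = j") auto

lemma grid_less_iff: "grid T M p ==> i <= M ==> j <= M ==> p i < p j \<longleftrightarrow> i < j"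
  using grid_less[of T M p i j] grid_le[of T M p j i] by (cases "i < j") auto

lemma grid_le_iff: "grid T M p ==> i <= M ==> j <= M ==> p i <= p j \<longleftrightarrow> i <= j"
  using grid_less_iff[of T M p j i] by (auto simp: not_less[symmetric])

lemma grid_range: "grid T M p ==> i <= M ==> 0 <= p i \<and> p i <= T"
  using grid_le[of T M p 0 i] grid_le[of T M p i M] by (auto simp: grid_def)

lemma grid_find:
  assumes "grid T M p" "0 <= t" "t < T" shows "\<exists>i<M. p i <= t \<and> t < p (Suc i)"
proof -
  have "\<exists>i<m. p i <= t \<and> t < p (Suc i)" if "m <= M" "t < p m" for m
    using that
  proof (induction m)
    case 0 then show ?case using assms by (simp add: grid_def)
  next
    case (Suc m)
    then show ?case by (cases "t < p m") (auto intro: less_SucI)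
  qed
  then show ?thesis using assms by (auto simp: grid_def)
qed

lemma grid_unique:
  assumes "grid T M p" "i < M" "j < M" "p i <= t" "t < p (Suc i)" "p j <= t" "t < p (Suc j)" shows "i = j"
proof -
  have "p i < p (Suc j)" "p j < p (Suc i)" using assms by linarith+
  then show ?thesis using grid_less_iff[OF assms(1), of i "Suc j"] grid_less_iff[OF assms(1), of j "Suc i"] assms by auto
qed

lemma process_at_in:
  assumes "grid T N \<tau>" "i < N" "\<tau> i <= t" "t < \<tau> (Suc i)" shows "process_at (N, \<tau>, \<xi>) t = \<xi> i"
proof
  fix w
  have "indicator {\<tau> k..<\<tau> (Suc k)} t *\<^sub>R \<xi> k w = (if k = i then \<xi> i w else 0)" if "k < N" for k
  proof (cases "k = i")
    case False
    then have "\<not> (\<tau> k <= t \<and> t < \<tau> (Suc k))" using grid_unique[OF assms(1), of k i t] assms that by blast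
    then show ?thesis using False by simp
  qed (use assms in simp)
  then have "process_at (N, \<tau>, \<xi>) t w = (\<Sum>k<N. if k = i then \<xi> i w else 0)"
    unfolding process_at_def prod.case by (intro sum.cong) auto
  then show "process_at (N, \<tau>, \<xi>) t w = \<xi> i w" using assms by simp
qed

lemma process_at_out:
  assumes "grid T N \<tau>" "t < 0 \<or> T <= t" shows "process_at (N, \<tau>, \<xi>) t = (%w. 0)"
proof
  fix w
  have "\<not> (\<tau> k <= t \<and> t < \<tau> (Suc k))" if "k < N" for k
    using grid_range[OF assms(1), of k] grid_range[OF assms(1), of "Suc k"] that assms(2) by auto
  then show "process_at (N, \<tau>, \<xi>) t w = 0"
    unfolding process_at_def by (auto simp: indicator_def intro!: sum.neutral)
qed

lemma process_at_cases:
  assumes "grid T N \<tau>"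
  obtains "process_at (N, \<tau>, \<xi>) t = (%w. 0)" "t < 0 \<or> T <= t"
  | i where "i < N" "\<tau> i <= t" "t < \<tau> (Suc i)" "process_at (N, \<tau>, \<xi>) t = \<xi> i"
proof (cases "t < 0 \<or> T <= t")
  case True then show thesis using that(1) process_at_out[OF assms True] by auto
next
  case False
  then obtain i where "i < N" "\<tau> i <= t" "t < \<tau> (Suc i)" using grid_find[OF assms, of t] by auto
  then show thesis using that(2) process_at_in[OF assms] by blast
qed

lemma sp_xi_cyl: assumes "(N, \<tau>, \<xi>) \<in> simple_processes T" "i < N" shows "\<xi> i \<in> cyl {0..\<tau> i}"
  using assms grid_range[of T N \<tau> i] Lip_eq_cyl[of "\<tau> i"] by (auto simp: sp_iff)

lemma sp_I: "grid T N \<tau> ==> (!!i. i < N ==> \<xi> i \<in> cyl {0..\<tau> i}) ==> (N, \<tau>, \<xi>) \<in> simple_processes T"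
  using grid_range[of T N \<tau>] by (auto simp: sp_iff Lip_eq_cyl)

lemma process_at_cyl:
  assumes "\<eta> \<in> simple_processes T" "0 <= t" shows "process_at \<eta> t \<in> cyl {0..t}"
proof -
  obtain N \<tau> \<xi> where \<eta>: "\<eta> = (N, \<tau>, \<xi>)" using prod_cases3 by blast
  then have g: "grid T N \<tau>" using assms sp_iff by blast
  show ?thesis
    using g
  proof (cases rule: process_at_cases[where t=t and \<xi>=\<xi>])
    case 1 then show ?thesis by (simp add: \<eta> cyl_const)
  next
    case (2 i)
    then show ?thesis using sp_xi_cyl[of N \<tau> \<xi> T i] assms cyl_mono[of "{0..\<tau> i}" "{0..t}"] by (auto simp: \<eta>)
  qed
qed

lemma process_at_cyl_T:
  assumes "\<eta> \<in> simple_processes T" "0 < T" shows "process_at \<eta> t \<in> cyl {0..T}"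
proof (cases "0 <= t \<and> t <= T")
  case True
  then show ?thesis using process_at_cyl[OF assms(1), of t] by (auto intro: cyl_mono[rotated])
next
  case False
  obtain N \<tau> \<xi> where \<eta>: "\<eta> = (N, \<tau>, \<xi>)" using prod_cases3 by blast
  then have "process_at \<eta> t = (%w. 0)" using assms False process_at_out[of T N \<tau> t] by (auto simp: sp_iff)
  then show ?thesis by (simp add: cyl_const)
qed

text \<open>Term \<open>k\<close> of a representing sequence of the integral over
  \<open>[s,t]\<close>, when \<open>a r\<close> represents the integrator at time
  \<open>r\<close>.\<close>

definition isum :: "(real => nat => 'd::finite path => real) => real => real =>
    ('d, 'v::real_normed_vector) simple_process => nat => 'd path => 'v" where
  "isum a s t \<eta> k w = (case \<eta> of (N, \<tau>, \<xi>) =>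
     \<Sum>i<N. (a (clip s t (\<tau> (Suc i))) k w - a (clip s t (\<tau> i)) k w) *\<^sub>R \<xi> i w)"

lemma ex_grid:
  assumes "finite P" "P \<subseteq> {0..T}" "0 \<in> P" "T \<in> P"
  shows "\<exists>M p. grid T M p \<and> p ` {..M} = P"
proof -
  define l where "l = sorted_list_of_set P"
  have l: "set l = P" "sorted l" "distinct l" "sorted_wrt (<) l" using assms(1) by (auto simp: l_def strict_sorted_iff)
  have len: "length l > 0" using assms(3) l(1) by auto
  have mono: "l ! i < l ! j" if "i < j" "j < length l" for i j
    using l(4) that by (simp add: sorted_wrt_iff_nth_less)
  have img: "(%i. l ! i) ` {..length l - 1} = P"
  proof -
    have "{..length l - 1} = {0..<length l}" using len by (cases l) (auto simp: less_Suc_eq_le)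
    then show ?thesis using l(1) by (auto simp: in_set_conv_nth)
  qed
  have "l ! 0 = 0"
  proof -
    obtain j where j: "j < length l" "l ! j = 0" using assms(3) l(1) by (metis in_set_conv_nth)
    then have "l ! 0 <= 0" using mono[of 0 j] by (cases "j = 0") auto
    moreover have "l ! 0 \<in> P" using len l(1) nth_mem by blast
    ultimately show ?thesis using assms(2) by force
  qed
  moreover have "l ! (length l - 1) = T"
  proof -
    obtain j where j: "j < length l" "l ! j = T" using assms(4) l(1) by (metis in_set_conv_nth)
    have "T <= l ! (length l - 1)"
    proof (cases "j = length l - 1")
      case False
      then have "j < length l - 1" "length l - 1 < length l" using j(1) by linarith+
      then show ?thesis using mono[of j "length l - 1"] j(2) by linarith
    qed (use j in simp)
    moreover have "l ! (length l - 1) \<in> P" using nth_mem[of "length l - 1" l] len l(1) by simp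
    ultimately show ?thesis using assms(2) by force
  qed
  ultimately have "grid T (length l - 1) (%i. l ! i)" unfolding grid_def using mono by simp
  then show ?thesis using img by blast
qed

text \<open>On each old interval the process is constant, so the finer increments telescope. The
  triples themselves differ, which is why processes are compared through \<open>process_at\<close>
  and \<open>isum\<close> rather than by equality.\<close>

lemma sp_regrid:
  fixes \<xi> :: "nat => 'd::finite path => 'v::real_normed_vector"
  assumes \<eta>: "(N, \<tau>, \<xi>) \<in> simple_processes T" and g: "grid T M p" and sub: "\<tau> ` {..N} \<subseteq> p ` {..M}"
  defines "\<zeta> \<equiv> (M, p, %i. process_at (N, \<tau>, \<xi>) (p i))"
  shows "\<zeta> \<in> simple_processes T" "process_at \<zeta> = process_at (N, \<tau>, \<xi>)" "isum a s t \<zeta> = isum a s t (N, \<tau>, \<xi>)"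
proof -
  have h: "grid T N \<tau>" using \<eta> by (simp add: sp_iff)
  \<comment> \<open>The position of the \<open>j\<close>-th old point in the new grid; the blocks
    between consecutive positions tile the new index range.\<close>
  obtain \<alpha> where \<alpha>: "!!j. j <= N ==> \<alpha> j <= M \<and> p (\<alpha> j) = \<tau> j"
  proof -
    have "\<forall>j\<in>{..N}. \<exists>i. i <= M \<and> p i = \<tau> j" using sub by (fastforce simp: image_subset_iff image_iff)
    from bchoice[OF this] show thesis using that by auto
  qed
  have \<alpha>_less: "\<alpha> j < \<alpha> (Suc j)" if "j < N" for j
    using grid_less_iff[OF g, of "\<alpha> j" "\<alpha> (Suc j)"] \<alpha>[of j] \<alpha>[of "Suc j"] that h by (simp add: grid_def)
  have \<alpha>0: "\<alpha> 0 = 0" using grid_le_iff[OF g, of "\<alpha> 0" 0] \<alpha>[of 0] h g by (simp add: grid_def)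
  have \<alpha>N: "\<alpha> N = M" using grid_le_iff[OF g, of M "\<alpha> N"] \<alpha>[of N] h g by (simp add: grid_def)
  have val: "process_at (N, \<tau>, \<xi>) r = \<xi> j" if "j < N" "\<tau> j <= r" "r < \<tau> (Suc j)" for j r
    using process_at_in[OF h that] .
  have between: "\<tau> j <= p i \<and> p (Suc i) <= \<tau> (Suc j)" if "j < N" "\<alpha> j <= i" "i < \<alpha> (Suc j)" for i j
    using that \<alpha>[of j] \<alpha>[of "Suc j"] grid_le[OF g, of "\<alpha> j" i] grid_le[OF g, of "Suc i" "\<alpha> (Suc j)"] by auto
  have step: "p i < p (Suc i)" if "i < M" for i using g that by (simp add: grid_def)
  show "\<zeta> \<in> simple_processes T" unfolding \<zeta>_def
    using grid_range[OF g] by (intro sp_I g process_at_cyl[OF \<eta>]) auto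
  have locate: "\<exists>j<N. \<alpha> j <= i \<and> i < \<alpha> (Suc j)" if i: "i < M" for i
  proof -
    have "0 <= p i" "p i < T" using grid_range[OF g, of i] grid_range[OF g, of "Suc i"] step[OF i] i by auto
    then obtain j where j: "j < N" "\<tau> j <= p i" "p i < \<tau> (Suc j)" using grid_find[OF h] by blast
    then have "p (\<alpha> j) <= p i" "p i < p (\<alpha> (Suc j))" using \<alpha>[of j] \<alpha>[of "Suc j"] by auto
    then have "\<alpha> j <= i" "i < \<alpha> (Suc j)"
      using grid_le_iff[OF g, of "\<alpha> j" i] grid_less_iff[OF g, of i "\<alpha> (Suc j)"] \<alpha>[of j] \<alpha>[of "Suc j"] i j by auto
    then show ?thesis using j by blast
  qed
  show "process_at \<zeta> = process_at (N, \<tau>, \<xi>)"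
  proof
    fix r
    show "process_at \<zeta> r = process_at (N, \<tau>, \<xi>) r"
      using g
    proof (cases rule: process_at_cases[where t=r and \<xi>="%i. process_at (N, \<tau>, \<xi>) (p i)"])
      case 1 then show ?thesis by (simp add: \<zeta>_def process_at_out[OF h 1(2)])
    next
      case (2 i)
      obtain j where j: "j < N" "\<alpha> j <= i" "i < \<alpha> (Suc j)" using locate[OF 2(1)] by blast
      have "process_at (N, \<tau>, \<xi>) (p i) = \<xi> j" "process_at (N, \<tau>, \<xi>) r = \<xi> j"
        using between[OF j] 2 step[OF 2(1)] by (auto intro!: val j)
      then show ?thesis using 2(4) by (simp add: \<zeta>_def)
    qed
  qed
  show "isum a s t \<zeta> = isum a s t (N, \<tau>, \<xi>)"
  proof (intro ext)
    fix k w
    let ?b = "%r. a (clip s t r) k w"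
    have "(\<Sum>i<\<alpha> n. (?b (p (Suc i)) - ?b (p i)) *\<^sub>R process_at (N, \<tau>, \<xi>) (p i) w) =
          (\<Sum>j<n. (?b (\<tau> (Suc j)) - ?b (\<tau> j)) *\<^sub>R \<xi> j w)" if "n <= N" for n
      using that
    proof (induction n)
      case 0 then show ?case by (simp add: \<alpha>0)
    next
      case (Suc n)
      let ?f = "%i. (?b (p (Suc i)) - ?b (p i)) *\<^sub>R process_at (N, \<tau>, \<xi>) (p i) w"
      have n: "n < N" using Suc.prems by simp
      have "sum ?f {..<\<alpha> (Suc n)} = sum ?f {..<\<alpha> n} + sum ?f {\<alpha> n..<\<alpha> (Suc n)}"
        using \<alpha>_less[OF n] by (subst sum.union_disjoint[symmetric]) (auto intro!: sum.cong)
      also have "sum ?f {\<alpha> n..<\<alpha> (Suc n)} = (\<Sum>i\<in>{\<alpha> n..<\<alpha> (Suc n)}. (?b (p (Suc i)) - ?b (p i)) *\<^sub>R \<xi> n w)"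
      proof (intro sum.cong refl)
        fix i assume "i \<in> {\<alpha> n..<\<alpha> (Suc n)}"
        then have i: "\<alpha> n <= i" "i < \<alpha> (Suc n)" "i < M" using \<alpha>[of "Suc n"] n by auto
        have "process_at (N, \<tau>, \<xi>) (p i) = \<xi> n" using between[OF n i(1,2)] step[OF i(3)] by (intro val n) auto
        then show "?f i = (?b (p (Suc i)) - ?b (p i)) *\<^sub>R \<xi> n w" by simp
      qed
      also have "... = (?b (p (\<alpha> (Suc n))) - ?b (p (\<alpha> n))) *\<^sub>R \<xi> n w"
        using \<alpha>_less[OF n] by (subst scaleR_left.sum[symmetric], subst sum_Suc_diff') auto
      finally show ?case using Suc n \<alpha>[of n] \<alpha>[of "Suc n"] by simp
    qed
    from this[of N] show "isum a s t \<zeta> k w = isum a s t (N, \<tau>, \<xi>) k w"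
      by (simp add: isum_def \<zeta>_def \<alpha>N)
  qed
qed

text \<open>A common refinement of both partitions. The values on the finer grid are read off the
  old processes at left endpoints, which keeps them adapted. Differences and other combinations of
  simple processes then reduce to componentwise ones.\<close>

lemma sp_pair:
  fixes \<eta> :: "('d::finite, 'v::real_normed_vector) simple_process" and \<zeta> :: "('d, 'w::real_normed_vector) simple_process"
  assumes "\<eta> \<in> simple_processes T" "\<zeta> \<in> simple_processes T" "0 < T"
  shows "\<exists>M p x y. (M, p, x) \<in> simple_processes T \<and> (M, p, y) \<in> simple_processes T \<and>
    process_at (M, p, x) = process_at \<eta> \<and> process_at (M, p, y) = process_at \<zeta> \<and>
    (\<forall>a s t. isum a s t (M, p, x) = isum a s t \<eta>) \<and> (\<forall>a s t. isum a s t (M, p, y) = isum a s t \<zeta>)"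
proof -
  obtain N \<tau> \<xi> where \<eta>: "\<eta> = (N, \<tau>, \<xi>)" using prod_cases3 by blast
  obtain N' \<tau>' \<xi>' where \<zeta>: "\<zeta> = (N', \<tau>', \<xi>')" using prod_cases3 by blast
  have g: "grid T N \<tau>" "grid T N' \<tau>'" using assms by (auto simp: \<eta> \<zeta> sp_iff)
  let ?P = "\<tau> ` {..N} \<union> \<tau>' ` {..N'}"
  have "?P \<subseteq> {0..T}" using grid_range[OF g(1)] grid_range[OF g(2)] by auto
  moreover have "0 \<in> ?P" "T \<in> ?P" using g(1) unfolding grid_def by (auto simp: image_iff)
  ultimately obtain M p where p: "grid T M p" "p ` {..M} = ?P" using ex_grid[of ?P T] by auto
  note r = sp_regrid[OF assms(1)[unfolded \<eta>] p(1)] sp_regrid[OF assms(2)[unfolded \<zeta>] p(1)]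
  show ?thesis
    by (intro exI[of _ M] exI[of _ p] exI[of _ "%i. process_at \<eta> (p i)"] exI[of _ "%i. process_at \<zeta> (p i)"] conjI allI)
       (unfold \<eta> \<zeta> p(2), (rule r; use p(2) in blast)+)
qed

lemma sp_diff:
  assumes "\<eta> \<in> simple_processes T" "\<zeta> \<in> simple_processes T" "0 < T"
  shows "\<exists>\<delta>\<in>simple_processes T. (\<forall>t. process_at \<delta> t = (%w. process_at \<eta> t w - process_at \<zeta> t w)) \<and>
    (\<forall>a s t. isum a s t \<delta> = (%k w. isum a s t \<eta> k w - isum a s t \<zeta> k w))"
proof -
  obtain M p x y where *: "(M, p, x) \<in> simple_processes T" "(M, p, y) \<in> simple_processes T"
    "process_at (M, p, x) = process_at \<eta>" "process_at (M, p, y) = process_at \<zeta>"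
    "!!a s t. isum a s t (M, p, x) = isum a s t \<eta>" "!!a s t. isum a s t (M, p, y) = isum a s t \<zeta>"
    using sp_pair[OF assms] by blast
  have g: "grid T M p" using * by (simp add: sp_iff)
  let ?d = "(M, p, %i w. x i w - y i w)"
  have "?d \<in> simple_processes T" using sp_xi_cyl[OF *(1)] sp_xi_cyl[OF *(2)] by (intro sp_I g cyl_diff)
  moreover have "process_at ?d t w = process_at \<eta> t w - process_at \<zeta> t w" for t w
    unfolding *(3,4)[symmetric] by (simp add: process_at_def scaleR_diff_right sum_subtractf)
  moreover have "isum a s t ?d k w = isum a s t \<eta> k w - isum a s t \<zeta> k w" for a s t k w
    unfolding *(5,6)[symmetric] by (simp add: isum_def scaleR_diff_right sum_subtractf)
  ultimately show ?thesis by (intro bexI[of _ ?d] conjI allI ext)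
qed

lemma measure_Ico_Icc:
  assumes "a <= b" "s <= t"
  shows "measure lebesgue ({a..<b} \<inter> {s..t}) = clip s t b - clip s t a"
proof (cases "t < b")
  case True
  then have "{a..<b} \<inter> {s..t} = {max a s..t}" by auto
  then show ?thesis using True assms by (simp add: clip_def max_def min_def)
next
  case False
  then have "{a..<b} \<inter> {s..t} = {max a s..<b}" by auto
  then show ?thesis using False assms by (simp add: clip_def max_def min_def)
qed

text \<open>Any functional of a simple process is a step function of time. The condition on
  \<open>g\<close> at the zero variable concerns the times outside \<open>[0,T)\<close>, where the
  process vanishes; this includes the endpoint \<open>T\<close>.\<close>

lemma sp_integral:
  fixes g :: "('d::finite path => 'v::real_normed_vector) => real"
  assumes "(N, \<tau>, \<xi>) \<in> simple_processes T" "g (%w. 0) = 0" "s <= t"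
  shows "set_integrable lebesgue {s..t} (%r. g (process_at (N, \<tau>, \<xi>) r))"
    "(LINT r:{s..t}|lebesgue. g (process_at (N, \<tau>, \<xi>) r)) =
      (\<Sum>i<N. (clip s t (\<tau> (Suc i)) - clip s t (\<tau> i)) * g (\<xi> i))"
proof -
  have gr: "grid T N \<tau>" using assms by (simp add: sp_iff)
  have eq: "g (process_at (N, \<tau>, \<xi>) r) = (\<Sum>i<N. indicator {\<tau> i..<\<tau> (Suc i)} r * g (\<xi> i))" for r
    using gr
  proof (cases rule: process_at_cases[where t=r and \<xi>=\<xi>])
    case 1
    then have "r \<notin> {\<tau> i..<\<tau> (Suc i)}" if "i < N" for i
      using grid_range[OF gr, of i] grid_range[OF gr, of "Suc i"] that by auto
    then have "(\<Sum>i<N. indicator {\<tau> i..<\<tau> (Suc i)} r * g (\<xi> i)) = 0" by (intro sum.neutral) auto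
    then show ?thesis using 1(1) assms(2) by simp
  next
    case (2 i)
    have "indicator {\<tau> j..<\<tau> (Suc j)} r * g (\<xi> j) = (if j = i then g (\<xi> i) else 0)" if "j < N" for j
    proof (cases "j = i")
      case False
      then have "\<not> (\<tau> j <= r \<and> r < \<tau> (Suc j))" using grid_unique[OF gr, of j i r] 2 that by blast
      then show ?thesis using False by simp
    qed (use 2 in simp)
    then have "(\<Sum>j<N. indicator {\<tau> j..<\<tau> (Suc j)} r * g (\<xi> j)) = (\<Sum>j<N. if j = i then g (\<xi> i) else 0)"
      by (intro sum.cong) auto
    then show ?thesis using 2 by simp
  qed
  have ind: "indicator {s..t} r *\<^sub>R (\<Sum>i<N. indicator {\<tau> i..<\<tau> (Suc i)} r * g (\<xi> i)) =
      (\<Sum>i<N. indicator ({\<tau> i..<\<tau> (Suc i)} \<inter> {s..t}) r * g (\<xi> i))" for r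
    unfolding real_scaleR_def sum_distrib_left by (intro sum.cong) (auto simp: indicator_def)
  have fin: "emeasure lebesgue ({\<tau> i..<\<tau> (Suc i)} \<inter> {s..t}) < \<infinity>" for i
    by (rule le_less_trans[OF emeasure_mono[of _ "{s..t}"]]) (auto simp: emeasure_lborel_Icc_eq)
  have int: "integrable lebesgue (%r. indicator ({\<tau> i..<\<tau> (Suc i)} \<inter> {s..t}) r * g (\<xi> i))" for i
    using fin by (intro integrable_mult_left integrable_real_indicator) auto
  show "set_integrable lebesgue {s..t} (%r. g (process_at (N, \<tau>, \<xi>) r))"
    unfolding set_integrable_def eq ind using int by (intro Bochner_Integration.integrable_sum) auto
  show "(LINT r:{s..t}|lebesgue. g (process_at (N, \<tau>, \<xi>) r)) = (\<Sum>i<N. (clip s t (\<tau> (Suc i)) - clip s t (\<tau> i)) * g (\<xi> i))"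
    unfolding set_lebesgue_integral_def eq ind using int fin gr assms(3)
    by (subst Bochner_Integration.integral_sum)
       (auto intro!: sum.cong simp: measure_Ico_Icc[symmetric] grid_def less_imp_le)
qed

lemma clip_in: "s <= t ==> clip s t r \<in> {s..t}" by (auto simp: clip_def)
lemma clip_mono: "r <= r' ==> clip s t r <= clip s t r'" by (auto simp: clip_def)
lemma clip_diff_le: "r <= r' ==> s <= t ==> clip s t r' - clip s t r <= r' - r" by (auto simp: clip_def)

lemma sum_clip: "grid T N \<tau> ==> 0 <= s ==> s <= t ==> t <= T ==> (\<Sum>i<N. clip s t (\<tau> (Suc i)) - clip s t (\<tau> i)) = t - s"
  by (subst sum_lessThan_telescope) (auto simp: grid_def clip_def)

lemma isum_split:
  assumes "\<eta> \<in> simple_processes T" "0 <= s" "s <= t"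
  shows "isum a 0 t \<eta> k w - isum a 0 s \<eta> k w = isum a s t \<eta> k w"
proof -
  obtain N \<tau> \<xi> where \<eta>: "\<eta> = (N, \<tau>, \<xi>)" using prod_cases3 by blast
  have g: "grid T N \<tau>" using assms by (simp add: \<eta> sp_iff)
  have *: "a (clip 0 t r) k w - a (clip 0 s r) k w = a (clip s t r) k w - a s k w" if "0 <= r" for r
    using assms that by (cases "r <= s") (auto simp: clip_def max_def min_def)
  have "(a (clip 0 t (\<tau> (Suc i))) k w - a (clip 0 t (\<tau> i)) k w) - (a (clip 0 s (\<tau> (Suc i))) k w - a (clip 0 s (\<tau> i)) k w) =
      a (clip s t (\<tau> (Suc i))) k w - a (clip s t (\<tau> i)) k w" if "i < N" for i
    using *[of "\<tau> i"] *[of "\<tau> (Suc i)"] grid_range[OF g, of i] grid_range[OF g, of "Suc i"] that by simp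
  then show ?thesis unfolding isum_def \<eta>
    by (simp add: sum_subtractf[symmetric] scaleR_diff_left[symmetric] del: scaleR_left_diff_distrib)
qed

lemma cyl_powr: assumes "p12 p" "X \<in> cyl I" shows "(%w. norm (X w) powr p) \<in> cyl I"
proof (cases "p = 1")
  case True then show ?thesis using assms by (simp add: cyl_norm)
next
  case False
  then have "p = 2" using assms by (simp add: p12_def)
  then show ?thesis using cyl_power2[OF cyl_norm[OF assms(2)]] by simp
qed

lemma powr_add_le: assumes "p12 p" "0 <= a" "0 <= b" shows "(a + b) powr p <= 2 * (a powr p + b powr p)"
proof (cases "p = 1")
  case True then show ?thesis using assms by simp
next
  case False
  then have "p = 2" using assms by (simp add: p12_def)
  moreover have "(a + b)^2 <= 2 * (a\<^sup>2 + b\<^sup>2)" using zero_le_power2[of "a - b"] by (simp add: power2_eq_square algebra_simps)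
  ultimately show ?thesis using assms by simp
qed

lemma powr_null:
  assumes "p12 p" "!!k. 0 <= f k" "(%k::nat. f k powr p) ----> 0" shows "f ----> 0"
proof (cases "p = 1")
  case True then show ?thesis using assms by simp
next
  case False
  then have "p = 2" using assms by (simp add: p12_def)
  then have "(%k. sqrt ((f k)^2)) ----> sqrt 0" using assms by (intro tendsto_real_sqrt) simp
  then show ?thesis using assms by simp
qed

lemma null_seq_less: "f ----> 0 ==> (c::real) > 0 ==> \<exists>M. \<forall>k\<ge>M. f k < c"
  using order_tendstoD(2)[of f 0 sequentially c] by (simp add: eventually_sequentially)

text \<open>Simple processes vanish at the terminal time, so pointwise estimates hold for
  \<open>t < T\<close> only; this removes the endpoint from integrals.\<close>

lemma AE_neq: "AE t in lebesgue. t \<noteq> (c::real)"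
  by (rule AE_I[of _ _ "{c}"]) auto

section \<open>The process spaces: \<open>MG\<close>, \<open>MG_bar\<close> and approximation by
  simple processes\<close>

context sublinear_T
begin

abbreviation "SP \<equiv> simple_processes T"
abbreviation "SI f \<equiv> set_integrable lebesgue {0..T} f"
abbreviation "LI f \<equiv> (LINT t:{0..T}|lebesgue. f t)"
abbreviation "pem p \<eta> t \<equiv> emb p (process_at \<eta> t)"

lemma pa_T: "\<eta> \<in> SP ==> process_at \<eta> t \<in> cyl {0..T}" by (rule process_at_cyl_T[OF _ T0])
lemma pem_in: "p12 p ==> \<eta> \<in> SP ==> pem p \<eta> t \<in> LGs p" by (intro emb_in pa_T)

lemma SI_const: "SI (%t. c :: real)" "LI (%t. c :: real) = c * T"
proof -
  have "integrable lebesgue (indicator {0..T} :: real => real)" by (intro integrable_real_indicator) (auto simp: emeasure_lborel_Icc_eq)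
  then show "SI (%t. c :: real)" unfolding set_integrable_def by (auto intro: integrable_mult_left)
  show "LI (%t. c :: real) = c * T" unfolding set_lebesgue_integral_def using T0 by simp
qed

text \<open>The \<open>p\<close>-th power of the \<open>M_G^p\<close> norm, with the time integral
  of the step function written out as a sum, so that it is visibly the expectation of a cylinder
  function.\<close>

definition mgE :: "real => ('d, 'v::real_normed_vector) simple_process => real" where
  "mgE p \<eta> = E (%w. case \<eta> of (N, \<tau>, \<xi>) => \<Sum>i<N. (\<tau> (Suc i) - \<tau> i) * norm (\<xi> i w) powr p)"

lemma clip_grid: "grid T N \<tau> ==> i <= N ==> clip 0 T (\<tau> i) = \<tau> i"
  using grid_range[of T N \<tau> i] by (auto simp: clip_def)

lemma mg_pdist_delta:
  assumes "\<delta> \<in> SP" "!!t. process_at \<delta> t = (%w. process_at \<eta> t w - process_at \<zeta> t w)" "p12 p"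
  shows "mg_pdist E T p \<eta> \<zeta> = mgE p \<delta> powr (1 / p)"
proof -
  obtain N \<tau> \<xi> where d: "\<delta> = (N, \<tau>, \<xi>)" using prod_cases3 by blast
  have g: "grid T N \<tau>" using assms(1) by (simp add: d sp_iff)
  have "(LINT t:{0..T}|lebesgue. norm (process_at \<delta> t w) powr p) = (\<Sum>i<N. (\<tau> (Suc i) - \<tau> i) * norm (\<xi> i w) powr p)" for w
    using sp_integral(2)[OF assms(1)[unfolded d], of "%X. norm (X w) powr p" 0 T] T0 assms(3)
    by (auto simp: d clip_grid[OF g] intro!: sum.cong)
  then show ?thesis unfolding mg_pdist_def mgE_def d by (simp add: assms(2)[unfolded d])
qed

lemma mgE_summands:
  assumes "(N, \<tau>, \<xi>) \<in> SP" "p12 p" "i < N"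
  shows "(%w. (\<tau> (Suc i) - \<tau> i) * norm (\<xi> i w) powr p) \<in> LA" "0 <= \<tau> (Suc i) - \<tau> i" "\<xi> i \<in> cyl {0..T}" "\<xi> i \<in> LA"
proof -
  have g: "grid T N \<tau>" using assms(1) by (simp add: sp_iff)
  show "0 <= \<tau> (Suc i) - \<tau> i" using g assms(3) by (simp add: grid_def less_imp_le)
  have "\<xi> i \<in> cyl {0..\<tau> i}" using sp_xi_cyl assms by blast
  then show "\<xi> i \<in> cyl {0..T}" using grid_range[OF g, of i] assms(3) by (intro Lip_cyl[of "\<tau> i"]) auto
  then show "\<xi> i \<in> LA" by (rule cyl_LA)
  then show "(%w. (\<tau> (Suc i) - \<tau> i) * norm (\<xi> i w) powr p) \<in> LA"
    using assms(2) by (intro cyl_mult cyl_const cyl_powr)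
qed

lemma nE_process_integral:
  fixes \<eta> :: "('d, 'v::real_normed_vector) simple_process"
  assumes "\<eta> \<in> SP" "p12 p" "s <= t"
  shows "set_integrable lebesgue {s..t} (%r. nE E p (process_at \<eta> r) powr p)"
    "set_integrable lebesgue {s..t} (%r. nE E p (process_at \<eta> r))"
proof -
  obtain N \<tau> \<xi> where d: "\<eta> = (N, \<tau>, \<xi>)" using prod_cases3 by blast
  have z: "nE E p (%w. 0::'v) = 0" using nE_const[OF assms(2), of "0::'v"] by simp
  show "set_integrable lebesgue {s..t} (%r. nE E p (process_at \<eta> r) powr p)"
    using sp_integral(1)[OF assms(1)[unfolded d], of "%X. nE E p X powr p" s t] assms z by (simp add: d)
  show "set_integrable lebesgue {s..t} (%r. nE E p (process_at \<eta> r))"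
    using sp_integral(1)[OF assms(1)[unfolded d], of "%X. nE E p X" s t] assms z by (simp add: d)
qed

lemma mgE_nonneg: assumes "\<eta> \<in> SP" "p12 p" shows "0 <= mgE p \<eta>"
proof -
  obtain N \<tau> \<xi> where d: "\<eta> = (N, \<tau>, \<xi>)" using prod_cases3 by blast
  note s = mgE_summands[OF assms(1)[unfolded d] assms(2)]
  show ?thesis unfolding mgE_def d prod.case
    by (intro E_nonneg cyl_sum sum_nonneg mult_nonneg_nonneg) (auto intro: s(1) simp: s(2)[simplified])
qed

text \<open>Sub-additivity moves the expectation inside the sum over the partition. For this reason
  the norm of \<open>MG_bar\<close> dominates that of \<open>MG\<close>, and \<open>mg_incl\<close>
  makes sense.\<close>

lemma mgE_le:
  fixes \<eta> :: "('d, 'v::real_normed_vector) simple_process"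
  assumes "\<eta> \<in> SP" "p12 p" shows "mgE p \<eta> <= LI (%t. nE E p (process_at \<eta> t) powr p)"
proof -
  obtain N \<tau> \<xi> where d: "\<eta> = (N, \<tau>, \<xi>)" using prod_cases3 by blast
  have g: "grid T N \<tau>" using assms(1) by (simp add: d sp_iff)
  note s = mgE_summands[OF assms(1)[unfolded d] assms(2)]
  have z: "nE E p (%w. 0::'v) = 0" using nE_const[OF assms(2), of "0::'v"] by simp
  have "mgE p \<eta> <= (\<Sum>i<N. E (%w. (\<tau> (Suc i) - \<tau> i) * norm (\<xi> i w) powr p))"
    unfolding mgE_def d prod.case by (intro E_sum) (auto intro: s)
  also have "... = (\<Sum>i<N. (\<tau> (Suc i) - \<tau> i) * nE E p (\<xi> i) powr p)"
    using s assms(2) by (intro sum.cong refl) (subst E_scale, auto simp: nE_powr intro!: cyl_powr)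
  also have "... = LI (%t. nE E p (process_at \<eta> t) powr p)"
    using sp_integral(2)[OF assms(1)[unfolded d], of "%X. nE E p X powr p" 0 T] T0 z assms(2)
    by (auto simp: d clip_grid[OF g] intro!: sum.cong)
  finally show ?thesis .
qed

lemma ld_pem:
  "p12 p ==> \<eta> \<in> SP ==> \<zeta> \<in> SP ==> ld p (pem p \<eta> t) (pem p \<zeta> t) = nE E p (%w. process_at \<eta> t w - process_at \<zeta> t w)"
  by (intro ld_emb pa_T)

lemma ld_pem_integrable:
  assumes "p12 p" "\<eta> \<in> SP" "\<zeta> \<in> SP"
  shows "SI (%t. ld p (pem p \<eta> t) (pem p \<zeta> t) powr p)" "SI (%t. ld p (pem p \<eta> t) (pem p \<zeta> t))"
    "mg_pdist E T p \<eta> \<zeta> powr p <= LI (%t. ld p (pem p \<eta> t) (pem p \<zeta> t) powr p)"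
proof -
  obtain \<delta> where \<delta>: "\<delta> \<in> SP" "!!t. process_at \<delta> t = (%w. process_at \<eta> t w - process_at \<zeta> t w)"
    using sp_diff[OF assms(2,3) T0] by (elim bexE conjE) (rule that, assumption, simp)
  then have eq: "ld p (pem p \<eta> t) (pem p \<zeta> t) = nE E p (process_at \<delta> t)" for t using ld_pem[OF assms] by simp
  show "SI (%t. ld p (pem p \<eta> t) (pem p \<zeta> t) powr p)" "SI (%t. ld p (pem p \<eta> t) (pem p \<zeta> t))"
    unfolding eq using nE_process_integral[OF \<delta>(1) assms(1)] T0 by auto
  have "p \<noteq> 0" using assms(1) by (auto simp: p12_def)
  then have "mg_pdist E T p \<eta> \<zeta> powr p = mgE p \<delta>"
    using mg_pdist_delta[OF \<delta> assms(1)] mgE_nonneg[OF \<delta>(1) assms(1)] by (simp add: powr_powr)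
  then show "mg_pdist E T p \<eta> \<zeta> powr p <= LI (%t. ld p (pem p \<eta> t) (pem p \<zeta> t) powr p)"
    unfolding eq using mgE_le[OF \<delta>(1) assms(1)] by simp
qed

text \<open>Processes are arbitrary functions of time with values in a space of classes, so
  measurability of their distance has no direct source. It is inherited from step functions, of
  which the distance is an almost everywhere limit; null sets do no harm because Lebesgue measure is
  complete.\<close>

lemma ld_measurable_core:
  assumes p: "p12 p" and sp: "!!m. \<eta> m \<in> SP" "!!m. \<zeta> m \<in> SP"
    and X: "!!t. t \<in> {0..T} ==> X t \<in> LGs p" and Y: "!!t. t \<in> {0..T} ==> Y t \<in> LGs p"
    and l: "AE t in lebesgue. t \<in> {0..T} --> (%m. ld p (pem p (\<eta> m) t) (X t)) ----> 0"
      "AE t in lebesgue. t \<in> {0..T} --> (%m. ld p (pem p (\<zeta> m) t) (Y t)) ----> 0"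
  shows "set_borel_measurable lebesgue {0..T} (%t. ld p (X t) (Y t))"
proof -
  let ?F = "%m t. indicator {0..T} t *\<^sub>R ld p (pem p (\<eta> m) t) (pem p (\<zeta> m) t)"
  have F: "?F m \<in> borel_measurable lebesgue" for m
    using ld_pem_integrable(2)[OF p sp(1)[of m] sp(2)[of m]] unfolding set_integrable_def by (rule borel_measurable_integrable)
  have "(%t. lim (%m. ?F m t)) \<in> borel_measurable lebesgue" using F by (rule borel_measurable_lim_metric)
  moreover have "AE t in lebesgue. lim (%m. ?F m t) = indicator {0..T} t *\<^sub>R ld p (X t) (Y t)"
    using l
  proof eventually_elim
    case (elim t)
    show ?case
    proof (cases "t \<in> {0..T}")
      case True
      have "(%m. ld p (pem p (\<eta> m) t) (pem p (\<zeta> m) t)) ----> ld p (X t) (Y t)"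
        using True elim X Y sp p by (intro ld_tendsto pem_in) auto
      then have "(%m. ?F m t) ----> indicator {0..T} t *\<^sub>R ld p (X t) (Y t)" by (intro tendsto_intros)
      then show ?thesis by (rule limI)
    next
      case False
      then have "(%m. ?F m t) ----> indicator {0..T} t *\<^sub>R ld p (X t) (Y t)" by simp
      then show ?thesis by (rule limI)
    qed
  qed
  ultimately show ?thesis unfolding set_borel_measurable_def by (rule borel_measurable_AE)
qed

lemma set_measurable_powr:
  assumes "set_borel_measurable lebesgue A f" "p12 p"
  shows "set_borel_measurable lebesgue A (%t. f t powr p)"
proof -
  have "(%t. indicator A t *\<^sub>R (f t powr p)) = (%t. (indicator A t *\<^sub>R f t) powr p)"
    using assms(2) by (auto simp: indicator_def p12_def)
  moreover have "(%t. (indicator A t *\<^sub>R f t) powr p) \<in> borel_measurable lebesgue"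
    using assms(1) unfolding set_borel_measurable_def by measurable
  ultimately show ?thesis unfolding set_borel_measurable_def by simp
qed

lemma L1_null_subseq:
  fixes g :: "nat => real => real"
  assumes g: "!!k. SI (g k)" "(%k. LI (g k)) ----> 0" and pos: "!!k t. 0 <= t ==> t < T ==> 0 <= g k t"
  obtains r where "strict_mono r" "AE t in lebesgue. t \<in> {0..T} --> (%k. g (r k) t) ----> 0"
proof -
  let ?u = "%k t. indicator {0..T} t *\<^sub>R g k t"
  have u: "integrable lebesgue (?u k)" for k using g(1) unfolding set_integrable_def by blast
  have "(LINT t|lebesgue. norm (?u k t)) = LI (g k)" for k
    unfolding set_lebesgue_integral_def
  proof (rule integral_cong_AE)
    show "AE t in lebesgue. norm (?u k t) = ?u k t"
      using AE_neq[of T] by eventually_elim (use pos in \<open>auto simp: indicator_def\<close>)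
  qed (use u in \<open>auto intro: borel_measurable_integrable\<close>)
  then have "(%k. LINT t|lebesgue. norm (?u k t)) ----> 0" using g(2) by simp
  from tendsto_L1_AE_subseq[OF u this] obtain r where r: "strict_mono r" "AE t in lebesgue. (%k. ?u (r k) t) ----> 0" by blast
  have "AE t in lebesgue. t \<in> {0..T} --> (%k. g (r k) t) ----> 0"
    using r(2) by eventually_elim auto
  then show thesis using that r(1) by blast
qed

text \<open>Majorants suffice: measurability of the distances follows from almost everywhere convergence
  along a subsequence.\<close>

lemma mg_bar_approxI:
  assumes p: "p12 p" and \<eta>: "!!k. \<eta> k \<in> SP" and X: "!!t. t \<in> {0..T} ==> X t \<in> LGs p"
    and le: "!!k t. 0 <= t ==> t < T ==> ld p (pem p (\<eta> k) t) (X t) powr p <= g k t"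
    and gi: "!!k. SI (g k)" and g0: "(%k. LI (g k)) ----> 0"
  shows "mg_bar_approx E T p \<eta> X"
proof -
  let ?D = "%k t. ld p (pem p (\<eta> k) t) (X t)"
  have pos: "0 <= g k t" if "0 <= t" "t < T" for k t using order_trans[OF powr_ge_zero le[OF that]] .
  obtain r where r: "strict_mono r" "AE t in lebesgue. t \<in> {0..T} --> (%k. g (r k) t) ----> 0"
    using L1_null_subseq[OF gi g0 pos] by blast
  have D0: "AE t in lebesgue. t \<in> {0..T} --> (%m. ?D (r m) t) ----> 0"
    using r(2) AE_neq[of T]
  proof eventually_elim
    case (elim t)
    show ?case
    proof
      assume t: "t \<in> {0..T}"
      then have t': "0 <= t" "t < T" using elim(2) by auto
      have "(%m. ?D (r m) t powr p) ----> 0"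
        by (rule null_le[OF _ le[OF t'] powr_ge_zero]) (use elim(1) t in blast)
      then show "(%m. ?D (r m) t) ----> 0"
        by (rule powr_null[OF p ld_nonneg[OF p pem_in[OF p \<eta>] X[OF t]]])
    qed
  qed
  have meas: "set_borel_measurable lebesgue {0..T} (?D k)" for k
    by (rule ld_measurable_core[where \<eta>="%_. \<eta> k" and \<zeta>="%m. \<eta> (r m)", OF p \<eta> \<eta> pem_in[OF p \<eta>] X _ D0])
       (auto simp: ld_refl[OF p pem_in[OF p \<eta>]])
  have AE_le: "AE t in lebesgue. t \<in> {0..T} --> norm (?D k t powr p) <= norm (g k t)" for k
    using AE_neq[of T] by eventually_elim (use le[of _ k] in \<open>force\<close>)
  have int: "SI (%t. ?D k t powr p)" for k
    by (rule set_integrable_bound[OF gi set_measurable_powr[OF meas p] AE_le])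
  have le1: "LI (%t. ?D k t powr p) <= LI (g k)" for k
    using AE_neq[of T] by (intro set_integral_mono_AE int gi) (use le in \<open>auto elim!: eventually_mono\<close>)
  have ge0: "0 <= LI (%t. ?D k t powr p)" for k
    unfolding set_lebesgue_integral_def by (intro Bochner_Integration.integral_nonneg) auto
  have "(%k. LI (%t. ?D k t powr p)) ----> 0" by (rule null_le[OF g0 le1 ge0])
  then show ?thesis unfolding mg_bar_approx_def using \<eta> int by blast
qed

lemma mg_bar_approxD:
  assumes "mg_bar_approx E T p \<eta> X"
  shows "\<eta> k \<in> SP" "SI (%t. ld p (pem p (\<eta> k) t) (X t) powr p)"
    "(%k. LI (%t. ld p (pem p (\<eta> k) t) (X t) powr p)) ----> 0"
  using assms by (auto simp: mg_bar_approx_def)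

lemma mg_bar_AE_subseq:
  assumes p: "p12 p" and a: "mg_bar_approx E T p \<eta> X" and X: "!!t. t \<in> {0..T} ==> X t \<in> LGs p"
  obtains r where "strict_mono r" "AE t in lebesgue. t \<in> {0..T} --> (%k. ld p (pem p (\<eta> (r k)) t) (X t)) ----> 0"
proof -
  obtain r where r: "strict_mono r" "AE t in lebesgue. t \<in> {0..T} --> (%k. ld p (pem p (\<eta> (r k)) t) (X t) powr p) ----> 0"
    using L1_null_subseq[OF mg_bar_approxD(2)[OF a] mg_bar_approxD(3)[OF a]] by auto
  have "AE t in lebesgue. t \<in> {0..T} --> (%k. ld p (pem p (\<eta> (r k)) t) (X t)) ----> 0"
    using r(2)
    by eventually_elim (intro impI powr_null[OF p ld_nonneg[OF p pem_in[OF p mg_bar_approxD(1)[OF a]] X]]; simp)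
  then show thesis using that r(1) by blast
qed

lemma MG_barD: "X \<in> MG_bar E T p ==> t \<in> {0..T} ==> X t \<in> LGs p" by (simp add: MG_bar_def)

lemma MG_bar_ld_measurable:
  assumes p: "p12 p" and X: "X \<in> MG_bar E T p" and Y: "Y \<in> MG_bar E T p"
  shows "set_borel_measurable lebesgue {0..T} (%t. ld p (X t) (Y t))"
proof -
  obtain \<eta> \<zeta> where a: "mg_bar_approx E T p \<eta> X" "mg_bar_approx E T p \<zeta> Y" using X Y by (auto simp: MG_bar_def)
  obtain r where r: "strict_mono r" "AE t in lebesgue. t \<in> {0..T} --> (%k. ld p (pem p (\<eta> (r k)) t) (X t)) ----> 0"
    using mg_bar_AE_subseq[OF p a(1) MG_barD[OF X]] by blast
  obtain r' where r': "strict_mono r'" "AE t in lebesgue. t \<in> {0..T} --> (%k. ld p (pem p (\<zeta> (r' k)) t) (Y t)) ----> 0"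
    using mg_bar_AE_subseq[OF p a(2) MG_barD[OF Y]] by blast
  show ?thesis
    by (rule ld_measurable_core[OF p mg_bar_approxD(1)[OF a(1)] mg_bar_approxD(1)[OF a(2)] MG_barD[OF X] MG_barD[OF Y] r(2) r'(2)])
qed

lemma MG_bar_ld_integrable:
  assumes p: "p12 p" and X: "X \<in> MG_bar E T p" and Y: "Y \<in> MG_bar E T p"
  shows "SI (%t. ld p (X t) (Y t) powr p)"
proof -
  obtain \<eta> \<zeta> where a: "mg_bar_approx E T p \<eta> X" "mg_bar_approx E T p \<zeta> Y" using X Y by (auto simp: MG_bar_def)
  note s = mg_bar_approxD(1)[OF a(1), of 0] mg_bar_approxD(1)[OF a(2), of 0]
  \<comment> \<open>The coefficients come from applying \<open>powr_add_le\<close> twice to a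
    triangle inequality through the two simple processes.\<close>
  let ?g = "%t. 2 * (ld p (pem p (\<eta> 0) t) (X t) powr p) + 4 * (ld p (pem p (\<eta> 0) t) (pem p (\<zeta> 0) t) powr p) + 4 * (ld p (pem p (\<zeta> 0) t) (Y t) powr p)"
  have g: "SI ?g"
    using mg_bar_approxD(2)[OF a(1)] mg_bar_approxD(2)[OF a(2)] ld_pem_integrable(1)[OF p s]
    by (intro set_integral_add set_integrable_mult_right)
  show ?thesis
  proof (rule set_integrable_bound[OF g set_measurable_powr[OF MG_bar_ld_measurable[OF p X Y] p]], intro AE_I2 impI)
    fix t assume t: "t \<in> {0..T}"
    let ?a = "ld p (pem p (\<eta> 0) t) (X t)" and ?b = "ld p (pem p (\<eta> 0) t) (pem p (\<zeta> 0) t)" and ?c = "ld p (pem p (\<zeta> 0) t) (Y t)"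
    have L: "X t \<in> LGs p" "Y t \<in> LGs p" "pem p (\<eta> 0) t \<in> LGs p" "pem p (\<zeta> 0) t \<in> LGs p"
      using MG_barD[OF X t] MG_barD[OF Y t] pem_in[OF p s(1)] pem_in[OF p s(2)] by auto
    have n: "0 <= ?a" "0 <= ?b" "0 <= ?c" using L ld_nonneg[OF p] by auto
    have "ld p (X t) (Y t) <= ?a + (?b + ?c)"
      using ld_tri[OF p L(1,3,2)] ld_tri[OF p L(3,4,2)] ld_sym[OF p L(1,3)] by simp
    then have "ld p (X t) (Y t) powr p <= (?a + (?b + ?c)) powr p"
      using ld_nonneg[OF p L(1,2)] p by (intro powr_mono2) (auto simp: p12_def)
    also have "... <= 2 * (?a powr p + (?b + ?c) powr p)" using n by (intro powr_add_le p) auto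
    also have "... <= 2 * (?a powr p + 2 * (?b powr p + ?c powr p))" using powr_add_le[OF p n(2,3)] by simp
    also have "... = ?g t" by simp
    finally show "norm (ld p (X t) (Y t) powr p) <= norm (?g t)" by simp
  qed
qed

text \<open>Both sequences approximate the same process. Taken with one sequence twice, the estimate
  shows that it is Cauchy in \<open>M_G^p\<close>; taken with two sequences, that they are
  equivalent there.\<close>

lemma mg_pdist_approx_le:
  assumes p: "p12 p" and X: "!!t. t \<in> {0..T} ==> X t \<in> LGs p"
    and a: "mg_bar_approx E T p \<eta> X" "mg_bar_approx E T p \<zeta> X"
  shows "mg_pdist E T p (\<eta> k) (\<zeta> l) powr p <= 2 * LI (%t. ld p (pem p (\<eta> k) t) (X t) powr p) + 2 * LI (%t. ld p (pem p (\<zeta> l) t) (X t) powr p)"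
proof -
  note s = mg_bar_approxD(1)[OF a(1), of k] mg_bar_approxD(1)[OF a(2), of l]
  note i = mg_bar_approxD(2)[OF a(1), of k] mg_bar_approxD(2)[OF a(2), of l]
  have "mg_pdist E T p (\<eta> k) (\<zeta> l) powr p <= LI (%t. ld p (pem p (\<eta> k) t) (pem p (\<zeta> l) t) powr p)"
    by (rule ld_pem_integrable(3)[OF p s])
  also have "... <= LI (%t. 2 * (ld p (pem p (\<eta> k) t) (X t) powr p) + 2 * (ld p (pem p (\<zeta> l) t) (X t) powr p))"
  proof (rule set_integral_mono)
    show "SI (%t. ld p (pem p (\<eta> k) t) (pem p (\<zeta> l) t) powr p)" by (rule ld_pem_integrable(1)[OF p s])
    show "SI (%t. 2 * (ld p (pem p (\<eta> k) t) (X t) powr p) + 2 * (ld p (pem p (\<zeta> l) t) (X t) powr p))"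
      using i by (intro set_integral_add set_integrable_mult_right)
    fix t assume t: "t \<in> {0..T}"
    let ?a = "ld p (pem p (\<eta> k) t) (X t)" and ?c = "ld p (pem p (\<zeta> l) t) (X t)"
    have L: "X t \<in> LGs p" "pem p (\<eta> k) t \<in> LGs p" "pem p (\<zeta> l) t \<in> LGs p"
      using X[OF t] pem_in[OF p s(1)] pem_in[OF p s(2)] by auto
    have "ld p (pem p (\<eta> k) t) (pem p (\<zeta> l) t) powr p <= (?a + ?c) powr p"
      using ld_tri[OF p L(2,1,3)] ld_sym[OF p L(1,3)] ld_nonneg[OF p L(2,3)] p by (intro powr_mono2) (auto simp: p12_def)
    also have "... <= 2 * (?a powr p + ?c powr p)" using L ld_nonneg[OF p] by (intro powr_add_le p) auto
    finally show "ld p (pem p (\<eta> k) t) (pem p (\<zeta> l) t) powr p <= 2 * (?a powr p) + 2 * (?c powr p)" by simp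
  qed
  also have "... = 2 * LI (%t. ld p (pem p (\<eta> k) t) (X t) powr p) + 2 * LI (%t. ld p (pem p (\<zeta> l) t) (X t) powr p)"
    using i by (subst set_integral_add) (auto intro: set_integrable_mult_right)
  finally show ?thesis .
qed

lemma mg_pdist_nonneg: "0 <= mg_pdist E T p \<eta> \<zeta>" by (simp add: mg_pdist_def)

lemma mg_pdist_approx_null:
  assumes p: "p12 p" and X: "!!t. t \<in> {0..T} ==> X t \<in> LGs p"
    and a: "mg_bar_approx E T p \<eta> X" "mg_bar_approx E T p \<zeta> X"
  shows "(%k. mg_pdist E T p (\<eta> k) (\<zeta> k)) ----> 0"
proof (rule powr_null[OF p mg_pdist_nonneg])
  show "(%k. mg_pdist E T p (\<eta> k) (\<zeta> k) powr p) ----> 0"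
  proof (rule null_le[OF _ mg_pdist_approx_le[OF p X a] powr_ge_zero])
    show "(%k. 2 * LI (%t. ld p (pem p (\<eta> k) t) (X t) powr p) + 2 * LI (%t. ld p (pem p (\<zeta> k) t) (X t) powr p)) ----> 0"
      using tendsto_add[OF tendsto_mult_right_zero[OF mg_bar_approxD(3)[OF a(1)], of 2] tendsto_mult_right_zero[OF mg_bar_approxD(3)[OF a(2)], of 2]] by simp
  qed
qed

lemma mg_approx_Cauchy:
  assumes p: "p12 p" and X: "!!t. t \<in> {0..T} ==> X t \<in> LGs p" and a: "mg_bar_approx E T p \<eta> X"
  shows "\<eta> \<in> cauchy_seqs SP (mg_pdist E T p)"
  unfolding cauchy_seqs_def
proof (safe intro!: mg_bar_approxD(1)[OF a])
  fix eps :: real assume e: "eps > 0"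
  then have "eps powr p / 4 > 0" by simp
  then obtain M where M: "!!k. k \<ge> M ==> LI (%t. ld p (pem p (\<eta> k) t) (X t) powr p) < eps powr p / 4"
    using null_seq_less[OF mg_bar_approxD(3)[OF a]] by blast
  have "mg_pdist E T p (\<eta> k) (\<eta> l) < eps" if "k \<ge> M" "l \<ge> M" for k l
  proof -
    have "mg_pdist E T p (\<eta> k) (\<eta> l) powr p < eps powr p"
      using mg_pdist_approx_le[OF p X a a, of k l] M[OF that(1)] M[OF that(2)] by simp
    then show ?thesis using e p by (auto simp: p12_def mg_pdist_nonneg power_less_imp_less_base)
  qed
  then show "\<exists>M. \<forall>k\<ge>M. \<forall>l\<ge>M. mg_pdist E T p (\<eta> k) (\<eta> l) < eps" by blast
qed

lemma mg_incl_in: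
  assumes p: "p12 p" and X: "!!t. t \<in> {0..T} ==> X t \<in> LGs p" and a: "mg_bar_approx E T p \<eta> X"
  shows "\<eta> \<in> mg_incl E T p X"
proof -
  have "\<eta> \<in> cauchy_class SP (mg_pdist E T p) \<eta>"
    using mg_approx_Cauchy[OF p X a] mg_pdist_approx_null[OF p X a a] by (auto simp: cauchy_class_def cauchy_rel_def)
  then show ?thesis using a unfolding mg_incl_def by blast
qed

lemma mg_inclD:
  assumes "u \<in> mg_incl E T p X"
  obtains \<eta> where "mg_bar_approx E T p \<eta> X" "!!k. u k \<in> SP" "(%k. mg_pdist E T p (\<eta> k) (u k)) ----> 0"
  using assms unfolding mg_incl_def cauchy_class_def cauchy_rel_def cauchy_seqs_def by blast

text \<open>The majorant \<open>g\<close> stands in for the distance, whose measurability in time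
  then need not be known beforehand. The endpoint \<open>T\<close> is exempt because simple
  processes vanish there.\<close>

definition approximable :: "real => (real => (nat => 'd path => 'v::real_normed_vector) set) => bool" where
  "approximable p X \<longleftrightarrow> (\<forall>eps>0. \<exists>\<eta>\<in>SP. \<exists>g. SI g \<and> LI g < eps \<and>
     (\<forall>t. 0 <= t --> t < T --> ld p (pem p \<eta> t) (X t) powr p <= g t))"

lemma approximable_MG_bar:
  assumes p: "p12 p" and X: "!!t. t \<in> {0..T} ==> X t \<in> LGs p" and a: "approximable p X"
  shows "X \<in> MG_bar E T p"
proof -
  have "\<forall>k::nat. \<exists>z. fst z \<in> SP \<and> SI (snd z) \<and> LI (snd z) < 1 / (real k + 1) \<and>
     (\<forall>t. 0 <= t --> t < T --> ld p (pem p (fst z) t) (X t) powr p <= snd z t)"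
  proof
    fix k :: nat
    have "1 / (real k + 1) > 0" by simp
    then obtain \<eta> g where "\<eta> \<in> SP" "SI g" "LI g < 1 / (real k + 1)"
      "\<forall>t. 0 <= t --> t < T --> ld p (pem p \<eta> t) (X t) powr p <= g t" using a unfolding approximable_def by meson
    then show "\<exists>z. fst z \<in> SP \<and> SI (snd z) \<and> LI (snd z) < 1 / (real k + 1) \<and>
     (\<forall>t. 0 <= t --> t < T --> ld p (pem p (fst z) t) (X t) powr p <= snd z t)"
      by (intro exI[of _ "(\<eta>, g)"]) simp
  qed
  from choice[OF this] obtain z where z: "!!k. fst (z k) \<in> SP" "!!k. SI (snd (z k))" "!!k. LI (snd (z k)) < 1 / (real k + 1)"
    "!!k t. 0 <= t ==> t < T ==> ld p (pem p (fst (z k)) t) (X t) powr p <= snd (z k) t" by blast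
  have nn: "0 <= LI (snd (z k))" for k
  proof -
    have "LI (%t. 0) <= LI (snd (z k))"
    proof (rule set_integral_mono_AE)
      show "AE t\<in>{0..T} in lebesgue. 0 <= snd (z k) t"
        using AE_neq[of T] by eventually_elim (use order_trans[OF powr_ge_zero z(4)] in force)
    qed (rule SI_const z(2))+
    then show ?thesis by (simp add: set_lebesgue_integral_def)
  qed
  have l0: "(%k. 1 / (real k + 1)) ----> 0"
    using LIMSEQ_inverse_real_of_nat by (simp add: inverse_eq_divide add.commute)
  have "(%k. LI (snd (z k))) ----> 0" by (rule null_le[OF l0 less_imp_le[OF z(3)] nn])
  then have "mg_bar_approx E T p (%k. fst (z k)) X" using z by (intro mg_bar_approxI[OF p _ X, where g="%k. snd (z k)"]) auto
  then show ?thesis using X by (auto simp: MG_bar_def)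
qed

lemma uniform_grid: "n > 0 ==> grid T n (%i. real i * T / real n)"
  using T0 by (auto simp: grid_def divide_strict_right_mono)

lemma continuous_adapted_approximable:
  assumes p: "p12 p" and X: "!!t. t \<in> {0..T} ==> X t \<in> LGs p" and ad: "!!t. t \<in> {0..T} ==> adapted t (X t)"
    and cont: "!!eps. eps > 0 ==> \<exists>\<delta>>0. \<forall>s\<in>{0..T}. \<forall>t\<in>{0..T}. s <= t --> t - s < \<delta> --> ld p (X s) (X t) < eps"
  shows "X \<in> MG_bar E T p"
proof (rule approximable_MG_bar[OF p X])
  show "approximable p X" unfolding approximable_def
  proof (intro allI impI)
    fix eps :: real assume e: "eps > 0"
    have ppos: "0 < p" using p by (auto simp: p12_def)
    \<comment> \<open>The error of freezing and the error of the cylinder function are each below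
      \<open>c\<close>, and \<open>(c + c)^p\<close> integrated over \<open>[0,T]\<close> is
      \<open>eps / 2\<close>.\<close>
    define c where "c = (eps / (2 * T)) powr (1 / p) / 2"
    have c: "c > 0" using e T0 by (simp add: c_def)
    have c2: "(c + c) powr p = eps / (2 * T)" using e T0 ppos by (simp add: c_def powr_powr)
    obtain \<delta> where \<delta>: "\<delta> > 0" "!!s t. s \<in> {0..T} ==> t \<in> {0..T} ==> s <= t ==> t - s < \<delta> ==> ld p (X s) (X t) < c"
      using cont[OF c] by blast
    obtain n :: nat where n: "T / \<delta> < real n" using reals_Archimedean2 by blast
    have "0 < T / \<delta>" using \<delta>(1) T0 by simp
    then have n': "0 < real n" using n by linarith
    then have n0: "n > 0" "T / real n < \<delta>" using n \<delta>(1) by (simp_all add: pos_divide_less_eq mult.commute)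
    let ?\<tau> = "%i. real i * T / real n"
    have g: "grid T n ?\<tau>" using uniform_grid[OF n0(1)] .
    have "\<exists>wt\<in>cyl {0..?\<tau> i}. ld p (emb p wt) (X (?\<tau> i)) < c" if "i < n" for i
    proof -
      have t: "?\<tau> i \<in> {0..T}" using grid_range[OF g, of i] that by simp
      obtain wt where wt: "wt \<in> X (?\<tau> i)" "!!k. wt k \<in> cyl {0..?\<tau> i}" using ad[OF t] by (auto simp: adapted_def)
      have "\<forall>\<^sub>F k in sequentially. ld p (emb p (wt k)) (X (?\<tau> i)) < c"
        using order_tendstoD(2)[OF emb_tendsto[OF p X[OF t] wt(1)] c] .
      then show ?thesis using wt(2) by (auto simp: eventually_sequentially)
    qed
    then obtain \<xi> where \<xi>: "!!i. i < n ==> \<xi> i \<in> cyl {0..?\<tau> i}" "!!i. i < n ==> ld p (emb p (\<xi> i)) (X (?\<tau> i)) < c" by metis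
    have sp: "(n, ?\<tau>, \<xi>) \<in> SP" using \<xi>(1) by (intro sp_I g)
    have "ld p (pem p (n, ?\<tau>, \<xi>) t) (X t) powr p <= eps / (2 * T)" if t: "0 <= t" "t < T" for t
    proof -
      obtain i where i: "i < n" "?\<tau> i <= t" "t < ?\<tau> (Suc i)" using grid_find[OF g t] by blast
      have ti: "?\<tau> i \<in> {0..T}" using grid_range[OF g, of i] i(1) by simp
      have "?\<tau> (Suc i) - ?\<tau> i = T / real n" using n0(1) by (simp add: field_simps)
      then have "t - ?\<tau> i < \<delta>" using i n0(2) by linarith
      then have 1: "ld p (X (?\<tau> i)) (X t) < c" using ti t i by (intro \<delta>(2)) auto
      have L: "emb p (\<xi> i) \<in> LGs p" using Lip_cyl[OF ti \<xi>(1)[OF i(1)]] by (rule emb_in(1)[OF p])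
      have Xt: "X t \<in> LGs p" "X (?\<tau> i) \<in> LGs p" using X t ti by auto
      have "ld p (emb p (\<xi> i)) (X t) <= c + c" using ld_tri[OF p L Xt(2,1)] 1 \<xi>(2)[OF i(1)] by simp
      then have "ld p (emb p (\<xi> i)) (X t) powr p <= (c + c) powr p" using ld_nonneg[OF p L Xt(1)] ppos by (intro powr_mono2) auto
      then show ?thesis using process_at_in[OF g i, of \<xi>] c2 by simp
    qed
    then show "\<exists>\<eta>\<in>SP. \<exists>g. SI g \<and> LI g < eps \<and> (\<forall>t. 0 <= t --> t < T --> ld p (pem p \<eta> t) (X t) powr p <= g t)"
      using sp SI_const[of "eps / (2 * T)"] e T0 by (intro bexI[OF _ sp] exI[of _ "%t. eps / (2 * T)"]) auto
  qed
qed

lemma lg_map_pem: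
  assumes "fadm f L" "p12 p" "p12 q" "p <= q" "\<eta> \<in> SP"
  shows "lg_map E T p f (pem q \<eta> t) = emb p (%w. f w (process_at \<eta> t w))"
  using lg_map_emb[OF assms(1-4) pa_T[OF assms(5)]] by simp

text \<open>The approximating sequence is kept, so that integrals in both spaces can be obtained as
  limits along the same simple processes.\<close>

lemma mg_bar_approx_2_1:
  assumes a: "mg_bar_approx E T 2 \<eta> X" and X: "!!t. t \<in> {0..T} ==> X t \<in> LGs 2"
  shows "mg_bar_approx E T 1 \<eta> (%t. inc (X t))"
proof (rule mg_bar_approxI)
  let ?D = "%k t. ld 2 (pem 2 (\<eta> k) t) (X t)"
  note sp = mg_bar_approxD(1)[OF a]
  have sq: "?D k t powr 2 = (?D k t)^2" if "t \<in> {0..T}" for k t using ld_nonneg[of 2 "pem 2 (\<eta> k) t" "X t"] pem_in[OF _ sp] X[OF that] by simp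
  have meas: "set_borel_measurable lebesgue {0..T} (?D k)" for k
  proof -
    obtain r where r: "strict_mono r" "AE t in lebesgue. t \<in> {0..T} --> (%k. ?D (r k) t) ----> 0"
      using mg_bar_AE_subseq[OF _ a X] by auto
    show ?thesis
      by (rule ld_measurable_core[where \<eta>="%_. \<eta> k" and \<zeta>="%m. \<eta> (r m)", OF _ sp sp pem_in[OF _ sp] X _ r(2)]) (auto simp: ld_refl[OF _ pem_in[OF _ sp]])
  qed
  \<comment> \<open>With \<open>e\<close> free, this replaces the Cauchy-Schwarz inequality in time:
    \<open>e\<close> is fixed small first, then the integral of the squared distance is made
    small.\<close>
  have D_le: "?D k t <= e + (1 / e) * (?D k t powr 2)" if "t \<in> {0..T}" "e > 0" for k t e
  proof -
    have "0 <= (?D k t - e)^2 + e * ?D k t" using that ld_nonneg[OF _ pem_in[OF _ sp[of k]] X[OF that(1)]] by simp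
    then have "e * ?D k t <= e * (e + (1 / e) * (?D k t)^2)" using that by (simp add: power2_eq_square algebra_simps)
    then show ?thesis unfolding sq[OF that(1)] using that by simp
  qed
  have SIe: "SI (%t. e + (1 / e) * (?D k t powr 2))" for e k
    using mg_bar_approxD(2)[OF a, of k] by (intro set_integral_add SI_const set_integrable_mult_right)
  show SID: "SI (?D k)" for k
  proof (rule set_integrable_bound[OF SIe[of 1 k] meas], intro AE_I2 impI)
    fix t assume t: "t \<in> {0..T}"
    then show "norm (?D k t) <= norm (1 + (1 / 1) * (?D k t powr 2))"
      using D_le[OF t, of 1 k] ld_nonneg[OF _ pem_in[OF _ sp[of k]] X[OF t]] by simp
  qed
  show "(%k. LI (?D k)) ----> 0"
  proof (rule LIMSEQ_I)
    fix eps :: real assume e: "eps > 0"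
    define d where "d = eps / (2 * T)"
    have d: "d > 0" "d * T = eps / 2" using e T0 by (auto simp: d_def)
    have "d * eps / 2 > 0" using d e by simp
    then obtain M where M: "!!k. k \<ge> M ==> LI (%t. ?D k t powr 2) < d * eps / 2"
      using null_seq_less[OF mg_bar_approxD(3)[OF a]] by blast
    have "norm (LI (?D k) - 0) < eps" if "k \<ge> M" for k
    proof -
      have "LI (?D k) <= LI (%t. d + (1 / d) * (?D k t powr 2))"
        using D_le d by (intro set_integral_mono SID SIe) auto
      also have "... = d * T + (1 / d) * LI (%t. ?D k t powr 2)"
        using mg_bar_approxD(2)[OF a, of k] by (subst set_integral_add) (auto simp: SI_const)
      also have "... < eps / 2 + (1 / d) * (d * eps / 2)" using d M[OF that] by (intro add_le_less_mono mult_strict_left_mono) auto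
      also have "... = eps" using d by simp
      finally have "LI (?D k) < eps" .
      moreover have "0 <= LI (?D k)" unfolding set_lebesgue_integral_def
        using ld_nonneg[OF _ pem_in[OF _ sp] X] by (intro Bochner_Integration.integral_nonneg) (auto simp: indicator_def)
      ultimately show ?thesis by simp
    qed
    then show "\<exists>M. \<forall>k\<ge>M. norm (LI (?D k) - 0) < eps" by blast
  qed
  fix k t assume t: "0 <= t" "t < T"
  then have X2: "X t \<in> LGs 2" using X by simp
  have "inc (pem 2 (\<eta> k) t) = pem 1 (\<eta> k) t" using lg_map_pem[OF fadm_id _ _ _ sp] by simp
  then have "ld 1 (pem 1 (\<eta> k) t) (inc (X t)) <= ?D k t"
    using ld_lg_map[OF fadm_id, of 1 2 "pem 2 (\<eta> k) t" "X t"] pem_in[OF _ sp] X2 by simp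
  then show "ld 1 (pem 1 (\<eta> k) t) (inc (X t)) powr 1 <= ?D k t"
    using ld_nonneg[of 1 "pem 1 (\<eta> k) t" "inc (X t)"] pem_in[OF _ sp] inc_rep(1)[OF _ X2] by simp
qed (use mg_bar_approxD(1)[OF a] X inc_rep(1)[of 2] in auto)

end

section \<open>Increments of the Brownian motion\<close>

definition bounded_lip :: "('a::real_normed_vector => real) => bool" where
  "bounded_lip \<psi> \<longleftrightarrow> (\<exists>C. \<forall>x. \<bar>\<psi> x\<bar> <= C) \<and> (\<exists>L\<ge>0. \<forall>x y. \<bar>\<psi> x - \<psi> y\<bar> <= L * norm (x - y))"

lemma blI: "(!!x. \<bar>\<psi> x\<bar> <= C) ==> 0 <= L ==> (!!x y. \<bar>\<psi> x - \<psi> y\<bar> <= L * norm (x - y)) ==> bounded_lip \<psi>"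
  unfolding bounded_lip_def by blast

lemma bl_C_bLip: "bounded_lip \<psi> ==> \<psi> \<in> C_bLip"
  unfolding bounded_lip_def C_bLip_def C_Lip_def lipschitz_on_def dist_norm bounded_iff by auto

lemma bl_cyl: assumes "bounded_lip \<psi>" "s \<in> I" "t \<in> I" shows "(%w. \<psi> (B t w - B s w)) \<in> cyl I"
proof -
  obtain C L where "!!x. \<bar>\<psi> x\<bar> <= C" "!!x y. \<bar>\<psi> x - \<psi> y\<bar> <= L * norm (x - y)"
    using assms(1) unfolding bounded_lip_def by blast
  then show ?thesis by (intro cyl_C_bLip_increment[OF assms(2,3), of \<psi> C L]) (auto simp: dist_norm)
qed

lemma bl_const: "bounded_lip (%x. c)" by (rule blI[of _ "\<bar>c\<bar>" 0]) auto

lemma bl_scale: assumes "bounded_lip \<psi>" shows "bounded_lip (%x. c * \<psi> x)"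
proof -
  obtain C L where *: "!!x. \<bar>\<psi> x\<bar> <= C" "0 <= L" "!!x y. \<bar>\<psi> x - \<psi> y\<bar> <= L * norm (x - y)"
    using assms unfolding bounded_lip_def by blast
  show ?thesis
    by (rule blI[of _ "\<bar>c\<bar> * C" "\<bar>c\<bar> * L"])
       (use * in \<open>auto simp: abs_mult mult.assoc mult_left_mono simp flip: right_diff_distrib\<close>)
qed

lemma bl_add: assumes "bounded_lip \<psi>" "bounded_lip \<theta>" shows "bounded_lip (%x. \<psi> x + \<theta> x)"
proof -
  obtain C L where *: "!!x. \<bar>\<psi> x\<bar> <= C" "0 <= L" "!!x y. \<bar>\<psi> x - \<psi> y\<bar> <= L * norm (x - y)"
    using assms(1) unfolding bounded_lip_def by blast
  obtain C' L' where **: "!!x. \<bar>\<theta> x\<bar> <= C'" "0 <= L'" "!!x y. \<bar>\<theta> x - \<theta> y\<bar> <= L' * norm (x - y)"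
    using assms(2) unfolding bounded_lip_def by blast
  have "\<bar>\<psi> x + \<theta> x\<bar> <= C + C'" for x using *(1)[of x] **(1)[of x] by linarith
  moreover have "\<bar>\<psi> x + \<theta> x - (\<psi> y + \<theta> y)\<bar> <= (L + L') * norm (x - y)" for x y
    using *(3)[of x y] **(3)[of x y] unfolding distrib_right by linarith
  ultimately show ?thesis using *(2) **(2) by (intro blI[of _ "C + C'" "L + L'"]) auto
qed

lemma bl_square: assumes "bounded_lip \<psi>" shows "bounded_lip (%x. (\<psi> x)^2)"
proof -
  obtain C L where *: "!!x. \<bar>\<psi> x\<bar> <= C" "0 <= L" "!!x y. \<bar>\<psi> x - \<psi> y\<bar> <= L * norm (x - y)"
    using assms(1) unfolding bounded_lip_def by blast
  have C: "0 <= C" using *(1)[of 0] by linarith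
  have "\<bar>(\<psi> x)^2\<bar> <= C\<^sup>2" for x using power_mono[OF *(1)[of x] abs_ge_zero, of 2] by simp
  moreover have "\<bar>(\<psi> x)^2 - (\<psi> y)^2\<bar> <= (2 * C * L) * norm (x - y)" for x y
  proof -
    have "\<bar>(\<psi> x)^2 - (\<psi> y)^2\<bar> = \<bar>\<psi> x + \<psi> y\<bar> * \<bar>\<psi> x - \<psi> y\<bar>"
      by (simp add: power2_eq_square abs_mult[symmetric] algebra_simps)
    also have "... <= (2 * C) * (L * norm (x - y))" using *(1)[of x] *(1)[of y] *(3)[of x y] C by (intro mult_mono) auto
    finally show ?thesis by simp
  qed
  ultimately show ?thesis using C *(2) by (intro blI[of _ "C\<^sup>2" "2 * C * L"]) auto
qed

text \<open>Cutting the tail of the norm beyond \<open>R\<close> off at \<open>K\<close> makes it a bounded Lipschitz function.\<close>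

definition exc :: "real => real => 'a::real_normed_vector => real" where
  "exc R K x = min (max 0 (norm x - R)) K"

lemma exc_bounds: "0 <= K ==> 0 <= exc R K x" "exc R K x <= K" by (auto simp: exc_def)

lemma exc_bl: assumes "0 <= K" shows "bounded_lip (exc R K)"
proof (rule blI[of _ K 1])
  fix x y :: 'a
  show "\<bar>exc R K x\<bar> <= K" using exc_bounds(1)[OF assms, of R x] exc_bounds(2)[of R K x] by simp
  show "\<bar>exc R K x - exc R K y\<bar> <= 1 * norm (x - y)"
    using norm_triangle_ineq3[of x y] unfolding exc_def by (simp add: abs_if max_def min_def split: if_splits)
qed simp

lemma exc_antimono: "R <= R' ==> K <= K' ==> exc R' K x <= exc R K' x" by (auto simp: exc_def)

lemma exc_scale: assumes "c > 0" shows "exc R K (c *\<^sub>R x) = c * exc (R / c) (K / c) x"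
proof -
  have "c * min (max 0 (norm x - R / c)) (K / c) = min (c * max 0 (norm x - R / c)) (c * (K / c))"
    using assms by (simp add: min_mult_distrib_left)
  also have "... = min (max 0 (c * (norm x - R / c))) K" using assms by (simp add: max_mult_distrib_left)
  finally show ?thesis using assms by (simp add: exc_def right_diff_distrib)
qed

section \<open>Errors of truncation\<close>

definition cl :: "real => real => real" where "cl k y = max (- k) (min k y)"

lemma clamp_real: "0 <= k ==> clamp (- k) k y = cl k y" unfolding clamp_def Basis_real_def by (auto simp: cl_def max_def min_def)
lemma cl_lip: "\<bar>cl k x - cl k y\<bar> <= \<bar>x - y\<bar>" by (auto simp: cl_def)
lemma cl_bound: "0 <= k ==> \<bar>cl k x\<bar> <= k" by (auto simp: cl_def)
lemma cl_id: "\<bar>x\<bar> <= k ==> cl k x = x" by (auto simp: cl_def)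
lemma cl_minus: "0 <= k ==> cl k (- x) = - cl k x" by (auto simp: cl_def)
lemma cl_tail: "0 <= k ==> k <= l ==> \<bar>cl k y - cl l y\<bar> <= min (max 0 (\<bar>y\<bar> - k)) l" by (auto simp: cl_def max_def min_def abs_if split: if_splits)
lemma cl_resid: "0 <= k ==> \<bar>y - cl k y\<bar> = max 0 (\<bar>y\<bar> - k)" by (auto simp: cl_def)

text \<open>Truncation is not additive, but it is exact when \<open>x\<close> and \<open>y\<close>
  are at most \<open>k / 2\<close> in absolute value, so both are compared with their truncations at
  \<open>k / 2\<close>. The cap \<open>3 * k\<close>, a crude bound of the left side, turns the
  error terms into bounded functions, on which \<open>E\<close> can be evaluated.\<close>

lemma cl_increment:
  assumes "0 <= k"
  shows "\<bar>cl k y - cl k x - cl k (y - x)\<bar> <= 2 * min (max 0 (\<bar>x\<bar> - k / 2)) (3 * k) + 2 * min (max 0 (\<bar>y\<bar> - k / 2)) (3 * k)"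
proof -
  let ?x = "cl (k / 2) x" and ?y = "cl (k / 2) y"
  let ?p = "max 0 (\<bar>x\<bar> - k / 2)" and ?q = "max 0 (\<bar>y\<bar> - k / 2)"
  have b: "\<bar>?x\<bar> <= k / 2" "\<bar>?y\<bar> <= k / 2" using cl_bound[of "k / 2" x] cl_bound[of "k / 2" y] assms by simp_all
  have z: "cl k ?y = ?y" "cl k ?x = ?x" "cl k (?y - ?x) = ?y - ?x" using b assms by (auto intro!: cl_id)
  have r: "\<bar>x - ?x\<bar> = ?p" "\<bar>y - ?y\<bar> = ?q" using assms by (auto intro: cl_resid)
  have "\<bar>cl k y - cl k x - cl k (y - x)\<bar> <= 2 * ?p + 2 * ?q"
  proof -
    have 1: "\<bar>cl k y - ?y\<bar> <= ?q" using cl_lip[of k y ?y] unfolding z r .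
    have 2: "\<bar>cl k x - ?x\<bar> <= ?p" using cl_lip[of k x ?x] unfolding z r .
    have "\<bar>cl k (y - x) - (?y - ?x)\<bar> <= \<bar>(y - x) - (?y - ?x)\<bar>" using cl_lip[of k "y - x" "?y - ?x"] unfolding z .
    also have "... <= \<bar>x - ?x\<bar> + \<bar>y - ?y\<bar>" by linarith
    also have "... = ?p + ?q" unfolding r ..
    finally have 3: "\<bar>cl k (y - x) - (?y - ?x)\<bar> <= ?p + ?q" .
    have "\<bar>u - v - wt\<bar> <= 2 * p + 2 * q" if "\<bar>u - u'\<bar> <= q" "\<bar>v - v'\<bar> <= p" "\<bar>wt - (u' - v')\<bar> <= p + q"
      for u v wt u' v' p q :: real using that by (simp add: abs_le_iff)
    from this[OF 1 2 3] show ?thesis .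
  qed
  moreover have "\<bar>cl k y - cl k x - cl k (y - x)\<bar> <= 3 * k"
    using cl_bound[OF assms, of y] cl_bound[OF assms, of x] cl_bound[OF assms, of "y - x"] by linarith
  moreover have "D <= 2 * min P (3 * k) + 2 * min Q (3 * k)" if "D <= 2 * P + 2 * Q" "D <= 3 * k" "0 <= P" "0 <= Q" for D P Q :: real
    using that assms by (auto simp: min_def)
  ultimately show ?thesis by simp
qed

text \<open>The two sides can differ only when \<open>c\<close> times the absolute value of
  \<open>y\<close> exceeds \<open>k\<close>. By oddness of the truncation the case of positive
  \<open>y\<close> suffices.\<close>

lemma cl_homogeneous:
  assumes "0 <= k" "1 <= c" shows "\<bar>cl k (c * y) - c * cl k y\<bar> <= c * min (max 0 (\<bar>y\<bar> - k / c)) k"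
proof (cases "c * \<bar>y\<bar> <= k")
  case True
  have "\<bar>y\<bar> <= k" using True assms mult_right_mono[of 1 c "\<bar>y\<bar>"] by linarith
  then show ?thesis using True assms by (simp add: cl_id abs_mult exc_def)
next
  case False
  have s: "\<bar>cl k (c * z) - c * cl k z\<bar> <= c * min (max 0 (\<bar>z\<bar> - k / c)) k" if z: "c * z > k" "z \<ge> 0" for z
  proof -
    have "cl k (c * z) = k" using z assms by (auto simp: cl_def)
    moreover have "cl k z = min k z" using z assms by (auto simp: cl_def)
    moreover have "k <= c * min k z" using z assms mult_right_mono[of 1 c k] by (auto simp: min_def)
    ultimately have "\<bar>cl k (c * z) - c * cl k z\<bar> = c * min k z - k" by simp
    also have "... = c * (min k z - k / c)" using assms by (simp add: right_diff_distrib)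
    also have "... <= c * min (max 0 (\<bar>z\<bar> - k / c)) k"
    proof (rule mult_left_mono)
      have "0 <= k / c" using assms by simp
      then show "min k z - k / c <= min (max 0 (\<bar>z\<bar> - k / c)) k" using z by (auto simp: min_def max_def)
    qed (use assms in simp)
    finally show ?thesis .
  qed
  show ?thesis
  proof (cases "y \<ge> 0")
    case True then show ?thesis using s[of y] False by simp
  next
    case F: False
    have "\<bar>cl k (c * y) - c * cl k y\<bar> = \<bar>cl k (c * (- y)) - c * cl k (- y)\<bar>"
      using cl_minus[OF assms(1), of y] cl_minus[OF assms(1), of "c * y"] by simp
    then show ?thesis using s[of "- y"] False F by simp
  qed
qed

text \<open>Tails of a coordinate are reduced to tails of the norm by Cauchy-Schwarz. Using
  \<open>norm a + 1\<close> in place of \<open>norm a\<close> keeps the divisor positive for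
  \<open>a = 0\<close> and the factor at least \<open>1\<close>, so that the cap may be enlarged by
  it.\<close>

lemma tail_inner:
  fixes a x :: "'a::real_inner"
  assumes "0 <= k" "0 <= K"
  shows "min (max 0 (\<bar>a \<bullet> x\<bar> - k)) K <= (norm a + 1) * exc (k / (norm a + 1)) K x"
proof -
  let ?\<alpha> = "norm a + 1"
  have \<alpha>: "?\<alpha> \<ge> 1" "?\<alpha> \<noteq> 0" "?\<alpha> > 0" using norm_ge_zero[of a] by linarith+
  have "\<bar>a \<bullet> x\<bar> <= norm a * norm x" by (rule Cauchy_Schwarz_ineq2)
  also have "... <= ?\<alpha> * norm x" by (rule mult_right_mono) auto
  finally have "max 0 (\<bar>a \<bullet> x\<bar> - k) <= max 0 (?\<alpha> * norm x - k)" by simp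
  also have "... = ?\<alpha> * max 0 (norm x - k / ?\<alpha>)"
    using \<alpha> by (simp add: max_mult_distrib_left right_diff_distrib) 
  finally have 1: "max 0 (\<bar>a \<bullet> x\<bar> - k) <= ?\<alpha> * max 0 (norm x - k / ?\<alpha>)" .
  have 2: "K <= ?\<alpha> * K" using mult_right_mono[OF \<alpha>(1) assms(2)] by simp
  have "min (max 0 (\<bar>a \<bullet> x\<bar> - k)) K <= min (?\<alpha> * max 0 (norm x - k / ?\<alpha>)) (?\<alpha> * K)"
    using 1 2 by (intro min.mono)
  also have "... = ?\<alpha> * exc (k / ?\<alpha>) K x" using \<alpha> by (simp add: exc_def min_mult_distrib_left)
  finally show ?thesis .
qed

definition bt :: "real^'d::finite => real => nat => 'd path => real" where
  "bt a r k w = clamp (- real k) (real k) (a \<bullet> B r w)"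

lemma bt_cl: "bt a r k w = cl (real k) (a \<bullet> B r w)" by (simp add: bt_def clamp_real)

lemma bl_cl_inner: fixes a :: "'a::real_inner" assumes "0 <= k" shows "bounded_lip (%x. cl k (a \<bullet> x))"
proof (rule blI[of _ k "norm a"])
  fix x y :: 'a
  have "\<bar>cl k (a \<bullet> x) - cl k (a \<bullet> y)\<bar> <= \<bar>a \<bullet> (x - y)\<bar>" using cl_lip[of k "a \<bullet> x" "a \<bullet> y"] by (simp add: inner_diff_right)
  then show "\<bar>cl k (a \<bullet> x) - cl k (a \<bullet> y)\<bar> <= norm a * norm (x - y)" using Cauchy_Schwarz_ineq2 order_trans by blast
qed (use assms in \<open>auto intro: cl_bound\<close>)

lemma bl_B_cyl: assumes "bounded_lip \<psi>" "0 <= r" "r \<in> I" "0 \<in> I" shows "(%w. \<psi> (B r w)) \<in> cyl I"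
  using bl_cyl[OF assms(1,4,3)] by (simp add: B_nonpos)

lemma bt_cyl: "0 <= r ==> bt a r k \<in> cyl {0..r}"
  unfolding bt_cl[abs_def] by (rule bl_B_cyl[OF bl_cl_inner]) auto

lemma bt_diff_le:
  "\<bar>bt a r' k w - bt a r k w\<bar> <= (norm a + 1) * exc 0 (2 * real k) (B r' w - B r w)"
proof -
  have "\<bar>bt a r' k w - bt a r k w\<bar> <= \<bar>a \<bullet> (B r' w - B r w)\<bar>"
    using cl_lip[of "real k" "a \<bullet> B r' w" "a \<bullet> B r w"] by (simp add: bt_cl inner_diff_right)
  moreover have "\<bar>bt a r' k w - bt a r k w\<bar> <= 2 * real k"
    using cl_bound[of "real k" "a \<bullet> B r' w"] cl_bound[of "real k" "a \<bullet> B r w"] by (simp add: bt_cl)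
  ultimately show ?thesis using tail_inner[of 0 "2 * real k" a "B r' w - B r w"] by simp
qed

lemma bt_tail_le:
  assumes "k <= l" shows "\<bar>bt a r k w - bt a r l w\<bar> <= (norm a + 1) * exc (real k / (norm a + 1)) (real l) (B r w)"
  unfolding bt_cl using assms by (intro order_trans[OF cl_tail tail_inner]) auto

lemma clamp_box_component:
  fixes x :: "real^'d::finite"
  assumes "i \<in> Basis" shows "clamp (- real N *\<^sub>R One) (real N *\<^sub>R One) x \<bullet> i = cl (real N) (x \<bullet> i)"
proof -
  have "(\<Sum>j\<in>Basis. f j *\<^sub>R j) \<bullet> i = f i" for f :: "real^'d => real" using assms by (simp add: inner_sum_left_Basis)
  then show ?thesis using assms by (simp add: clamp_def cl_def)
qed

text \<open>In each coordinate the clamp at \<open>N\<close> lies between \<open>0\<close> and the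
  clamp at \<open>M\<close>, and then \<open>(u - v)^2 <= u^2 - v^2\<close>. Squared tails are thus
  dominated by differences of truncated squares, which a Cauchy property in \<open>L_G^1\<close>
  controls. The threshold \<open>N * DIM\<close> bounds the norm of a vector clamped at
  \<open>N\<close>.\<close>

lemma exc_le_clamp:
  fixes x :: "real^'d::finite"
  defines "c \<equiv> %N. clamp (- real N *\<^sub>R One) (real N *\<^sub>R One) x"
  assumes "N <= M" "0 <= K" "K <= real M - real N"
  shows "(exc (real N * DIM(real^'d)) K x)^2 <= (norm (c M))^2 - (norm (c N))^2"
proof -
  have comp: "c N \<bullet> i = cl (real N) (x \<bullet> i)" if "i \<in> Basis" for N i using clamp_box_component[OF that] by (simp add: c_def)
  have nc: "norm (c N) <= real N * DIM(real^'d)"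
  proof -
    have "norm (c N) <= (\<Sum>i\<in>Basis. \<bar>c N \<bullet> i\<bar>)" by (rule norm_le_l1)
    also have "... <= (\<Sum>i\<in>(Basis::(real^'d) set). real N)" by (intro sum_mono) (auto simp: comp intro: cl_bound)
    finally show ?thesis by (simp add: mult.commute)
  qed
  have nsq: "(norm z)^2 = (\<Sum>i\<in>Basis. (z \<bullet> i)^2)" for z :: "real^'d"
    unfolding power2_norm_eq_inner by (subst euclidean_inner) (simp add: power2_eq_square)
  have "exc (real N * DIM(real^'d)) K x <= norm (c M - c N)"
  \<comment> \<open>Either no coordinate is cut at \<open>M\<close> and the tail is at most a
    difference of norms, or some coordinate of the two clamped vectors differs by
    \<open>M - N\<close>, which is at least the cap \<open>K\<close>.\<close>
  proof (cases "\<forall>i\<in>Basis. \<bar>x \<bullet> i\<bar> <= real M")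
    case True
    have "c M = x" by (rule euclidean_eqI) (use True in \<open>auto simp: comp cl_id\<close>)
    then have "max 0 (norm x - real N * DIM(real^'d)) <= norm (c M - c N)"
      using norm_triangle_ineq2[of "c M" "c N"] nc norm_ge_zero[of "c M - c N"] by simp
    then show ?thesis unfolding exc_def by (rule min.coboundedI1)
  next
    case False
    then obtain i where i: "i \<in> Basis" "real M < \<bar>x \<bullet> i\<bar>" by auto
    have "K <= \<bar>(c M - c N) \<bullet> i\<bar>" using i assms(2-4) by (auto simp: inner_diff_left comp cl_def)
    also have "... <= norm (c M - c N)" using i(1) by (rule Basis_le_norm)
    finally show ?thesis by (auto simp: exc_def)
  qed
  then have "(exc (real N * DIM(real^'d)) K x)^2 <= (norm (c M - c N))^2" using exc_bounds(1)[OF assms(3)] by (intro power_mono)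
  also have "... = (\<Sum>i\<in>Basis. (c M \<bullet> i - c N \<bullet> i)^2)" by (simp add: nsq inner_diff_left)
  also have "... <= (\<Sum>i\<in>Basis. (c M \<bullet> i)^2 - (c N \<bullet> i)^2)"
  proof (intro sum_mono)
    fix i :: "real^'d" assume i: "i \<in> Basis"
    let ?u = "c M \<bullet> i" and ?v = "c N \<bullet> i"
    have "(0 <= ?v \<and> ?v <= ?u) \<or> (?v <= 0 \<and> ?u <= ?v)" using assms(2) by (auto simp: comp[OF i] cl_def)
    then have "0 <= 2 * (?v * (?u - ?v))" by (auto intro: mult_nonneg_nonneg mult_nonpos_nonpos)
    then show "(?u - ?v)^2 <= ?u\<^sup>2 - ?v\<^sup>2" by (simp add: power2_eq_square algebra_simps)
  qed
  also have "... = (norm (c M))^2 - (norm (c N))^2"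
    by (simp add: sum_subtractf nsq)
  finally show ?thesis .
qed

section \<open>Independence and moments of Brownian increments\<close>

locale brownian = sublinear_T E T for E :: "('d::finite path => real) => real" and T +
  assumes bd: "0 <= t ==> 0 <= s ==> ident_distributed E (%w. B (t + s) w - B t w) (%w. sqrt s *\<^sub>R B 1 w)"
    and bi: "0 <= t ==> 0 <= s ==> ts \<noteq> [] ==> set ts \<subseteq> {0..t} ==>
      independent_from E (%w. B (t + s) w - B t w) (map B ts)"
    and bq: "quad_form_B\<^sub>1 E (mat 1) \<in> LG E 1 1"
begin

lemma distr: assumes "bounded_lip \<psi>" "0 <= r" "r <= r'" shows "E (%w. \<psi> (B r' w - B r w)) = E (%w. \<psi> (sqrt (r' - r) *\<^sub>R B 1 w))"
  using bd[of r "r' - r"] bl_C_bLip[OF assms(1)] assms(2,3) by (simp add: ident_distributed_def)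

text \<open>Independence is assumed for lists of values of \<open>B\<close> and functions on tuples;
  here the past enters as one cylinder variable. As \<open>\<zeta>\<close> is bounded,
  \<open>F\<close> has to be bounded and Lipschitz only for bounded first arguments, which admits
  products.\<close>

lemma indep:
  assumes \<zeta>: "\<zeta> \<in> cyl {0..r}" and r: "0 <= r" "r <= r'"
    and F: "!!C. \<exists>L\<ge>0. \<forall>x x' y y'. \<bar>x\<bar> <= C --> \<bar>x'\<bar> <= C --> \<bar>F x y - F x' y'\<bar> <= L * (\<bar>x - x'\<bar> + norm (y - y'))"
    and Fb: "!!C. \<exists>K. \<forall>x y. \<bar>x\<bar> <= C --> \<bar>F x y\<bar> <= (K::real)"
  shows "E (%w. F (\<zeta> w) (B r' w - B r w)) = E (%w. E (%w'. F (\<zeta> w) (B r' w' - B r w')))"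
proof -
  have "\<zeta> \<in> Lip r" using \<zeta> r by (simp add: Lip_eq_cyl)
  then obtain ts \<phi> where ts: "ts \<noteq> []" "set ts \<subseteq> {0..r}" "\<phi> \<in> C_bLip_tuple (length ts)"
    and \<zeta>_eq: "\<zeta> = (%w. \<phi> (map (%t. B t w) ts))" by (auto simp: Lip_def)
  let ?m = "length ts"
  obtain C L where C: "!!xs. length xs = ?m ==> \<bar>\<phi> xs\<bar> <= C"
    and L: "!!xs ys. length xs = ?m ==> length ys = ?m ==> dist (\<phi> xs) (\<phi> ys) <= L * L2_set (%i. dist (xs ! i) (ys ! i)) {..<?m}"
    using ts(3) unfolding C_bLip_tuple_def real_norm_def by blast
  obtain K where K: "!!x y. \<bar>x\<bar> <= C ==> \<bar>F x y\<bar> <= K" using Fb[of C] by blast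
  obtain M where M: "M \<ge> 0" "!!x x' y y'. \<bar>x\<bar> <= C ==> \<bar>x'\<bar> <= C ==> \<bar>F x y - F x' y'\<bar> <= M * (\<bar>x - x'\<bar> + norm (y - y'))"
    using F[of C] by blast
  \<comment> \<open>\<open>independent_from\<close> puts the new variable at the end of the list, so
    \<open>\<zeta>\<close> is recovered from \<open>butlast\<close> and the increment from
    \<open>last\<close>.\<close>
  let ?\<Phi> = "%xs. F (\<phi> (butlast xs)) (last xs)"
  have \<Phi>: "?\<Phi> \<in> C_bLip_tuple (Suc ?m)"
    unfolding C_bLip_tuple_def
  proof (intro CollectI conjI exI allI impI)
    fix xs :: "(real^'d) list" assume xs: "length xs = Suc ?m"
    then show "norm (?\<Phi> xs) <= K" using K[OF C[of "butlast xs"]] by simp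
  next
    fix xs ys :: "(real^'d) list"
    assume xs: "length xs = Suc ?m" "length ys = Suc ?m"
    let ?l = "L2_set (%i. dist (xs ! i) (ys ! i)) {..<Suc ?m}"
    have lb: "length (butlast xs) = ?m" "length (butlast ys) = ?m" using xs by auto
    have "L2_set (%i. dist (butlast xs ! i) (butlast ys ! i)) {..<?m} = L2_set (%i. dist (xs ! i) (ys ! i)) {..<?m}"
      using xs by (intro L2_set_cong) (auto simp: nth_butlast)
    also have "... <= ?l" unfolding L2_set_def by (intro real_sqrt_le_mono sum_mono2) auto
    finally have 1: "L2_set (%i. dist (butlast xs ! i) (butlast ys ! i)) {..<?m} <= ?l" .
    have "xs \<noteq> []" "ys \<noteq> []" using xs by auto
    then have "last xs = xs ! ?m" "last ys = ys ! ?m" using xs by (simp_all add: last_conv_nth)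
    then have 2: "norm (last xs - last ys) <= ?l" unfolding dist_norm[symmetric] by (auto intro: member_le_L2_set)
    have "\<bar>\<phi> (butlast xs) - \<phi> (butlast ys)\<bar> <= \<bar>L\<bar> * ?l"
    proof -
      let ?l1 = "L2_set (%i. dist (butlast xs ! i) (butlast ys ! i)) {..<?m}"
      have "\<bar>\<phi> (butlast xs) - \<phi> (butlast ys)\<bar> <= L * ?l1" using L[OF lb] by (simp add: dist_real_def)
      also have "... <= \<bar>L\<bar> * ?l1" by (intro mult_right_mono L2_set_nonneg) auto
      also have "... <= \<bar>L\<bar> * ?l" by (intro mult_left_mono 1) auto
      finally show ?thesis .
    qed
    then have "\<bar>\<phi> (butlast xs) - \<phi> (butlast ys)\<bar> + norm (last xs - last ys) <= (\<bar>L\<bar> + 1) * ?l" using 2 unfolding distrib_right by linarith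
    then have "M * (\<bar>\<phi> (butlast xs) - \<phi> (butlast ys)\<bar> + norm (last xs - last ys)) <= M * ((\<bar>L\<bar> + 1) * ?l)" using M(1) by (rule mult_left_mono)
    then have "\<bar>?\<Phi> xs - ?\<Phi> ys\<bar> <= M * ((\<bar>L\<bar> + 1) * ?l)" using M(2)[OF C[OF lb(1)] C[OF lb(2)], of "last xs" "last ys"] by linarith
    then show "dist (?\<Phi> xs) (?\<Phi> ys) <= (M * (\<bar>L\<bar> + 1)) * L2_set (%i. dist (xs ! i) (ys ! i)) {..<Suc ?m}"
      by (simp add: dist_real_def mult.assoc)
  qed
  have ind: "independent_from E (%w. B r' w - B r w) (map B ts)"
    using bi[OF r(1) _ ts(1,2), of "r' - r"] r(2) by simp
  show ?thesis
    using bspec[OF ind[unfolded independent_from_def length_map] \<Phi>] by (simp add: \<zeta>_eq o_def)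
qed

text \<open>Positive homogeneity pulls the nonnegative value of \<open>\<zeta>\<close> out of the
  inner expectation. Keeping \<open>\<zeta> w * c\<close> inside \<open>E\<close> allows
  \<open>c\<close> of any sign.\<close>

lemma indep_mult_le:
  assumes \<zeta>: "\<zeta> \<in> cyl {0..r}" "!!w. 0 <= \<zeta> w" and r: "0 <= r" "r <= r'" and \<psi>: "bounded_lip \<psi>"
    and c: "E (%w. \<psi> (B r' w - B r w)) <= c"
  shows "E (%w. \<zeta> w * \<psi> (B r' w - B r w)) <= E (%w. \<zeta> w * c)"
proof -
  obtain C L where \<psi>': "!!x. \<bar>\<psi> x\<bar> <= C" "0 <= L" "!!x y. \<bar>\<psi> x - \<psi> y\<bar> <= L * norm (x - y)"
    using \<psi> unfolding bounded_lip_def by blast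
  have C: "0 <= C" using \<psi>'(1)[of 0] by linarith
  have L: "(%w. \<psi> (B r' w - B r w)) \<in> LA" by (rule bl_cyl[OF \<psi>]) (use r in auto)
  have "E (%w. \<zeta> w * \<psi> (B r' w - B r w)) = E (%w. E (%w'. \<zeta> w * \<psi> (B r' w' - B r w')))"
  proof (rule indep[OF \<zeta>(1) r, where F="%x y. x * \<psi> y"])
    fix D :: real
    have "\<bar>x * \<psi> y - x' * \<psi> y'\<bar> <= (C + \<bar>D\<bar> * L) * (\<bar>x - x'\<bar> + norm (y - y'))"
      if "\<bar>x\<bar> <= D" "\<bar>x'\<bar> <= D" for x x' and y y' :: "real^'d"
    proof -
      have "x * \<psi> y - x' * \<psi> y' = (x - x') * \<psi> y + x' * (\<psi> y - \<psi> y')" by (simp add: algebra_simps)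
      then have "\<bar>x * \<psi> y - x' * \<psi> y'\<bar> <= \<bar>x - x'\<bar> * \<bar>\<psi> y\<bar> + \<bar>x'\<bar> * \<bar>\<psi> y - \<psi> y'\<bar>"
        by (metis abs_mult abs_triangle_ineq)
      also have "... <= \<bar>x - x'\<bar> * C + \<bar>D\<bar> * (L * norm (y - y'))"
        using \<psi>' that by (intro add_mono mult_mono) auto
      also have "... <= (C + \<bar>D\<bar> * L) * (\<bar>x - x'\<bar> + norm (y - y'))"
        using C \<psi>'(2) by (simp add: algebra_simps)
      finally show ?thesis .
    qed
    then show "\<exists>L\<ge>0. \<forall>x x' y y'. \<bar>x\<bar> <= D --> \<bar>x'\<bar> <= D --> \<bar>x * \<psi> y - x' * \<psi> y'\<bar> <= L * (\<bar>x - x'\<bar> + norm (y - y'))"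
      using C \<psi>'(2) by (intro exI[of _ "C + \<bar>D\<bar> * L"]) auto
    have "\<bar>x * \<psi> y\<bar> <= \<bar>D\<bar> * C" if "\<bar>x\<bar> <= D" for x y unfolding abs_mult using that \<psi>'(1) by (intro mult_mono) auto
    then show "\<exists>K. \<forall>x y. \<bar>x\<bar> <= D --> \<bar>x * \<psi> y\<bar> <= K" by blast
  qed
  also have "... = E (%w. \<zeta> w * E (%w'. \<psi> (B r' w' - B r w')))"
    using E_scale[OF L \<zeta>(2)] by simp
  also have "... <= E (%w. \<zeta> w * c)"
    using \<zeta> c by (intro E_mono cyl_intros cyl_LA[OF \<zeta>(1)] mult_left_mono)
  finally show ?thesis .
qed

text \<open>Given the past, the inner expectation only shifts by the constant
  \<open>\<zeta> w\<close>, so additivity is exact here, unlike for general summands.\<close>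

lemma indep_add:
  assumes \<zeta>: "\<zeta> \<in> cyl {0..r}" and r: "0 <= r" "r <= r'" and \<psi>: "bounded_lip \<psi>"
  shows "E (%w. \<zeta> w + \<psi> (B r' w - B r w)) = E \<zeta> + E (%w. \<psi> (B r' w - B r w))"
proof -
  obtain C L where \<psi>': "!!x. \<bar>\<psi> x\<bar> <= C" "0 <= L" "!!x y. \<bar>\<psi> x - \<psi> y\<bar> <= L * norm (x - y)"
    using \<psi> unfolding bounded_lip_def by blast
  have L: "(%w. \<psi> (B r' w - B r w)) \<in> LA" by (rule bl_cyl[OF \<psi>]) (use r in auto)
  have "E (%w. \<zeta> w + \<psi> (B r' w - B r w)) = E (%w. E (%w'. \<zeta> w + \<psi> (B r' w' - B r w')))"
  proof (rule indep[OF \<zeta> r, where F="%x y. x + \<psi> y"])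
    fix D :: real
    have "\<bar>x + \<psi> y - (x' + \<psi> y')\<bar> <= (1 + L) * (\<bar>x - x'\<bar> + norm (y - y'))" for x x' and y y' :: "real^'d"
    proof -
      have "\<bar>x + \<psi> y - (x' + \<psi> y')\<bar> <= \<bar>x - x'\<bar> + \<bar>\<psi> y - \<psi> y'\<bar>" by linarith
      also have "... <= \<bar>x - x'\<bar> + L * norm (y - y')" using \<psi>'(3) by simp
      also have "... <= (1 + L) * (\<bar>x - x'\<bar> + norm (y - y'))" using \<psi>'(2) by (simp add: algebra_simps)
      finally show ?thesis .
    qed
    then show "\<exists>L\<ge>0. \<forall>x x' y y'. \<bar>x\<bar> <= D --> \<bar>x'\<bar> <= D --> \<bar>x + \<psi> y - (x' + \<psi> y')\<bar> <= L * (\<bar>x - x'\<bar> + norm (y - y'))"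
      using \<psi>'(2) by (intro exI[of _ "1 + L"]) auto
    have "\<bar>x + \<psi> y\<bar> <= D + C" if "\<bar>x\<bar> <= D" for x y using that \<psi>'(1)[of y] by linarith
    then show "\<exists>K. \<forall>x y. \<bar>x\<bar> <= D --> \<bar>x + \<psi> y\<bar> <= K" by blast
  qed
  also have "... = E (%w. \<zeta> w + E (%w'. \<psi> (B r' w' - B r w')))"
    using E_add_const[OF L] by (simp add: add.commute)
  also have "... = E \<zeta> + E (%w. \<psi> (B r' w - B r w))" using E_add_const[OF cyl_LA[OF \<zeta>]] .
  finally show ?thesis .
qed

text \<open>The squared tail is dominated by the growth of the truncated squares of
  \<open>B_1\<close> between two levels (\<open>exc_le_clamp\<close>), and these form a Cauchy
  sequence in \<open>L_G^1\<close>. What matters later is that the bound is uniform in the cap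
  \<open>K\<close>.\<close>

lemma B_1_tail: assumes "eps > 0" shows "\<exists>R\<ge>0. \<forall>K\<ge>0. E (%w. (exc R K (B 1 w))^2) <= eps"
proof -
  let ?c = "%N w. clamp (- real N *\<^sub>R One) (real N *\<^sub>R One) (B 1 w :: real^'d)"
  define u where "u = (%N w. (norm (?c N w))^2)"
  have "quad_form_B\<^sub>1 E (mat 1) = cauchy_class (Lip 1) (lg_pdist E 1) u"
    by (simp add: quad_form_B\<^sub>1_def lg_class_def Let_def u_def power2_norm_eq_inner)
  \<comment> \<open>Membership of the class in the completion says that it is the class of some
    Cauchy sequence \<open>v\<close>. It then contains \<open>v\<close>, so \<open>u\<close> is
    related to \<open>v\<close> and is itself Cauchy.\<close>
  then obtain v where v: "v \<in> cauchy_seqs (Lip 1) (lg_pdist E 1)"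
    "cauchy_class (Lip 1) (lg_pdist E 1) u = cauchy_rel (Lip 1) (lg_pdist E 1) `` {v}"
    using bq by (auto simp: LG_def completion_def quotient_def)
  have "lg_pdist E 1 X X = 0" for X :: "'d path => real" using nE_const[of 1 "0::real"] by (simp add: lg_pdist_eq_nE)
  then have "v \<in> cauchy_rel (Lip 1) (lg_pdist E 1) `` {v}" using v(1) by (simp add: cauchy_rel_def)
  then have u: "u \<in> cauchy_seqs (Lip 1) (lg_pdist E 1)"
    unfolding v(2)[symmetric] cauchy_class_def by (simp add: cauchy_rel_def)
  have uL: "u k \<in> LA" for k using u Lip_eq_cyl[of 1] by (auto simp: cauchy_seqs_def intro: cyl_LA)
  obtain N where N: "!!k l. k \<ge> N ==> l \<ge> N ==> nE E 1 (%w. u k w - u l w) < eps"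
    using u assms unfolding cauchy_seqs_def lg_pdist_eq_nE by blast
  show ?thesis
  proof (intro exI[of _ "real N * DIM(real^'d)"] conjI allI impI)
    fix K :: real assume K: "0 <= K"
    obtain j where j: "K <= real j" using real_arch_simple by blast
    have tlL: "(%w. exc (real N * DIM(real^'d)) K (B 1 w :: real^'d)) \<in> LA" by (rule bl_B_cyl[OF exc_bl[OF K]]) auto
    have "E (%w. (exc (real N * DIM(real^'d)) K (B 1 w))^2) <= E (%w. \<bar>u (N + j) w - u N w\<bar>)"
    proof (intro E_mono cyl_power2 cyl_abs cyl_diff uL tlL)
      fix w
      have "(exc (real N * DIM(real^'d)) K (B 1 w))^2 <= u (N + j) w - u N w"
        unfolding u_def using exc_le_clamp[of N "N + j" K "B 1 w"] K j by simp
      then show "(exc (real N * DIM(real^'d)) K (B 1 w))^2 <= \<bar>u (N + j) w - u N w\<bar>" by linarith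
    qed
    also have "... <= eps" using N[of "N + j" N] uL by (simp add: nE_1_LA cyl_diff)
    finally show "E (%w. (exc (real N * DIM(real^'d)) K (B 1 w))^2) <= eps" .
  qed simp
qed

text \<open>Brownian scaling changes both the threshold and the cap. The new cap is left existential
  because all later bounds are uniform in it. For \<open>r = r'\<close> the increment vanishes and
  there is nothing to scale.\<close>

lemma exc_sq_scale:
  assumes "0 <= r" "r <= r'" "0 <= K" "0 <= R"
  shows "\<exists>K'\<ge>0. E (%w. (exc R K (B r' w - B r w))^2) = (r' - r) * E (%w. (exc (R / sqrt (r' - r)) K' (B 1 w))^2)"
proof (cases "r = r'")
  case True
  then show ?thesis using assms by (intro exI[of _ 0]) (simp add: exc_def E_const)
next
  case False
  let ?c = "sqrt (r' - r)"
  have c: "?c > 0" "?c\<^sup>2 = r' - r" using False assms by auto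
  have "E (%w. (exc R K (B r' w - B r w))^2) = E (%w. (exc R K (?c *\<^sub>R B 1 w))^2)"
    by (rule distr[OF bl_square[OF exc_bl[OF assms(3)]] assms(1,2)])
  also have "... = E (%w. (r' - r) * (exc (R / ?c) (K / ?c) (B 1 w))^2)"
    using c by (simp add: exc_scale power_mult_distrib)
  also have "... = (r' - r) * E (%w. (exc (R / ?c) (K / ?c) (B 1 w))^2)"
    using c assms by (intro E_scale bl_B_cyl[OF bl_square[OF exc_bl]]) auto
  finally show ?thesis using c(1) assms(3) by (intro exI[of _ "K / ?c"]) auto
qed

text \<open>Since \<open>r' - r <= S\<close>, scaling the threshold \<open>R * sqrt S\<close> back
  to time \<open>1\<close> leaves at least \<open>R\<close>, and the factor \<open>r' - r\<close>
  comes out of the square.\<close>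

lemma increment_tail:
  assumes "eps > 0" "S > 0"
  shows "\<exists>R\<ge>0. \<forall>r r' K. 0 <= r --> r <= r' --> r' - r <= S --> 0 <= K --> E (%w. (exc R K (B r' w - B r w))^2) <= (r' - r) * eps"
proof -
  obtain R where R: "R \<ge> 0" "!!K. 0 <= K ==> E (%w. (exc R K (B 1 w))^2) <= eps" using B_1_tail[OF assms(1)] by blast
  have "E (%w. (exc (R * sqrt S) K (B r' w - B r w))^2) <= (r' - r) * eps"
    if *: "0 <= r" "r <= r'" "r' - r <= S" "0 <= K" for r r' K
  proof -
    obtain K' where K': "K' \<ge> 0" "E (%w. (exc (R * sqrt S) K (B r' w - B r w))^2) = (r' - r) * E (%w. (exc ((R * sqrt S) / sqrt (r' - r)) K' (B 1 w))^2)"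
      using exc_sq_scale[OF *(1,2,4), of "R * sqrt S"] R(1) assms by auto
    show ?thesis
    proof (cases "r = r'")
      case True then show ?thesis using K' by simp
    next
      case False
      have "R <= (R * sqrt S) / sqrt (r' - r)" using False * R(1) by (simp add: pos_le_divide_eq mult_left_mono)
      then have "E (%w. (exc ((R * sqrt S) / sqrt (r' - r)) K' (B 1 w))^2) <= E (%w. (exc R K' (B 1 w))^2)"
        using K'(1) by (intro E_mono bl_B_cyl[OF bl_square[OF exc_bl]] power_mono exc_antimono exc_bounds) auto
      also have "... <= eps" using R(2)[OF K'(1)] .
      finally show ?thesis unfolding K'(2) using * by (intro mult_left_mono) auto
    qed
  qed
  then show ?thesis using R(1) assms by (intro exI[of _ "R * sqrt S"]) auto
qed

text \<open>With \<open>R\<close> such that the squared tail of \<open>B_1\<close> above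
  \<open>R\<close> has expectation at most \<open>1\<close>, the norm is at most \<open>R\<close>
  plus its tail; squaring yields the constant \<open>2 * R\<^sup>2 + 2\<close>, and scaling passes
  from \<open>B_1\<close> to increments.\<close>

lemma ex_\<mu>: "\<exists>\<mu>>0. \<forall>r r' K. 0 <= r --> r <= r' --> 0 <= K --> E (%w. (exc 0 K (B r' w - B r w))^2) <= \<mu> * (r' - r)"
proof -
  obtain R where R: "R \<ge> 0" "!!K. 0 <= K ==> E (%w. (exc R K (B 1 w))^2) <= 1" using B_1_tail[of 1] by auto
  have *: "E (%w. (exc 0 K (B 1 w))^2) <= 2 * R\<^sup>2 + 2" if K: "0 <= K" for K
  proof -
    have L: "(%w. (exc R K (B 1 w :: real^'d))^2) \<in> LA" using K by (intro bl_B_cyl[OF bl_square[OF exc_bl]]) auto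
    have "E (%w. (exc 0 K (B 1 w))^2) <= E (%w. 2 * (exc R K (B 1 w))^2 + 2 * R\<^sup>2)"
    proof (intro E_mono cyl_add cyl_mult cyl_const L)
      fix w
      have "exc 0 K (B 1 w) <= R + exc R K (B 1 w)" using R(1) K by (auto simp: exc_def)
      then have "(exc 0 K (B 1 w))^2 <= (R + exc R K (B 1 w))^2" using K by (intro power_mono exc_bounds)
      also have "... <= 2 * (exc R K (B 1 w))^2 + 2 * R\<^sup>2" using zero_le_power2[of "R - exc R K (B 1 w)"] by (simp add: power2_eq_square algebra_simps)
      finally show "(exc 0 K (B 1 w))^2 <= 2 * (exc R K (B 1 w))^2 + 2 * R\<^sup>2" .
    qed (use K in \<open>auto intro!: bl_B_cyl[OF bl_square[OF exc_bl]]\<close>)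
    also have "... = 2 * E (%w. (exc R K (B 1 w))^2) + 2 * R\<^sup>2"
      using L by (subst E_add_const) (auto intro!: cyl_mult cyl_const simp: E_scale)
    also have "... <= 2 * R\<^sup>2 + 2" using R(2)[OF K] by simp
    finally show ?thesis .
  qed
  have "E (%w. (exc 0 K (B r' w - B r w))^2) <= (2 * R\<^sup>2 + 2) * (r' - r)" if a: "0 <= r" "r <= r'" "0 <= K" for r r' K
  proof -
    obtain K' where K': "K' \<ge> 0" "E (%w. (exc 0 K (B r' w - B r w))^2) = (r' - r) * E (%w. (exc (0 / sqrt (r' - r)) K' (B 1 w))^2)"
      using exc_sq_scale[OF a, of 0] by auto
    show ?thesis unfolding K'(2) using *[OF K'(1)] a by (simp add: mult.commute mult_left_mono)
  qed
  then show ?thesis by (intro exI[of _ "2 * R\<^sup>2 + 2"]) (auto simp: add_nonneg_pos)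
qed

text \<open>Plays the part of \<open>E[|B_1|^2]\<close>. The square is unbounded and hence not in
  \<open>Lip_all\<close>; a bound that is uniform in the cap \<open>K\<close> replaces it.\<close>

definition \<mu> :: real where "\<mu> = (SOME \<mu>. \<mu> > 0 \<and> (\<forall>r r' K. 0 <= r --> r <= r' --> 0 <= K --> E (%w. (exc 0 K (B r' w - B r w))^2) <= \<mu> * (r' - r)))"

lemma \<mu>: "\<mu> > 0" "0 <= r ==> r <= r' ==> 0 <= K ==> E (%w. (exc 0 K (B r' w - B r w))^2) <= \<mu> * (r' - r)"
proof -
  have "\<mu> > 0 \<and> (\<forall>r r' K. 0 <= r --> r <= r' --> 0 <= K --> E (%w. (exc 0 K (B r' w - B r w))^2) <= \<mu> * (r' - r))"
    unfolding \<mu>_def by (rule someI_ex[OF ex_\<mu>])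
  then show "\<mu> > 0" "0 <= r ==> r <= r' ==> 0 <= K ==> E (%w. (exc 0 K (B r' w - B r w))^2) <= \<mu> * (r' - r)" by blast+
qed

lemma nE_2_sq_real: "X \<in> LA ==> (nE E 2 X)^2 = E (%w. (X w :: real)^2)"
  by (simp add: nE_2_sq)

lemma exc_B_LA: "0 <= r ==> 0 <= K ==> (%w. exc R K (B r w :: real^'d)) \<in> LA"
  by (rule bl_B_cyl[OF exc_bl]) auto

lemma exc_incr_LA: "0 <= r ==> 0 <= r' ==> 0 <= K ==> (%w. exc R K (B r' w - B r w :: real^'d)) \<in> LA"
  by (rule bl_cyl[OF exc_bl]) auto

lemma bt_LA: "0 <= r ==> bt a r k \<in> LA" using cyl_LA[OF bt_cyl] .

lemma bt_inc_sq:
  assumes "0 <= r" "r <= r'"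
  shows "(nE E 2 (%w. bt a r' k w - bt a r k w))^2 <= (norm a + 1)^2 * \<mu> * (r' - r)"
proof -
  let ?e = "%w. exc 0 (2 * real k) (B r' w - B r w :: real^'d)"
  have L: "?e \<in> LA" "(%w. bt a r' k w - bt a r k w) \<in> LA" using assms by (auto intro!: exc_incr_LA cyl_diff bt_LA)
  have "(nE E 2 (%w. bt a r' k w - bt a r k w))^2 = E (%w. (bt a r' k w - bt a r k w)^2)"
    using L by (simp add: nE_2_sq_real)
  also have "... <= E (%w. (norm a + 1)^2 * (?e w)^2)"
  proof (intro E_mono cyl_power2 cyl_mult cyl_const L)
    fix w
    have "\<bar>bt a r' k w - bt a r k w\<bar>\<^sup>2 <= ((norm a + 1) * ?e w)^2" by (intro power_mono bt_diff_le) auto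
    then show "(bt a r' k w - bt a r k w)^2 <= (norm a + 1)^2 * (?e w)^2" by (simp add: power_mult_distrib)
  qed
  also have "... = (norm a + 1)^2 * E (%w. (?e w)^2)" by (intro E_scale cyl_power2 L) auto
  also have "... <= (norm a + 1)^2 * (\<mu> * (r' - r))" by (intro mult_left_mono \<mu>(2)) (use assms in auto)
  finally show ?thesis by (simp add: mult.assoc)
qed

text \<open>The truncation error is uniform over bounded time intervals because the tails of all
  increments of bounded length share one threshold. A single truncation level then serves all points
  of a grid.\<close>

lemma bt_tail:
  assumes "eps > 0" "S > 0"
  shows "\<exists>K0. \<forall>r\<in>{0..S}. \<forall>k l. K0 <= k --> k <= l --> nE E 2 (%w. bt a r k w - bt a r l w) <= eps"
proof -
  let ?\<alpha> = "norm a + 1"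
  have \<alpha>: "?\<alpha> > 0" using norm_ge_zero[of a] by linarith
  define e where "e = (eps / ?\<alpha>)^2 / S"
  have e: "e > 0" "S * e = (eps / ?\<alpha>)^2" using assms \<alpha> by (auto simp: e_def)
  obtain R where R: "R \<ge> 0" "!!r r' K. 0 <= r ==> r <= r' ==> r' - r <= S ==> 0 <= K ==> E (%w. (exc R K (B r' w - B r w))^2) <= (r' - r) * e"
    using increment_tail[OF e(1) assms(2)] by blast
  obtain K0 :: nat where K0: "R * ?\<alpha> <= real K0" using real_arch_simple by blast
  have "nE E 2 (%w. bt a r k w - bt a r l w) <= eps" if r: "r \<in> {0..S}" and kl: "K0 <= k" "k <= l" for r k l
  proof -
    have r0: "0 <= r" using r by simp
    let ?e = "%w. exc R (real l) (B r w :: real^'d)"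
    have L: "?e \<in> LA" using r0 by (intro exc_B_LA) auto
    have "E (%w. (exc R (real l) (B r w - B 0 w))^2) <= (r - 0) * e" using r by (intro R(2)) auto
    then have "E (%w. (?e w)^2) <= r * e" by (simp add: B_nonpos)
    also have "... <= S * e" using r e by (intro mult_right_mono) auto
    finally have "(nE E 2 ?e)^2 <= (eps / ?\<alpha>)^2" using L e by (simp add: nE_2_sq_real)
    then have 1: "nE E 2 ?e <= eps / ?\<alpha>" using assms \<alpha> by (auto intro: power2_le_imp_le)
    have "R <= real k / ?\<alpha>" using K0 kl \<alpha> by (simp add: pos_le_divide_eq)
    then have le: "\<bar>bt a r k w - bt a r l w\<bar> <= ?\<alpha> * ?e w" for w
      using bt_tail_le[OF kl(2), of a r w] exc_antimono[of R "real k / ?\<alpha>" "real l" "real l" "B r w"] \<alpha>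
      by (meson mult_left_mono order_trans order_refl less_imp_le)
    have ab: "\<bar>?e w\<bar> = ?e w" for w by (intro abs_of_nonneg exc_bounds) auto
    have "nE E 2 (%w. bt a r k w - bt a r l w) <= ?\<alpha> * nE E 2 ?e"
      using L \<alpha> r0 le by (intro nE_mono cyl_diff bt_LA) (auto simp: ab)
    also have "... <= ?\<alpha> * (eps / ?\<alpha>)" using 1 \<alpha> by (intro mult_left_mono) auto
    finally show ?thesis using \<alpha> by simp
  qed
  then show ?thesis by blast
qed

lemma bt_CS: assumes "r \<in> {0..T}" shows "bt a r \<in> CS 2"
  unfolding CS_iff
proof (safe intro!: Lip_cyl[OF assms bt_cyl])
  show "0 <= r" using assms by simp
  fix eps :: real assume "eps > 0"
  then have "eps / 2 > 0" by simp
  from bt_tail[OF this T0, of a] obtain K0 where "\<forall>r\<in>{0..T}. \<forall>k l. K0 <= k --> k <= l --> nE E 2 (%w. bt a r k w - bt a r l w) <= eps / 2" by blast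
  note K0 = this[rule_format, OF assms]
  have "nE E 2 (%w. bt a r k w - bt a r l w) < eps" if "K0 <= k" "K0 <= l" for k l
    using K0[of k l] K0[of l k] nE_minus_commute[of 2 "bt a r k" "bt a r l"] that \<open>eps > 0\<close> by (cases "k <= l") auto
  then show "\<exists>M. \<forall>k\<ge>M. \<forall>l\<ge>M. nE E 2 (%w. bt a r k w - bt a r l w) < eps" by blast
qed

text \<open>Threshold and cap grow in proportion to \<open>k\<close>, as in the error terms of
  \<open>cl_increment\<close> and \<open>cl_homogeneous\<close>. Uniformity of the tail bound in the
  cap makes such terms vanish.\<close>

lemma exc_null:
  assumes "0 <= r" "c > 0" "C \<ge> 0"
  shows "(%k. nE E 2 (%w. exc (real k * c) (real k * C) (B r w))) ----> 0"
proof (rule LIMSEQ_I)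
  fix eps :: real assume e0: "eps > 0"
  define e where "e = (eps / 2)^2 / (r + 1)"
  have e: "e > 0" "(r + 1) * e = (eps / 2)^2" using e0 assms by (auto simp: e_def)
  obtain R where R: "R \<ge> 0" "!!r' s K. 0 <= r' ==> r' <= s ==> s - r' <= r + 1 ==> 0 <= K ==> E (%w. (exc R K (B s w - B r' w))^2) <= (s - r') * e"
    using increment_tail[OF e(1), of "r + 1"] assms by force
  obtain K0 :: nat where K0: "R / c <= real K0" using real_arch_simple by blast
  have "norm (nE E 2 (%w. exc (real k * c) (real k * C) (B r w :: real^'d)) - 0) < eps" if k: "K0 <= k" for k
  proof -
    have K: "0 <= real k * C" using assms by simp
    have "R <= real K0 * c" using K0 assms by (simp add: pos_divide_le_eq)
    also have "... <= real k * c" using k assms by (intro mult_right_mono) auto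
    finally have Rk: "R <= real k * c" .
    have "(nE E 2 (%w. exc (real k * c) (real k * C) (B r w :: real^'d)))^2 = E (%w. (exc (real k * c) (real k * C) (B r w :: real^'d))^2)"
      using assms K by (intro nE_2_sq_real exc_B_LA)
    also have "... <= E (%w. (exc R (real k * C) (B r w :: real^'d))^2)"
      using assms K Rk by (intro E_mono cyl_power2 exc_B_LA power_mono exc_antimono exc_bounds) auto
    also have "... <= r * e" using R(2)[of 0 r "real k * C"] assms K by (simp add: B_nonpos)
    also have "... <= (eps / 2)^2" unfolding e(2)[symmetric] using e by (intro mult_right_mono) auto
    finally have "nE E 2 (%w. exc (real k * c) (real k * C) (B r w :: real^'d)) <= eps / 2" by (rule power2_le_imp_le) (use e0 in simp)
    then show ?thesis using e0 by (simp add: abs_of_nonneg nE_nonneg)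
  qed
  then show "\<exists>M. \<forall>k\<ge>M. norm (nE E 2 (%w. exc (real k * c) (real k * C) (B r w :: real^'d)) - 0) < eps" by blast
qed

lemma cl_incr_LA: "0 <= r ==> 0 <= r' ==> (%w. cl (real k) (a \<bullet> (B r' w - B r w))) \<in> LA"
  by (rule bl_cyl[OF bl_cl_inner]) auto

lemma bt_incr_approx:
  assumes "0 <= r" "0 <= r'"
  shows "(%k. nE E 2 (%w. bt a r' k w - bt a r k w - cl (real k) (a \<bullet> (B r' w - B r w)))) ----> 0"
proof -
  let ?\<alpha> = "norm a + 1"
  have \<alpha>: "?\<alpha> > 0" using norm_ge_zero[of a] by linarith
  \<comment> \<open>The threshold \<open>k / 2\<close> of \<open>cl_increment\<close>, divided by
    \<open>norm a + 1\<close> as in \<open>tail_inner\<close>.\<close>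
  define c where "c = 1 / (2 * ?\<alpha>)"
  have c: "c > 0" "(real k / 2) / ?\<alpha> = real k * c" for k using \<alpha> by (auto simp: c_def)
  let ?e = "%r k w. exc (real k * c) (real k * 3) (B r w :: real^'d)"
  have eL: "?e r k \<in> LA" if "0 <= r" for r k using that by (intro exc_B_LA) auto
  have le: "nE E 2 (%w. bt a r' k w - bt a r k w - cl (real k) (a \<bullet> (B r' w - B r w))) <= 2 * ?\<alpha> * (nE E 2 (?e r k) + nE E 2 (?e r' k))" for k
  proof -
    have "\<bar>bt a r' k w - bt a r k w - cl (real k) (a \<bullet> (B r' w - B r w))\<bar> <= 2 * ?\<alpha> * norm (?e r k w + ?e r' k w)" for w
    proof -
      have t: "min (max 0 (\<bar>a \<bullet> B s w\<bar> - real k / 2)) (3 * real k) <= ?\<alpha> * ?e s k w" for s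
        using tail_inner[of "real k / 2" "3 * real k" a "B s w"] unfolding c(2) by (simp add: mult.commute)
      have p: "0 <= ?e s k w" for s by (intro exc_bounds) auto
      have "\<bar>bt a r' k w - bt a r k w - cl (real k) (a \<bullet> (B r' w - B r w))\<bar> <=
         2 * min (max 0 (\<bar>a \<bullet> B r w\<bar> - real k / 2)) (3 * real k) + 2 * min (max 0 (\<bar>a \<bullet> B r' w\<bar> - real k / 2)) (3 * real k)"
        using cl_increment[of "real k" "a \<bullet> B r' w" "a \<bullet> B r w"] by (simp add: bt_cl inner_diff_right)
      also have "... <= 2 * (?\<alpha> * ?e r k w) + 2 * (?\<alpha> * ?e r' k w)" by (intro add_mono mult_left_mono t) auto
      also have "... = 2 * ?\<alpha> * norm (?e r k w + ?e r' k w)" using p[of r] p[of r'] by (simp add: algebra_simps)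
      finally show ?thesis .
    qed
    then have "nE E 2 (%w. bt a r' k w - bt a r k w - cl (real k) (a \<bullet> (B r' w - B r w))) <= 2 * ?\<alpha> * nE E 2 (%w. ?e r k w + ?e r' k w)"
      using assms \<alpha> eL by (intro nE_mono cyl_diff cyl_add bt_LA cl_incr_LA) auto
    also have "... <= 2 * ?\<alpha> * (nE E 2 (?e r k) + nE E 2 (?e r' k))"
      using \<alpha> eL assms by (intro mult_left_mono nE_triangle) auto
    finally show ?thesis .
  qed
  have "(%k. 2 * ?\<alpha> * (nE E 2 (?e r k) + nE E 2 (?e r' k))) ----> 0"
    using tendsto_mult_right_zero[OF tendsto_add_zero[OF exc_null[OF assms(1) c(1), of 3] exc_null[OF assms(2) c(1), of 3]]] by simp
  from null_le[OF this le nE_nonneg] show ?thesis .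
qed

text \<open>Both evaluations of the mean of \<open>B_2\<close> hold up to truncation only. The
  errors vanish by \<open>bt_incr_approx\<close> for the sum of two increments and by
  \<open>cl_homogeneous\<close> for the scaling by \<open>sqrt 2\<close>, so the conclusion is a
  limit in \<open>k\<close>.\<close>

lemma mean_zero_1: "(%k. E (bt a 1 k)) ----> 0"
proof -
  let ?\<alpha> = "norm a + 1"
  have \<alpha>: "?\<alpha> > 0" using norm_ge_zero[of a] by linarith
  let ?m = "%k. E (bt a 1 k)"
  have L: "bt a 1 k \<in> LA" "bt a 2 k \<in> LA" for k by (auto intro: bt_LA)
  have cl12: "E (%w. cl (real k) (a \<bullet> (B 2 w - B 1 w))) = ?m k" for k
    using distr[OF bl_cl_inner, of "real k" 1 2 a] by (simp add: bt_cl[abs_def])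
  have sum12: "E (%w. bt a 1 k w + cl (real k) (a \<bullet> (B 2 w - B 1 w))) = 2 * ?m k" for k
    using indep_add[OF bt_cyl _ _ bl_cl_inner, of 1 2 "real k" a k a] by (simp add: cl12)
  have 1: "(%k. E (bt a 2 k) - 2 * ?m k) ----> 0"
  proof (rule Lim_null_comparison[OF always_eventually bt_incr_approx[of 1 2 a]], rule allI)
    fix k
    let ?D = "%w. bt a 2 k w - bt a 1 k w - cl (real k) (a \<bullet> (B 2 w - B 1 w))"
    have DL: "?D \<in> LA" using L by (intro cyl_diff cl_incr_LA) auto
    have "\<bar>E (bt a 2 k) - 2 * ?m k\<bar> <= E (%w. \<bar>bt a 2 k w - (bt a 1 k w + cl (real k) (a \<bullet> (B 2 w - B 1 w)))\<bar>)"
      unfolding sum12[symmetric] using L by (intro E_abs_diff cyl_add cl_incr_LA) auto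
    also have "... = nE E 1 ?D" using DL by (simp add: nE_1_LA diff_diff_eq)
    also have "... <= nE E 2 ?D" using DL by (rule nE_1_le_2)
    finally show "norm (E (bt a 2 k) - 2 * ?m k) <= nE E 2 ?D" by simp
  qed auto
  define c where "c = 1 / (sqrt 2 * ?\<alpha>)"
  have c: "c > 0" "(real k / sqrt 2) / ?\<alpha> = real k * c" for k using \<alpha> by (auto simp: c_def)
  let ?e = "%k w. exc (real k * c) (real k * 1) (B 1 w :: real^'d)"
  have lim: "(%k. (sqrt 2 * ?\<alpha>) * nE E 2 (?e k)) ----> 0" by (intro tendsto_mult_right_zero exc_null c) auto
  have 2: "(%k. E (bt a 2 k) - sqrt 2 * ?m k) ----> 0"
  proof (rule Lim_null_comparison[OF always_eventually lim], rule allI)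
    fix k
    let ?f = "%w. cl (real k) (sqrt 2 * (a \<bullet> B 1 w))"
    have eL: "?e k \<in> LA" by (intro exc_B_LA) auto
    have fL: "?f \<in> LA" using bl_B_cyl[OF bl_cl_inner, of "real k" 1 "{0..}" "sqrt 2 *\<^sub>R a"] by simp
    have "E (bt a 2 k) = E ?f" using distr[OF bl_cl_inner, of "real k" 0 2 a] by (simp add: bt_cl[abs_def] B_nonpos)
    moreover have "sqrt 2 * ?m k = E (%w. sqrt 2 * bt a 1 k w)" using E_scale[OF L(1), of "sqrt 2" k] by simp
    ultimately have "\<bar>E (bt a 2 k) - sqrt 2 * ?m k\<bar> <= E (%w. \<bar>?f w - sqrt 2 * bt a 1 k w\<bar>)"
      using E_abs_diff[OF fL, of "%w. sqrt 2 * bt a 1 k w"] L by (simp add: cyl_mult cyl_const)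
    also have "... <= E (%w. (sqrt 2 * ?\<alpha>) * ?e k w)"
    proof (intro E_mono cyl_abs cyl_diff fL cyl_mult cyl_const L eL)
      fix w
      have "\<bar>?f w - sqrt 2 * bt a 1 k w\<bar> <= sqrt 2 * min (max 0 (\<bar>a \<bullet> B 1 w\<bar> - real k / sqrt 2)) (real k)"
        unfolding bt_cl by (intro cl_homogeneous) auto
      also have "... <= sqrt 2 * (?\<alpha> * ?e k w)"
        using tail_inner[of "real k / sqrt 2" "real k" a "B 1 w"] unfolding c(2) by (intro mult_left_mono) simp_all
      finally show "\<bar>?f w - sqrt 2 * bt a 1 k w\<bar> <= (sqrt 2 * ?\<alpha>) * ?e k w" by simp
    qed
    also have "... = (sqrt 2 * ?\<alpha>) * E (?e k)" using eL \<alpha> by (intro E_scale) auto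
    also have "E (?e k) = nE E 1 (?e k)"
    proof -
      have "norm (?e k w) = ?e k w" for w using exc_bounds(1)[of "real k * 1" "real k * c" "B 1 w"] by simp
      then show ?thesis using eL by (simp add: nE_1_LA)
    qed
    also have "(sqrt 2 * ?\<alpha>) * nE E 1 (?e k) <= (sqrt 2 * ?\<alpha>) * nE E 2 (?e k)" using \<alpha> eL by (intro mult_left_mono nE_1_le_2) auto
    finally show "norm (E (bt a 2 k) - sqrt 2 * ?m k) <= (sqrt 2 * ?\<alpha>) * nE E 2 (?e k)" by simp
  qed
  have "sqrt 2 < 2" by (rule real_less_lsqrt) auto
  then have ne: "sqrt 2 - 2 \<noteq> 0" by simp
  have "(%k. (E (bt a 2 k) - 2 * ?m k) - (E (bt a 2 k) - sqrt 2 * ?m k)) ----> 0" using tendsto_diff[OF 1 2] by simp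
  then have "(%k. (sqrt 2 - 2) * ?m k) ----> 0" by (simp add: algebra_simps)
  from tendsto_mult_left[OF this, of "1 / (sqrt 2 - 2)"] show ?thesis using ne by simp
qed

lemma mean_zero:
  assumes "0 <= r" "r <= r'"
  shows "(%k. E (%w. cl (real k) (a \<bullet> (B r' w - B r w)))) ----> 0"
proof -
  have "E (%w. cl (real k) (a \<bullet> (B r' w - B r w))) = E (bt (sqrt (r' - r) *\<^sub>R a) 1 k)" for k
    using distr[OF bl_cl_inner assms, of "real k" a] by (simp add: bt_cl[abs_def])
  then show ?thesis using mean_zero_1 by simp
qed

text \<open>The martingale property in the form required for cross terms. The difference of
  truncations is replaced by the truncated increment, at an error that Cauchy-Schwarz controls by
  the uniform bound \<open>C\<close>; independence and vanishing means do the rest.\<close>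

lemma incr_mult_null:
  assumes r: "0 <= r" "r <= r'" and \<zeta>: "!!k. \<zeta> k \<in> cyl {0..r}" "!!k. nE E 2 (\<zeta> k) <= C"
  shows "\<exists>\<delta>. \<delta> ----> 0 \<and> (\<forall>k. E (%w. \<zeta> k w * (bt a r' k w - bt a r k w)) <= \<delta> k)"
proof -
  let ?\<psi> = "%k w. cl (real k) (a \<bullet> (B r' w - B r w))"
  let ?D = "%k w. bt a r' k w - bt a r k w - ?\<psi> k w"
  define m where "m k = \<bar>E (?\<psi> k)\<bar>" for k
  define m' where "m' k = \<bar>E (%w. cl (real k) ((- a) \<bullet> (B r' w - B r w)))\<bar>" for k
  have \<zeta>L: "\<zeta> k \<in> LA" for k using cyl_LA[OF \<zeta>(1)] .
  have \<psi>L: "?\<psi> k \<in> LA" for k using r by (intro cl_incr_LA) auto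
  have DL: "?D k \<in> LA" for k using r by (intro cyl_diff bt_LA \<psi>L) auto
  have C: "0 <= C" using \<zeta>(2)[of 0] nE_nonneg[of 2 "\<zeta> 0"] by linarith
  have m0: "m ----> 0" "m' ----> 0"
    unfolding m_def m'_def by (intro tendsto_rabs_zero mean_zero r)+
  have nE1: "E (%w. \<bar>\<zeta> k w\<bar>) <= C" for k
    using nE_1_le_2[OF \<zeta>L, of k] \<zeta>(2)[of k] \<zeta>L[of k] by (simp add: nE_1_LA)
  have part: "E (%w. \<xi> w * cl (real k) (b \<bullet> (B r' w - B r w))) <= C * \<bar>E (%w. cl (real k) (b \<bullet> (B r' w - B r w)))\<bar>"
    if \<xi>: "\<xi> \<in> cyl {0..r}" "!!w. 0 <= \<xi> w" "!!w. \<xi> w <= \<bar>\<zeta> k w\<bar>" for \<xi> k b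
  proof -
    let ?c = "\<bar>E (%w. cl (real k) (b \<bullet> (B r' w - B r w)))\<bar>"
    have "E (%w. \<xi> w * cl (real k) (b \<bullet> (B r' w - B r w))) <= E (%w. \<xi> w * ?c)"
      using indep_mult_le[OF \<xi>(1,2) r bl_cl_inner, of "real k" b ?c] by simp
    also have "... <= E (%w. ?c * \<bar>\<zeta> k w\<bar>)"
    proof (intro E_mono cyl_mult cyl_const cyl_abs \<zeta>L cyl_LA[OF \<xi>(1)])
      fix w show "\<xi> w * ?c <= ?c * \<bar>\<zeta> k w\<bar>" using mult_right_mono[OF \<xi>(3)[of w], of ?c] by (simp add: mult.commute)
    qed
    also have "... = ?c * E (%w. \<bar>\<zeta> k w\<bar>)" by (intro E_scale cyl_abs \<zeta>L) auto
    also have "... <= C * ?c" using mult_left_mono[OF nE1[of k], of ?c] by (simp add: mult.commute)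
    finally show ?thesis .
  qed
  have main: "E (%w. \<zeta> k w * (bt a r' k w - bt a r k w)) <= C * nE E 2 (?D k) + C * m k + C * m' k" for k
  proof -
    let ?p = "%w. max (\<zeta> k w) 0" and ?n = "%w. max (- \<zeta> k w) 0"
    \<comment> \<open>The direction \<open>- a\<close> accompanies the negative part of
      \<open>\<zeta> k\<close>: a negative factor cannot be pulled out of \<open>E\<close>, and
      \<open>E\<close> of a negated variable is not the negated expectation.\<close>
    let ?\<psi>' = "%w. cl (real k) ((- a) \<bullet> (B r' w - B r w))"
    have \<psi>'L: "?\<psi>' \<in> LA" using r by (intro cl_incr_LA) auto
    have pn: "?p \<in> cyl {0..r}" "?n \<in> cyl {0..r}" by (intro cyl_max cyl_uminus cyl_const \<zeta>(1))+
    have "?\<psi>' w = - ?\<psi> k w" for w using cl_minus[of "real k" "a \<bullet> (B r' w - B r w)"] by simp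
    then have "\<zeta> k w * (bt a r' k w - bt a r k w) = \<zeta> k w * ?D k w + (?p w * ?\<psi> k w + ?n w * ?\<psi>' w)" for w
      by (simp add: algebra_simps max_def)
    then have "E (%w. \<zeta> k w * (bt a r' k w - bt a r k w)) = E (%w. \<zeta> k w * ?D k w + (?p w * ?\<psi> k w + ?n w * ?\<psi>' w))" by simp
    also have "... <= E (%w. \<zeta> k w * ?D k w) + E (%w. ?p w * ?\<psi> k w + ?n w * ?\<psi>' w)"
      by (intro E_add cyl_mult cyl_add \<zeta>L DL \<psi>L \<psi>'L cyl_LA[OF pn(1)] cyl_LA[OF pn(2)])
    also have "E (%w. ?p w * ?\<psi> k w + ?n w * ?\<psi>' w) <= E (%w. ?p w * ?\<psi> k w) + E (%w. ?n w * ?\<psi>' w)"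
      by (intro E_add cyl_mult \<psi>L \<psi>'L cyl_LA[OF pn(1)] cyl_LA[OF pn(2)])
    also have "E (%w. ?p w * ?\<psi> k w) <= C * m k" unfolding m_def by (rule part[OF pn(1)]) auto
    also have "E (%w. ?n w * ?\<psi>' w) <= C * m' k" unfolding m'_def by (rule part[OF pn(2)]) auto
    also have "E (%w. \<zeta> k w * ?D k w) <= nE E 2 (\<zeta> k) * nE E 2 (?D k)"
      using E_Cauchy_Schwarz[OF \<zeta>L[of k] DL[of k]] \<zeta>L[of k] DL[of k] by (simp add: nE_2)
    also have "... <= C * nE E 2 (?D k)" by (intro mult_right_mono \<zeta>(2) nE_nonneg)
    finally show ?thesis by simp
  qed
  have "(%k. C * nE E 2 (?D k) + C * m k + C * m' k) ----> 0"
    using bt_incr_approx[of r r' a] r m0 by (intro tendsto_add_zero tendsto_mult_right_zero) auto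
  then show ?thesis using main by blast
qed

end

section \<open>Integrators\<close>

text \<open>A value of a simple process depends on the path up to the left partition point
  \<open>x\<close>. If the projected interval does not collapse, \<open>x\<close> lies before its
  projection, so the value is known when the projected increment starts.\<close>

lemma clip_adapted:
  assumes "s <= t" "x < y" "clip s t x \<noteq> clip s t y" shows "x <= clip s t x" "clip s t x < clip s t y"
  using assms by (auto simp: clip_def max_def min_def split: if_splits)

lemma weighted_Cauchy_Schwarz:
  fixes wt x :: "'i => real"
  assumes "!!i. i \<in> I ==> 0 <= wt i"
  shows "(\<Sum>i\<in>I. wt i * x i)^2 <= (\<Sum>i\<in>I. wt i) * (\<Sum>i\<in>I. wt i * (x i)^2)"
proof -
  have "(\<Sum>i\<in>I. wt i * x i) = (\<Sum>i\<in>I. sqrt (wt i) * (sqrt (wt i) * x i))"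
    using assms by (intro sum.cong) (auto simp: mult.assoc[symmetric])
  then have "(\<Sum>i\<in>I. wt i * x i)^2 <= (\<Sum>i\<in>I. (sqrt (wt i))^2) * (\<Sum>i\<in>I. (sqrt (wt i) * x i)^2)"
    using Cauchy_Schwarz_ineq_sum[of "%i. sqrt (wt i)" "%i. sqrt (wt i) * x i" I] by simp
  also have "(\<Sum>i\<in>I. (sqrt (wt i))^2) = (\<Sum>i\<in>I. wt i)" using assms by (intro sum.cong) auto
  also have "(\<Sum>i\<in>I. (sqrt (wt i) * x i)^2) = (\<Sum>i\<in>I. wt i * (x i)^2)" using assms by (intro sum.cong) (auto simp: power_mult_distrib)
  finally show ?thesis .
qed

lemma tendsto_powr12:
  assumes "p12 p" "!!k. 0 <= f k" "f ----> l" shows "(%k::nat. f k powr p) ----> l powr p"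
proof -
  have l: "0 <= l" by (rule LIMSEQ_le_const[OF assms(3)]) (use assms(2) in auto)
  show ?thesis
  proof (cases "p = 1")
    case True then show ?thesis using assms l by simp
  next
    case False
    then have "p = 2" using assms(1) by (simp add: p12_def)
    then show ?thesis using tendsto_power[OF assms(3), of 2] assms l by simp
  qed
qed

lemma isum_eq: "isum a s t (N, \<tau>, \<xi>) = (%k w. \<Sum>i<N. (a (clip s t (\<tau> (Suc i))) k w - a (clip s t (\<tau> i)) k w) *\<^sub>R \<xi> i w)"
  by (intro ext) (simp add: isum_def)

context sublinear_T
begin

definition reps :: "real => (real => (nat => 'd path => real) set) => (real => nat => 'd path => real) => bool" where
  "reps p A a \<longleftrightarrow> (\<forall>r\<in>{0..T}. A r \<in> LGs p \<and> a r \<in> A r \<and> (\<forall>k. a r k \<in> cyl {0..r}))"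

lemma repsD: "reps p A a ==> r \<in> {0..T} ==> A r \<in> LGs p" "reps p A a ==> r \<in> {0..T} ==> a r \<in> A r"
  "reps p A a ==> r \<in> {0..T} ==> a r k \<in> cyl {0..r}" by (auto simp: reps_def)

lemma clip_T: "0 <= s ==> s <= t ==> t <= T ==> clip s t r \<in> {0..T}" using clip_in[of s t r] by auto

lemma isum_CS:
  assumes p: "p12 p" and a: "!!r. r \<in> {0..T} ==> a r \<in> CS p" and \<eta>: "\<eta> \<in> SP" and st: "0 <= s" "s <= t" "t <= T"
  shows "isum a s t \<eta> \<in> CS p"
proof -
  obtain N \<tau> \<xi> where d: "\<eta> = (N, \<tau>, \<xi>)" using prod_cases3 by blast
  have "(%k w. (a (clip s t (\<tau> (Suc i))) k w - a (clip s t (\<tau> i)) k w) *\<^sub>R \<xi> i w) \<in> CS p" if "i < N" for i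
  proof -
    have "\<xi> i \<in> cyl {0..T}" using mgE_summands(3)[OF \<eta>[unfolded d] p that] .
    then obtain L where L: "fadm (%w y. y *\<^sub>R \<xi> i w) L" using fadm_scaleR by blast
    have "(%k w. a (clip s t (\<tau> (Suc i))) k w - a (clip s t (\<tau> i)) k w) \<in> CS p"
      by (intro CS_diff p a clip_T st)
    then show ?thesis using fadm_CS[OF L p p order_refl] by simp
  qed
  then have "(%k w. \<Sum>i\<in>{..<N}. (a (clip s t (\<tau> (Suc i))) k w - a (clip s t (\<tau> i)) k w) *\<^sub>R \<xi> i w) \<in> CS p"
    by (intro CS_sum p) auto
  then show ?thesis by (simp add: isum_eq d)
qed

text \<open>An interval beyond \<open>t\<close> collapses under projection while its
  \<open>\<xi> i\<close> may look further ahead than the projected time; \<open>f0\<close> makes its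
  coefficient vanish.\<close>

lemma sum_adapted:
  assumes \<eta>: "(N, \<tau>, \<xi>) \<in> SP" and st: "0 <= s" "s <= t" and j: "j <= N"
    and f: "!!i. i < N ==> clip s t (\<tau> i) < clip s t (\<tau> (Suc i)) ==> f i \<in> cyl {0..clip s t (\<tau> (Suc i))}"
    and f0: "!!i. i < N ==> clip s t (\<tau> i) = clip s t (\<tau> (Suc i)) ==> f i = (%w. 0)"
  shows "(%w. \<Sum>i<j. f i w *\<^sub>R \<xi> i w) \<in> cyl {0..clip s t (\<tau> j)}"
proof (rule cyl_sum)
  have g: "grid T N \<tau>" using \<eta> by (simp add: sp_iff)
  fix i assume "i \<in> {..<j}"
  then have i: "i < j" "i < N" using j by auto
  have lt: "\<tau> i < \<tau> (Suc i)" using g i by (simp add: grid_def)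
  show "(%w. f i w *\<^sub>R \<xi> i w) \<in> cyl {0..clip s t (\<tau> j)}"
  proof (cases "clip s t (\<tau> i) = clip s t (\<tau> (Suc i))")
    case True then show ?thesis using f0[OF i(2)] by (simp add: cyl_const)
  next
    case False
    note c = clip_adapted[OF st(2) lt False]
    have m: "clip s t (\<tau> (Suc i)) <= clip s t (\<tau> j)" using grid_le[OF g, of "Suc i" j] i j by (intro clip_mono) auto
    have 1: "f i \<in> cyl {0..clip s t (\<tau> j)}" using m by (intro cyl_mono[OF _ f[OF i(2) c(2)]]) auto
    have 2: "\<xi> i \<in> cyl {0..clip s t (\<tau> j)}" using m c by (intro cyl_mono[OF _ sp_xi_cyl[OF \<eta> i(2)]]) auto
    show ?thesis by (rule cyl_scaleR[OF 1 2])
  qed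
qed

lemma isum_partial_adapted:
  assumes a: "!!r k. r \<in> {0..T} ==> a r k \<in> cyl {0..r}" and \<eta>: "(N, \<tau>, \<xi>) \<in> SP" and st: "0 <= s" "s <= t" "t <= T" and j: "j <= N"
  shows "(%w. \<Sum>i<j. (a (clip s t (\<tau> (Suc i))) k w - a (clip s t (\<tau> i)) k w) *\<^sub>R \<xi> i w) \<in> cyl {0..clip s t (\<tau> j)}"
proof (rule sum_adapted[OF \<eta> st(1,2) j])
  fix i assume "clip s t (\<tau> i) < clip s t (\<tau> (Suc i))"
  then have "a (clip s t (\<tau> i)) k \<in> cyl {0..clip s t (\<tau> (Suc i))}"
    by (intro cyl_mono[OF _ a[OF clip_T[OF st]]]) auto
  then show "(%w. a (clip s t (\<tau> (Suc i))) k w - a (clip s t (\<tau> i)) k w) \<in> cyl {0..clip s t (\<tau> (Suc i))}"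
    by (intro cyl_diff a[OF clip_T[OF st]])
qed simp

lemma isum_adapted:
  assumes a: "!!r k. r \<in> {0..T} ==> a r k \<in> cyl {0..r}" and \<eta>: "\<eta> \<in> SP" and st: "0 <= s" "s <= t" "t <= T"
  shows "isum a s t \<eta> k \<in> cyl {0..t}"
proof -
  obtain N \<tau> \<xi> where d: "\<eta> = (N, \<tau>, \<xi>)" using prod_cases3 by blast
  have "\<tau> N = T" using \<eta> by (simp add: d sp_iff grid_def)
  then have "clip s t (\<tau> N) = t" using st by (auto simp: clip_def)
  then show ?thesis using isum_partial_adapted[where k=k, OF a \<eta>[unfolded d] st order_refl] by (simp add: isum_eq d)
qed

lemma integral_simple_rep:
  assumes p: "p12 p" and a: "reps p A a" and \<eta>: "\<eta> \<in> SP" and t: "t \<in> {0..T}"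
  shows "integral_simple E T p A t \<eta> \<in> LGs p" "isum a 0 t \<eta> \<in> integral_simple E T p A t \<eta>"
proof -
  obtain N \<tau> \<xi> where d: "\<eta> = (N, \<tau>, \<xi>)" using prod_cases3 by blast
  have g: "grid T N \<tau>" using \<eta> by (simp add: d sp_iff)
  have c: "clip 0 t (\<tau> i) = min (\<tau> i) t" if "i <= N" for i using grid_range[OF g that] t by (auto simp: clip_def)
  let ?U = "%i. lg_map E T p (%w y. y *\<^sub>R \<xi> i w) (lg_diff E T p (A (min (\<tau> (Suc i)) t)) (A (min (\<tau> i) t)))"
  let ?u = "%i k w. (a (clip 0 t (\<tau> (Suc i))) k w - a (clip 0 t (\<tau> i)) k w) *\<^sub>R \<xi> i w"
  have *: "?U i \<in> LGs p \<and> ?u i \<in> ?U i" if i: "i < N" for i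
  proof -
    have "\<xi> i \<in> cyl {0..T}" using mgE_summands(3)[OF \<eta>[unfolded d] p i] .
    then obtain L where L: "fadm (%w y. y *\<^sub>R \<xi> i w) L" using fadm_scaleR by blast
    have r: "clip 0 t (\<tau> i) \<in> {0..T}" "clip 0 t (\<tau> (Suc i)) \<in> {0..T}" by (rule clip_T; use t in simp)+
    have ci: "clip 0 t (\<tau> i) = min (\<tau> i) t" "clip 0 t (\<tau> (Suc i)) = min (\<tau> (Suc i)) t" using c i by auto
    note D = lg_diff_rep[OF p repsD(1)[OF a r(2)] repsD(1)[OF a r(1)] repsD(2)[OF a r(2)] repsD(2)[OF a r(1)]]
    show ?thesis using lg_map_rep[OF L p p order_refl D] unfolding ci by blast
  qed
  have "lg_sum E T p ?U {..<N} \<in> LGs p" "(%k w. \<Sum>i\<in>{..<N}. ?u i k w) \<in> lg_sum E T p ?U {..<N}"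
    using * by (auto intro!: lg_sum_rep[OF p])
  then show "integral_simple E T p A t \<eta> \<in> LGs p" "isum a 0 t \<eta> \<in> integral_simple E T p A t \<eta>"
    by (simp_all add: integral_simple_def d isum_eq)
qed

text \<open>\<open>J\<close> is the integral as an operator with values in \<open>L\<^sub>G\<^sup>2\<close>.  For \<open>p = 1\<close> the values of \<open>integral_simple\<close>
  lie in \<open>L\<^sub>G\<^sup>1\<close>, where no estimate of second moments can be stated.\<close>

definition good_integrator ::
  "real => (real => (nat => 'd path => real) set) =>
   (('d, 'v::real_normed_vector) simple_process => real => (nat => 'd path => 'v) set) => real => bool" where
  "good_integrator p A J C \<longleftrightarrow> 0 <= C \<and> (\<forall>t\<in>{0..T}. \<forall>\<eta>\<in>SP.
     J \<eta> t \<in> LGs 2 \<and> adapted t (J \<eta> t) \<and>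
     integral_simple E T p A t \<eta> \<in> LGs p \<and> inc (J \<eta> t) = inc (integral_simple E T p A t \<eta>) \<and>
     (\<forall>\<zeta>\<in>SP. ld p (integral_simple E T p A t \<eta>) (integral_simple E T p A t \<zeta>) powr p <= C * mg_pdist E T p \<eta> \<zeta> powr p \<and>
        (ld 2 (J \<eta> t) (J \<zeta> t))^2 <= C * (LINT r:{0..t}|lebesgue. (ld 2 (pem 2 \<eta> r) (pem 2 \<zeta> r))^2)) \<and>
     (\<forall>s\<in>{0..t}. (ld 2 (J \<eta> s) (J \<eta> t))^2 <= C * (LINT r:{s..t}|lebesgue. (nE E 2 (process_at \<eta> r))^2)))"

text \<open>Comparison in \<open>L_G^1\<close> is enough: the difference is Cauchy in
  \<open>L_G^2\<close> and null in \<open>L_G^1\<close>, hence null in \<open>L_G^2\<close> by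
  \<open>CS_2_null\<close>. The sequence \<open>d\<close> absorbs truncation errors that disappear
  in the limit.\<close>

lemma ld_sq_le:
  assumes U: "U \<in> LGs 2" "V \<in> LGs 2" "u \<in> U" "v \<in> V" and wt: "wt \<in> CS 2"
    and n: "(%k. nE E 1 (%w. (u k w - v k w) - wt k w)) ----> 0"
    and b: "d ----> 0" "!!k. (nE E 2 (wt k))^2 <= d k + c"
  shows "(ld 2 U V)^2 <= c"
proof -
  have uv: "u \<in> CS 2" "v \<in> CS 2" using LG_D(1)[of 2] U by auto
  have "(%k w. (u k w - v k w) - wt k w) \<in> CS 2" using uv wt by (intro CS_diff) auto
  from CS_2_null[OF this n] have n2: "(%k. nE E 2 (%w. (u k w - v k w) - wt k w)) ----> 0" .
  have "(%k. nE E 2 (wt k) - nE E 2 (%w. u k w - v k w)) ----> 0"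
  proof (rule Lim_null_comparison[OF always_eventually n2], rule allI)
    fix k
    have "\<bar>nE E 2 (%w. u k w - v k w) - nE E 2 (wt k)\<bar> <= nE E 2 (%w. (u k w - v k w) - wt k w)"
      using CS_LA[OF uv(1)] CS_LA[OF uv(2)] CS_LA[OF wt] by (intro nE_abs_diff cyl_diff) auto
    then show "norm (nE E 2 (wt k) - nE E 2 (%w. u k w - v k w)) <= nE E 2 (%w. (u k w - v k w) - wt k w)"
      by (simp add: abs_minus_commute)
  qed
  from tendsto_add[OF this ld_lim[OF p12_2 U]] have "(%k. nE E 2 (wt k)) ----> ld 2 U V" by simp
  from tendsto_power[OF this, of 2] show ?thesis
  proof (rule LIMSEQ_le)
    show "(%k. d k + c) ----> c" using tendsto_add[OF b(1) tendsto_const[of c]] by simp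
  qed (use b(2) in blast)
qed

text \<open>\<open>V s t \<eta>\<close> is a candidate for the integral over \<open>[s,t]\<close> in
  \<open>L_G^2\<close> that agrees with \<open>isum\<close> up to an \<open>L_G^1\<close>-null
  sequence. It may come from cutting \<open>isum\<close>, and then it is additive in time and linear
  in \<open>\<eta>\<close> only asymptotically; the fact \<open>tri\<close> transfers these
  properties from \<open>isum\<close>, where they are exact.\<close>

lemma good_integratorI:
  fixes V :: "real => real => ('d, 'v::real_normed_vector) simple_process => nat => 'd path => 'v"
  assumes p: "p12 p" and a: "reps p A a" and C: "0 <= C"
    and V: "!!\<eta> s t. \<eta> \<in> SP ==> 0 <= s ==> s <= t ==> t <= T ==> V s t \<eta> \<in> CS 2"
    and V1: "!!\<eta> s t. \<eta> \<in> SP ==> 0 <= s ==> s <= t ==> t <= T ==> (%k. nE E 1 (%w. isum a s t \<eta> k w - V s t \<eta> k w)) ----> 0"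
    and V2: "!!\<eta> s t. \<eta> \<in> SP ==> 0 <= s ==> s <= t ==> t <= T ==>
      \<exists>d. d ----> 0 \<and> (\<forall>k. (nE E 2 (V s t \<eta> k))^2 <= d k + C * (LINT r:{s..t}|lebesgue. (nE E 2 (process_at \<eta> r))^2))"
    and Vp: "!!(\<eta> :: ('d, 'v) simple_process) t. \<eta> \<in> SP ==> 0 <= t ==> t <= T ==> \<exists>d. d ----> 0 \<and> (\<forall>k. nE E p (isum a 0 t \<eta> k) powr p <= d k + C * mgE p \<eta>)"
    and Vad: "!!\<eta> t k. \<eta> \<in> SP ==> 0 <= t ==> t <= T ==> V 0 t \<eta> k \<in> cyl {0..t}"
  shows "good_integrator p A (%\<eta> t. cls 2 (V 0 t \<eta>)) C"
proof -
  let ?J = "%\<eta> t. cls 2 (V 0 t \<eta>)"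
  let ?I = "%\<eta> t. integral_simple E T p A t \<eta>"
  have aCS: "a r \<in> CS 1" if "r \<in> {0..T}" for r
    using LG_D(1)[OF p repsD(1,2)[OF a that]] p CS_2_1 by (auto simp: p12_def)
  have IL: "isum a s t \<eta> k \<in> LA" if "\<eta> \<in> SP" "0 <= s" "s <= t" "t <= T" for \<eta> :: "('d, 'v) simple_process" and s t k
    using CS_LA[OF isum_CS[OF _ aCS that]] by simp
  have VL: "V s t \<eta> k \<in> LA" if "\<eta> \<in> SP" "0 <= s" "s <= t" "t <= T" for \<eta> s t k using CS_LA[OF V[OF that]] .
  have J: "?J \<eta> t \<in> LGs 2" "V 0 t \<eta> \<in> ?J \<eta> t" if "\<eta> \<in> SP" "t \<in> {0..T}" for \<eta> t
    using cls_in[OF p12_2 V[of \<eta> 0 t]] that by auto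
  have tri: "(%k. nE E 1 (%w. (xa k w - xb k w) - xc k w)) ----> 0"
    if "!!k. xa k \<in> LA" "!!k. xb k \<in> LA" "!!k. xc k \<in> LA" "!!k. ya k \<in> LA" "!!k. yb k \<in> LA" "!!k. yc k \<in> LA"
      "(%k. nE E 1 (%w. ya k w - xa k w)) ----> 0" "(%k. nE E 1 (%w. yb k w - xb k w)) ----> 0"
      "(%k. nE E 1 (%w. yc k w - xc k w)) ----> 0" "!!k w. yc k w = ya k w - yb k w"
    for xa xb xc ya yb yc :: "nat => 'd path => 'v"
  proof -
    have le: "nE E 1 (%w. (xa k w - xb k w) - xc k w) <= nE E 1 (%w. ya k w - xa k w) + (nE E 1 (%w. yb k w - xb k w) + nE E 1 (%w. yc k w - xc k w))" for k
    proof -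
      have "nE E 1 (%w. (xa k w - xb k w) - xc k w) = nE E 1 (%w. (xa k w - ya k w) + ((yb k w - xb k w) + (yc k w - xc k w)))"
        using that(10) by (simp add: algebra_simps)
      also have "... <= nE E 1 (%w. xa k w - ya k w) + nE E 1 (%w. (yb k w - xb k w) + (yc k w - xc k w))"
        by (intro nE_triangle cyl_diff cyl_add that p12_simps)
      also have "nE E 1 (%w. (yb k w - xb k w) + (yc k w - xc k w)) <= nE E 1 (%w. yb k w - xb k w) + nE E 1 (%w. yc k w - xc k w)"
        by (intro nE_triangle cyl_diff cyl_add that p12_simps)
      finally show ?thesis using nE_minus_commute[of 1 "xa k" "ya k"] by simp
    qed
    show ?thesis by (rule null_le[OF _ le nE_nonneg]) (intro tendsto_add_zero that)
  qed
  show ?thesis unfolding good_integrator_def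
  proof (intro conjI ballI C)
    fix t and \<eta> :: "('d, 'v) simple_process" assume t: "t \<in> {0..T}" and \<eta>: "\<eta> \<in> SP"
    then have t': "0 <= t" "t <= T" by auto
    note IS = integral_simple_rep[OF p a \<eta> t]
    show "?J \<eta> t \<in> LGs 2" by (rule J[OF \<eta> t])
    show "adapted t (?J \<eta> t)" using J(2)[OF \<eta> t] Vad[OF \<eta> t'] by (auto simp: adapted_def)
    show "?I \<eta> t \<in> LGs p" by (rule IS)
    show "inc (?J \<eta> t) = inc (?I \<eta> t)"
    proof (rule LG_eqI[OF p12_1 inc_rep(1)[OF p12_2 J(1)[OF \<eta> t]] inc_rep(1)[OF p IS(1)]])
      show "V 0 t \<eta> \<in> inc (?J \<eta> t)" by (rule inc_rep(2)[OF p12_2 J[OF \<eta> t]])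
      show "isum a 0 t \<eta> \<in> inc (?I \<eta> t)" by (rule inc_rep(2)[OF p IS])
      show "(%k. nE E 1 (%w. V 0 t \<eta> k w - isum a 0 t \<eta> k w)) ----> 0"
        using V1[OF \<eta> _ t', of] unfolding nE_minus_commute[of 1 "V 0 t \<eta> _"] by simp
    qed
    show "(ld 2 (?J \<eta> s) (?J \<eta> t))^2 <= C * (LINT r:{s..t}|lebesgue. (nE E 2 (process_at \<eta> r))^2)" if s: "s \<in> {0..t}" for s
    proof -
      have s': "0 <= s" "s <= t" "s <= T" "s \<in> {0..T}" using s t by auto
      obtain d where d: "d ----> 0" "!!k. (nE E 2 (V s t \<eta> k))^2 <= d k + C * (LINT r:{s..t}|lebesgue. (nE E 2 (process_at \<eta> r))^2)"
        using V2[OF \<eta> s'(1,2) t'(2)] by blast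
      have "(ld 2 (?J \<eta> t) (?J \<eta> s))^2 <= C * (LINT r:{s..t}|lebesgue. (nE E 2 (process_at \<eta> r))^2)"
      proof (rule ld_sq_le[OF J(1)[OF \<eta> t] J(1)[OF \<eta> s'(4)] J(2)[OF \<eta> t] J(2)[OF \<eta> s'(4)] V[OF \<eta> s'(1,2) t'(2)] _ d])
        show "(%k. nE E 1 (%w. V 0 t \<eta> k w - V 0 s \<eta> k w - V s t \<eta> k w)) ----> 0"
          by (rule tri[of _ _ _ "isum a 0 t \<eta>" "isum a 0 s \<eta>" "isum a s t \<eta>"])
             (use \<eta> s' t' in \<open>auto intro!: VL IL V1 simp: isum_split\<close>)
      qed
      then show ?thesis using ld_sym[OF p12_2 J(1)[OF \<eta> t] J(1)[OF \<eta> s'(4)]] by simp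
    qed
    fix \<zeta> :: "('d, 'v) simple_process" assume \<zeta>: "\<zeta> \<in> SP"
    obtain \<delta> :: "('d, 'v) simple_process" where \<delta>: "\<delta> \<in> SP" "!!t. process_at \<delta> t = (%w. process_at \<eta> t w - process_at \<zeta> t w)"
      "!!a s t. isum a s t \<delta> = (%k w. isum a s t \<eta> k w - isum a s t \<zeta> k w)"
      using sp_diff[OF \<eta> \<zeta> T0] by (elim bexE conjE) (rule that, assumption, simp, simp)
    show "ld p (?I \<eta> t) (?I \<zeta> t) powr p <= C * mg_pdist E T p \<eta> \<zeta> powr p"
    proof -
      note IZ = integral_simple_rep[OF p a \<zeta> t]
      obtain d where d: "d ----> 0" "!!k. nE E p (isum a 0 t \<delta> k) powr p <= d k + C * mgE p \<delta>"
        using Vp[OF \<delta>(1) t'] by blast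
      have "(%k. nE E p (isum a 0 t \<delta> k)) ----> ld p (?I \<eta> t) (?I \<zeta> t)"
        unfolding \<delta>(3) by (rule ld_lim[OF p IS(1) IZ(1) IS(2) IZ(2)])
      from tendsto_powr12[OF p nE_nonneg this] have "ld p (?I \<eta> t) (?I \<zeta> t) powr p <= C * mgE p \<delta>"
      proof (rule LIMSEQ_le)
        show "(%k. d k + C * mgE p \<delta>) ----> C * mgE p \<delta>" using tendsto_add[OF d(1) tendsto_const[of "C * mgE p \<delta>"]] by simp
      qed (use d(2) in blast)
      moreover have "mg_pdist E T p \<eta> \<zeta> powr p = mgE p \<delta>"
        using mg_pdist_delta[OF \<delta>(1,2) p] mgE_nonneg[OF \<delta>(1) p] p by (auto simp: powr_powr p12_def)
      ultimately show ?thesis by simp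
    qed
    show "(ld 2 (?J \<eta> t) (?J \<zeta> t))^2 <= C * (LINT r:{0..t}|lebesgue. (ld 2 (pem 2 \<eta> r) (pem 2 \<zeta> r))^2)"
    proof -
      obtain d where d: "d ----> 0" "!!k. (nE E 2 (V 0 t \<delta> k))^2 <= d k + C * (LINT r:{0..t}|lebesgue. (nE E 2 (process_at \<delta> r))^2)"
        using V2[OF \<delta>(1) order_refl t'] by blast
      have "(ld 2 (?J \<eta> t) (?J \<zeta> t))^2 <= C * (LINT r:{0..t}|lebesgue. (nE E 2 (process_at \<delta> r))^2)"
      proof (rule ld_sq_le[OF J(1)[OF \<eta> t] J(1)[OF \<zeta> t] J(2)[OF \<eta> t] J(2)[OF \<zeta> t] V[OF \<delta>(1) order_refl t'] _ d])
        show "(%k. nE E 1 (%w. V 0 t \<eta> k w - V 0 t \<zeta> k w - V 0 t \<delta> k w)) ----> 0"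
          by (rule tri[of _ _ _ "isum a 0 t \<eta>" "isum a 0 t \<zeta>" "isum a 0 t \<delta>"];
              ((rule VL IL V1; (rule \<eta> \<zeta> \<delta>(1) order_refl t'))| simp only: \<delta>(3)))
      qed
      then show ?thesis by (simp add: ld_pem[OF _ \<eta> \<zeta>] \<delta>(2))
    qed
  qed
qed

text \<open>Encodes that increments of \<open>A\<close> over \<open>[s,t]\<close> are at most
  \<open>C * (t - s)\<close> in absolute value. Classes of sequences admit no pointwise inequality,
  so the expectation of the excess has to vanish along a representing sequence.\<close>

definition lip_integrator :: "(real => (nat => 'd path => real) set) => real => bool" where
  "lip_integrator A C \<longleftrightarrow> 0 <= C \<and> (\<exists>a. reps 1 A a \<and> (\<forall>s t. 0 <= s --> s <= t --> t <= T -->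
     (%k. E (%w. max 0 (\<bar>a t k w - a s k w\<bar> - C * (t - s)))) ----> 0))"

lemma cyl_cl: "X \<in> cyl I ==> (%w. cl c (X w)) \<in> cyl I"
  by (rule cyl_comp, assumption, rule blipI_lip[of _ 1]) (simp add: dist_real_def cl_lip)

lemma E_weighted_sq:
  assumes "(N, \<tau>, \<xi>) \<in> SP" "0 <= s" "s <= t" "t <= T"
  shows "E (%w. \<Sum>i<N. (clip s t (\<tau> (Suc i)) - clip s t (\<tau> i)) * (norm (\<xi> i w))^2) <= (LINT r:{s..t}|lebesgue. (nE E 2 (process_at (N, \<tau>, \<xi>) r))^2)"
proof -
  have g: "grid T N \<tau>" using assms(1) by (simp add: sp_iff)
  have wt: "0 <= clip s t (\<tau> (Suc i)) - clip s t (\<tau> i)" if "i < N" for i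
    using clip_mono[of "\<tau> i" "\<tau> (Suc i)" s t] g that by (simp add: grid_def less_imp_le)
  have x: "\<xi> i \<in> LA" if "i < N" for i using mgE_summands(4)[OF assms(1) p12_1 that] .
  have "E (%w. \<Sum>i<N. (clip s t (\<tau> (Suc i)) - clip s t (\<tau> i)) * (norm (\<xi> i w))^2) <= (\<Sum>i<N. E (%w. (clip s t (\<tau> (Suc i)) - clip s t (\<tau> i)) * (norm (\<xi> i w))^2))"
    using x by (intro E_sum cyl_mult cyl_const cyl_power2 cyl_norm) auto
  also have "... = (\<Sum>i<N. (clip s t (\<tau> (Suc i)) - clip s t (\<tau> i)) * (nE E 2 (\<xi> i))^2)"
    using x wt by (intro sum.cong refl) (subst E_scale, auto simp: nE_2_sq intro!: cyl_power2 cyl_norm)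
  also have "... = (LINT r:{s..t}|lebesgue. (nE E 2 (process_at (N, \<tau>, \<xi>) r))^2)"
    using sp_integral(2)[OF assms(1), of "%X. (nE E 2 X)^2" s t] assms(3) by (simp add: nE_const[OF p12_2])
  finally show ?thesis .
qed

text \<open>Increments of the integrator are cut at \<open>C\<close> times the length of their
  interval. This changes the sums by an \<open>L_G^1\<close>-null sequence, but the cut sums are
  bounded uniformly in \<open>k\<close>, hence Cauchy in \<open>L_G^2\<close> too, and obey a second
  moment estimate by Cauchy-Schwarz in time. In the constant, \<open>C\<close> serves the first
  moments and \<open>C\<^sup>2 * T\<close> the second.\<close>

lemma lip_good:
  assumes "lip_integrator A C"
  shows "\<exists>J :: ('d, 'v::real_normed_vector) simple_process => real => (nat => 'd path => 'v) set. good_integrator 1 A J (C + C\<^sup>2 * T)"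
proof -
  obtain a where C: "0 <= C" and a: "reps 1 A a"
    and lim: "!!s t. 0 <= s ==> s <= t ==> t <= T ==> (%k. E (%w. max 0 (\<bar>a t k w - a s k w\<bar> - C * (t - s)))) ----> 0"
    using assms unfolding lip_integrator_def by blast
  have aCS: "a r \<in> CS 1" if "r \<in> {0..T}" for r using LG_D(1)[OF p12_1 repsD(1,2)[OF a that]] .
  define W where "W s t \<eta> k w = (case \<eta> of (N, \<tau>, \<xi>) => \<Sum>i<N. cl (C * (clip s t (\<tau> (Suc i)) - clip s t (\<tau> i)))
    (a (clip s t (\<tau> (Suc i))) k w - a (clip s t (\<tau> i)) k w) *\<^sub>R \<xi> i w)" for s t and \<eta> :: "('d, 'v) simple_process" and k w
  have main: "W s t \<eta> k \<in> cyl {0..t} \<and> W s t \<eta> \<in> CS 2 \<and> (%k. nE E 1 (%w. isum a s t \<eta> k w - W s t \<eta> k w)) ----> 0 \<and>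
      (nE E 2 (W s t \<eta> k))^2 <= C\<^sup>2 * T * (LINT r:{s..t}|lebesgue. (nE E 2 (process_at \<eta> r))^2) \<and> nE E 1 (W s t \<eta> k) <= C * mgE 1 \<eta>"
    if \<eta>: "\<eta> \<in> SP" and st: "0 <= s" "s <= t" "t <= T" for \<eta> s t k
  proof -
    obtain N \<tau> \<xi> where d: "\<eta> = (N, \<tau>, \<xi>)" using prod_cases3 by blast
    have g: "grid T N \<tau>" using \<eta> by (simp add: d sp_iff)
    let ?c = "%i. clip s t (\<tau> i)"
    let ?wt = "%i. ?c (Suc i) - ?c i"
    let ?D = "%i k w. a (?c (Suc i)) k w - a (?c i) k w"
    have wt: "0 <= ?wt i" "?wt i <= \<tau> (Suc i) - \<tau> i" "?c i <= ?c (Suc i)" if "i < N" for i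
      using clip_mono[of "\<tau> i" "\<tau> (Suc i)" s t] clip_diff_le[of "\<tau> i" "\<tau> (Suc i)" s t] g that st by (auto simp: grid_def less_imp_le)
    have x: "\<xi> i \<in> LA" "\<xi> i \<in> cyl {0..T}" if "i < N" for i using mgE_summands(3,4)[OF \<eta>[unfolded d] p12_1 that] by auto
    have DT: "?D i k \<in> cyl {0..T}" if "i < N" for i k
      by (intro cyl_diff Lip_cyl[OF clip_T[OF st] repsD(3)[OF a clip_T[OF st]]])
    have Weq: "W s t \<eta> k w = (\<Sum>i<N. cl (C * ?wt i) (?D i k w) *\<^sub>R \<xi> i w)" for k w by (simp add: W_def d)
    have Ieq: "isum a s t \<eta> k w = (\<Sum>i<N. ?D i k w *\<^sub>R \<xi> i w)" for k w by (simp add: isum_def d)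
    have "\<tau> N = T" using g by (simp add: grid_def)
    then have cN: "?c N = t" using st by (auto simp: clip_def)
    have ad: "W s t \<eta> k \<in> cyl {0..t}" for k
    proof -
      have "(%w. \<Sum>i<N. cl (C * ?wt i) (?D i k w) *\<^sub>R \<xi> i w) \<in> cyl {0..?c N}"
      proof (rule sum_adapted[OF \<eta>[unfolded d] st(1,2) order_refl])
        fix i assume i: "i < N" "?c i < ?c (Suc i)"
        then show "(%w. cl (C * ?wt i) (?D i k w)) \<in> cyl {0..?c (Suc i)}"
          by (intro cyl_cl cyl_diff repsD(3)[OF a clip_T[OF st]] cyl_mono[OF _ repsD(3)[OF a clip_T[OF st]], of _ "{0..?c (Suc i)}"]) auto
      qed (simp add: cl_def)
      then show ?thesis unfolding cN Weq[symmetric] .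
    qed
    have WT: "W s t \<eta> k \<in> cyl {0..T}" for k using ad[of k] st by (intro Lip_cyl[of t]) auto
    have WLA: "W s t \<eta> k \<in> LA" for k using cyl_LA[OF WT] .
    have x_bd: "\<exists>K\<ge>0. \<forall>w. norm (\<xi> i w) <= K" if "i < N" for i using x(1)[OF that] by (rule cylE) blast
    obtain K where K: "!!i. i < N ==> 0 <= K i" "!!i w. i < N ==> norm (\<xi> i w) <= K i" using x_bd by metis
    let ?m = "%i k w. max 0 (\<bar>?D i k w\<bar> - C * ?wt i)"
    have mL: "?m i k \<in> LA" if "i < N" for i k
      by (rule cyl_max[OF cyl_const cyl_diff[OF cyl_abs[OF cyl_LA[OF DT[OF that]]] cyl_const]])
    \<comment> \<open>The cut removes exactly the excess of the increment over its bound
      (\<open>cl_resid\<close>), whose expectation vanishes by assumption; \<open>K i\<close> bounds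
      the value multiplied with it.\<close>
    have null: "(%k. nE E 1 (%w. isum a s t \<eta> k w - W s t \<eta> k w)) ----> 0"
    proof (rule null_le[OF _ _ nE_nonneg])
      show "nE E 1 (%w. isum a s t \<eta> k w - W s t \<eta> k w) <= (\<Sum>i<N. K i * E (?m i k))" for k
      proof -
        have L: "(%w. (?D i k w - cl (C * ?wt i) (?D i k w)) *\<^sub>R \<xi> i w) \<in> LA" if "i < N" for i
          using that x DT[OF that] by (intro cyl_scaleR cyl_diff cyl_cl cyl_LA[OF DT[OF that]])
        have "nE E 1 (%w. isum a s t \<eta> k w - W s t \<eta> k w) = nE E 1 (%w. \<Sum>i<N. (?D i k w - cl (C * ?wt i) (?D i k w)) *\<^sub>R \<xi> i w)"
          unfolding Weq Ieq by (simp only: sum_subtractf[symmetric] scaleR_diff_left[symmetric])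
        also have "... <= (\<Sum>i<N. nE E 1 (%w. (?D i k w - cl (C * ?wt i) (?D i k w)) *\<^sub>R \<xi> i w))"
          using L by (intro nE_sum) auto
        also have "... <= (\<Sum>i<N. K i * nE E 1 (?m i k))"
        proof (intro sum_mono nE_mono L mL K p12_simps)
          fix i w assume "i \<in> {..<N}"
          then have i: "i < N" by simp
          have "\<bar>?D i k w - cl (C * ?wt i) (?D i k w)\<bar> = ?m i k w" using C wt(1)[OF i] by (intro cl_resid) simp
          then show "norm ((?D i k w - cl (C * ?wt i) (?D i k w)) *\<^sub>R \<xi> i w) <= K i * norm (?m i k w)"
            using mult_left_mono[OF K(2)[OF i, of w], of "?m i k w"] by (simp add: mult.commute)
        qed auto
        also have "... = (\<Sum>i<N. K i * E (?m i k))"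
        proof (intro sum.cong refl)
          fix i assume "i \<in> {..<N}"
          moreover have "norm (?m i k w) = ?m i k w" for w by simp
          ultimately show "K i * nE E 1 (?m i k) = K i * E (?m i k)" using mL[of i k] by (simp add: nE_1_LA)
        qed
        finally show ?thesis .
      qed
      have "(%k. \<Sum>i<N. K i * E (?m i k)) ----> (\<Sum>i<N. K i * 0)"
        using wt clip_T[OF st] by (intro tendsto_sum tendsto_mult_left lim) auto
      then show "(%k. \<Sum>i<N. K i * E (?m i k)) ----> 0" by simp
    qed
    have pw: "norm (W s t \<eta> k w) <= C * (\<Sum>i<N. ?wt i * norm (\<xi> i w))" for k w
    proof -
      have "norm (W s t \<eta> k w) <= (\<Sum>i<N. norm (cl (C * ?wt i) (?D i k w) *\<^sub>R \<xi> i w))" unfolding Weq by (rule norm_sum)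
      also have "... <= (\<Sum>i<N. (C * ?wt i) * norm (\<xi> i w))"
        unfolding norm_scaleR using C wt(1) by (intro sum_mono mult_right_mono cl_bound) auto
      finally show ?thesis by (simp add: sum_distrib_left mult.assoc)
    qed
    have WCS: "W s t \<eta> \<in> CS 2"
    proof (rule CS_1_bounded)
      show "W s t \<eta> \<in> CS 1" by (rule CS_cong[OF p12_1 isum_CS[OF p12_1 aCS \<eta> st] WT null])
      show "norm (W s t \<eta> k w) <= C * (\<Sum>i<N. ?wt i * K i)" for k w
        by (rule order_trans[OF pw]) (use C wt K in \<open>auto intro!: mult_left_mono sum_mono\<close>)
    qed
    have sq: "(nE E 2 (W s t \<eta> k))^2 <= C\<^sup>2 * T * (LINT r:{s..t}|lebesgue. (nE E 2 (process_at \<eta> r))^2)" for k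
    proof -
      have QL: "(%w. \<Sum>i<N. ?wt i * (norm (\<xi> i w))^2) \<in> LA" using x by (intro cyl_sum cyl_mult cyl_const cyl_power2 cyl_norm) auto
      have "(nE E 2 (W s t \<eta> k))^2 = E (%w. (norm (W s t \<eta> k w))^2)" by (rule nE_2_sq[OF WLA])
      also have "... <= E (%w. (C\<^sup>2 * T) * (\<Sum>i<N. ?wt i * (norm (\<xi> i w))^2))"
      proof (intro E_mono cyl_power2 cyl_norm WLA cyl_mult[OF cyl_const QL])
        fix w
        have "(norm (W s t \<eta> k w))^2 <= (C * (\<Sum>i<N. ?wt i * norm (\<xi> i w)))^2" by (intro power_mono pw) auto
        also have "... = C\<^sup>2 * (\<Sum>i<N. ?wt i * norm (\<xi> i w))^2" by (simp add: power_mult_distrib)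
        also have "... <= C\<^sup>2 * ((\<Sum>i<N. ?wt i) * (\<Sum>i<N. ?wt i * (norm (\<xi> i w))^2))"
          using wt by (intro mult_left_mono weighted_Cauchy_Schwarz) auto
        also have "(\<Sum>i<N. ?wt i) = t - s" by (rule sum_clip[OF g st])
        also have "C\<^sup>2 * ((t - s) * (\<Sum>i<N. ?wt i * (norm (\<xi> i w))^2)) <= C\<^sup>2 * (T * (\<Sum>i<N. ?wt i * (norm (\<xi> i w))^2))"
          using st wt by (intro mult_left_mono mult_right_mono sum_nonneg mult_nonneg_nonneg) auto
        finally show "(norm (W s t \<eta> k w))^2 <= (C\<^sup>2 * T) * (\<Sum>i<N. ?wt i * (norm (\<xi> i w))^2)" by (simp add: mult.assoc)
      qed
      also have "... = (C\<^sup>2 * T) * E (%w. \<Sum>i<N. ?wt i * (norm (\<xi> i w))^2)" using T0 by (intro E_scale QL) auto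
      also have "... <= C\<^sup>2 * T * (LINT r:{s..t}|lebesgue. (nE E 2 (process_at \<eta> r))^2)"
        using E_weighted_sq[OF \<eta>[unfolded d] st] T0 by (intro mult_left_mono) (auto simp: d)
      finally show ?thesis .
    qed
    have one: "nE E 1 (W s t \<eta> k) <= C * mgE 1 \<eta>" for k
    proof -
      have QL: "(%w. \<Sum>i<N. (\<tau> (Suc i) - \<tau> i) * norm (\<xi> i w)) \<in> LA" using x by (intro cyl_sum cyl_mult cyl_const cyl_norm) auto
      have "nE E 1 (W s t \<eta> k) <= E (%w. C * (\<Sum>i<N. (\<tau> (Suc i) - \<tau> i) * norm (\<xi> i w)))"
        unfolding nE_1_LA[OF WLA]
      proof (intro E_mono cyl_norm WLA cyl_mult[OF cyl_const QL])
        fix w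
        show "norm (W s t \<eta> k w) <= C * (\<Sum>i<N. (\<tau> (Suc i) - \<tau> i) * norm (\<xi> i w))"
          by (rule order_trans[OF pw]) (use C wt in \<open>auto intro!: mult_left_mono sum_mono mult_right_mono\<close>)
      qed
      also have "... = C * mgE 1 \<eta>" unfolding mgE_def d using QL C by (simp add: E_scale)
      finally show ?thesis .
    qed
    show ?thesis using ad null WCS sq one by blast
  qed
  have mg0: "0 <= mgE 1 \<eta>" if "\<eta> \<in> SP" for \<eta> :: "('d, 'v) simple_process" using mgE_nonneg[OF that] by simp
  have int0: "0 <= (LINT r:{s..t}|lebesgue. (nE E 2 (process_at \<eta> r))^2)" for s t and \<eta> :: "('d, 'v) simple_process"
    unfolding set_lebesgue_integral_def by (intro Bochner_Integration.integral_nonneg) auto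
  have "good_integrator 1 A (%\<eta> t. cls 2 (W 0 t \<eta>)) (C + C\<^sup>2 * T)"
  proof (rule good_integratorI[OF p12_1 a])
    show "0 <= C + C\<^sup>2 * T" using C T0 by simp
    fix \<eta> :: "('d, 'v) simple_process" and s t assume \<eta>: "\<eta> \<in> SP" and st: "0 <= s" "s <= t" "t <= T"
    show "W s t \<eta> \<in> CS 2" "(%k. nE E 1 (%w. isum a s t \<eta> k w - W s t \<eta> k w)) ----> 0" using main[OF \<eta> st] by auto
    have "(nE E 2 (W s t \<eta> k))^2 <= 0 + (C + C\<^sup>2 * T) * (LINT r:{s..t}|lebesgue. (nE E 2 (process_at \<eta> r))^2)" for k
      using main[OF \<eta> st, of k] mult_nonneg_nonneg[OF C int0[of s t \<eta>]] by (simp add: algebra_simps)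
    then show "\<exists>d. d ----> 0 \<and> (\<forall>k. (nE E 2 (W s t \<eta> k))^2 <= d k + (C + C\<^sup>2 * T) * (LINT r:{s..t}|lebesgue. (nE E 2 (process_at \<eta> r))^2))"
      by (intro exI[of _ "%_. 0"]) auto
  next
    fix \<eta> :: "('d, 'v) simple_process" and t assume \<eta>: "\<eta> \<in> SP" and t: "0 <= t" "t <= T"
    show "W 0 t \<eta> k \<in> cyl {0..t}" for k using main[OF \<eta> order_refl t] by blast
    let ?d = "%k. nE E 1 (%w. isum a 0 t \<eta> k w - W 0 t \<eta> k w)"
    have "nE E 1 (isum a 0 t \<eta> k) powr 1 <= ?d k + (C + C\<^sup>2 * T) * mgE 1 \<eta>" for k
    proof -
      have WC: "W 0 t \<eta> \<in> CS 2" using main[OF \<eta> order_refl t] by blast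
      have L: "isum a 0 t \<eta> k \<in> LA" "W 0 t \<eta> k \<in> LA"
        by (rule CS_LA[OF isum_CS[OF p12_1 aCS \<eta> order_refl t]], assumption) (rule CS_LA[OF WC])
      have "nE E 1 (isum a 0 t \<eta> k) <= ?d k + nE E 1 (W 0 t \<eta> k)"
        using nE_triangle[OF p12_1 cyl_diff[OF L] L(2)] by simp
      also have "... <= ?d k + C * mgE 1 \<eta>" using main[OF \<eta> order_refl t, of k] by simp
      also have "... <= ?d k + (C + C\<^sup>2 * T) * mgE 1 \<eta>" using mg0[OF \<eta>] T0 by (simp add: mult_right_mono)
      finally show ?thesis by (simp add: nE_nonneg)
    qed
    then show "\<exists>d. d ----> 0 \<and> (\<forall>k. nE E 1 (isum a 0 t \<eta> k) powr 1 <= d k + (C + C\<^sup>2 * T) * mgE 1 \<eta>)"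
      using main[OF \<eta> order_refl t] by blast
  qed
  then show ?thesis by blast
qed
end

section \<open>The stochastic integral of simple processes\<close>

context brownian
begin

text \<open>Along the partition, the compensated square \<open>|S|^2 - \<kappa> Q\<close> keeps its
  expectation below a null sequence: cross terms vanish by \<open>incr_mult_null\<close>, and
  squared increments are beaten by their compensators. The compensator stays inside \<open>E\<close>
  because the bound must be the expectation of a sum, as in the norm of \<open>M_G^2\<close>; a sum
  of expectations would control integrals only in the norm of \<open>MG_bar\<close>.\<close>

lemma ito:
  fixes \<xi> :: "nat => 'd path => 'v::real_inner" and a :: "real^'d"
  assumes \<eta>: "(N, \<tau>, \<xi>) \<in> SP" and st: "0 <= s" "s <= t" "t <= T"
  defines "\<kappa> \<equiv> (norm a + 1)^2 * \<mu>"
  shows "\<exists>\<delta>. \<delta> ----> 0 \<and> (\<forall>k. (nE E 2 (isum (bt a) s t (N, \<tau>, \<xi>) k))^2 <= \<delta> k +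
     \<kappa> * E (%w. \<Sum>i<N. (clip s t (\<tau> (Suc i)) - clip s t (\<tau> i)) * (norm (\<xi> i w))^2))"
proof -
  have g: "grid T N \<tau>" using \<eta> by (simp add: sp_iff)
  let ?c = "%i. clip s t (\<tau> i)"
  let ?D = "%i k w. bt a (?c (Suc i)) k w - bt a (?c i) k w"
  define S where "S j k w = (\<Sum>i<j. ?D i k w *\<^sub>R \<xi> i w)" for j k w
  define Q where "Q j w = (\<Sum>i<j. (?c (Suc i) - ?c i) * (norm (\<xi> i w))^2)" for j w
  have \<kappa>0: "0 <= \<kappa>" using \<mu>(1) by (simp add: \<kappa>_def)
  have cT: "?c i \<in> {0..T}" for i by (rule clip_T[OF st])
  have c0: "0 <= ?c i" for i using cT[of i] by simp
  have cm: "?c i <= ?c (Suc i)" if "i < N" for i using g that by (intro clip_mono) (simp add: grid_def less_imp_le)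
  have x: "\<xi> i \<in> LA" if "i < N" for i using mgE_summands(4)[OF \<eta> p12_1 that] .
  have Sc: "S j k \<in> cyl {0..?c j}" if "j <= N" for j k
    unfolding S_def[abs_def] by (rule isum_partial_adapted[OF _ \<eta> st that]) (auto intro: bt_cyl)
  have SLA: "S j k \<in> LA" if "j <= N" for j k using cyl_LA[OF Sc[OF that]] .
  have QLA: "Q j \<in> LA" if "j <= N" for j unfolding Q_def[abs_def] using x that by (intro cyl_sum cyl_mult cyl_const cyl_power2 cyl_norm) auto
  have DLA: "?D i k \<in> LA" for i k using c0 by (intro cyl_diff bt_LA)
  have x_bd: "\<exists>K\<ge>0. \<forall>w. norm (\<xi> i w) <= K" if "i < N" for i using x[OF that] by (rule cylE) blast
  obtain K where K: "!!i. i < N ==> 0 <= K i" "!!i w. i < N ==> norm (\<xi> i w) <= K i" using x_bd by metis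
  \<comment> \<open>A second moment bound that is uniform in the truncation level \<open>k\<close>,
    as \<open>incr_mult_null\<close> requires; its size does not matter.\<close>
  have Sb: "\<exists>M. \<forall>k. nE E 2 (S j k) <= M" if "j <= N" for j
    using that
  proof (induction j)
    case 0 then show ?case unfolding S_def[abs_def] using nE_const[OF p12_2] by auto
  next
    case (Suc j)
    then obtain M where M: "!!k. nE E 2 (S j k) <= M" by auto
    have j: "j < N" using Suc.prems by simp
    have "nE E 2 (S (Suc j) k) <= M + K j * sqrt (\<kappa> * (?c (Suc j) - ?c j))" for k
    proof -
      have L: "(%w. ?D j k w *\<^sub>R \<xi> j w) \<in> LA" by (intro cyl_scaleR DLA x[OF j])
      have "nE E 2 (S (Suc j) k) = nE E 2 (%w. S j k w + ?D j k w *\<^sub>R \<xi> j w)" by (simp add: S_def[abs_def])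
      also have "... <= nE E 2 (S j k) + nE E 2 (%w. ?D j k w *\<^sub>R \<xi> j w)" using j by (intro nE_triangle L SLA) auto
      also have "nE E 2 (%w. ?D j k w *\<^sub>R \<xi> j w) <= K j * nE E 2 (?D j k)"
        using K(1)[OF j] K(2)[OF j] by (intro nE_mono L DLA) (auto simp: mult.commute[of "K j"] mult_left_mono)
      also have "nE E 2 (?D j k) <= sqrt (\<kappa> * (?c (Suc j) - ?c j))"
        unfolding \<kappa>_def by (rule real_le_rsqrt[OF bt_inc_sq[OF c0 cm[OF j]]])
      finally show ?thesis using M[of k] K(1)[OF j] by (simp add: mult_left_mono)
    qed
    then show ?case by blast
  qed
  have claim: "\<exists>\<delta>. \<delta> ----> 0 \<and> (\<forall>k. E (%w. (norm (S j k w))^2 - \<kappa> * Q j w) <= \<delta> k)" if "j <= N" for j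
    using that
  proof (induction j)
    case 0 then show ?case unfolding S_def Q_def by (intro exI[of _ "%_. 0"]) (simp add: E_const)
  next
    case (Suc j)
    then have j: "j < N" "j <= N" by auto
    obtain \<delta> where \<delta>: "\<delta> ----> 0" "!!k. E (%w. (norm (S j k w))^2 - \<kappa> * Q j w) <= \<delta> k" using Suc.IH[OF j(2)] by blast
    show ?case
    \<comment> \<open>On a collapsed interval nothing is added, and \<open>\<xi> j\<close> may
      depend on later times than the projected one, so independence could not be invoked.\<close>
    proof (cases "?c j = ?c (Suc j)")
      case True
      then have "S (Suc j) = S j" "Q (Suc j) = Q j" by (auto simp: S_def Q_def fun_eq_iff)
      then show ?thesis using \<delta> by auto
    next
      case False
      have lt: "\<tau> j < \<tau> (Suc j)" using g j by (simp add: grid_def)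
      note ca = clip_adapted[OF st(2) lt False]
      have xc: "\<xi> j \<in> cyl {0..?c j}" using ca by (intro cyl_mono[OF _ sp_xi_cyl[OF \<eta> j(1)]]) auto
      obtain M where M: "!!k. nE E 2 (S j k) <= M" using Sb[OF j(2)] by blast
      let ?z = "%k w. S j k w \<bullet> \<xi> j w"
      have zc: "?z k \<in> cyl {0..?c j}" for k by (intro cyl_inner Sc[OF j(2)] xc)
      have "nE E 2 (?z k) <= K j * M" for k
      proof -
        have "norm (?z k w) <= K j * norm (S j k w)" for w
          using Cauchy_Schwarz_ineq2[of "S j k w" "\<xi> j w"] mult_left_mono[OF K(2)[OF j(1), of w] norm_ge_zero[of "S j k w"]] by (simp add: mult.commute)
        then have "nE E 2 (?z k) <= K j * nE E 2 (S j k)" using K(1)[OF j(1)] by (intro nE_mono cyl_LA[OF zc] SLA[OF j(2)]) auto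
        also have "... <= K j * M" using M K(1)[OF j(1)] by (intro mult_left_mono)
        finally show ?thesis .
      qed
      from incr_mult_null[where a=a and \<zeta>="?z", OF c0 cm[OF j(1)] zc this]
      obtain \<delta>' where \<delta>': "\<delta>' ----> 0" "!!k. E (%w. ?z k w * ?D j k w) <= \<delta>' k" by blast
      let ?dc = "?c (Suc j) - ?c j"
      have third: "E (%w. (?D j k w)^2 * (norm (\<xi> j w))^2 - \<kappa> * (?dc * (norm (\<xi> j w))^2)) <= 0" for k
      proof -
        \<comment> \<open>A bound for the squared increment minus its compensator. By the choice of
          \<open>\<kappa>\<close> its mean is at most \<open>0\<close>, and
          \<open>indep_mult_le\<close> multiplies it by the squared norm of
          \<open>\<xi> j\<close>.\<close>
        let ?\<psi> = "%y. (norm a + 1)^2 * (exc 0 (2 * real k) y)^2 + (- \<kappa> * ?dc)"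
        have bounded_lip\<psi>: "bounded_lip (%y :: real^'d. ?\<psi> y)" by (intro bl_add bl_scale bl_square exc_bl bl_const) auto
        have n2: "(%w. (norm (\<xi> j w))^2) \<in> cyl {0..?c j}" by (intro cyl_power2 cyl_norm xc)
        have eL: "(%w. (exc 0 (2 * real k) (B (?c (Suc j)) w - B (?c j) w :: real^'d))^2) \<in> LA" using c0 by (intro cyl_power2 exc_incr_LA) auto
        have "E (%w. ?\<psi> (B (?c (Suc j)) w - B (?c j) w)) = (norm a + 1)^2 * E (%w. (exc 0 (2 * real k) (B (?c (Suc j)) w - B (?c j) w))^2) - \<kappa> * ?dc"
          using eL by (subst E_add_const) (auto intro!: cyl_mult cyl_const simp: E_scale)
        also have "... <= (norm a + 1)^2 * (\<mu> * ?dc) - \<kappa> * ?dc"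
          by (intro diff_right_mono mult_left_mono \<mu>(2) c0 cm[OF j(1)]) auto
        also have "... = 0" by (simp add: \<kappa>_def)
        finally have "E (%w. ?\<psi> (B (?c (Suc j)) w - B (?c j) w)) <= 0" .
        from indep_mult_le[OF n2 _ c0 cm[OF j(1)] bounded_lip\<psi> this]
        have "E (%w. (norm (\<xi> j w))^2 * ?\<psi> (B (?c (Suc j)) w - B (?c j) w)) <= 0" by (simp add: E_const)
        moreover have "E (%w. (?D j k w)^2 * (norm (\<xi> j w))^2 - \<kappa> * (?dc * (norm (\<xi> j w))^2)) <= E (%w. (norm (\<xi> j w))^2 * ?\<psi> (B (?c (Suc j)) w - B (?c j) w))"
        proof (rule E_mono)
          show "(%w. (?D j k w)^2 * (norm (\<xi> j w))^2 - \<kappa> * (?dc * (norm (\<xi> j w))^2)) \<in> LA"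
            by (intro cyl_diff cyl_mult cyl_const cyl_power2 DLA cyl_norm x j)
          show "(%w. (norm (\<xi> j w))^2 * ?\<psi> (B (?c (Suc j)) w - B (?c j) w)) \<in> LA"
            by (intro cyl_add cyl_mult cyl_const cyl_power2 cyl_norm x j exc_incr_LA c0) auto
          fix w
          have "\<bar>?D j k w\<bar>\<^sup>2 <= ((norm a + 1) * exc 0 (2 * real k) (B (?c (Suc j)) w - B (?c j) w))^2"
            by (intro power_mono bt_diff_le) auto
          then have "(?D j k w)^2 <= (norm a + 1)^2 * (exc 0 (2 * real k) (B (?c (Suc j)) w - B (?c j) w))^2" by (simp add: power_mult_distrib)
          then have "(norm (\<xi> j w))^2 * (?D j k w)^2 <= (norm (\<xi> j w))^2 * ((norm a + 1)^2 * (exc 0 (2 * real k) (B (?c (Suc j)) w - B (?c j) w))^2)"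
            by (rule mult_left_mono) simp
          then show "(?D j k w)^2 * (norm (\<xi> j w))^2 - \<kappa> * (?dc * (norm (\<xi> j w))^2) <= (norm (\<xi> j w))^2 * ?\<psi> (B (?c (Suc j)) w - B (?c j) w)"
            by (simp add: algebra_simps)
        qed
        ultimately show ?thesis by linarith
      qed
      have "E (%w. (norm (S (Suc j) k w))^2 - \<kappa> * Q (Suc j) w) <= \<delta> k + 2 * \<delta>' k" for k
      proof -
        let ?A = "%w. (norm (S j k w))^2 - \<kappa> * Q j w" and ?B = "%w. 2 * (?z k w * ?D j k w)"
        let ?C = "%w. (?D j k w)^2 * (norm (\<xi> j w))^2 - \<kappa> * (?dc * (norm (\<xi> j w))^2)"
        have L: "?A \<in> LA" "?B \<in> LA" "?C \<in> LA" "(%w. ?z k w * ?D j k w) \<in> LA"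
          by (intro cyl_diff cyl_mult cyl_const cyl_power2 cyl_norm cyl_inner SLA QLA DLA x j)+
        have "(norm (S (Suc j) k w))^2 - \<kappa> * Q (Suc j) w = ?A w + (?B w + ?C w)" for w
        proof -
          have "(norm (S (Suc j) k w))^2 = (norm (S j k w))^2 + 2 * (?z k w * ?D j k w) + (?D j k w)^2 * (norm (\<xi> j w))^2"
          proof -
            have "(norm (u + c *\<^sub>R v))^2 = (norm u)^2 + 2 * ((u \<bullet> v) * c) + c\<^sup>2 * (norm v)^2" for u v :: 'v and c
              unfolding power2_norm_eq_inner by (simp add: inner_add_left inner_add_right inner_commute power2_eq_square algebra_simps)
            moreover have "S (Suc j) k w = S j k w + ?D j k w *\<^sub>R \<xi> j w" by (simp add: S_def)
            ultimately show ?thesis by simp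
          qed
          then show ?thesis by (simp add: Q_def algebra_simps)
        qed
        then have "E (%w. (norm (S (Suc j) k w))^2 - \<kappa> * Q (Suc j) w) = E (%w. ?A w + (?B w + ?C w))" by simp
        also have "... <= E ?A + E (%w. ?B w + ?C w)" by (intro E_add L cyl_add)
        also have "E (%w. ?B w + ?C w) <= E ?B + E ?C" by (intro E_add L)
        also have "E ?B = 2 * E (%w. ?z k w * ?D j k w)" by (intro E_scale L) auto
        finally show ?thesis using \<delta>(2)[of k] \<delta>'(2)[of k] third[of k] by linarith
      qed
      moreover have "(%k. \<delta> k + 2 * \<delta>' k) ----> 0" by (intro tendsto_add_zero tendsto_mult_right_zero \<delta> \<delta>')
      ultimately show ?thesis by blast
    qed
  qed
  obtain \<delta> where \<delta>: "\<delta> ----> 0" "!!k. E (%w. (norm (S N k w))^2 - \<kappa> * Q N w) <= \<delta> k" using claim[OF order_refl] by blast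
  have IS: "isum (bt a) s t (N, \<tau>, \<xi>) = S N" by (simp add: isum_eq S_def[abs_def])
  have "(nE E 2 (S N k))^2 <= \<delta> k + \<kappa> * E (Q N)" for k
  proof -
    have L: "(%w. (norm (S N k w))^2 - \<kappa> * Q N w) \<in> LA" "(%w. \<kappa> * Q N w) \<in> LA"
      by (intro cyl_diff cyl_mult cyl_const cyl_power2 cyl_norm SLA QLA order_refl)+
    have "(nE E 2 (S N k))^2 = E (%w. ((norm (S N k w))^2 - \<kappa> * Q N w) + \<kappa> * Q N w)" by (simp add: nE_2_sq[OF SLA[OF order_refl]])
    also have "... <= E (%w. (norm (S N k w))^2 - \<kappa> * Q N w) + E (%w. \<kappa> * Q N w)" by (intro E_add L)
    also have "E (%w. \<kappa> * Q N w) = \<kappa> * E (Q N)" by (intro E_scale QLA \<kappa>0 order_refl)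
    finally show ?thesis using \<delta>(2)[of k] by linarith
  qed
  then show ?thesis unfolding IS using \<delta>(1) by (auto simp: Q_def[abs_def])
qed

lemma B_dir_reps: "reps 2 (B_dir E T a) (bt a)"
  unfolding reps_def B_dir_def using cls_in[OF p12_2 bt_CS] bt_cyl by (auto simp: bt_def[abs_def])

lemma bt_good: "good_integrator 2 (B_dir E T a)
    (%(\<eta> :: ('d, 'v::real_inner) simple_process) t. cls 2 (isum (bt a) 0 t \<eta>)) ((norm a + 1)^2 * \<mu>)"
proof (rule good_integratorI[OF p12_2 B_dir_reps])
  let ?\<kappa> = "(norm a + 1)^2 * \<mu>"
  show \<kappa>: "0 <= ?\<kappa>" using \<mu>(1) by simp
  fix \<eta> :: "('d, 'v) simple_process" and s t assume \<eta>: "\<eta> \<in> SP" and st: "0 <= s" "s <= t" "t <= T"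
  obtain N \<tau> \<xi> where d: "\<eta> = (N, \<tau>, \<xi>)" using prod_cases3 by blast
  show "isum (bt a) s t \<eta> \<in> CS 2" by (rule isum_CS[OF p12_2 bt_CS \<eta> st])
  show "(%k. nE E 1 (%w. isum (bt a) s t \<eta> k w - isum (bt a) s t \<eta> k w)) ----> 0" by (simp add: nE_const[OF p12_1])
  obtain \<delta> where \<delta>: "\<delta> ----> 0" "!!k. (nE E 2 (isum (bt a) s t \<eta> k))^2 <= \<delta> k + ?\<kappa> * E (%w. \<Sum>i<N. (clip s t (\<tau> (Suc i)) - clip s t (\<tau> i)) * (norm (\<xi> i w))^2)"
    using ito[OF \<eta>[unfolded d] st, of a] by (auto simp: d)
  have "(nE E 2 (isum (bt a) s t \<eta> k))^2 <= \<delta> k + ?\<kappa> * (LINT r:{s..t}|lebesgue. (nE E 2 (process_at \<eta> r))^2)" for k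
    using \<delta>(2)[of k] mult_left_mono[OF E_weighted_sq[OF \<eta>[unfolded d] st] \<kappa>] by (simp add: d)
  then show "\<exists>\<delta>. \<delta> ----> 0 \<and> (\<forall>k. (nE E 2 (isum (bt a) s t \<eta> k))^2 <= \<delta> k + ?\<kappa> * (LINT r:{s..t}|lebesgue. (nE E 2 (process_at \<eta> r))^2))"
    using \<delta>(1) by blast
next
  let ?\<kappa> = "(norm a + 1)^2 * \<mu>"
  have \<kappa>: "0 <= ?\<kappa>" using \<mu>(1) by simp
  fix \<eta> :: "('d, 'v) simple_process" and t assume \<eta>: "\<eta> \<in> SP" and t: "0 <= t" "t <= T"
  obtain N \<tau> \<xi> where d: "\<eta> = (N, \<tau>, \<xi>)" using prod_cases3 by blast
  have g: "grid T N \<tau>" using \<eta> by (simp add: d sp_iff)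
  have x: "\<xi> i \<in> LA" if "i < N" for i using mgE_summands(4)[OF \<eta>[unfolded d] p12_1 that] .
  show "isum (bt a) 0 t \<eta> k \<in> cyl {0..t}" for k by (rule isum_adapted[OF _ \<eta> order_refl t]) (auto intro: bt_cyl)
  obtain \<delta> where \<delta>: "\<delta> ----> 0" "!!k. (nE E 2 (isum (bt a) 0 t \<eta> k))^2 <= \<delta> k + ?\<kappa> * E (%w. \<Sum>i<N. (clip 0 t (\<tau> (Suc i)) - clip 0 t (\<tau> i)) * (norm (\<xi> i w))^2)"
    using ito[OF \<eta>[unfolded d] order_refl t, of a] by (auto simp: d)
  have L1: "(%w. \<Sum>i<N. (clip 0 t (\<tau> (Suc i)) - clip 0 t (\<tau> i)) * (norm (\<xi> i w))^2) \<in> LA"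
    using x by (intro cyl_sum cyl_mult cyl_const cyl_power2 cyl_norm) auto
  have L2: "(%w. \<Sum>i<N. (\<tau> (Suc i) - \<tau> i) * norm (\<xi> i w) powr 2) \<in> LA"
    using x by (intro cyl_sum cyl_mult cyl_const cyl_powr) auto
  have "E (%w. \<Sum>i<N. (clip 0 t (\<tau> (Suc i)) - clip 0 t (\<tau> i)) * (norm (\<xi> i w))^2) <= mgE 2 \<eta>"
    unfolding mgE_def d prod.case
  proof (rule E_mono[OF L1 L2])
    fix w
    show "(\<Sum>i<N. (clip 0 t (\<tau> (Suc i)) - clip 0 t (\<tau> i)) * (norm (\<xi> i w))^2) <= (\<Sum>i<N. (\<tau> (Suc i) - \<tau> i) * norm (\<xi> i w) powr 2)"
      using clip_diff_le[of "\<tau> _" "\<tau> (Suc _)" 0 t] g t by (auto intro!: sum_mono mult_right_mono simp: grid_def less_imp_le)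
  qed
  then have "nE E 2 (isum (bt a) 0 t \<eta> k) powr 2 <= \<delta> k + ?\<kappa> * mgE 2 \<eta>" for k
    using \<delta>(2)[of k] mult_left_mono[OF _ \<kappa>] by (fastforce simp: nE_nonneg)
  then show "\<exists>\<delta>. \<delta> ----> 0 \<and> (\<forall>k. nE E 2 (isum (bt a) 0 t \<eta> k) powr 2 <= \<delta> k + ?\<kappa> * mgE 2 \<eta>)" using \<delta>(1) by blast
qed

end

text \<open>\<open>C + 1\<close> dominates both \<open>C\<close> and its square root, so one
  constant serves both exponents.\<close>

lemma powr_le_root:
  assumes "p12 p" "0 <= x" "0 <= y" "0 <= C" "x powr p <= C * y powr p" shows "x <= (C + 1) * y"
proof (cases "p = 1")
  case True then show ?thesis using assms by (simp add: distrib_right)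
next
  case False
  then have "p = 2" using assms(1) by (simp add: p12_def)
  then have "x\<^sup>2 <= C * y\<^sup>2" using assms by simp
  also have "... <= (C + 1)^2 * y\<^sup>2" using assms(4) by (intro mult_right_mono) (auto simp: power2_eq_square algebra_simps)
  finally have "x\<^sup>2 <= ((C + 1) * y)^2" by (simp add: power_mult_distrib)
  then show ?thesis by (rule power2_le_imp_le) (use assms in simp)
qed

section \<open>Extension of the integrals from simple processes\<close>

context sublinear_T
begin

lemma adapted_T: assumes "p12 p" "U \<in> LGs p" shows "adapted T U"
  using LG_ne[OF assms] LG_D(1)[OF assms] CS_cyl unfolding adapted_def by blast

lemma good_D:
  fixes J :: "('d, 'v::real_normed_vector) simple_process => real => (nat => 'd path => 'v) set" and \<eta> \<zeta> :: "('d, 'v) simple_process"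
  assumes "good_integrator p A J C" "t \<in> {0..T}" "\<eta> \<in> SP"
  shows "0 <= C" "J \<eta> t \<in> LGs 2" "adapted t (J \<eta> t)" "integral_simple E T p A t \<eta> \<in> LGs p"
    "inc (J \<eta> t) = inc (integral_simple E T p A t \<eta>)"
    "\<zeta> \<in> SP ==> ld p (integral_simple E T p A t \<eta>) (integral_simple E T p A t \<zeta>) powr p <= C * mg_pdist E T p \<eta> \<zeta> powr p"
    "\<zeta> \<in> SP ==> (ld 2 (J \<eta> t) (J \<zeta> t))^2 <= C * (LINT r:{0..t}|lebesgue. (ld 2 (pem 2 \<eta> r) (pem 2 \<zeta> r))^2)"
    "s \<in> {0..t} ==> (ld 2 (J \<eta> s) (J \<eta> t))^2 <= C * (LINT r:{s..t}|lebesgue. (nE E 2 (process_at \<eta> r))^2)"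
  using assms unfolding good_integrator_def by blast+

lemma good_root:
  fixes J :: "('d, 'v::real_normed_vector) simple_process => real => (nat => 'd path => 'v) set" and \<eta> \<zeta> :: "('d, 'v) simple_process"
  assumes g: "good_integrator p A J C" "p12 p" "t \<in> {0..T}" and \<eta>: "\<eta> \<in> SP" "\<zeta> \<in> SP"
  shows "ld p (integral_simple E T p A t \<eta>) (integral_simple E T p A t \<zeta>) <= (C + 1) * mg_pdist E T p \<eta> \<zeta>"
  by (rule powr_le_root[OF g(2) ld_nonneg[OF g(2) good_D(4)[OF g(1,3) \<eta>(1)] good_D(4)[OF g(1,3) \<eta>(2)]] mg_pdist_nonneg
        good_D(1)[OF g(1,3) \<eta>(1)] good_D(6)[OF g(1,3) \<eta>]])

text \<open>The definite description in \<open>integral_upto\<close> ranges over all sequences in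
  the class. It is evaluated along one approximating sequence; along any other member, the simple
  integrals stay within \<open>C + 1\<close> times a vanishing \<open>M_G^p\<close>
  distance.\<close>

lemma integral_upto_limit:
  fixes J :: "('d, 'v::real_normed_vector) simple_process => real => (nat => 'd path => 'v) set" and X :: "real => (nat => 'd path => 'v) set" and \<eta> :: "nat => ('d, 'v) simple_process"
  assumes g: "good_integrator p A J C" and p: "p12 p" and X: "!!t. t \<in> {0..T} ==> X t \<in> LGs p"
    and a: "mg_bar_approx E T p \<eta> X" and t: "t \<in> {0..T}"
  shows "integral_upto E T p A t (mg_incl E T p X) \<in> LGs p"
    "(%k. ld p (integral_simple E T p A t (\<eta> k)) (integral_upto E T p A t (mg_incl E T p X))) ----> 0"
proof -
  let ?I = "integral_simple E T p A t :: ('d, 'v) simple_process => _"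
  have IL: "?I \<zeta> \<in> LGs p" if "\<zeta> \<in> SP" for \<zeta> using good_D(4)[OF g t that] .
  have C: "0 <= C" using g by (simp add: good_integrator_def)
  note sp = mg_bar_approxD(1)[OF a]
  have cau: "\<exists>M. \<forall>k\<ge>M. \<forall>l\<ge>M. ld p (?I (\<eta> k)) (?I (\<eta> l)) < eps" if "eps > 0" for eps
  proof -
    have "eps / (C + 1) > 0" using that C by simp
    then obtain M where M: "!!k l. k \<ge> M ==> l \<ge> M ==> mg_pdist E T p (\<eta> k) (\<eta> l) < eps / (C + 1)"
      using mg_approx_Cauchy[OF p X a] unfolding cauchy_seqs_def by blast
    have "ld p (?I (\<eta> k)) (?I (\<eta> l)) < eps" if "k \<ge> M" "l \<ge> M" for k l
    proof -
      have "ld p (?I (\<eta> k)) (?I (\<eta> l)) <= (C + 1) * mg_pdist E T p (\<eta> k) (\<eta> l)" by (rule good_root[OF g p t sp sp])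
      also have "... < (C + 1) * (eps / (C + 1))" using M[OF that] C by (intro mult_strict_left_mono) auto
      finally show ?thesis using C by simp
    qed
    then show ?thesis by blast
  qed
  have TT: "T \<in> {0..T}" using T0 by simp
  obtain V where V: "V \<in> LGs p" "(%m. ld p (?I (\<eta> m)) V) ----> 0"
    using LG_complete[OF p IL[OF sp] cau TT adapted_T[OF p IL[OF sp]]] by blast
  have ui: "\<eta> \<in> mg_incl E T p X" by (rule mg_incl_in[OF p _ a]) (rule X)
  have "integral_upto E T p A t (mg_incl E T p X) = V"
    unfolding integral_upto_def
  proof (rule cont_extension_LG[where u=\<eta> and f="?I", OF p V(1) ui IL[OF sp]])
    fix u assume "u \<in> mg_incl E T p X"
    then obtain \<eta>' where \<eta>': "mg_bar_approx E T p \<eta>' X" "!!k. u k \<in> SP" "(%k. mg_pdist E T p (\<eta>' k) (u k)) ----> 0"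
      by (rule mg_inclD) blast
    note sp' = mg_bar_approxD(1)[OF \<eta>'(1)]
    have le: "ld p (?I (u k)) V <= (C + 1) * mg_pdist E T p (\<eta>' k) (u k) + ((C + 1) * mg_pdist E T p (\<eta> k) (\<eta>' k) + ld p (?I (\<eta> k)) V)" for k
    proof -
      have "ld p (?I (u k)) V <= ld p (?I (\<eta>' k)) (?I (u k)) + ld p (?I (\<eta>' k)) V"
        using ld_tri[OF p IL[OF \<eta>'(2)] IL[OF sp'] V(1), of k k] ld_sym[OF p IL[OF \<eta>'(2)] IL[OF sp'], of k k] by simp
      also have "ld p (?I (\<eta>' k)) V <= ld p (?I (\<eta> k)) (?I (\<eta>' k)) + ld p (?I (\<eta> k)) V"
        using ld_tri[OF p IL[OF sp'] IL[OF sp] V(1), of k k] ld_sym[OF p IL[OF sp'] IL[OF sp], of k k] by simp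
      finally show ?thesis using good_root[OF g p t sp' \<eta>'(2), of k k] good_root[OF g p t sp sp', of k k] by linarith
    qed
    have lim: "(%k. (C + 1) * mg_pdist E T p (\<eta>' k) (u k) + ((C + 1) * mg_pdist E T p (\<eta> k) (\<eta>' k) + ld p (?I (\<eta> k)) V)) ----> 0"
      by (intro tendsto_add_zero tendsto_mult_right_zero \<eta>'(3) V(2) mg_pdist_approx_null[OF p X a \<eta>'(1)])
    show "(%k. ld p (?I (u k)) V) ----> 0" by (rule null_le[OF lim le ld_nonneg[OF p IL[OF \<eta>'(2)] V(1)]])
  qed
  then show "integral_upto E T p A t (mg_incl E T p X) \<in> LGs p"
    "(%k. ld p (?I (\<eta> k)) (integral_upto E T p A t (mg_incl E T p X))) ----> 0" using V by auto
qed

lemma SI_subinterval: 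
  fixes f :: "real => real"
  assumes "SI f" "0 <= s" "t <= T" shows "set_integrable lebesgue {s..t} f"
  by (rule set_integrable_subset[OF assms(1)]) (use assms in auto)

lemma LI_subinterval_le:
  fixes f :: "real => real"
  assumes "SI f" "0 <= s" "t <= T" "!!r. r \<in> {0..T} ==> 0 <= f r"
  shows "(LINT r:{s..t}|lebesgue. f r) <= LI f"
  unfolding set_lebesgue_integral_def
  using assms(1) SI_subinterval[OF assms(1-3)] assms(2-4) unfolding set_integrable_def
  by (intro integral_mono) (auto simp: indicator_def)

lemma LI_nonneg: "(!!r. r \<in> {s..t} ==> 0 <= f r) ==> 0 <= (LINT r:{s..t}|lebesgue. f r :: real)"
  unfolding set_lebesgue_integral_def by (intro Bochner_Integration.integral_nonneg) (auto simp: indicator_def)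

definition approx_error :: "('d, 'v::real_normed_vector) simple_process => (real => (nat => 'd path => 'v) set) => real" where
  "approx_error \<eta> X = LI (%t. ld 2 (pem 2 \<eta> t) (X t) powr 2)"

lemma MG_bar_sq_integrable:
  assumes "X \<in> MG_bar E T 2" "Y \<in> MG_bar E T 2"
  shows "SI (%t. (ld 2 (X t) (Y t))^2)"
proof -
  have "SI (%t. ld 2 (X t) (Y t) powr 2)" by (rule MG_bar_ld_integrable[OF p12_2 assms])
  moreover have "ld 2 (X t) (Y t) powr 2 = (ld 2 (X t) (Y t))^2" if "t \<in> {0..T}" for t
    using ld_nonneg[OF p12_2 MG_barD[OF assms(1) that] MG_barD[OF assms(2) that]] by simp
  ultimately show ?thesis using set_integrable_cong[OF refl refl, of "{0..T}" "%t. ld 2 (X t) (Y t) powr 2" "%t. (ld 2 (X t) (Y t))^2" lebesgue] by simp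
qed

lemma simple_dist_integral_le:
  assumes sp: "\<eta> \<in> SP" "\<zeta> \<in> SP" and X: "X \<in> MG_bar E T 2" "Y \<in> MG_bar E T 2" and t: "t \<in> {0..T}"
    and i: "SI (%t. ld 2 (pem 2 \<eta> t) (X t) powr 2)" "SI (%t. ld 2 (pem 2 \<zeta> t) (Y t) powr 2)"
  shows "(LINT r:{0..t}|lebesgue. (ld 2 (pem 2 \<eta> r) (pem 2 \<zeta> r))^2) <=
    3 * (LINT r:{0..t}|lebesgue. (ld 2 (X r) (Y r))^2) + 3 * approx_error \<eta> X + 3 * approx_error \<zeta> Y"
proof -
  let ?a = "%r. ld 2 (X r) (Y r)" and ?b = "%r. ld 2 (pem 2 \<eta> r) (X r)" and ?c = "%r. ld 2 (pem 2 \<zeta> r) (Y r)"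
  have t': "0 <= (0::real)" "t <= T" using t by auto
  note s = SI_subinterval[OF MG_bar_sq_integrable[OF X] t'] SI_subinterval[OF i(1) t'] SI_subinterval[OF i(2) t']
  have "(LINT r:{0..t}|lebesgue. (ld 2 (pem 2 \<eta> r) (pem 2 \<zeta> r))^2) <=
     (LINT r:{0..t}|lebesgue. 3 * (?a r)^2 + (3 * (?b r powr 2) + 3 * (?c r powr 2)))"
  proof (rule set_integral_mono)
    have "SI (%r. ld 2 (pem 2 \<eta> r) (pem 2 \<zeta> r) powr 2)" by (rule ld_pem_integrable(1)[OF p12_2 sp])
    moreover have "ld 2 (pem 2 \<eta> r) (pem 2 \<zeta> r) powr 2 = (ld 2 (pem 2 \<eta> r) (pem 2 \<zeta> r))^2" for r
      using ld_nonneg[OF p12_2 pem_in[OF p12_2 sp(1)] pem_in[OF p12_2 sp(2)], of r r] by simp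
    ultimately show "set_integrable lebesgue {0..t} (%r. (ld 2 (pem 2 \<eta> r) (pem 2 \<zeta> r))^2)" using SI_subinterval[OF _ t'] by simp
    show "set_integrable lebesgue {0..t} (%r. 3 * (?a r)^2 + (3 * (?b r powr 2) + 3 * (?c r powr 2)))"
      using s by (intro set_integral_add set_integrable_mult_right)
    fix r assume "r \<in> {0..t}"
    then have r: "r \<in> {0..T}" using t by auto
    have L: "X r \<in> LGs 2" "Y r \<in> LGs 2" "pem 2 \<eta> r \<in> LGs 2" "pem 2 \<zeta> r \<in> LGs 2"
      using MG_barD[OF X(1) r] MG_barD[OF X(2) r] pem_in[OF p12_2 sp(1)] pem_in[OF p12_2 sp(2)] by auto
    have n: "0 <= ?a r" "0 <= ?b r" "0 <= ?c r" using L ld_nonneg[OF p12_2] by auto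
    have "ld 2 (pem 2 \<eta> r) (pem 2 \<zeta> r) <= ?b r + (?a r + ?c r)"
      using ld_tri[OF p12_2 L(3,1,4)] ld_tri[OF p12_2 L(1,2,4)] ld_sym[OF p12_2 L(2,4)] by simp
    then have "(ld 2 (pem 2 \<eta> r) (pem 2 \<zeta> r))^2 <= (?b r + (?a r + ?c r))^2"
      using ld_nonneg[OF p12_2 L(3,4)] by (intro power_mono) auto
    also have "... <= 3 * (?a r)^2 + (3 * (?b r)^2 + 3 * (?c r)^2)"
      using zero_le_power2[of "?a r - ?b r"] zero_le_power2[of "?a r - ?c r"] zero_le_power2[of "?b r - ?c r"]
      by (simp add: power2_eq_square algebra_simps)
    finally show "(ld 2 (pem 2 \<eta> r) (pem 2 \<zeta> r))^2 <= 3 * (?a r)^2 + (3 * (?b r powr 2) + 3 * (?c r powr 2))" using n by simp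
  qed
  also have "... = 3 * (LINT r:{0..t}|lebesgue. (?a r)^2) + (3 * (LINT r:{0..t}|lebesgue. ?b r powr 2) + 3 * (LINT r:{0..t}|lebesgue. ?c r powr 2))"
    using s by (subst set_integral_add, simp, simp)+ simp
  also have "... <= 3 * (LINT r:{0..t}|lebesgue. (?a r)^2) + (3 * approx_error \<eta> X + 3 * approx_error \<zeta> Y)"
    unfolding approx_error_def using LI_subinterval_le[OF i(1) t'] LI_subinterval_le[OF i(2) t'] by (intro add_mono mult_left_mono order_refl) auto
  finally show ?thesis by simp
qed

abbreviation "zero2 \<equiv> emb 2 (%w. 0)"

lemma zero2_in: "zero2 \<in> LGs 2" by (rule emb_in[OF p12_2 cyl_const])

lemma zero_MG_bar: "(%t. zero2) \<in> MG_bar E T 2"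
proof (rule continuous_adapted_approximable[OF p12_2 zero2_in])
  show "adapted t zero2" for t
    unfolding adapted_def by (rule bexI[OF _ emb_in(2)[OF p12_2 cyl_const]]) (simp add: cyl_const)
  show "\<exists>\<delta>>0. \<forall>s\<in>{0..T}. \<forall>t\<in>{0..T}. s <= t --> t - s < \<delta> --> ld 2 zero2 zero2 < eps" if "eps > 0" for eps
    using that by (intro exI[of _ 1]) (simp add: ld_refl[OF p12_2 zero2_in])
qed

lemma simple_norm_integral_le:
  assumes sp: "\<eta> \<in> SP" and X: "X \<in> MG_bar E T 2" and st: "0 <= s" "s <= t" "t <= T"
    and i: "SI (%t. ld 2 (pem 2 \<eta> t) (X t) powr 2)"
  shows "(LINT r:{s..t}|lebesgue. (nE E 2 (process_at \<eta> r))^2) <=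
    2 * (LINT r:{s..t}|lebesgue. (ld 2 (X r) zero2)^2) + 2 * approx_error \<eta> X"
proof -
  let ?a = "%r. ld 2 (X r) zero2" and ?b = "%r. ld 2 (pem 2 \<eta> r) (X r)"
  note s = SI_subinterval[OF MG_bar_sq_integrable[OF X zero_MG_bar] st(1,3)] SI_subinterval[OF i(1) st(1,3)]
  have "(LINT r:{s..t}|lebesgue. (nE E 2 (process_at \<eta> r))^2) <= (LINT r:{s..t}|lebesgue. 2 * (?a r)^2 + 2 * (?b r powr 2))"
  proof (rule set_integral_mono)
    show "set_integrable lebesgue {s..t} (%r. (nE E 2 (process_at \<eta> r))^2)"
      using nE_process_integral(1)[OF sp p12_2 st(2)] by (simp add: nE_nonneg)
    show "set_integrable lebesgue {s..t} (%r. 2 * (?a r)^2 + 2 * (?b r powr 2))"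
      using s by (intro set_integral_add set_integrable_mult_right)
    fix r assume "r \<in> {s..t}"
    then have r: "r \<in> {0..T}" using st by auto
    have L: "X r \<in> LGs 2" "pem 2 \<eta> r \<in> LGs 2" using MG_barD[OF X(1) r] pem_in[OF p12_2 sp] by auto
    have n: "0 <= ?a r" "0 <= ?b r" using L zero2_in ld_nonneg[OF p12_2] by auto
    have "nE E 2 (process_at \<eta> r) = ld 2 (pem 2 \<eta> r) zero2" using ld_emb[OF p12_2 pa_T[OF sp] cyl_const[of 0]] by simp
    also have "... <= ?b r + ?a r" by (rule ld_tri[OF p12_2 L(2,1) zero2_in])
    finally have "(nE E 2 (process_at \<eta> r))^2 <= (?b r + ?a r)^2" using nE_nonneg by (intro power_mono) auto
    also have "... <= 2 * (?a r)^2 + 2 * (?b r)^2"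
      using zero_le_power2[of "?a r - ?b r"] by (simp add: power2_eq_square algebra_simps)
    finally show "(nE E 2 (process_at \<eta> r))^2 <= 2 * (?a r)^2 + 2 * (?b r powr 2)" using n by simp
  qed
  also have "... = 2 * (LINT r:{s..t}|lebesgue. (?a r)^2) + 2 * (LINT r:{s..t}|lebesgue. ?b r powr 2)"
    using s by (subst set_integral_add) auto
  also have "... <= 2 * (LINT r:{s..t}|lebesgue. (?a r)^2) + 2 * approx_error \<eta> X"
    unfolding approx_error_def using LI_subinterval_le[OF i(1) st(1,3)] by auto
  finally show ?thesis by simp
qed

text \<open>The integral as an \<open>L_G^2\<close> class, the common limit along all approximating
  sequences of an integrand in \<open>MG_bar 2\<close>. Adaptedness is made part of the choice,
  since the fixed point map has to produce adapted processes.\<close>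

definition L2int ::
  "(('d, 'v::real_normed_vector) simple_process => real => (nat => 'd path => 'v) set) =>
   (real => (nat => 'd path => 'v) set) => real => (nat => 'd path => 'v) set" where
  "L2int J X t = (SOME U. U \<in> LGs 2 \<and> adapted t U \<and>
     (\<forall>\<eta>. mg_bar_approx E T 2 \<eta> X --> (%k. ld 2 (J (\<eta> k) t) U) ----> 0))"

lemma approx_error_null: "mg_bar_approx E T 2 \<eta> X ==> (%k. approx_error (\<eta> k) X) ----> 0"
  unfolding approx_error_def by (rule mg_bar_approxD(3))

lemma good_J_diff:
  fixes J :: "('d, 'v::real_normed_vector) simple_process => real => (nat => 'd path => 'v) set" and X Y :: "real => (nat => 'd path => 'v) set" and \<eta> \<zeta> :: "nat => ('d, 'v) simple_process"
  assumes g: "good_integrator p A J C" and X: "X \<in> MG_bar E T 2" "Y \<in> MG_bar E T 2" and t: "t \<in> {0..T}"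
    and a: "mg_bar_approx E T 2 \<eta> X" "mg_bar_approx E T 2 \<zeta> Y"
  shows "(ld 2 (J (\<eta> k) t) (J (\<zeta> l) t))^2 <= 3 * C * (LINT r:{0..t}|lebesgue. (ld 2 (X r) (Y r))^2) + 3 * C * (approx_error (\<eta> k) X + approx_error (\<zeta> l) Y)"
proof -
  note s = mg_bar_approxD(1)[OF a(1), of k] mg_bar_approxD(1)[OF a(2), of l]
  have "(ld 2 (J (\<eta> k) t) (J (\<zeta> l) t))^2 <= C * (LINT r:{0..t}|lebesgue. (ld 2 (pem 2 (\<eta> k) r) (pem 2 (\<zeta> l) r))^2)"
    by (rule good_D(7)[OF g t s])
  also have "... <= C * (3 * (LINT r:{0..t}|lebesgue. (ld 2 (X r) (Y r))^2) + 3 * approx_error (\<eta> k) X + 3 * approx_error (\<zeta> l) Y)"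
    using good_D(1)[OF g t s(1)] mg_bar_approxD(2)[OF a(1)] mg_bar_approxD(2)[OF a(2)] by (intro mult_left_mono simple_dist_integral_le[OF s X t])
  finally show ?thesis by (simp add: algebra_simps)
qed

lemma self_distance_integral: "X \<in> MG_bar E T 2 ==> t \<in> {0..T} ==> (LINT r:{0..t}|lebesgue. (ld 2 (X r) (X r))^2) = 0"
proof -
  assume X: "X \<in> MG_bar E T 2" and t: "t \<in> {0..T}"
  have "(LINT r:{0..t}|lebesgue. (ld 2 (X r) (X r))^2) = (LINT r:{0..t}|lebesgue. 0::real)"
    using t by (intro set_lebesgue_integral_cong) (auto simp: ld_refl[OF p12_2 MG_barD[OF X]])
  then show ?thesis by (simp add: set_lebesgue_integral_def)
qed

lemma sq_null: "(%k. (f k :: real)^2) ----> 0 ==> f ----> 0"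
  using tendsto_real_sqrt[of "%k. (f k)^2" 0 sequentially] by (simp add: tendsto_rabs_zero_iff)

lemma L2int:
  fixes J :: "('d, 'v::real_normed_vector) simple_process => real => (nat => 'd path => 'v) set" and X :: "real => (nat => 'd path => 'v) set" and \<eta> :: "nat => ('d, 'v) simple_process"
  assumes g: "good_integrator p A J C" and X: "X \<in> MG_bar E T 2" and t: "t \<in> {0..T}"
  shows "L2int J X t \<in> LGs 2" "adapted t (L2int J X t)"
    "mg_bar_approx E T 2 \<eta> X ==> (%k. ld 2 (J (\<eta> k) t) (L2int J X t)) ----> 0"
proof -
  obtain \<eta>0 where a: "mg_bar_approx E T 2 \<eta>0 X" using X by (auto simp: MG_bar_def)
  have C: "0 <= C" using g by (simp add: good_integrator_def)
  have JL: "J \<zeta> t \<in> LGs 2" "adapted t (J \<zeta> t)" if "\<zeta> \<in> SP" for \<zeta> using good_D(2,3)[OF g t that] by auto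
  note sp = mg_bar_approxD(1)[OF a]
  have est: "(ld 2 (J (\<eta> k) t) (J (\<zeta> l) t))^2 <= 3 * C * (approx_error (\<eta> k) X + approx_error (\<zeta> l) X)"
    if "mg_bar_approx E T 2 \<eta> X" "mg_bar_approx E T 2 \<zeta> X" for \<eta> \<zeta> k l
    using good_J_diff[OF g X X t that, of k l] self_distance_integral[OF X t] by simp
  have cau: "\<exists>M. \<forall>k\<ge>M. \<forall>l\<ge>M. ld 2 (J (\<eta>0 k) t) (J (\<eta>0 l) t) < eps" if e: "eps > 0" for eps
  proof -
    have "(%k. 6 * C * approx_error (\<eta>0 k) X) ----> 0" by (intro tendsto_mult_right_zero approx_error_null a)
    from null_seq_less[OF this, of "eps\<^sup>2"] e obtain M where M: "!!k. k \<ge> M ==> 6 * C * approx_error (\<eta>0 k) X < eps\<^sup>2" by auto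
    have "ld 2 (J (\<eta>0 k) t) (J (\<eta>0 l) t) < eps" if "k \<ge> M" "l \<ge> M" for k l
    proof (rule power2_less_imp_less)
      show "(ld 2 (J (\<eta>0 k) t) (J (\<eta>0 l) t))^2 < eps\<^sup>2" using est[OF a a, of k l] M[OF that(1)] M[OF that(2)] by (simp add: algebra_simps)
    qed (use e in simp)
    then show ?thesis by blast
  qed
  obtain U where U: "U \<in> LGs 2" "adapted t U" "(%k. ld 2 (J (\<eta>0 k) t) U) ----> 0"
    using LG_complete[OF p12_2 JL(1)[OF sp] cau t JL(2)[OF sp]] by blast
  have conv: "(%k. ld 2 (J (\<eta> k) t) U) ----> 0" if \<eta>: "mg_bar_approx E T 2 \<eta> X" for \<eta>
  proof -
    note sp' = mg_bar_approxD(1)[OF \<eta>]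
    have lim0: "(%k. 3 * C * (approx_error (\<eta> k) X + approx_error (\<eta>0 k) X)) ----> 0" by (intro tendsto_mult_right_zero tendsto_add_zero approx_error_null a \<eta>)
    have "(%k. ld 2 (J (\<eta> k) t) (J (\<eta>0 k) t)) ----> 0"
      by (rule sq_null, rule null_le[OF lim0 est[OF \<eta> a] zero_le_power2])
    from tendsto_add_zero[OF this U(3)] show ?thesis
      by (rule null_le[OF _ ld_tri[OF p12_2 JL(1)[OF sp'] JL(1)[OF sp] U(1)] ld_nonneg[OF p12_2 JL(1)[OF sp'] U(1)]])
  qed
  have "\<exists>U. U \<in> LGs 2 \<and> adapted t U \<and> (\<forall>\<eta>. mg_bar_approx E T 2 \<eta> X --> (%k. ld 2 (J (\<eta> k) t) U) ----> 0)"
    using U conv by blast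
  from someI_ex[OF this] show "L2int J X t \<in> LGs 2" "adapted t (L2int J X t)"
    "mg_bar_approx E T 2 \<eta> X ==> (%k. ld 2 (J (\<eta> k) t) (L2int J X t)) ----> 0"
    unfolding L2int_def by blast+
qed

lemma L2int_diff:
  fixes J :: "('d, 'v::real_normed_vector) simple_process => real => (nat => 'd path => 'v) set" and X Y :: "real => (nat => 'd path => 'v) set"
  assumes g: "good_integrator p A J C" and X: "X \<in> MG_bar E T 2" "Y \<in> MG_bar E T 2" and t: "t \<in> {0..T}"
  shows "(ld 2 (L2int J X t) (L2int J Y t))^2 <= 3 * C * (LINT r:{0..t}|lebesgue. (ld 2 (X r) (Y r))^2)"
proof -
  obtain \<eta> \<zeta> where a: "mg_bar_approx E T 2 \<eta> X" "mg_bar_approx E T 2 \<zeta> Y" using X by (auto simp: MG_bar_def)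
  let ?c = "3 * C * (LINT r:{0..t}|lebesgue. (ld 2 (X r) (Y r))^2)"
  have "(%k. ld 2 (J (\<eta> k) t) (J (\<zeta> k) t)) ----> ld 2 (L2int J X t) (L2int J Y t)"
    by (rule ld_tendsto[OF p12_2 good_D(2)[OF g t mg_bar_approxD(1)[OF a(1)]] good_D(2)[OF g t mg_bar_approxD(1)[OF a(2)]]
          L2int(1)[OF g X(1) t] L2int(1)[OF g X(2) t] L2int(3)[OF g X(1) t a(1)] L2int(3)[OF g X(2) t a(2)]])
  from tendsto_power[OF this, of 2] show ?thesis
  proof (rule LIMSEQ_le)
    have "(%k. 3 * C * (approx_error (\<eta> k) X + approx_error (\<zeta> k) Y)) ----> 0" by (intro tendsto_mult_right_zero tendsto_add_zero approx_error_null a)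
    from tendsto_add[OF tendsto_const[of ?c] this] show "(%k. ?c + 3 * C * (approx_error (\<eta> k) X + approx_error (\<zeta> k) Y)) ----> ?c" by simp
  qed (use good_J_diff[OF g X t a] in blast)
qed

text \<open>Continuity in time of the integral, which makes it again a limit of simple processes by
  \<open>continuous_adapted_approximable\<close>.\<close>

lemma L2int_cont:
  fixes J :: "('d, 'v::real_normed_vector) simple_process => real => (nat => 'd path => 'v) set" and X :: "real => (nat => 'd path => 'v) set"
  assumes g: "good_integrator p A J C" and X: "X \<in> MG_bar E T 2" and st: "0 <= s" "s <= t" "t <= T"
  shows "(ld 2 (L2int J X s) (L2int J X t))^2 <= 2 * C * (LINT r:{s..t}|lebesgue. (ld 2 (X r) zero2)^2)"
proof -
  obtain \<eta> where a: "mg_bar_approx E T 2 \<eta> X" using X by (auto simp: MG_bar_def)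
  note sp = mg_bar_approxD(1)[OF a]
  have t: "s \<in> {0..T}" "t \<in> {0..T}" "s \<in> {0..t}" using st by auto
  let ?c = "2 * C * (LINT r:{s..t}|lebesgue. (ld 2 (X r) zero2)^2)"
  have "(%k. ld 2 (J (\<eta> k) s) (J (\<eta> k) t)) ----> ld 2 (L2int J X s) (L2int J X t)"
    by (rule ld_tendsto[OF p12_2 good_D(2)[OF g t(1) sp] good_D(2)[OF g t(2) sp]
          L2int(1)[OF g X t(1)] L2int(1)[OF g X t(2)] L2int(3)[OF g X t(1) a] L2int(3)[OF g X t(2) a]])
  from tendsto_power[OF this, of 2] show ?thesis
  proof (rule LIMSEQ_le)
    have "(%k. 2 * C * approx_error (\<eta> k) X) ----> 0" by (intro tendsto_mult_right_zero approx_error_null a)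
    from tendsto_add[OF tendsto_const[of ?c] this] show "(%k. ?c + 2 * C * approx_error (\<eta> k) X) ----> ?c" by simp
    have "(ld 2 (J (\<eta> k) s) (J (\<eta> k) t))^2 <= ?c + 2 * C * approx_error (\<eta> k) X" for k
    proof -
      have "(ld 2 (J (\<eta> k) s) (J (\<eta> k) t))^2 <= C * (LINT r:{s..t}|lebesgue. (nE E 2 (process_at (\<eta> k) r))^2)"
        by (rule good_D(8)[OF g t(2) sp t(3)])
      also have "... <= C * (2 * (LINT r:{s..t}|lebesgue. (ld 2 (X r) zero2)^2) + 2 * approx_error (\<eta> k) X)"
        by (intro mult_left_mono good_D(1)[OF g t(2) sp] simple_norm_integral_le[OF sp X st mg_bar_approxD(2)[OF a]])
      finally show ?thesis by (simp add: algebra_simps)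
    qed
    then show "\<exists>N. \<forall>n\<ge>N. (ld 2 (J (\<eta> n) s) (J (\<eta> n) t))^2 <= ?c + 2 * C * approx_error (\<eta> n) X" by blast
  qed
qed

lemma mg_bar_approx_cong:
  assumes "!!t. t \<in> {0..T} ==> X t = Y t" shows "mg_bar_approx E T p \<eta> X = mg_bar_approx E T p \<eta> Y"
proof -
  have "SI (%t. ld p (pem p (\<eta> k) t) (X t) powr p) = SI (%t. ld p (pem p (\<eta> k) t) (Y t) powr p)" for k
    using assms by (intro set_integrable_cong) auto
  moreover have "LI (%t. ld p (pem p (\<eta> k) t) (X t) powr p) = LI (%t. ld p (pem p (\<eta> k) t) (Y t) powr p)" for k
    using assms by (intro set_lebesgue_integral_cong) auto
  ultimately show ?thesis unfolding mg_bar_approx_def by simp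
qed

text \<open>Both sides are \<open>L_G^1\<close> limits of the same simple integrals, because one
  approximating sequence serves both exponents.\<close>

lemma inc_L2int:
  fixes J :: "('d, 'v::real_normed_vector) simple_process => real => (nat => 'd path => 'v) set" and X Xp :: "real => (nat => 'd path => 'v) set"
  assumes g: "good_integrator p A J C" and p: "p12 p" and X: "X \<in> MG_bar E T 2" and t: "t \<in> {0..T}"
    and Xp: "!!t. t \<in> {0..T} ==> Xp t = (if p = 1 then inc (X t) else X t)"
  shows "inc (L2int J X t) = inc (integral_upto E T p A t (mg_incl E T p Xp))"
proof -
  obtain \<eta> where a: "mg_bar_approx E T 2 \<eta> X" using X by (auto simp: MG_bar_def)
  note sp = mg_bar_approxD(1)[OF a]
  have XL: "Xp t \<in> LGs p" if "t \<in> {0..T}" for t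
    using Xp[OF that] MG_barD[OF X that] inc_rep(1)[OF p12_2 MG_barD[OF X that]] p by (auto simp: p12_def)
  have ap: "mg_bar_approx E T p \<eta> Xp"
  proof (cases "p = 1")
    case True
    have "mg_bar_approx E T 1 \<eta> (%t. inc (X t))" by (rule mg_bar_approx_2_1[OF a MG_barD[OF X]])
    then show ?thesis using mg_bar_approx_cong[of Xp "%t. inc (X t)" 1 \<eta>] Xp True by simp
  next
    case False
    then have "p = 2" using p by (simp add: p12_def)
    then show ?thesis using mg_bar_approx_cong[of Xp X 2 \<eta>] Xp a by simp
  qed
  let ?V = "integral_upto E T p A t (mg_incl E T p Xp)" and ?I = "%k. integral_simple E T p A t (\<eta> k)"
  note V = integral_upto_limit[OF g p XL ap t]
  note I = good_D(4)[OF g t sp]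
  note JL = good_D(2)[OF g t sp]
  have le1: "1 <= p" using p by (auto simp: p12_def)
  have 1: "(%k. ld 1 (inc (?I k)) (inc ?V)) ----> 0"
  proof (rule null_le[OF V(2)])
    show "ld 1 (inc (?I k)) (inc ?V) <= ld p (?I k) ?V" for k using ld_lg_map[OF fadm_id p12_1 p le1 I V(1), of k] by simp
    show "0 <= ld 1 (inc (?I k)) (inc ?V)" for k by (intro ld_nonneg p12_simps inc_rep(1)[OF p I] inc_rep(1)[OF p V(1)])
  qed
  have 2: "(%k. ld 1 (inc (?I k)) (inc (L2int J X t))) ----> 0"
    unfolding good_D(5)[OF g t sp, symmetric]
  proof (rule null_le[OF L2int(3)[OF g X t a]])
    show "ld 1 (inc (J (\<eta> k) t)) (inc (L2int J X t)) <= ld 2 (J (\<eta> k) t) (L2int J X t)" for k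
      using ld_lg_map[OF fadm_id p12_1 p12_2 _ JL L2int(1)[OF g X t], of k] by simp
    show "0 <= ld 1 (inc (J (\<eta> k) t)) (inc (L2int J X t))" for k
      by (intro ld_nonneg p12_simps inc_rep(1)[OF p12_2 JL] inc_rep(1)[OF p12_2 L2int(1)[OF g X t]])
  qed
  show ?thesis
    by (rule LG_limit_unique[OF p12_1 inc_rep(1)[OF p I] inc_rep(1)[OF p12_2 L2int(1)[OF g X t]] inc_rep(1)[OF p V(1)] 2 1])
qed

lemma integral_upto_bounded:
  fixes J :: "('d, 'v::real_normed_vector) simple_process => real => (nat => 'd path => 'v) set" and X :: "real => (nat => 'd path => 'v) set"
  assumes g: "good_integrator p A J C" and p: "p12 p" and X: "X \<in> MG_bar E T p"
  shows "\<exists>M. \<forall>t\<in>{0..T}. ld 1 (inc (integral_upto E T p A t (mg_incl E T p X))) (emb 1 (%w. 0)) <= M"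
proof -
  obtain \<eta> where a: "mg_bar_approx E T p \<eta> X" using X by (auto simp: MG_bar_def)
  note sp = mg_bar_approxD(1)[OF a]
  have C: "0 <= C" using g by (simp add: good_integrator_def)
  have le1: "1 <= p" using p by (auto simp: p12_def)
  obtain m where m: "!!k l. k \<ge> m ==> l \<ge> m ==> mg_pdist E T p (\<eta> k) (\<eta> l) < 1"
    using mg_approx_Cauchy[OF p MG_barD[OF X] a] zero_less_one unfolding cauchy_seqs_def by blast
  have Z: "emb 1 (%w. 0::'v) \<in> LGs 1" by (rule emb_in[OF p12_1 cyl_const])
  have z0: "0 \<in> {0..T}" using T0 by simp
  \<comment> \<open>The summands bound the growth of the integral of the simple process, its value
    at time \<open>0\<close>, and its distance to the given integral.\<close>
  define M where "M = sqrt (C * LI (%r. (nE E 2 (process_at (\<eta> m) r))^2)) + ld 2 (J (\<eta> m) 0) zero2 + (C + 1)"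
  have "ld 1 (inc (integral_upto E T p A t (mg_incl E T p X))) (emb 1 (%w. 0)) <= M" if t: "t \<in> {0..T}" for t
  proof -
    let ?V = "integral_upto E T p A t (mg_incl E T p X)" and ?I = "%k. integral_simple E T p A t (\<eta> k)"
    note V = integral_upto_limit[OF g p MG_barD[OF X] a t]
    note I = good_D(4)[OF g t sp]
    note JL = good_D(2)[OF g t sp, of m] good_D(2)[OF g z0 sp, of m]
    have const0: "(%k. ld p (?I m) (?I m)) ----> 0" by (simp add: ld_refl[OF p I])
    have "(%k. ld p (?I k) (?I m)) ----> ld p ?V (?I m)" by (rule ld_tendsto[OF p I I V(1) I V(2) const0])
    then have "ld p ?V (?I m) <= C + 1"
    proof (rule LIMSEQ_le_const2)
      have "ld p (?I k) (?I m) <= C + 1" if "k \<ge> m" for k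
      proof (rule order_trans[OF good_root[OF g p t sp sp]])
        have "(C + 1) * mg_pdist E T p (\<eta> k) (\<eta> m) <= (C + 1) * 1"
          using m[OF that order_refl] C by (intro mult_left_mono) auto
        then show "(C + 1) * mg_pdist E T p (\<eta> k) (\<eta> m) <= C + 1" by simp
      qed
      then show "\<exists>N. \<forall>n\<ge>N. ld p (?I n) (?I m) <= C + 1" by blast
    qed
    then have 1: "ld 1 (inc ?V) (inc (?I m)) <= C + 1" using ld_lg_map[OF fadm_id p12_1 p le1 V(1) I, of m] by simp
    have SIq: "SI (%r. (nE E 2 (process_at (\<eta> m) r))^2)"
      using nE_process_integral(1)[OF sp p12_2, of 0 T m] T0 by (simp add: nE_nonneg)
    have "(ld 2 (J (\<eta> m) 0) (J (\<eta> m) t))^2 <= C * (LINT r:{0..t}|lebesgue. (nE E 2 (process_at (\<eta> m) r))^2)"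
      using t by (intro good_D(8)[OF g t sp]) auto
    also have "... <= C * LI (%r. (nE E 2 (process_at (\<eta> m) r))^2)"
      using t C by (intro mult_left_mono LI_subinterval_le SIq) auto
    finally have 2: "ld 2 (J (\<eta> m) 0) (J (\<eta> m) t) <= sqrt (C * LI (%r. (nE E 2 (process_at (\<eta> m) r))^2))" by (rule real_le_rsqrt)
    have "inc zero2 = (emb 1 (%w. 0) :: (nat => 'd path => 'v) set)"
      using lg_map_emb[OF fadm_id p12_1 p12_2 _ cyl_const] by simp
    then have "ld 1 (inc (?I m)) (emb 1 (%w. 0)) = ld 1 (inc (J (\<eta> m) t)) (inc zero2)" using good_D(5)[OF g t sp, of m] by simp
    also have "... <= ld 2 (J (\<eta> m) t) zero2" using ld_lg_map[OF fadm_id p12_1 p12_2 _ JL(1) zero2_in] by simp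
    also have "... <= ld 2 (J (\<eta> m) 0) (J (\<eta> m) t) + ld 2 (J (\<eta> m) 0) zero2"
      using ld_tri[OF p12_2 JL(1,2) zero2_in] ld_sym[OF p12_2 JL] by simp
    finally show ?thesis
      using ld_tri[OF p12_1 inc_rep(1)[OF p V(1)] inc_rep(1)[OF p I] Z, of m] 1 2 unfolding M_def by linarith
  qed
  then show ?thesis by blast
qed

end

section \<open>The quadratic variation\<close>

text \<open>The factor of \<open>z\<close> is nonnegative, as \<open>indep_mult_le\<close> demands.
  Expanding the square of \<open>p + z\<close> itself would not give this.\<close>

lemma pos_part_add_sq: "(max 0 (p + z))^2 <= (max 0 p)^2 + 2 * (max 0 p * z) + (z :: real)^2"
proof -
  have "max 0 (p + z) <= \<bar>max 0 p + z\<bar>" by auto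
  then have "(max 0 (p + z))^2 <= \<bar>max 0 p + z\<bar>\<^sup>2" by (intro power_mono) auto
  then show ?thesis by (simp add: power2_sum mult.assoc)
qed

lemma bl_truncated_sq:
  assumes "0 <= K" shows "bounded_lip (%x :: 'a::real_normed_vector. min ((exc 0 K x)^2) c - d)"
proof -
  have "bounded_lip (%x :: 'a. (exc 0 K x)^2)" by (rule bl_square[OF exc_bl[OF assms]])
  then obtain C L where *: "!!x :: 'a. \<bar>(exc 0 K x)^2\<bar> <= C" "0 <= L"
    "!!x y :: 'a. \<bar>(exc 0 K x)^2 - (exc 0 K y)^2\<bar> <= L * norm (x - y)" unfolding bounded_lip_def by blast
  show ?thesis
  proof (rule blI[of _ "C + \<bar>c\<bar> + \<bar>d\<bar>" L])
    fix x y :: 'a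
    have "\<bar>min u c - d\<bar> <= \<bar>u\<bar> + \<bar>c\<bar> + \<bar>d\<bar>" for u :: real by (auto simp: min_def)
    from this[of "(exc 0 K x)^2"] *(1)[of x] show "\<bar>min ((exc 0 K x)^2) c - d\<bar> <= C + \<bar>c\<bar> + \<bar>d\<bar>" by linarith
    have "\<bar>min u c - d - (min v c - d)\<bar> <= \<bar>u - v\<bar>" for u v :: real by (auto simp: min_def)
    from this[of "(exc 0 K x)^2" "(exc 0 K y)^2"] *(3)[of x y]
    show "\<bar>min ((exc 0 K x)^2) c - d - (min ((exc 0 K y)^2) c - d)\<bar> <= L * norm (x - y)" by linarith
  qed (rule *(2))
qed

text \<open>Where \<open>exc 0 K x\<close> exceeds \<open>2 * r\<close> it is at most twice the tail
  above \<open>r\<close>, whence the factor \<open>4\<close>; elsewhere the truncation at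
  \<open>4 * r\<^sup>2\<close> has no effect.\<close>

lemma exc_sq_truncate:
  assumes "0 <= r" "0 <= K" shows "(exc 0 K x)^2 - min ((exc 0 K x)^2) (4 * r\<^sup>2) <= 4 * (exc r K x)^2"
proof (cases "exc 0 K x <= 2 * r")
  case True
  then have "(exc 0 K x)^2 <= (2 * r)^2" using assms exc_bounds(1) by (intro power_mono) auto
  then show ?thesis by (simp add: power_mult_distrib)
next
  case False
  then have "exc 0 K x <= 2 * exc r K x" using assms by (auto simp: exc_def min_def max_def split: if_splits)
  then have "(exc 0 K x)^2 <= (2 * exc r K x)^2" using assms exc_bounds(1) by (intro power_mono) auto
  moreover have "0 <= min ((exc 0 K x)^2) (4 * r\<^sup>2)" by simp
  moreover have "(2 * exc r K x)^2 = 4 * (exc r K x)^2" by (simp add: power_mult_distrib)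
  ultimately show ?thesis by linarith
qed

context sublinear_T
begin

lemma CS_sq:
  fixes u :: "nat => 'd path => real"
  assumes u: "u \<in> CS 2" shows "(%k w. (u k w)^2) \<in> CS 1"
  unfolding CS_iff
proof (safe intro!: cyl_power2 CS_cyl[OF u])
  fix eps :: real assume e: "eps > 0"
  obtain K where K: "K \<ge> 0" "!!k. nE E 2 (u k) <= K" using CS_bounded[OF p12_2 u] by blast
  have "eps / (2 * K + 1) > 0" using e K by simp
  then obtain M where M: "!!k l. k \<ge> M ==> l \<ge> M ==> nE E 2 (%w. u k w - u l w) < eps / (2 * K + 1)" using u unfolding CS_iff by blast
  have "nE E 1 (%w. (u k w)^2 - (u l w)^2) < eps" if "k \<ge> M" "l \<ge> M" for k l
  proof -
    note L = CS_LA[OF u, of k] CS_LA[OF u, of l]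
    have "nE E 1 (%w. (u k w)^2 - (u l w)^2) <= nE E 2 (%w. u k w - u l w) * nE E 2 (%w. u k w + u l w)"
      using L by (intro nE_1_mult cyl_diff cyl_add cyl_power2) (simp_all add: abs_mult[symmetric] power2_eq_square algebra_simps)
    also have "... <= nE E 2 (%w. u k w - u l w) * (2 * K + 1)"
      using nE_triangle[OF p12_2 L] K(2)[of k] K(2)[of l] by (intro mult_left_mono nE_nonneg) simp
    also have "... < eps" using M[OF that] K(1) by (simp add: pos_less_divide_eq)
    finally show ?thesis .
  qed
  then show "\<exists>M. \<forall>k\<ge>M. \<forall>l\<ge>M. nE E 1 (%w. (u k w)^2 - (u l w)^2) < eps" by blast
qed
end

context brownian
begin

lemma exc_sq_scaled_bound:
  assumes R: "R \<ge> 0" "!!K. 0 <= K ==> E (%w. (exc R K (B 1 w :: real^'d))^2) <= eps" and r: "0 <= r" "r <= r'" "0 <= K"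
  shows "E (%w. (exc (R * sqrt (r' - r)) K (B r' w - B r w :: real^'d))^2) <= (r' - r) * eps"
proof -
  have "0 <= R * sqrt (r' - r)" using R r by simp
  from exc_sq_scale[OF r this] obtain K' where K': "K' \<ge> 0"
    "E (%w. (exc (R * sqrt (r' - r)) K (B r' w - B r w :: real^'d))^2) = (r' - r) * E (%w. (exc (R * sqrt (r' - r) / sqrt (r' - r)) K' (B 1 w))^2)" by blast
  show ?thesis
  proof (cases "r = r'")
    case True then show ?thesis using K'(2) by simp
  next
    case False
    then have "R * sqrt (r' - r) / sqrt (r' - r) = R" using r by simp
    then show ?thesis unfolding K'(2) using R(2)[OF K'(1)] r by (simp add: mult_left_mono)
  qed
qed

text \<open>
  A weak law of large numbers for squared increments.  Since fourth moments are not available,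
  the summands are truncated at a multiple of the length of the time interval.
\<close>

lemma exc_lln:
  assumes e: "eps > 0"
  shows "\<exists>M\<ge>0. \<forall>c n K h. 0 <= c 0 --> (\<forall>i<n. c i <= c (Suc i) \<and> c (Suc i) - c i <= h) --> 0 <= K -->
    E (%w. max 0 ((\<Sum>i<n. (exc 0 K (B (c (Suc i)) w - B (c i) w :: real^'d))^2) - \<mu> * (c n - c 0))) <=
      4 * eps * (c n - c 0) + M * sqrt (h * (c n - c 0))"
proof -
  obtain R where R: "R \<ge> 0" "!!K. 0 <= K ==> E (%w. (exc R K (B 1 w :: real^'d))^2) <= eps" using B_1_tail[OF e] by blast
  \<comment> \<open>\<open>M\<close> times the length of the interval bounds a truncated and centred
    square: \<open>4 * R\<^sup>2\<close> comes from the truncation, \<open>\<mu>\<close> from the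
    centring.\<close>
  define M where "M = 4 * R\<^sup>2 + \<mu>"
  have M0: "0 <= M" using \<mu>(1) by (simp add: M_def)
  show ?thesis
  proof (intro exI[of _ M] conjI M0 allI impI)
    fix c :: "nat => real" and n and K h :: real
    assume c0: "0 <= c 0" and cmh: "\<forall>i<n. c i <= c (Suc i) \<and> c (Suc i) - c i <= h" and K: "0 <= K"
    let ?x = "%i w. B (c (Suc i)) w - B (c i) w :: real^'d"
    let ?\<Delta> = "%i. c (Suc i) - c i"
    \<comment> \<open>The truncation level is proportional to the length of the interval. By
      scaling, what it cuts off has expectation at most \<open>4 * eps\<close> times that
      length.\<close>
    define Z where "Z i x = min ((exc 0 K x)^2) (4 * (R * sqrt (?\<Delta> i))^2) - \<mu> * ?\<Delta> i" for i and x :: "real^'d"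
    define P where "P j w = (\<Sum>i<j. Z i (?x i w))" for j w
    have cm: "c i <= c (Suc i)" "?\<Delta> i <= h" "0 <= ?\<Delta> i" if "i < n" for i using cmh that by auto
    have mono: "c i <= c j" if "i <= j" "j <= n" for i j using that
    proof (induction j rule: dec_induct)
      case (step m) then show ?case using cm(1)[of m] by simp
    qed simp
    have cpos: "0 <= c j" if "j <= n" for j using mono[of 0 j] c0 that by simp
    have tel: "(\<Sum>i<n. ?\<Delta> i) = c n - c 0" by (rule sum_lessThan_telescope)
    have blZ: "bounded_lip (Z i)" for i unfolding Z_def[abs_def] by (rule bl_truncated_sq[OF K])
    have xc: "(%w. Z i (?x i w)) \<in> cyl {0..c (Suc i)}" if "i < n" for i
      using that cpos[of i] cm(1)[of i] by (intro bl_cyl[OF blZ]) auto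
    have Pc: "P j \<in> cyl {0..c j}" if "j <= n" for j
      unfolding P_def[abs_def]
    proof (rule cyl_sum)
      fix i assume "i \<in> {..<j}"
      then have "{0..c (Suc i)} \<subseteq> {0..c j}" "i < n" using mono[of "Suc i" j] that by auto
      then show "(%w. Z i (?x i w)) \<in> cyl {0..c j}" using cyl_mono xc by blast
    qed
    have exL: "(%w. (exc r K (?x i w))^2) \<in> LA" if "i < n" for i r
      using cpos[of i] cpos[of "Suc i"] that K by (intro cyl_power2 exc_incr_LA) auto
    have EZ: "E (%w. Z i (?x i w)) <= 0" if i: "i < n" for i
    proof -
      have "E (%w. Z i (?x i w)) <= E (%w. (exc 0 K (?x i w))^2 + (- \<mu> * ?\<Delta> i))"
        by (rule E_mono[OF cyl_LA[OF xc[OF i]] cyl_add[OF exL[OF i] cyl_const]]) (simp add: Z_def)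
      also have "... = E (%w. (exc 0 K (?x i w))^2) + (- \<mu> * ?\<Delta> i)" by (rule E_add_const[OF exL[OF i]])
      also have "... <= 0" using \<mu>(2)[of "c i" "c (Suc i)" K] cpos[of i] cm[OF i] i K by simp
      finally show ?thesis .
    qed
    have zb: "(Z i x)^2 <= (M * ?\<Delta> i)^2" if i: "i < n" for i x
    proof -
      have r: "4 * (R * sqrt (?\<Delta> i))^2 = 4 * R\<^sup>2 * ?\<Delta> i" using cm[OF i] by (simp add: power_mult_distrib)
      have "0 <= 4 * R\<^sup>2 * ?\<Delta> i" "0 <= \<mu> * ?\<Delta> i" using cm[OF i] \<mu>(1) by auto
      moreover have "0 <= min ((exc 0 K x)^2) (4 * R\<^sup>2 * ?\<Delta> i)" "min ((exc 0 K x)^2) (4 * R\<^sup>2 * ?\<Delta> i) <= 4 * R\<^sup>2 * ?\<Delta> i"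
        using calculation by auto
      ultimately have "\<bar>Z i x\<bar> <= M * ?\<Delta> i" unfolding Z_def r M_def distrib_right by linarith
      then have "\<bar>Z i x\<bar>\<^sup>2 <= (M * ?\<Delta> i)^2" by (intro power_mono) auto
      then show ?thesis by simp
    qed
    \<comment> \<open>Only the positive part of the partial sum is squared: its product with the
      next \<open>Z\<close> has expectation at most \<open>0\<close>, as \<open>Z\<close> has mean
      at most \<open>0\<close>, while nothing is known about the mean of \<open>- Z\<close>. The
      squares of the bounds then simply add up.\<close>
    have step: "E (%w. (max 0 (P j w))^2) <= (\<Sum>i<j. (M * ?\<Delta> i)^2)" if "j <= n" for j using that
    proof (induction j)
      case 0 then show ?case by (simp add: P_def E_const)
    next
      case (Suc j)
      then have j: "j < n" "j <= n" by auto
      let ?p = "%w. max 0 (P j w)" and ?z = "%w. Z j (?x j w)"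
      have pc: "?p \<in> cyl {0..c j}" by (intro cyl_max cyl_const Pc j)
      note pL = cyl_LA[OF pc] and zL = cyl_LA[OF xc[OF j(1)]]
      have pz: "(%w. ?p w * ?z w) \<in> LA" by (intro cyl_mult pL zL)
      have "E (%w. (max 0 (P (Suc j) w))^2) <= E (%w. ((?p w)^2 + 2 * (?p w * ?z w)) + (M * ?\<Delta> j)^2)"
      proof (rule E_mono)
        show "(%w. (max 0 (P (Suc j) w))^2) \<in> LA" by (intro cyl_power2 cyl_max cyl_const cyl_LA[OF Pc] Suc.prems)
        show "(%w. ((?p w)^2 + 2 * (?p w * ?z w)) + (M * ?\<Delta> j)^2) \<in> LA" by (intro cyl_add cyl_const cyl_power2 pL cyl_mult zL)
        show "(max 0 (P (Suc j) w))^2 <= ((?p w)^2 + 2 * (?p w * ?z w)) + (M * ?\<Delta> j)^2" for w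
          using pos_part_add_sq[of "P j w" "?z w"] zb[OF j(1), of "?x j w"] by (simp add: P_def)
      qed
      also have "... = E (%w. (?p w)^2 + 2 * (?p w * ?z w)) + (M * ?\<Delta> j)^2"
        by (rule E_add_const) (intro cyl_add cyl_const cyl_power2 pL cyl_mult zL)
      also have "E (%w. (?p w)^2 + 2 * (?p w * ?z w)) <= E (%w. (?p w)^2) + E (%w. 2 * (?p w * ?z w))"
        by (intro E_add cyl_power2 pL cyl_mult cyl_const zL)
      also have "E (%w. 2 * (?p w * ?z w)) = 2 * E (%w. ?p w * ?z w)" by (rule E_scale[OF pz]) simp
      also have "E (%w. ?p w * ?z w) <= E (%w. ?p w * 0)"
        by (rule indep_mult_le[OF pc _ cpos[OF j(2)] cm(1)[OF j(1)] blZ EZ[OF j(1)]]) simp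
      finally show ?case using Suc.IH[OF j(2)] by (simp add: E_const)
    qed
    have "(\<Sum>i<n. (M * ?\<Delta> i)^2) <= (\<Sum>i<n. M\<^sup>2 * (h * ?\<Delta> i))"
    proof (rule sum_mono)
      fix i assume "i \<in> {..<n}"
      then have "?\<Delta> i * ?\<Delta> i <= h * ?\<Delta> i" using cm by (intro mult_right_mono) auto
      then show "(M * ?\<Delta> i)^2 <= M\<^sup>2 * (h * ?\<Delta> i)" by (simp add: power_mult_distrib power2_eq_square[of "?\<Delta> i"] mult_left_mono)
    qed
    also have "... = M\<^sup>2 * (h * (c n - c 0))" by (simp add: sum_distrib_left[symmetric] sum_lessThan_telescope)
    finally have sb: "E (%w. (max 0 (P n w))^2) <= M\<^sup>2 * (h * (c n - c 0))" using step[OF order_refl] by linarith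
    have PnL: "(%w. max 0 (P n w)) \<in> LA" by (intro cyl_max cyl_const cyl_LA[OF Pc] order_refl)
    have "E (%w. max 0 (P n w)) <= sqrt (E (%w. (max 0 (P n w))^2))"
      using E_Cauchy_Schwarz[OF PnL cyl_const[of 1]] by (simp add: E_const)
    also have "... <= sqrt (M\<^sup>2 * (h * (c n - c 0)))" using sb by (rule real_sqrt_le_mono)
    finally have 1: "E (%w. max 0 (P n w)) <= M * sqrt (h * (c n - c 0))" using M0 by (simp add: real_sqrt_mult)
    let ?e = "%i w. 4 * (exc (R * sqrt (?\<Delta> i)) K (?x i w))^2"
    have eL: "?e i \<in> LA" if "i < n" for i using exL[OF that] by (intro cyl_mult cyl_const)
    have "E (%w. \<Sum>i<n. ?e i w) <= (\<Sum>i<n. E (?e i))" by (rule E_sum) (use eL in auto)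
    also have "... <= (\<Sum>i<n. 4 * eps * ?\<Delta> i)"
    proof (rule sum_mono)
      fix i assume "i \<in> {..<n}"
      then have i: "i < n" by simp
      have "E (?e i) = 4 * E (%w. (exc (R * sqrt (?\<Delta> i)) K (?x i w))^2)" by (rule E_scale[OF exL[OF i]]) simp
      also have "... <= 4 * (?\<Delta> i * eps)"
        using exc_sq_scaled_bound[OF R cpos[of i] cm(1)[OF i] K] i by simp
      also have "... = 4 * eps * ?\<Delta> i" by simp
      finally show "E (?e i) <= 4 * eps * ?\<Delta> i" .
    qed
    also have "... = 4 * eps * (c n - c 0)" by (simp add: sum_distrib_left[symmetric] sum_lessThan_telescope)
    finally have 2: "E (%w. \<Sum>i<n. ?e i w) <= 4 * eps * (c n - c 0)" .
    have sL: "(%w. \<Sum>i<n. ?e i w) \<in> LA" by (rule cyl_sum) (use eL in auto)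
    have "E (%w. max 0 ((\<Sum>i<n. (exc 0 K (?x i w))^2) - \<mu> * (c n - c 0))) <= E (%w. max 0 (P n w) + (\<Sum>i<n. ?e i w))"
    proof (rule E_mono)
      show "(%w. max 0 ((\<Sum>i<n. (exc 0 K (?x i w))^2) - \<mu> * (c n - c 0))) \<in> LA"
        using exL by (intro cyl_max cyl_const cyl_diff cyl_sum) auto
      show "(%w. max 0 (P n w) + (\<Sum>i<n. ?e i w)) \<in> LA" by (intro cyl_add PnL sL)
      fix w
      have "(\<Sum>i<n. (exc 0 K (?x i w))^2) - \<mu> * (c n - c 0) = (\<Sum>i<n. (exc 0 K (?x i w))^2 - \<mu> * ?\<Delta> i)"
        by (subst sum_subtractf) (simp only: tel[symmetric] sum_distrib_left)
      also have "... <= (\<Sum>i<n. Z i (?x i w) + ?e i w)"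
      proof (rule sum_mono)
        fix i assume "i \<in> {..<n}"
        then have "0 <= R * sqrt (?\<Delta> i)" using R cm by simp
        from exc_sq_truncate[OF this K, of "?x i w"]
        show "(exc 0 K (?x i w))^2 - \<mu> * ?\<Delta> i <= Z i (?x i w) + ?e i w" unfolding Z_def by linarith
      qed
      also have "... = P n w + (\<Sum>i<n. ?e i w)" by (simp add: P_def sum.distrib)
      finally have "(\<Sum>i<n. (exc 0 K (?x i w))^2) - \<mu> * (c n - c 0) <= P n w + (\<Sum>i<n. ?e i w)" .
      moreover have "0 <= (\<Sum>i<n. ?e i w)" by (intro sum_nonneg) auto
      moreover have "max 0 y <= max 0 p + s" if "y <= p + s" "0 <= s" for y p s :: real using that by auto
      ultimately show "max 0 ((\<Sum>i<n. (exc 0 K (?x i w))^2) - \<mu> * (c n - c 0)) <= max 0 (P n w) + (\<Sum>i<n. ?e i w)" by blast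
    qed
    also have "... <= E (%w. max 0 (P n w)) + E (%w. \<Sum>i<n. ?e i w)" by (rule E_add[OF PnL sL])
    finally show "E (%w. max 0 ((\<Sum>i<n. (exc 0 K (?x i w))^2) - \<mu> * (c n - c 0))) <=
      4 * eps * (c n - c 0) + M * sqrt (h * (c n - c 0))" using 1 2 by linarith
  qed
qed

abbreviation \<kappa> :: "real^'d => real" where "\<kappa> a \<equiv> (norm a + 1)^2 * \<mu>"

lemma \<kappa>0: "0 <= \<kappa> a" using \<mu>(1) by simp

lemma bt_inc: "0 <= r ==> r <= r' ==> nE E 2 (%w. bt a r' k w - bt a r k w) <= sqrt (\<kappa> a * (r' - r))"
  by (rule real_le_rsqrt[OF bt_inc_sq])

text \<open>A truncation level whose error is at most \<open>1/(m+1)\<close> at all times of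
  \<open>[0,T]\<close>. It lets the values held by \<open>step_B\<close> on a grid of
  \<open>m + 1\<close> intervals be bounded variables that do not depend on
  \<open>k\<close>.\<close>

definition level :: "real^'d => nat => nat" where
  "level a m = (SOME K. \<forall>r\<in>{0..T}. \<forall>k\<ge>K. nE E 2 (%w. bt a r K w - bt a r k w) <= 1 / real (Suc m))"

lemma level: assumes "r \<in> {0..T}" "level a m <= k"
  shows "nE E 2 (%w. bt a r (level a m) w - bt a r k w) <= 1 / real (Suc m)"
proof -
  have "1 / real (Suc m) > 0" by simp
  from bt_tail[OF this T0, of a]
  have "\<exists>K. \<forall>r\<in>{0..T}. \<forall>k\<ge>K. nE E 2 (%w. bt a r K w - bt a r k w) <= 1 / real (Suc m)" by blast
  from someI_ex[OF this] show ?thesis using assms unfolding level_def by blast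
qed

abbreviation ugrid :: "nat => nat => real" where "ugrid m i \<equiv> real i * T / real (Suc m)"

lemma ugrid: "grid T (Suc m) (ugrid m)" by (rule uniform_grid) simp

lemma ugrid_step: "ugrid m (Suc i) - ugrid m i = T / real (Suc m)"
proof -
  have "real (Suc i) * T - real i * T = T" by (simp add: algebra_simps)
  then show ?thesis by (simp only: diff_divide_distrib[symmetric])
qed

definition step_B :: "real^'d => nat => ('d, real) simple_process" where
  "step_B a m = (Suc m, ugrid m, %i. bt a (ugrid m i) (level a m))"

lemma step_B_SP: "step_B a m \<in> SP"
  unfolding step_B_def by (rule sp_I[OF ugrid bt_cyl]) (use T0 in simp)

lemma B_dir_ld:
  assumes st: "0 <= s" "s <= t" "t <= T"
  shows "ld 2 (B_dir E T a s) (B_dir E T a t) <= sqrt (\<kappa> a * (t - s))"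
proof -
  have r: "s \<in> {0..T}" "t \<in> {0..T}" using st by auto
  have "(%k. nE E 2 (%w. bt a s k w - bt a t k w)) ----> ld 2 (B_dir E T a s) (B_dir E T a t)"
    by (rule ld_lim[OF p12_2 repsD(1)[OF B_dir_reps r(1)] repsD(1)[OF B_dir_reps r(2)] repsD(2)[OF B_dir_reps r(1)] repsD(2)[OF B_dir_reps r(2)]])
  then show ?thesis
  proof (rule LIMSEQ_le_const2)
    have "nE E 2 (%w. bt a s k w - bt a t k w) <= sqrt (\<kappa> a * (t - s))" for k
      using bt_inc[OF st(1,2), of a k] nE_minus_commute[of 2 "bt a s k" "bt a t k"] by simp
    then show "\<exists>N. \<forall>k\<ge>N. nE E 2 (%w. bt a s k w - bt a t k w) <= sqrt (\<kappa> a * (t - s))" by blast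
  qed
qed

lemma divide_Suc_null: "(%m. c / real (Suc m)) ----> 0"
  using tendsto_mult_right_zero[OF LIMSEQ_inverse_real_of_nat, of c] by (simp add: divide_inverse)

lemma step_B_approx: "mg_bar_approx E T 2 (step_B a) (B_dir E T a)"
proof (rule mg_bar_approxI[OF p12_2 step_B_SP repsD(1)[OF B_dir_reps]])
  let ?e = "%m. 1 / real (Suc m) + sqrt (\<kappa> a * (T / real (Suc m)))"
  show "ld 2 (pem 2 (step_B a m) t) (B_dir E T a t) powr 2 <= (?e m)^2" if t: "0 <= t" "t < T" for m t
  proof -
    obtain i where i: "i < Suc m" "ugrid m i <= t" "t < ugrid m (Suc i)" using grid_find[OF ugrid t] by blast
    let ?r = "ugrid m i"
    have r: "?r \<in> {0..T}" "t \<in> {0..T}" "0 <= ?r" using grid_range[OF ugrid, of i m] i(1) t by auto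
    have wt: "bt a ?r (level a m) \<in> cyl {0..T}" by (rule Lip_cyl[OF r(1) bt_cyl[OF r(3)]])
    note L = emb_in(1)[OF p12_2 wt] repsD(1)[OF B_dir_reps[of a] r(1)] repsD(1)[OF B_dir_reps[of a] r(2)]
    have "(%k. nE E 2 (%w. bt a ?r (level a m) w - bt a ?r k w)) ----> ld 2 (emb 2 (bt a ?r (level a m))) (B_dir E T a ?r)"
      by (rule ld_lim[OF p12_2 L(1,2) emb_in(2)[OF p12_2 wt] repsD(2)[OF B_dir_reps r(1)]])
    then have 1: "ld 2 (emb 2 (bt a ?r (level a m))) (B_dir E T a ?r) <= 1 / real (Suc m)"
      by (rule LIMSEQ_le_const2) (use level[OF r(1), of a m] in blast)
    have "ld 2 (B_dir E T a ?r) (B_dir E T a t) <= sqrt (\<kappa> a * (t - ?r))" using r i t by (intro B_dir_ld) auto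
    also have "... <= sqrt (\<kappa> a * (T / real (Suc m)))"
      using ugrid_step[of i m] i \<kappa>0 by (intro real_sqrt_le_mono mult_left_mono) linarith+
    finally have "ld 2 (emb 2 (bt a ?r (level a m))) (B_dir E T a t) <= ?e m"
      using ld_tri[OF p12_2 L] 1 by linarith
    moreover have "process_at (step_B a m) t = bt a ?r (level a m)"
      unfolding step_B_def by (rule process_at_in[OF ugrid i])
    ultimately show ?thesis using ld_nonneg[OF p12_2 L(1,3)] by (simp add: power_mono)
  qed
  show "SI (%t. (?e m)^2)" for m by (rule SI_const(1))
  have "(%m. sqrt (\<kappa> a * (T / real (Suc m)))) ----> sqrt (\<kappa> a * 0)"
    by (intro tendsto_real_sqrt tendsto_mult tendsto_const divide_Suc_null)
  then have "(%m. ?e m) ----> 0" using tendsto_add[OF divide_Suc_null[of 1]] by fastforce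
  then have "(%m. (?e m)^2 * T) ----> 0\<^sup>2 * T" by (intro tendsto_intros)
  then show "(%m. LI (%t. (?e m)^2)) ----> 0" by (simp add: SI_const(2))
qed

lemma B_dir_MG_bar: "B_dir E T a \<in> MG_bar E T 2"
  unfolding MG_bar_def using step_B_approx repsD(1)[OF B_dir_reps] by blast

text \<open>Compares the left values of the truncated process with those held by
  \<open>step_B\<close>. A level error \<open>1/(m+1)\<close> times the size of an increment, summed
  over \<open>m + 1\<close> intervals, gives the second term; the first comes from the one interval
  cut by \<open>s\<close>.\<close>

lemma riemann_error:
  assumes st: "0 <= s" "s <= t" "t <= T" and k: "level a m <= k"
  shows "nE E 1 (%w. \<Sum>i<Suc m. (bt a (clip s t (ugrid m i)) k w - bt a (ugrid m i) (level a m) w) *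
      (bt a (clip s t (ugrid m (Suc i))) k w - bt a (clip s t (ugrid m i)) k w)) <=
    \<kappa> a * (T / real (Suc m)) + sqrt (\<kappa> a * (T / real (Suc m)))"
proof -
  let ?\<tau> = "ugrid m" and ?c = "%i. clip s t (ugrid m i)" and ?h = "T / real (Suc m)"
  let ?x = "%i w. bt a (?c i) k w - bt a (?\<tau> i) (level a m) w" and ?d = "%i w. bt a (?c (Suc i)) k w - bt a (?c i) k w"
  \<comment> \<open>Only on the grid interval that contains \<open>s\<close> does the projected left
    endpoint of a nondegenerate interval differ from the grid point. The difference of consecutive
    \<open>?b\<close> marks this interval, and its sum telescopes to at most
    \<open>1\<close>.\<close>
  let ?b = "%i. of_bool (?\<tau> i < s) :: real"
  have c0: "0 <= ?c i" for i using clip_in[OF st(2), of "?\<tau> i"] st(1) by auto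
  have t0: "0 <= ?\<tau> i" for i using T0 by simp
  have L: "?x i \<in> LA" "?d i \<in> LA" for i by (intro cyl_diff bt_LA c0 t0)+
  have h0: "0 <= \<kappa> a * ?h" using \<kappa>0 T0 by simp
  have tm: "nE E 1 (%w. ?x i w * ?d i w) <= (?b i - ?b (Suc i)) * (\<kappa> a * ?h) + 1 / real (Suc m) * sqrt (\<kappa> a * ?h)" if i: "i < Suc m" for i
  proof -
    have le: "?\<tau> i <= ?\<tau> (Suc i)" using ugrid_step[of i m] T0 by (smt (verit) divide_nonneg_nonneg of_nat_0_le_iff)
    have cle: "?c i <= ?c (Suc i)" by (rule clip_mono[OF le])
    have p: "nE E 1 (%w. ?x i w * ?d i w) <= nE E 2 (?x i) * nE E 2 (?d i)"
      by (rule nE_1_mult[OF L cyl_mult[OF L]]) (simp add: abs_mult)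
    have b: "0 <= ?b i - ?b (Suc i)" using le by auto
    show ?thesis
    proof (cases "?c i = ?c (Suc i)")
      case True
      then have "nE E 2 (?d i) = 0" by (simp add: nE_const[OF p12_2])
      moreover have "0 <= (?b i - ?b (Suc i)) * (\<kappa> a * ?h) + 1 / real (Suc m) * sqrt (\<kappa> a * ?h)"
        by (intro add_nonneg_nonneg mult_nonneg_nonneg[OF b h0] mult_nonneg_nonneg[OF _ real_sqrt_ge_zero[OF h0]]) simp
      ultimately show ?thesis using p by simp
    next
      case False
      then have lt: "?c i < ?c (Suc i)" using cle by simp
      have cm: "?c i = max s (?\<tau> i)" "s < ?\<tau> (Suc i)" using lt le by (auto simp: clip_def max_def min_def split: if_splits)
      have dh: "?c (Suc i) - ?c i <= ?h" using clip_diff_le[OF le st(2)] ugrid_step[of i m] by simp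
      have "nE E 2 (?d i) <= sqrt (\<kappa> a * (?c (Suc i) - ?c i))" by (rule bt_inc[OF c0 cle])
      also have "... <= sqrt (\<kappa> a * ?h)" using dh \<kappa>0 by (intro real_sqrt_le_mono mult_left_mono)
      finally have d: "nE E 2 (?d i) <= sqrt (\<kappa> a * ?h)" .
      have \<tau>T: "?\<tau> i \<in> {0..T}" using grid_range[OF ugrid, of i m] i by auto
      have lv: "nE E 2 (%w. bt a (?\<tau> i) k w - bt a (?\<tau> i) (level a m) w) <= 1 / real (Suc m)"
        using level[OF \<tau>T k] nE_minus_commute[of 2 "bt a (?\<tau> i) k" "bt a (?\<tau> i) (level a m)"] by simp
      have x: "nE E 2 (?x i) <= (?b i - ?b (Suc i)) * sqrt (\<kappa> a * ?h) + 1 / real (Suc m)"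
      proof (cases "?\<tau> i < s")
        case True
        then have c: "?c i = s" using cm by simp
        have x1: "nE E 2 (?x i) <= nE E 2 (%w. bt a s k w - bt a (?\<tau> i) k w) + nE E 2 (%w. bt a (?\<tau> i) k w - bt a (?\<tau> i) (level a m) w)"
          unfolding c by (intro nE_triangle_diff bt_LA t0 st(1) p12_simps)
        have x2: "nE E 2 (%w. bt a s k w - bt a (?\<tau> i) k w) <= sqrt (\<kappa> a * (s - ?\<tau> i))" using True by (intro bt_inc t0) simp
        have x3: "sqrt (\<kappa> a * (s - ?\<tau> i)) <= sqrt (\<kappa> a * ?h)"
          using cm(2) ugrid_step[of i m] \<kappa>0 by (intro real_sqrt_le_mono mult_left_mono) linarith+
        have x4: "?b i - ?b (Suc i) = 1" using True cm(2) by simp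
        show ?thesis unfolding x4 mult_1 using x1 x2 x3 lv by linarith
      next
        case False
        then have y: "?c i = ?\<tau> i" "?b i - ?b (Suc i) = 0" using cm by auto
        show ?thesis unfolding y mult_zero_left add_0 using lv .
      qed
      have "nE E 2 (?x i) * nE E 2 (?d i) <= ((?b i - ?b (Suc i)) * sqrt (\<kappa> a * ?h) + 1 / real (Suc m)) * sqrt (\<kappa> a * ?h)"
        by (intro mult_mono[OF x d] add_nonneg_nonneg mult_nonneg_nonneg[OF b] nE_nonneg real_sqrt_ge_zero h0) simp
      also have "... = (?b i - ?b (Suc i)) * (sqrt (\<kappa> a * ?h) * sqrt (\<kappa> a * ?h)) + 1 / real (Suc m) * sqrt (\<kappa> a * ?h)"
        by (simp only: distrib_right mult.assoc)
      also have "sqrt (\<kappa> a * ?h) * sqrt (\<kappa> a * ?h) = \<kappa> a * ?h" using h0 by (rule real_sqrt_mult_self[THEN trans, OF abs_of_nonneg])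
      finally show ?thesis using p by linarith
    qed
  qed
  have "nE E 1 (%w. \<Sum>i<Suc m. ?x i w * ?d i w) <= (\<Sum>i<Suc m. nE E 1 (%w. ?x i w * ?d i w))"
    by (intro nE_sum cyl_mult L p12_simps finite_lessThan)
  also have "... <= (\<Sum>i<Suc m. (?b i - ?b (Suc i)) * (\<kappa> a * ?h) + 1 / real (Suc m) * sqrt (\<kappa> a * ?h))"
    by (intro sum_mono tm) simp
  also have "... = (\<Sum>i<Suc m. ?b i - ?b (Suc i)) * (\<kappa> a * ?h) + real (Suc m) * (1 / real (Suc m) * sqrt (\<kappa> a * ?h))"
    by (simp only: sum.distrib sum_distrib_right sum_constant card_lessThan)
  also have "(\<Sum>i<Suc m. ?b i - ?b (Suc i)) = ?b 0 - ?b (Suc m)" by (rule sum_lessThan_telescope')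
  also have "real (Suc m) * (1 / real (Suc m) * sqrt (\<kappa> a * ?h)) = sqrt (\<kappa> a * ?h)" by simp
  also have "(?b 0 - ?b (Suc m)) * (\<kappa> a * ?h) <= 1 * (\<kappa> a * ?h)" by (rule mult_right_mono[OF _ h0]) simp
  finally show ?thesis by simp
qed

text \<open>An increment of the quadratic variation is a sum of squared increments of
  \<open>B\<close> over a grid, plus twice a Riemann error and twice the error of the simple
  integral. The first is controlled by \<open>exc_lln\<close>; the other two vanish as the grid is
  refined.\<close>

lemma quad_var_lip: "lip_integrator (quad_var E T a) (\<kappa> a)"
proof -
  let ?\<alpha> = "norm a + 1"
  let ?A = "B_dir E T a"
  let ?V = "%r. integral_upto E T 2 ?A r (mg_incl E T 2 ?A)"
  let ?I = "%m r. integral_simple E T 2 ?A r (step_B a m)"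
  note g = bt_good[where 'v=real, of a]
  have VL: "?V r \<in> LGs 2" "(%m. ld 2 (?I m r) (?V r)) ----> 0" "adapted r (?V r)" if r: "r \<in> {0..T}" for r
  proof -
    show V: "?V r \<in> LGs 2" "(%m. ld 2 (?I m r) (?V r)) ----> 0"
      using integral_upto_limit[OF g p12_2 MG_barD[OF B_dir_MG_bar] step_B_approx r] by blast+
    \<comment> \<open>\<open>integral_upto\<close> is defined without reference to adaptedness; the
      version \<open>L2int\<close> has it, and \<open>inc_inj\<close> identifies the two.\<close>
    let ?J = "L2int (%(\<eta> :: ('d, real) simple_process) t. cls 2 (isum (bt a) 0 t \<eta>)) ?A r"
    have "inc ?J = inc (?V r)" by (rule inc_L2int[OF g p12_2 B_dir_MG_bar r]) simp
    then have "?J = ?V r" using L2int(1)[OF g B_dir_MG_bar[of a] r] V(1) by (rule inc_inj[rotated 2])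
    then show "adapted r (?V r)" using L2int(2)[OF g B_dir_MG_bar[of a] r] by simp
  qed
  have "\<forall>r\<in>{0..T}. \<exists>v. v \<in> ?V r \<and> (\<forall>k. v k \<in> cyl {0..r})" using VL(3) unfolding adapted_def by blast
  from bchoice[OF this] obtain v where v: "!!r. r \<in> {0..T} ==> v r \<in> ?V r" "!!r k. r \<in> {0..T} ==> v r k \<in> cyl {0..r}" by blast
  define q where "q r k w = (bt a r k w)^2 - 2 * v r k w" for r k w
  have f2: "fadm (%w y. 2 * y :: real) 2"
  proof (rule fadm_lipschitz)
    show "norm (2 * x - 2 * y) <= 2 * norm (x - y)" for x y :: real by (simp add: abs_le_iff abs_if)
  qed simp
  have reps: "reps 1 (quad_var E T a) q"
    unfolding reps_def
  proof (intro ballI conjI allI)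
    fix r assume r: "r \<in> {0..T}"
    have sq: "B_dir_sq E T a r = cls 1 (%k w. (bt a r k w)^2)" by (simp add: B_dir_sq_def bt_def)
    note S = cls_in[OF p12_1 CS_sq[OF bt_CS[OF r, of a]], folded sq]
    have le: "(1::real) <= 2" by simp
    note M = lg_map_rep[OF f2 p12_1 p12_2 le VL(1)[OF r] v(1)[OF r]]
    show "quad_var E T a r \<in> LGs 1" "q r \<in> quad_var E T a r"
      using lg_diff_rep[OF p12_1 S(1) M(1) S(2) M(2)] by (simp_all add: quad_var_def q_def[abs_def])
    fix k show "q r k \<in> cyl {0..r}" unfolding q_def[abs_def]
      using r by (intro cyl_diff cyl_power2 cyl_mult cyl_const bt_cyl v(2)) auto
  qed
  have "(%k. E (%w. max 0 (\<bar>q t k w - q s k w\<bar> - \<kappa> a * (t - s)))) ----> 0" if st: "0 <= s" "s <= t" "t <= T" for s t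
  proof (rule LIMSEQ_I)
    fix eps :: real assume e: "eps > 0"
    have sT: "s \<in> {0..T}" "t \<in> {0..T}" using st by auto
    have \<alpha>: "?\<alpha> > 0" using norm_ge_zero[of a] by linarith
    \<comment> \<open>Makes the first error term of \<open>exc_lln\<close>, after multiplication by
      the square of \<open>norm a + 1\<close>, equal to \<open>eps / 8\<close> at length
      \<open>T\<close>.\<close>
    define e1 where "e1 = eps / (32 * ?\<alpha>\<^sup>2 * T)"
    have e1: "e1 > 0" "?\<alpha>\<^sup>2 * (4 * e1 * T) = eps / 8" using e \<alpha> T0 by (auto simp: e1_def)
    obtain M where M: "M \<ge> 0" "!!c n K h. 0 <= c 0 ==> (!!i. i < n ==> c i <= c (Suc i) \<and> c (Suc i) - c i <= h) ==> 0 <= K ==>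
      E (%w. max 0 ((\<Sum>i<n. (exc 0 K (B (c (Suc i)) w - B (c i) w :: real^'d))^2) - \<mu> * (c n - c 0))) <=
      4 * e1 * (c n - c 0) + M * sqrt (h * (c n - c 0))" using exc_lln[OF e1(1)] by blast
    let ?h = "%m. T / real (Suc m)"
    let ?D = "%m. ld 2 (?I m t) (?V t) + ld 2 (?I m s) (?V s)"
    define G where "G m = ?\<alpha>\<^sup>2 * (M * sqrt (?h m * T)) + 2 * (\<kappa> a * ?h m + sqrt (\<kappa> a * ?h m)) + 2 * ?D m" for m
    have "(%m. ?\<alpha>\<^sup>2 * (M * sqrt (?h m * T)) + 2 * (\<kappa> a * ?h m + sqrt (\<kappa> a * ?h m)) + 2 * ?D m) ---->
       ?\<alpha>\<^sup>2 * (M * sqrt (0 * T)) + 2 * (\<kappa> a * 0 + sqrt (\<kappa> a * 0)) + 2 * (0 + 0)"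
      by (intro tendsto_add tendsto_mult tendsto_const tendsto_real_sqrt divide_Suc_null VL(2) sT)
    then have "G ----> 0" unfolding G_def[abs_def] by simp
    \<comment> \<open>The grid is fixed here, through \<open>m\<close>; only afterwards does the
      level \<open>k\<close> of the representing sequences tend to infinity.\<close>
    from null_seq_less[OF this, of "eps / 8"] e obtain m where m: "G m < eps / 8" by auto
    let ?c = "%i. clip s t (ugrid m i)" and ?n = "Suc m"
    let ?X = "%k i w. bt a (?c (Suc i)) k w - bt a (?c i) k w"
    let ?S = "%k w. \<Sum>i<?n. (exc 0 (2 * real k) (B (?c (Suc i)) w - B (?c i) w :: real^'d))^2"
    let ?R = "%k w. \<Sum>i<?n. (bt a (?c i) k w - bt a (ugrid m i) (level a m) w) * ?X k i w"
    let ?Q = "%k w. isum (bt a) s t (step_B a m) k w - (v t k w - v s k w)"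
    have le: "ugrid m i <= ugrid m (Suc i)" for i using T0 by (intro divide_right_mono mult_right_mono) auto
    have cn: "?c 0 = s" "?c ?n = t" using st T0 by (auto simp: clip_def)
    have c0: "0 <= ?c i" for i using clip_in[OF st(2), of "ugrid m i"] st(1) by auto
    have t0: "0 <= ugrid m i" for i using T0 by simp
    have SL: "?S k \<in> LA" for k by (intro cyl_sum cyl_power2 exc_incr_LA c0) simp
    have mL: "(%w. max 0 (?S k w - \<mu> * (t - s))) \<in> LA" for k by (intro cyl_max cyl_const cyl_diff SL)
    have RL: "?R k \<in> LA" for k by (intro cyl_sum cyl_mult cyl_diff bt_LA c0 t0)
    have vL: "v t k \<in> LA" "v s k \<in> LA" for k using v(2)[OF sT(1)] v(2)[OF sT(2)] cyl_LA by auto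
    have iL: "isum (bt a) s t (step_B a m) k \<in> LA" for k
      by (rule cyl_LA[OF isum_adapted[OF bt_cyl step_B_SP st]]) simp
    have i0L: "isum (bt a) 0 r (step_B a m) k \<in> LA" if "r \<in> {0..T}" for r k
      by (rule cyl_LA[OF isum_adapted[OF bt_cyl step_B_SP]]) (use that in auto)
    have QL: "?Q k \<in> LA" for k by (intro cyl_diff iL vL)
    have LLN: "E (%w. max 0 (?S k w - \<mu> * (t - s))) <= 4 * e1 * T + M * sqrt (?h m * T)" for k
    proof -
      have "E (%w. max 0 (?S k w - \<mu> * (?c ?n - ?c 0))) <= 4 * e1 * (?c ?n - ?c 0) + M * sqrt (?h m * (?c ?n - ?c 0))"
        using clip_mono[OF le] clip_diff_le[OF le st(2)] ugrid_step[of _ m] c0[of 0] by (intro M(2)) auto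
      also have "... <= 4 * e1 * T + M * sqrt (?h m * T)"
        unfolding cn using st e1(1) M(1) T0 by (intro add_mono mult_left_mono real_sqrt_le_mono) auto
      finally show ?thesis unfolding cn .
    qed
    have point: "max 0 (\<bar>q t k w - q s k w\<bar> - \<kappa> a * (t - s)) <=
        ?\<alpha>\<^sup>2 * max 0 (?S k w - \<mu> * (t - s)) + (2 * \<bar>?R k w\<bar> + 2 * \<bar>?Q k w\<bar>)" for k w
    proof -
      define W where "W = (\<Sum>i<?n. (?X k i w)^2)"
      have W0: "0 <= W" unfolding W_def by (intro sum_nonneg) auto
      \<comment> \<open>Summation of \<open>y^2 - x^2 = (y - x)^2 + 2 x (y - x)\<close> over the
        projected grid. Replacing \<open>x\<close> by the value that \<open>step_B\<close> holds
        splits the last term into the Riemann error and the simple integral.\<close>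
      have "(bt a t k w)^2 - (bt a s k w)^2 = (\<Sum>i<?n. (bt a (?c (Suc i)) k w)^2 - (bt a (?c i) k w)^2)"
        unfolding sum_lessThan_telescope[of "%i. (bt a (?c i) k w)^2"] cn ..
      also have "... = (\<Sum>i<?n. (?X k i w)^2 + (2 * ((bt a (?c i) k w - bt a (ugrid m i) (level a m) w) * ?X k i w) + 2 * (?X k i w * bt a (ugrid m i) (level a m) w)))"
        by (rule sum.cong[OF refl]) (simp add: power2_eq_square algebra_simps)
      also have "... = W + (2 * ?R k w + 2 * isum (bt a) s t (step_B a m) k w)"
        by (simp only: sum.distrib sum_distrib_left[symmetric] W_def step_B_def isum_eq real_scaleR_def)
      finally have id: "q t k w - q s k w = W + (2 * ?R k w + 2 * ?Q k w)" by (simp add: q_def algebra_simps)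
      have "W <= (\<Sum>i<?n. ?\<alpha>\<^sup>2 * (exc 0 (2 * real k) (B (?c (Suc i)) w - B (?c i) w :: real^'d))^2)"
        unfolding W_def
      proof (rule sum_mono)
        fix i
        have "\<bar>?X k i w\<bar>\<^sup>2 <= (?\<alpha> * exc 0 (2 * real k) (B (?c (Suc i)) w - B (?c i) w))^2" by (intro power_mono bt_diff_le) auto
        then show "(?X k i w)^2 <= ?\<alpha>\<^sup>2 * (exc 0 (2 * real k) (B (?c (Suc i)) w - B (?c i) w :: real^'d))^2" by (simp add: power_mult_distrib)
      qed
      then have "W - \<kappa> a * (t - s) <= ?\<alpha>\<^sup>2 * (?S k w - \<mu> * (t - s))" by (simp add: sum_distrib_left[symmetric] right_diff_distrib)
      also have "... <= ?\<alpha>\<^sup>2 * max 0 (?S k w - \<mu> * (t - s))" by (intro mult_left_mono) auto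
      finally have Wle: "W - \<kappa> a * (t - s) <= ?\<alpha>\<^sup>2 * max 0 (?S k w - \<mu> * (t - s))" .
      have pos: "0 <= ?\<alpha>\<^sup>2 * max 0 (?S k w - \<mu> * (t - s))" by simp
      have "max 0 (\<bar>wt + (2 * r + 2 * y)\<bar> - x) <= z + (2 * \<bar>r\<bar> + 2 * \<bar>y\<bar>)" if "0 <= wt" "wt - x <= z" "0 <= z" for wt r y x z :: real
        using that by (auto simp: abs_le_iff)
      from this[OF W0 Wle pos, of "?R k w" "?Q k w"] show ?thesis unfolding id .
    qed
    have qL: "q r k \<in> LA" if "r \<in> {0..T}" for r k using cyl_LA[OF repsD(3)[OF reps that]] .
    have Eb: "E (%w. max 0 (\<bar>q t k w - q s k w\<bar> - \<kappa> a * (t - s))) <=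
        ?\<alpha>\<^sup>2 * (4 * e1 * T + M * sqrt (?h m * T)) + (2 * nE E 1 (?R k) + 2 * nE E 1 (?Q k))" for k
    proof -
      have "E (%w. max 0 (\<bar>q t k w - q s k w\<bar> - \<kappa> a * (t - s))) <=
          E (%w. ?\<alpha>\<^sup>2 * max 0 (?S k w - \<mu> * (t - s)) + (2 * \<bar>?R k w\<bar> + 2 * \<bar>?Q k w\<bar>))"
      proof (rule E_mono[OF _ _ point])
        show "(%w. max 0 (\<bar>q t k w - q s k w\<bar> - \<kappa> a * (t - s))) \<in> LA"
          by (intro cyl_max cyl_const cyl_diff cyl_abs qL sT)
        show "(%w. ?\<alpha>\<^sup>2 * max 0 (?S k w - \<mu> * (t - s)) + (2 * \<bar>?R k w\<bar> + 2 * \<bar>?Q k w\<bar>)) \<in> LA"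
          by (rule cyl_add[OF cyl_mult[OF cyl_const mL] cyl_add[OF cyl_mult[OF cyl_const cyl_abs[OF RL]] cyl_mult[OF cyl_const cyl_abs[OF QL]]]])
      qed
      also have "... <= E (%w. ?\<alpha>\<^sup>2 * max 0 (?S k w - \<mu> * (t - s))) + E (%w. 2 * \<bar>?R k w\<bar> + 2 * \<bar>?Q k w\<bar>)"
        by (rule E_add[OF cyl_mult[OF cyl_const mL] cyl_add[OF cyl_mult[OF cyl_const cyl_abs[OF RL]] cyl_mult[OF cyl_const cyl_abs[OF QL]]]])
      also have "E (%w. 2 * \<bar>?R k w\<bar> + 2 * \<bar>?Q k w\<bar>) <= E (%w. 2 * \<bar>?R k w\<bar>) + E (%w. 2 * \<bar>?Q k w\<bar>)"
        by (rule E_add[OF cyl_mult[OF cyl_const cyl_abs[OF RL]] cyl_mult[OF cyl_const cyl_abs[OF QL]]])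
      also have "E (%w. 2 * \<bar>?R k w\<bar>) = 2 * nE E 1 (?R k)" using E_scale[OF cyl_abs[OF RL[of k]], of 2] nE_1_LA[OF RL[of k]] by simp
      also have "E (%w. 2 * \<bar>?Q k w\<bar>) = 2 * nE E 1 (?Q k)" using E_scale[OF cyl_abs[OF QL[of k]], of 2] nE_1_LA[OF QL[of k]] by simp
      also have "E (%w. ?\<alpha>\<^sup>2 * max 0 (?S k w - \<mu> * (t - s))) = ?\<alpha>\<^sup>2 * E (%w. max 0 (?S k w - \<mu> * (t - s)))"
        by (rule E_scale[OF mL]) simp
      also have "... <= ?\<alpha>\<^sup>2 * (4 * e1 * T + M * sqrt (?h m * T))" by (rule mult_left_mono[OF LLN]) simp
      finally show ?thesis by simp
    qed
    have iI: "(%k. nE E 2 (%w. isum (bt a) 0 r (step_B a m) k w - v r k w)) ----> ld 2 (?I m r) (?V r)" if r: "r \<in> {0..T}" for r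
      by (rule ld_lim[OF p12_2 integral_simple_rep(1)[OF p12_2 B_dir_reps step_B_SP r] VL(1)[OF r]
            integral_simple_rep(2)[OF p12_2 B_dir_reps step_B_SP r] v(1)[OF r]])
    have Qle: "nE E 1 (?Q k) <= nE E 2 (%w. isum (bt a) 0 t (step_B a m) k w - v t k w) + nE E 2 (%w. isum (bt a) 0 s (step_B a m) k w - v s k w)" for k
    proof -
      let ?x = "%w. isum (bt a) 0 t (step_B a m) k w - v t k w" and ?y = "%w. isum (bt a) 0 s (step_B a m) k w - v s k w"
      have xL: "?x \<in> LA" "?y \<in> LA" by (intro cyl_diff i0L vL sT)+
      have "nE E 1 (?Q k) <= nE E 2 (?Q k)" by (rule nE_1_le_2[OF QL])
      also have "nE E 2 (?Q k) = nE E 2 (%w. ?x w + - ?y w)"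
        by (rule arg_cong[where f="nE E 2"]) (use isum_split[OF step_B_SP st(1,2), of "bt a" a m k] in \<open>auto simp: algebra_simps\<close>)
      also have "nE E 2 (%w. ?x w + - ?y w) <= nE E 2 ?x + nE E 2 (%w. - ?y w)" by (intro nE_triangle xL cyl_uminus p12_simps)
      also have "nE E 2 (%w. - ?y w) = nE E 2 ?y" by (rule nE_minus)
      finally show ?thesis by simp
    qed
    have "(%k. nE E 2 (%w. isum (bt a) 0 t (step_B a m) k w - v t k w) + nE E 2 (%w. isum (bt a) 0 s (step_B a m) k w - v s k w)) ----> ?D m"
      by (intro tendsto_add iI sT)
    then have "\<forall>\<^sub>F k in sequentially. nE E 2 (%w. isum (bt a) 0 t (step_B a m) k w - v t k w) + nE E 2 (%w. isum (bt a) 0 s (step_B a m) k w - v s k w) < ?D m + eps / 8"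
      using e by (intro order_tendstoD(2)) auto
    then obtain k0 where k0: "!!k. k \<ge> k0 ==> nE E 1 (?Q k) < ?D m + eps / 8"
      using Qle le_less_trans unfolding eventually_sequentially by blast
    have "norm (E (%w. max 0 (\<bar>q t k w - q s k w\<bar> - \<kappa> a * (t - s))) - 0) < eps" if k: "k \<ge> max k0 (level a m)" for k
    proof -
      have r: "nE E 1 (?R k) <= \<kappa> a * ?h m + sqrt (\<kappa> a * ?h m)" using k by (intro riemann_error[OF st]) simp
      have "0 <= E (%w. max 0 (\<bar>q t k w - q s k w\<bar> - \<kappa> a * (t - s)))"
        by (rule E_nonneg) (auto intro!: cyl_max cyl_const cyl_diff cyl_abs qL sT)
      moreover have "E (%w. max 0 (\<bar>q t k w - q s k w\<bar> - \<kappa> a * (t - s))) < eps"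
        using Eb[of k] r k0[of k] k m e e1(2) unfolding G_def distrib_left[of "?\<alpha>\<^sup>2"] by simp
      ultimately show ?thesis by simp
    qed
    then show "\<exists>N. \<forall>k\<ge>N. norm (E (%w. max 0 (\<bar>q t k w - q s k w\<bar> - \<kappa> a * (t - s))) - 0) < eps" by blast
  qed
  then show ?thesis unfolding lip_integrator_def using \<kappa>0 reps by blast
qed
end

context sublinear_T
begin

lemma lip_integrator_diff:
  assumes "lip_integrator A C" "lip_integrator A' C'"
  shows "lip_integrator (%t. lg_map E T 1 (%w y. y / 4) (lg_diff E T 1 (A t) (A' t))) ((C + C') / 4)"
proof -
  obtain x where C: "0 <= C" and x: "reps 1 A x" "!!s t. 0 <= s ==> s <= t ==> t <= T ==>
     (%k. E (%w. max 0 (\<bar>x t k w - x s k w\<bar> - C * (t - s)))) ----> 0"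
    using assms(1) unfolding lip_integrator_def by blast
  obtain y where C': "0 <= C'" and y: "reps 1 A' y" "!!s t. 0 <= s ==> s <= t ==> t <= T ==>
     (%k. E (%w. max 0 (\<bar>y t k w - y s k w\<bar> - C' * (t - s)))) ----> 0"
    using assms(2) unfolding lip_integrator_def by blast
  define z where "z r k w = (x r k w - y r k w) / 4" for r k w
  have f: "fadm (%w y. y / 4 :: real) (1 / 4)"
  proof (rule fadm_lipschitz)
    show "norm (x / 4 - y / 4) <= 1 / 4 * norm (x - y)" for x y :: real by (simp add: abs_le_iff abs_if)
  qed simp
  have reps: "reps 1 (%t. lg_map E T 1 (%w y. y / 4) (lg_diff E T 1 (A t) (A' t))) z"
    unfolding reps_def
  proof (intro ballI conjI allI)
    fix r assume r: "r \<in> {0..T}"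
    note D = lg_diff_rep[OF p12_1 repsD(1)[OF x(1) r] repsD(1)[OF y(1) r] repsD(2)[OF x(1) r] repsD(2)[OF y(1) r]]
    show "lg_map E T 1 (%w y. y / 4) (lg_diff E T 1 (A r) (A' r)) \<in> LGs 1"
      "z r \<in> lg_map E T 1 (%w y. y / 4) (lg_diff E T 1 (A r) (A' r))"
      using lg_map_rep[OF f p12_1 p12_1 order_refl D] by (simp_all add: z_def[abs_def])
    fix k
    have "(%w. (1 / 4) * (x r k w - y r k w)) \<in> cyl {0..r}" by (intro cyl_mult cyl_const cyl_diff repsD(3)[OF x(1) r] repsD(3)[OF y(1) r])
    then show "z r k \<in> cyl {0..r}" by (simp add: z_def[abs_def])
  qed
  have "(%k. E (%w. max 0 (\<bar>z t k w - z s k w\<bar> - (C + C') / 4 * (t - s)))) ----> 0" if st: "0 <= s" "s <= t" "t <= T" for s t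
  proof -
    let ?X = "%k w. max 0 (\<bar>x t k w - x s k w\<bar> - C * (t - s))" and ?Y = "%k w. max 0 (\<bar>y t k w - y s k w\<bar> - C' * (t - s))"
    let ?Z = "%k w. max 0 (\<bar>z t k w - z s k w\<bar> - (C + C') / 4 * (t - s))"
    have sT: "s \<in> {0..T}" "t \<in> {0..T}" using st by auto
    have L: "x r k \<in> LA" "y r k \<in> LA" "z r k \<in> LA" if "r \<in> {0..T}" for r k
      using that repsD(3)[OF x(1)] repsD(3)[OF y(1)] repsD(3)[OF reps] cyl_LA by blast+
    have m: "?X k \<in> LA" "?Y k \<in> LA" "?Z k \<in> LA" for k by (intro cyl_max cyl_const cyl_diff cyl_abs L sT)+
    have le: "E (?Z k) <= E (?X k) + E (?Y k)" for k
    proof -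
      have "max 0 (\<bar>(a - b) / 4 - (c - d) / 4\<bar> - (C + C') / 4 * r) <= max 0 (\<bar>a - c\<bar> - C * r) + max 0 (\<bar>b - d\<bar> - C' * r)" for a b c d r
      proof -
        have m1: "(C + C') / 4 * r = C * r / 4 + C' * r / 4" by (simp add: algebra_simps)
        have m2: "\<bar>(a - b) / 4 - (c - d) / 4\<bar> <= (\<bar>a - c\<bar> + \<bar>b - d\<bar>) / 4"
        proof -
          have eq: "(a - b) / 4 - (c - d) / 4 = ((a - c) - (b - d)) / 4" by (simp add: diff_divide_distrib)
          show ?thesis unfolding eq abs_divide using abs_triangle_ineq4[of "a - c" "b - d"] by simp
        qed
        have m3: "max 0 (u - (x / 4 + y / 4)) <= max 0 (p - x) + max 0 (q - y)" if "u <= (p + q) / 4" for u x y p q :: real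
          using that by (auto simp: max_def field_simps)
        show ?thesis unfolding m1 by (rule m3[OF m2])
      qed
      then have "E (?Z k) <= E (%w. ?X k w + ?Y k w)" unfolding z_def by (intro E_mono cyl_add m[unfolded z_def])
      also have "... <= E (?X k) + E (?Y k)" by (rule E_add[OF m(1,2)])
      finally show ?thesis .
    qed
    have lim: "(%k. E (?X k) + E (?Y k)) ----> 0" by (intro tendsto_add_zero x(2) y(2) st)
    show ?thesis by (rule null_le[OF lim le E_nonneg[OF m(3)]]) simp
  qed
  then show ?thesis unfolding lip_integrator_def using C C' reps by auto
qed

lemma time_lip: "lip_integrator (time E T) 1"
proof -
  have "reps 1 (time E T) (%r k w. r)"
    unfolding reps_def time_def by (intro ballI conjI allI emb_in p12_simps cyl_const)
  then show ?thesis unfolding lip_integrator_def by (intro conjI exI[of _ "%r k w. r"]) (auto simp: E_const)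
qed
end

context brownian
begin

lemma mutual_var_lip: "lip_integrator (mutual_var E T a a') ((\<kappa> (a + a') + \<kappa> (a - a')) / 4)"
  using lip_integrator_diff[OF quad_var_lip[of "a + a'"] quad_var_lip[of "a - a'"]] by (simp add: mutual_var_def[abs_def])

end

section \<open>Distributions and coefficients\<close>

text \<open>The infimum in \<open>lip_const\<close> is itself a Lipschitz constant, because every
  difference quotient is a lower bound of the set.\<close>

lemma lip_const_lipschitz:
  assumes "\<phi> \<in> C_Lip" shows "dist (\<phi> x) (\<phi> y) <= lip_const \<phi> * dist x y"
proof (cases "x = y")
  case False
  then have d: "dist x y > 0" by simp
  obtain L where L: "L-lipschitz_on UNIV \<phi>" using assms by (auto simp: C_Lip_def)
  have "dist (\<phi> x) (\<phi> y) / dist x y <= lip_const \<phi>"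
    unfolding lip_const_def
  proof (rule cInf_greatest)
    show "{L. L-lipschitz_on UNIV \<phi>} \<noteq> {}" using L by blast
    fix M assume "M \<in> {L. L-lipschitz_on UNIV \<phi>}"
    then have "dist (\<phi> x) (\<phi> y) <= M * dist x y" by (auto simp: lipschitz_on_def)
    then show "dist (\<phi> x) (\<phi> y) / dist x y <= M" using d by (simp add: pos_divide_le_eq)
  qed
  then show ?thesis using d by (simp add: pos_divide_le_eq)
qed simp

lemma lip_ballD:
  assumes "\<phi> \<in> lip_ball" shows "\<phi> \<in> C_Lip" "norm (\<phi> x - \<phi> y) <= 1 * norm (x - y)"
proof -
  show c: "\<phi> \<in> C_Lip" using assms by (simp add: lip_ball_def)
  have "lip_const \<phi> * dist x y <= 1 * dist x y" using assms by (intro mult_right_mono) (auto simp: lip_ball_def)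
  then show "norm (\<phi> x - \<phi> y) <= 1 * norm (x - y)" using lip_const_lipschitz[OF c, of x y] by (simp add: dist_norm)
qed

lemma C_LipD: assumes "\<phi> \<in> C_Lip" shows "\<exists>L\<ge>0. \<forall>x y. norm (\<phi> x - \<phi> y) <= L * norm (x - y :: 'a::real_normed_vector)"
  using assms unfolding C_Lip_def lipschitz_on_def by (auto simp: dist_norm)

lemma C_Lip_const: "(%x. c) \<in> C_Lip" unfolding C_Lip_def using lipschitz_on_constant by blast

lemma lip_ball_0: "(%x :: real^'n. 0) \<in> lip_ball"
proof -
  have "lip_const (%x :: real^'n. 0 :: real) <= 0" unfolding lip_const_def
  proof (rule cInf_lower)
    show "bdd_below {L. L-lipschitz_on UNIV (%x :: real^'n. 0 :: real)}" by (auto simp: lipschitz_on_def intro!: bdd_belowI[of _ 0])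
  qed (simp add: lipschitz_on_constant)
  then show ?thesis by (simp add: lip_ball_def C_Lip_const)
qed

lemma d\<^sub>1_refl: "d\<^sub>1 f f = 0"
proof -
  have "(%\<phi>. \<bar>f \<phi> - f \<phi>\<bar>) ` lip_ball = {0}" using lip_ball_0 by auto
  then show ?thesis by (simp add: d\<^sub>1_def)
qed

lemma d\<^sub>1_le: "(!!\<phi>. \<phi> \<in> lip_ball ==> \<bar>f \<phi> - g \<phi>\<bar> <= c) ==> d\<^sub>1 f g <= c"
  unfolding d\<^sub>1_def using lip_ball_0 by (intro cSUP_least) auto

context sublinear_T
begin

lemma E_diff_nE: assumes "X \<in> LA" "Y \<in> LA" shows "\<bar>E X - E Y\<bar> <= nE E 1 (%w. X w - Y w)"
  using E_abs_diff[OF assms] nE_1_LA[OF cyl_diff[OF assms]] by simp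

lemma lg_expectation_lim:
  assumes U: "U \<in> LGs 1" "u \<in> U" shows "(%k. E (u k)) ----> lg_expectation E U"
proof -
  have L: "v k \<in> LA" if "v \<in> U" for v k using LG_D(1)[OF p12_1 U(1) that] CS_LA by blast
  have "Cauchy (%k. E (u k))"
  proof (rule metric_CauchyI)
    fix eps :: real assume "eps > 0"
    then obtain M where "\<forall>k\<ge>M. \<forall>l\<ge>M. nE E 1 (%w. u k w - u l w) < eps"
      using LG_D(1)[OF p12_1 U] unfolding CS_iff by blast
    then show "\<exists>M. \<forall>m\<ge>M. \<forall>n\<ge>M. dist (E (u m)) (E (u n)) < eps"
      using E_diff_nE[OF L[OF U(2)] L[OF U(2)]] le_less_trans unfolding dist_real_def by blast
  qed
  then obtain r where r: "(%k. E (u k)) ----> r" using Cauchy_convergent convergent_def by blast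
  have all: "(%k. dist (E (v k)) r) ----> 0" if v: "v \<in> U" for v
  proof -
    have "(%k. E (v k) - E (u k)) ----> 0"
    proof (rule Lim_null_comparison[OF always_eventually])
      show "\<forall>k. norm (E (v k) - E (u k)) <= nE E 1 (%w. v k w - u k w)" using E_diff_nE[OF L[OF v] L[OF U(2)]] by simp
    qed (rule LG_null[OF p12_1 U(1) v U(2)])
    from tendsto_add[OF this r] have "(%k. E (v k)) ----> r" by simp
    then show ?thesis by (simp add: tendsto_dist_iff[symmetric])
  qed
  have "lg_expectation E U = r"
    unfolding lg_expectation_def cont_extension_def
  proof (rule the_equality)
    show "r \<in> UNIV \<and> (\<forall>u\<in>U. (%k. dist (E (u k)) r) ----> 0)" using all by blast
    fix V assume "V \<in> UNIV \<and> (\<forall>u\<in>U. (%k. dist (E (u k)) V) ----> 0)"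
    then have "(%k. E (u k)) ----> V" using U(2) tendsto_dist_iff by blast
    then show "V = r" using r LIMSEQ_unique by blast
  qed
  then show ?thesis using r by simp
qed

definition law_of :: "(nat => 'd path => real^'n) set => (real^'n => real) => real" where
  "law_of U = (\<lambda>\<phi>\<in>C_Lip. lg_expectation E (lg_map E T 1 (%w x. \<phi> x) U))"

lemma law_eq: "law E T X t = law_of (X t)" by (simp add: law_def law_of_def)

lemma law_lim:
  assumes q: "p12 q" and U: "U \<in> LGs q" "u \<in> U" and \<phi>: "\<phi> \<in> C_Lip"
  shows "(%k. E (%w. \<phi> (u k w))) ----> law_of U \<phi>" "(%w. \<phi> (u k w)) \<in> LA"
proof -
  obtain L where "0 <= L" "!!x y. norm (\<phi> x - \<phi> y) <= L * norm (x - y)" using C_LipD[OF \<phi>] by blast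
  then have f: "fadm (%w. \<phi>) L" by (rule fadm_lipschitz)
  have q1: "1 <= q" using q by (auto simp: p12_def)
  note r = lg_map_rep[OF f p12_1 q q1 U]
  show "(%k. E (%w. \<phi> (u k w))) ----> law_of U \<phi>"
    using lg_expectation_lim[OF r] \<phi> by (simp add: law_of_def)
  show "(%w. \<phi> (u k w)) \<in> LA" by (rule cyl_LA[OF fadmD(3)[OF f CS_cyl[OF LG_D(1)[OF q U]]]])
qed

text \<open>Evaluation at \<open>0\<close> is the law of the zero variable, and a test function with
  Lipschitz constant at most \<open>1\<close> separates two laws by no more than the
  \<open>L_G^1\<close> distance of the variables. Only first moments enter, which is what a solution
  provides.\<close>

lemma law_ball:
  assumes q: "p12 q" and U: "U \<in> LGs q" and \<phi>: "\<phi> \<in> lip_ball"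
  shows "\<bar>law_of U \<phi> - \<phi> 0\<bar> <= ld 1 (inc U) (emb 1 (%w. 0))"
proof -
  obtain u where u: "u \<in> U" using LG_ne[OF q U] by blast
  note l = law_lim[OF q U u lip_ballD(1)[OF \<phi>]]
  have uL: "u k \<in> LA" for k using LG_D(1)[OF q U u] CS_LA by blast
  show ?thesis
  proof (rule LIMSEQ_le)
    show "(%k. \<bar>E (%w. \<phi> (u k w)) - \<phi> 0\<bar>) ----> \<bar>law_of U \<phi> - \<phi> 0\<bar>" by (intro tendsto_intros l(1))
    show "(%k. nE E 1 (%w. u k w - 0)) ----> ld 1 (inc U) (emb 1 (%w. 0))"
      by (rule ld_lim[OF p12_1 inc_rep(1)[OF q U] emb_in(1)[OF p12_1 cyl_const] inc_rep(2)[OF q U u] emb_in(2)[OF p12_1 cyl_const]])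
    have "\<bar>E (%w. \<phi> (u k w)) - \<phi> 0\<bar> <= nE E 1 (%w. u k w - 0)" for k
    proof -
      have "\<bar>E (%w. \<phi> (u k w)) - \<phi> 0\<bar> <= nE E 1 (%w. \<phi> (u k w) - \<phi> 0)" using E_diff_nE[OF l(2) cyl_const] by (simp add: E_const)
      also have "... <= nE E 1 (%w. u k w - 0)"
        using lip_ballD(2)[OF \<phi>, of _ 0] l(2) uL by (intro nE_mono' cyl_diff cyl_const) auto
      finally show ?thesis .
    qed
    then show "\<exists>N. \<forall>n\<ge>N. \<bar>E (%w. \<phi> (u n w)) - \<phi> 0\<bar> <= nE E 1 (%w. u n w - 0)" by blast
  qed
qed

lemma d\<^sub>1_law:
  fixes U V :: "(nat => 'd path => real^'n) set"
  assumes U: "U \<in> LGs 2" "V \<in> LGs 2" shows "d\<^sub>1 (law_of U) (law_of V) <= ld 2 U V"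
proof (rule d\<^sub>1_le)
  fix \<phi> :: "real^'n => real" assume \<phi>: "\<phi> \<in> lip_ball"
  obtain u v where u: "u \<in> U" "v \<in> V" using LG_ne[OF p12_2] U by blast
  note l = law_lim[OF p12_2 U(1) u(1) lip_ballD(1)[OF \<phi>]] law_lim[OF p12_2 U(2) u(2) lip_ballD(1)[OF \<phi>]]
  have uL: "u k \<in> LA" "v k \<in> LA" for k using LG_D(1)[OF p12_2 U(1) u(1)] LG_D(1)[OF p12_2 U(2) u(2)] CS_LA by blast+
  show "\<bar>law_of U \<phi> - law_of V \<phi>\<bar> <= ld 2 U V"
  proof (rule LIMSEQ_le)
    show "(%k. \<bar>E (%w. \<phi> (u k w)) - E (%w. \<phi> (v k w))\<bar>) ----> \<bar>law_of U \<phi> - law_of V \<phi>\<bar>" by (intro tendsto_intros l)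
    show "(%k. nE E 2 (%w. u k w - v k w)) ----> ld 2 U V" by (rule ld_lim[OF p12_2 U u])
    have "\<bar>E (%w. \<phi> (u k w)) - E (%w. \<phi> (v k w))\<bar> <= nE E 2 (%w. u k w - v k w)" for k
    proof -
      have "\<bar>E (%w. \<phi> (u k w)) - E (%w. \<phi> (v k w))\<bar> <= nE E 1 (%w. \<phi> (u k w) - \<phi> (v k w))" by (rule E_diff_nE[OF l(2,4)])
      also have "... <= nE E 1 (%w. u k w - v k w)"
        using lip_ballD(2)[OF \<phi>] l(2,4) uL by (intro nE_mono' cyl_diff) auto
      also have "... <= nE E 2 (%w. u k w - v k w)" by (intro nE_1_le_2 cyl_diff uL)
      finally show ?thesis .
    qed
    then show "\<exists>N. \<forall>n\<ge>N. \<bar>E (%w. \<phi> (u n w)) - E (%w. \<phi> (v n w))\<bar> <= nE E 2 (%w. u n w - v n w)" by blast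
  qed
qed

lemma law_distr:
  assumes q: "p12 q" and U: "U \<in> LGs q" shows "law_of U \<in> \<D>"
proof -
  obtain u where u: "u \<in> U" using LG_ne[OF q U] by blast
  note l = law_lim[OF q U u]
  show ?thesis
    unfolding distr_space_def
  proof (intro CollectI conjI ballI allI impI)
    show "law_of U \<in> extensional C_Lip" by (simp add: law_of_def)
    show "law_of U \<psi> <= law_of U \<phi>" if "\<phi> \<in> C_Lip" "\<psi> \<in> C_Lip" "\<forall>x. \<psi> x <= \<phi> x" for \<phi> \<psi>
      by (rule LIMSEQ_le[OF l(1)[OF that(2)] l(1)[OF that(1)]]) (use that(3) in \<open>blast intro: E_mono l(2)[OF that(2)] l(2)[OF that(1)]\<close>)
    show "law_of U (%x. c) = c" for c
      using l(1)[OF C_Lip_const, of c] LIMSEQ_unique[OF tendsto_const] by (force simp: E_const)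
    show "law_of U (%x. \<phi> x + \<psi> x) <= law_of U \<phi> + law_of U \<psi>" if a: "\<phi> \<in> C_Lip" "\<psi> \<in> C_Lip" for \<phi> \<psi>
    proof -
      have "(%x. \<phi> x + \<psi> x) \<in> C_Lip" using a unfolding C_Lip_def by (blast intro: lipschitz_on_add)
      from LIMSEQ_le[OF l(1)[OF this] tendsto_add[OF l(1)[OF a(1)] l(1)[OF a(2)]]]
      show ?thesis using E_add[OF l(2)[OF a(1)] l(2)[OF a(2)]] by blast
    qed
    show "law_of U (%x. r * \<phi> x) = r * law_of U \<phi>" if a: "\<phi> \<in> C_Lip" "0 <= r" for \<phi> r
    proof -
      have "(%x. r * \<phi> x) \<in> C_Lip" using a(1) unfolding C_Lip_def by (blast intro: lipschitz_on_cmult_real)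
      from LIMSEQ_unique[OF l(1)[OF this]] tendsto_mult_left[OF l(1)[OF a(1)], of r]
      show ?thesis using E_scale[OF l(2)[OF a(1)] a(2)] by simp
    qed
    show "bdd_above ((%\<phi>. \<bar>law_of U \<phi> - \<phi> 0\<bar>) ` lip_ball)"
      using law_ball[OF q U] by (intro bdd_aboveI2)
  qed
qed

lemma law_flow:
  assumes q: "p12 q" and X: "!!t. t \<in> {0..T} ==> X t \<in> LGs q"
    and M: "!!t. t \<in> {0..T} ==> ld 1 (inc (X t)) (emb 1 (%w. 0)) <= M"
  shows "law E T X \<in> distr_flow T"
  unfolding distr_flow_def
proof (intro CollectI conjI ballI)
  fix t assume "t \<in> {0..T}"
  then show "law E T X t \<in> \<D>" using law_distr[OF q X] by (simp add: law_eq)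
next
  show "bdd_above ((%(t, \<phi>). \<bar>law E T X t \<phi> - \<phi> 0\<bar>) ` ({0..T} \<times> lip_ball))"
    using order_trans[OF law_ball[OF q X] M] by (intro bdd_aboveI[of _ M]) (force simp: law_eq)
qed

definition lip_coeff :: "real => (real => real^'n => ((real^'n => real) => real) => real^'n) => bool" where
  "lip_coeff K c \<longleftrightarrow> 0 <= K \<and> (\<forall>t\<in>{0..T}. \<forall>x y. \<forall>f\<in>\<D>. \<forall>g\<in>\<D>. norm (c t x f - c t y g) <= K * (norm (x - y) + d\<^sub>1 f g))"

lemma lip_coeffD:
  assumes "lip_coeff K c"
  shows "0 <= K" "t \<in> {0..T} ==> f \<in> \<D> ==> g \<in> \<D> ==> norm (c t x f - c t y g) <= K * (norm (x - y) + d\<^sub>1 f g)"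
    "t \<in> {0..T} ==> f \<in> \<D> ==> norm (c t x f - c t y f) <= K * norm (x - y)"
  using assms d\<^sub>1_refl[of f] unfolding lip_coeff_def by (force, force, fastforce)

lemma coeff_rep:
  assumes c: "lip_coeff K c" and p: "p12 p" "p <= 2" and t: "t \<in> {0..T}" and X: "X t \<in> LGs 2" "u \<in> X t"
  shows "coeff_process E T p c X t \<in> LGs p" "(%k w. c t (u k w) (law E T X t)) \<in> coeff_process E T p c X t"
    "(%w. c t (u k w) (law E T X t)) \<in> cyl {0..T}"
proof -
  have "law E T X t \<in> \<D>" using law_distr[OF p12_2 X(1)] by (simp add: law_eq)
  then have f: "fadm (%w x. c t x (law E T X t)) K" by (intro fadm_lipschitz lip_coeffD[OF c] t)
  show "coeff_process E T p c X t \<in> LGs p" "(%k w. c t (u k w) (law E T X t)) \<in> coeff_process E T p c X t"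
    unfolding coeff_process_def using lg_map_rep[OF f p(1) p12_2 p(2) X] by auto
  show "(%w. c t (u k w) (law E T X t)) \<in> cyl {0..T}" by (rule fadmD(3)[OF f CS_cyl[OF LG_D(1)[OF p12_2 X]]])
qed

lemma coeff_inc:
  assumes c: "lip_coeff K c" and t: "t \<in> {0..T}" and X: "X t \<in> LGs 2"
  shows "inc (coeff_process E T 2 c X t) = coeff_process E T 1 c X t"
proof -
  obtain u where u: "u \<in> X t" using LG_ne[OF p12_2 X] by blast
  have le: "(1::real) <= 2" by simp
  note r = coeff_rep(1,2)[where X=X and t=t and u=u, OF c p12_2 _ t X u, OF order_refl] coeff_rep(1,2)[where X=X and t=t and u=u, OF c p12_1 le t X u]
  note i = inc_rep(1)[OF p12_2 r(1)] inc_rep(2)[OF p12_2 r(1,2)]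
  show ?thesis using LG_D(2)[OF p12_1 i] LG_D(2)[OF p12_1 r(3,4)] by simp
qed

text \<open>One \<open>K\<close> pays for the variable and one for its law, which by
  \<open>d\<^sub>1_law\<close> moves no further than the variable.\<close>

lemma coeff_ld:
  assumes c: "lip_coeff K c" and t: "t \<in> {0..T}" and X: "X t \<in> LGs 2" "Y t \<in> LGs 2"
  shows "ld 2 (coeff_process E T 2 c X t) (coeff_process E T 2 c Y t) <= 2 * K * ld 2 (X t) (Y t)"
proof -
  obtain u v where u: "u \<in> X t" "v \<in> Y t" using LG_ne[OF p12_2] X by blast
  note r = coeff_rep[where X=X and t=t and u=u, OF c p12_2 _ t X(1) u(1), OF order_refl] coeff_rep[where X=Y and t=t and u=v, OF c p12_2 _ t X(2) u(2), OF order_refl]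
  let ?F = "law E T X t" and ?G = "law E T Y t"
  let ?d = "ld 2 (X t) (Y t)"
  have d0: "0 <= ?d" by (rule ld_nonneg[OF p12_2 X])
  have D: "?F \<in> \<D>" "?G \<in> \<D>" using law_distr[OF p12_2 X(1)] law_distr[OF p12_2 X(2)] by (auto simp: law_eq)
  have uL: "u k \<in> LA" "v k \<in> LA" for k using LG_D(1)[OF p12_2 X(1) u(1)] LG_D(1)[OF p12_2 X(2) u(2)] CS_LA by blast+
  have "ld 2 (coeff_process E T 2 c X t) (coeff_process E T 2 c Y t) <= K * (?d + ?d)"
  proof (rule LIMSEQ_le)
    show "(%k. nE E 2 (%w. c t (u k w) ?F - c t (v k w) ?G)) ----> ld 2 (coeff_process E T 2 c X t) (coeff_process E T 2 c Y t)"
      by (rule ld_lim[OF p12_2 r(1,4,2,5)])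
    show "(%k. K * (nE E 2 (%w. u k w - v k w) + ?d)) ----> K * (?d + ?d)"
      by (intro tendsto_mult tendsto_add tendsto_const ld_lim[OF p12_2 X u])
    have "nE E 2 (%w. c t (u k w) ?F - c t (v k w) ?G) <= K * (nE E 2 (%w. u k w - v k w) + ?d)" for k
    proof -
      have "nE E 2 (%w. c t (u k w) ?F - c t (v k w) ?G) <= K * nE E 2 (%w. norm (u k w - v k w) + ?d)"
      proof (rule nE_mono[OF p12_2 cyl_diff[OF cyl_LA[OF r(3)] cyl_LA[OF r(6)]] cyl_add[OF cyl_norm[OF cyl_diff[OF uL]] cyl_const] lip_coeffD(1)[OF c]])
        fix w
        have "norm (c t (u k w) ?F - c t (v k w) ?G) <= K * (norm (u k w - v k w) + d\<^sub>1 ?F ?G)" by (rule lip_coeffD(2)[OF c t D])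
        also have "... <= K * (norm (u k w - v k w) + ?d)"
          using d\<^sub>1_law[OF X] by (intro mult_left_mono lip_coeffD(1)[OF c]) (simp add: law_eq)
        finally show "norm (c t (u k w) ?F - c t (v k w) ?G) <= K * norm (norm (u k w - v k w) + ?d)" using d0 by simp
      qed
      also have "nE E 2 (%w. norm (u k w - v k w) + ?d) <= nE E 2 (%w. norm (u k w - v k w)) + nE E 2 (%w. ?d)"
        by (intro nE_triangle p12_simps cyl_norm cyl_diff uL cyl_const)
      finally show ?thesis using d0 lip_coeffD(1)[OF c] by (simp add: nE_norm nE_const mult_left_mono)
    qed
    then show "\<exists>N. \<forall>n\<ge>N. nE E 2 (%w. c t (u n w) ?F - c t (v n w) ?G) <= K * (nE E 2 (%w. u n w - v n w) + ?d)" by blast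
  qed
  then show ?thesis by (simp add: algebra_simps)
qed

text \<open>Allows approximation by members of the space instead of simple processes, again with a
  majorant in place of the distance.\<close>

lemma MG_bar_closed:
  fixes X :: "real => (nat => 'd path => 'v::real_normed_vector) set"
  assumes X: "!!t. t \<in> {0..T} ==> X t \<in> LGs 2"
    and a: "!!eps. eps > 0 ==> \<exists>Y\<in>MG_bar E T 2. \<exists>g. SI g \<and> LI g < eps \<and> (\<forall>t. 0 <= t --> t < T --> (ld 2 (Y t) (X t))^2 <= g t)"
  shows "X \<in> MG_bar E T 2"
proof (rule approximable_MG_bar[OF p12_2 X])
  show "approximable 2 X" unfolding approximable_def
  proof (intro allI impI)
    fix eps :: real assume e: "eps > 0"
    then have e4: "eps / 4 > 0" by simp
    from a[OF e4] obtain Y g where Y: "Y \<in> MG_bar E T 2" and g: "SI g" "LI g < eps / 4"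
      "!!t. 0 <= t ==> t < T ==> (ld 2 (Y t) (X t))^2 <= g t" by blast
    obtain \<eta> where \<eta>: "mg_bar_approx E T 2 \<eta> Y" using Y by (auto simp: MG_bar_def)
    obtain k where k: "LI (%t. ld 2 (pem 2 (\<eta> k) t) (Y t) powr 2) < eps / 4"
      using null_seq_less[OF mg_bar_approxD(3)[OF \<eta>] e4] by blast
    let ?D = "%t. ld 2 (pem 2 (\<eta> k) t) (Y t) powr 2"
    let ?G = "%t. 2 * ?D t + 2 * g t"
    note i = mg_bar_approxD(2)[OF \<eta>, of k] g(1)
    have "LI ?G = 2 * LI ?D + 2 * LI g" using i by (subst set_integral_add, simp, simp)+ simp
    then have G: "SI ?G" "LI ?G < eps" using i k g(2) by (auto intro!: set_integral_add set_integrable_mult_right)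
    have "ld 2 (pem 2 (\<eta> k) t) (X t) powr 2 <= ?G t" if t: "0 <= t" "t < T" for t
    proof -
      have tT: "t \<in> {0..T}" using t by simp
      note L = pem_in[OF p12_2 mg_bar_approxD(1)[OF \<eta>, of k], of t] MG_barD[OF Y tT] X[OF tT]
      have n: "0 <= ld 2 (pem 2 (\<eta> k) t) (X t)" "0 <= ld 2 (pem 2 (\<eta> k) t) (Y t)" using L by (auto intro!: ld_nonneg)
      have "(ld 2 (pem 2 (\<eta> k) t) (X t))^2 <= (ld 2 (pem 2 (\<eta> k) t) (Y t) + ld 2 (Y t) (X t))^2"
        by (intro power_mono ld_tri[OF p12_2 L] n)
      also have "... <= 2 * (ld 2 (pem 2 (\<eta> k) t) (Y t))^2 + 2 * (ld 2 (Y t) (X t))^2"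
        using zero_le_power2[of "ld 2 (pem 2 (\<eta> k) t) (Y t) - ld 2 (Y t) (X t)"] by (simp add: power2_eq_square algebra_simps)
      finally show ?thesis using n g(3)[OF t] by simp
    qed
    then show "\<exists>\<eta>\<in>SP. \<exists>g. SI g \<and> LI g < eps \<and> (\<forall>t. 0 <= t --> t < T --> ld 2 (pem 2 \<eta> t) (X t) powr 2 <= g t)"
      using G mg_bar_approxD(1)[OF \<eta>] by blast
  qed
qed

end

section \<open>Approximation of the coefficients\<close>

definition radial_clamp :: "real => 'a::real_normed_vector => 'a" where "radial_clamp M x = (M / max M (norm x)) *\<^sub>R x"

lemma radial_clamp_norm: assumes "0 < M" shows "norm (radial_clamp M x) <= M"
  using assms by (simp add: radial_clamp_def max_def field_simps)

lemma radial_clamp_id: assumes "0 < M" "norm x <= M" shows "radial_clamp M x = x"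
  using assms by (simp add: radial_clamp_def max_def)

lemma radial_clamp_diff: assumes "0 < M" shows "norm (radial_clamp M x - x) <= norm x"
proof -
  have "radial_clamp M x - x = (M / max M (norm x) - 1) *\<^sub>R x" by (simp add: radial_clamp_def scaleR_diff_left)
  moreover have "\<bar>M / max M (norm x) - 1\<bar> <= 1"
  proof -
    have pos: "0 < max M (norm x)" using assms by simp
    have "0 <= M / max M (norm x)" using assms pos by (intro divide_nonneg_pos) auto
    moreover have "M / max M (norm x) <= 1" by (subst divide_le_eq_1_pos[OF pos]) simp
    ultimately show ?thesis by linarith
  qed
  ultimately show ?thesis by (simp add: mult_left_le_one_le)
qed

lemma radial_clamp_continuous: assumes "0 < M" shows "continuous_on UNIV (radial_clamp M)"
  unfolding radial_clamp_def using assms by (intro continuous_intros) (auto simp: max_def)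

definition hat :: "real => 'a::real_normed_vector => 'a => real" where
  "hat \<delta> j x = max 0 (2 * \<delta> - norm (x - j))"

text \<open>Normalised hat functions. Cutting the denominator off at \<open>\<delta>\<close> keeps
  the quotient Lipschitz on bounded sets of the whole space; within distance \<open>\<delta>\<close>
  of \<open>J\<close> the sum exceeds \<open>\<delta>\<close>, so there the weights form a true
  partition of unity.\<close>

definition pou :: "real => 'a::real_normed_vector set => 'a => 'a => real" where
  "pou \<delta> J j x = hat \<delta> j x * (1 / max (\<Sum>i\<in>J. hat \<delta> i x) \<delta>)"

lemma pou_nonneg: "0 < \<delta> ==> 0 <= pou \<delta> J j x" by (simp add: pou_def hat_def)

lemma pou_support: assumes "0 < \<delta>" "pou \<delta> J j x \<noteq> 0" shows "norm (x - j) <= 2 * \<delta>"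
  using assms by (auto simp: pou_def hat_def max_def split: if_splits)

lemma pou_sum:
  assumes "0 < \<delta>" "finite J" "j \<in> J" "norm (x - j) < \<delta>" shows "(\<Sum>j\<in>J. pou \<delta> J j x) = 1"
proof -
  have "hat \<delta> j x <= (\<Sum>i\<in>J. hat \<delta> i x)" using assms by (intro member_le_sum) (auto simp: hat_def)
  moreover have "\<delta> < hat \<delta> j x" using assms by (simp add: hat_def)
  ultimately have "\<delta> < (\<Sum>i\<in>J. hat \<delta> i x)" by linarith
  then show ?thesis using assms(1) unfolding pou_def sum_distrib_right[symmetric] by (simp add: max_def)
qed

lemma pou_le_1: assumes "0 < \<delta>" "finite J" "j \<in> J" shows "pou \<delta> J j x <= 1"
proof -
  have "hat \<delta> j x <= (\<Sum>i\<in>J. hat \<delta> i x)" using assms by (intro member_le_sum) (auto simp: hat_def)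
  then show ?thesis using assms(1) by (simp add: pou_def max_def field_simps)
qed

lemma blip_inverse_max: assumes "0 < \<delta>" shows "blip (%x :: real. 1 / max x \<delta>)"
proof (rule blipI_lip[of _ "1 / \<delta>\<^sup>2"])
  fix x y :: real
  let ?x = "max x \<delta>" and ?y = "max y \<delta>"
  have pos: "\<delta> <= ?x" "\<delta> <= ?y" by auto
  then have p: "0 < ?x" "0 < ?y" using assms by linarith+
  have "1 / ?x - 1 / ?y = (?y - ?x) / (?x * ?y)" using p by (simp add: field_simps)
  then have "dist (1 / ?x) (1 / ?y) = \<bar>?y - ?x\<bar> / (?x * ?y)" using p by (simp add: dist_real_def abs_mult)
  also have "... <= \<bar>x - y\<bar> / \<delta>\<^sup>2"
    using pos assms by (intro frac_le) (auto simp: power2_eq_square intro!: mult_mono)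
  finally show "dist (1 / ?x) (1 / ?y) <= 1 / \<delta>\<^sup>2 * dist x y" by (simp add: dist_real_def)
qed

lemma pou_cyl: assumes "0 < \<delta>" "X \<in> cyl I" shows "(%w. pou \<delta> J j (X w)) \<in> cyl I"
proof -
  have h: "(%w. hat \<delta> i (X w)) \<in> cyl I" for i
    unfolding hat_def by (intro cyl_max cyl_const cyl_diff cyl_norm assms)
  show ?thesis unfolding pou_def by (intro cyl_mult h cyl_comp[OF cyl_sum blip_inverse_max] assms)
qed

lemma sp_comb_cyl:
  fixes \<eta> :: "('d::finite, 'v::real_normed_vector) simple_process" and \<zeta> :: "('d, 'w::real_normed_vector) simple_process"
    and f :: "'v => 'w => 'u::real_normed_vector"
  assumes "\<eta> \<in> simple_processes T" "\<zeta> \<in> simple_processes T" "0 < T"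
    and f: "!!I (X :: 'd path => 'v) Y. X \<in> cyl I ==> Y \<in> cyl I ==> (%w. f (X w) (Y w)) \<in> cyl I" "f 0 0 = 0"
  shows "\<exists>\<delta>\<in>simple_processes T. \<forall>t w. process_at \<delta> t w = f (process_at \<eta> t w) (process_at \<zeta> t w)"
proof -
  obtain M p x y where *: "(M, p, x) \<in> simple_processes T" "(M, p, y) \<in> simple_processes T"
    "process_at (M, p, x) = process_at \<eta>" "process_at (M, p, y) = process_at \<zeta>"
    using sp_pair[OF assms(1-3)] by blast
  have g: "grid T M p" using * by (simp add: sp_iff)
  let ?d = "(M, p, %i w. f (x i w) (y i w))"
  have "?d \<in> simple_processes T" by (rule sp_I[OF g f(1)[OF sp_xi_cyl[OF *(1)] sp_xi_cyl[OF *(2)]]])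
  moreover have "process_at ?d t w = f (process_at (M, p, x) t w) (process_at (M, p, y) t w)" for t w
    using g
  proof (cases rule: process_at_cases[where t=t and \<xi>="%i w. f (x i w) (y i w)"])
    case 1 then show ?thesis by (simp add: process_at_out[OF g 1(2)] f(2))
  next
    case (2 i) then show ?thesis by (simp add: process_at_in[OF g 2(1-3)])
  qed
  ultimately show ?thesis by (intro bexI[of _ ?d]) (simp_all add: *(3,4))
qed

lemma sp_weighted_sum:
  fixes \<eta> :: "('d::finite, 'v::real_normed_vector) simple_process" and \<theta> :: "'j => ('d, 'w::real_normed_vector) simple_process"
  assumes \<eta>: "\<eta> \<in> simple_processes T" and T: "0 < T" and \<rho>: "!!j I (X :: 'd path => 'v). X \<in> cyl I ==> (%w. \<rho> j (X w) :: real) \<in> cyl I"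
  shows "finite J ==> (!!j. j \<in> J ==> \<theta> j \<in> simple_processes T) ==>
    \<exists>\<zeta>\<in>simple_processes T. \<forall>t w. process_at \<zeta> t w = (\<Sum>j\<in>J. \<rho> j (process_at \<eta> t w) *\<^sub>R process_at (\<theta> j) t w)"
proof (induction J rule: finite_induct)
  case empty
  show ?case using sp_comb_cyl[OF \<eta> \<eta> T, of "%x y. 0"] by (simp add: cyl_const)
next
  case (insert j J)
  then obtain \<zeta> where \<zeta>: "\<zeta> \<in> simple_processes T"
    "!!t w. process_at \<zeta> t w = (\<Sum>j\<in>J. \<rho> j (process_at \<eta> t w) *\<^sub>R process_at (\<theta> j) t w)" by blast
  have "\<theta> j \<in> simple_processes T" using insert.prems by simp
  from sp_comb_cyl[OF \<eta> this T, of "%x y. \<rho> j x *\<^sub>R y"] obtain \<alpha> where \<alpha>: "\<alpha> \<in> simple_processes T"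
    "!!t w. process_at \<alpha> t w = \<rho> j (process_at \<eta> t w) *\<^sub>R process_at (\<theta> j) t w" using \<rho> cyl_scaleR by force
  from sp_comb_cyl[OF \<alpha>(1) \<zeta>(1) T, of "%x y. x + y"] obtain \<beta> where \<beta>: "\<beta> \<in> simple_processes T"
    "!!t w. process_at \<beta> t w = process_at \<alpha> t w + process_at \<zeta> t w" using cyl_add by force
  show ?case using insert.hyps by (intro bexI[OF _ \<beta>(1)]) (simp add: \<beta>(2) \<alpha>(2) \<zeta>(2))
qed

section \<open>Coefficient processes as limits of simple processes\<close>

context sublinear_T
begin

lemma SI_dominated:
  fixes f :: "nat => real => real"
  assumes f: "!!n. f n \<in> borel_measurable lebesgue" and wt: "SI wt"
    and b: "!!n t. t \<in> {0..T} ==> 0 <= f n t \<and> f n t <= wt t"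
    and l: "AE t in lebesgue. t \<in> {0..T} --> (%n. f n t) ----> 0"
  shows "SI (f n)" "(%n. LI (f n)) ----> 0"
proof -
  have 0: "(%t. 0::real) \<in> borel_measurable lebesgue" by simp
  have m: "(%t. indicator {0..T} t *\<^sub>R f n t) \<in> borel_measurable lebesgue" for n
    by (intro borel_measurable_scaleR borel_measurable_indicator f) simp
  have wi: "integrable lebesgue (%t. indicator {0..T} t *\<^sub>R wt t)" using wt by (simp add: set_integrable_def)
  have lim: "AE t in lebesgue. (%n. indicator {0..T} t *\<^sub>R f n t) ----> 0"
    using l by eventually_elim (auto simp: indicator_def)
  have bd: "AE t in lebesgue. norm (indicator {0..T} t *\<^sub>R f n t) <= indicator {0..T} t *\<^sub>R wt t" for n
    using b by (auto simp: indicator_def)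
  show "SI (f n)" unfolding set_integrable_def by (rule integrable_dominated_convergence2[OF 0 m wi lim bd])
  show "(%n. LI (f n)) ----> 0" unfolding set_lebesgue_integral_def
    using integral_dominated_convergence[OF 0 m wi lim bd] by simp
qed

text \<open>Radial truncation reduces to bounded functions. These are approximated almost everywhere
  by continuous ones, and truncating the latter at the same radius provides the constant majorant
  for dominated convergence.\<close>

lemma L2_dense_continuous:
  fixes g :: "real => 'v::euclidean_space"
  assumes g: "g \<in> L2_fun T" and e: "eps > 0"
  shows "\<exists>h. continuous_on UNIV h \<and> SI (%t. (norm (h t - g t))^2) \<and> LI (%t. (norm (h t - g t))^2) < eps"
proof -
  define G where "G t = indicator {0..T} t *\<^sub>R g t" for t
  have Gg: "G t = g t" if "t \<in> {0..T}" for t using that by (simp add: G_def)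
  have Gm: "G \<in> borel_measurable lebesgue" using g by (simp add: L2_fun_def set_borel_measurable_def G_def[abs_def])
  have wi: "SI (%t. (norm (g t))^2)" using g by (simp add: L2_fun_def)
  have trm: "radial_clamp M \<in> borel_measurable borel" if "0 < M" for M :: real and a :: 'v
    by (rule borel_measurable_continuous_onI[OF radial_clamp_continuous[OF that]])
  have trG: "(%t. radial_clamp M (G t)) \<in> borel_measurable lebesgue" if "0 < M" for M
    by (rule measurable_compose[OF Gm borel_measurable_continuous_onI[OF radial_clamp_continuous[OF that]]])
  let ?a = "%n t. (norm (radial_clamp (real (Suc n)) (G t) - G t))^2"
  have a: "SI (?a n)" "(%n. LI (?a n)) ----> 0" for n
  proof -
    have m: "?a n \<in> borel_measurable lebesgue" for n using trG[of "real (Suc n)"] Gm by measurable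
    have b: "0 <= ?a n t \<and> ?a n t <= (norm (g t))^2" if "t \<in> {0..T}" for n t
      using radial_clamp_diff[of "real (Suc n)" "G t"] Gg[OF that] by (simp add: power_mono)
    have l: "AE t in lebesgue. t \<in> {0..T} --> (%n. ?a n t) ----> 0"
    proof (intro AE_I2 impI)
      fix t
      obtain N :: nat where N: "norm (G t) <= real N" using real_arch_simple by blast
      have "\<forall>\<^sub>F n in sequentially. ?a n t = 0"
        unfolding eventually_sequentially using N by (intro exI[of _ N]) (auto simp: radial_clamp_id)
      then show "(%n. ?a n t) ----> 0" by (rule tendsto_eventually)
    qed
    show "SI (?a n)" "(%n. LI (?a n)) ----> 0" using SI_dominated[OF m wi b l] by auto
  qed
  have e4: "eps / 4 > 0" using e by simp
  obtain n where n: "LI (?a n) < eps / 4" using null_seq_less[OF a(2) e4] by blast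
  define M where "M = real (Suc n)"
  have M: "M > 0" by (simp add: M_def)
  \<comment> \<open>\<open>measurable_on\<close> is defined through continuous functions that
    converge off a negligible set, which supplies the sequence \<open>q\<close>.\<close>
  have "G measurable_on UNIV" by (rule lebesgue_measurable_imp_measurable_on[OF Gm]) simp
  then obtain N q where N: "negligible N" and q: "!!k. continuous_on UNIV (q k)" "!!x. x \<notin> N ==> (%k. q k x) ----> G x"
    unfolding measurable_on_def by auto
  let ?b = "%k t. (norm (radial_clamp M (q k t) - radial_clamp M (G t)))^2"
  have trq: "continuous_on UNIV (%t. radial_clamp M (q k t))" for k
    using continuous_on_compose2[OF radial_clamp_continuous[OF M] q(1)] by simp
  have b: "SI (?b k)" "(%k. LI (?b k)) ----> 0" for k
  proof -
    have "(%t. radial_clamp M (q k t)) \<in> borel_measurable lebesgue" for k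
      using borel_measurable_continuous_onI[OF trq] by (simp add: measurable_completion)
    then have m: "?b k \<in> borel_measurable lebesgue" for k using trG[OF M] by measurable
    have bd: "0 <= ?b k t \<and> ?b k t <= (2 * M)^2" for k t
    proof -
      have "norm (radial_clamp M (q k t) - radial_clamp M (G t)) <= 2 * M"
        using norm_triangle_ineq4[of "radial_clamp M (q k t)" "radial_clamp M (G t)"] radial_clamp_norm[OF M, of "q k t"] radial_clamp_norm[OF M, of "G t"] by linarith
      from power_mono[OF this norm_ge_zero, of 2] show ?thesis by simp
    qed
    have "AE t in lebesgue. t \<notin> N" using N by (intro AE_not_in) (simp add: negligible_iff_null_sets)
    then have l: "AE t in lebesgue. t \<in> {0..T} --> (%k. ?b k t) ----> 0"
    proof eventually_elim
      fix t assume "t \<notin> N"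
      have "continuous_on UNIV (radial_clamp M :: 'v => 'v)" by (rule radial_clamp_continuous[OF M])
      then have "isCont (radial_clamp M) (G t)" by (simp add: continuous_on_eq_continuous_at)
      from isCont_tendsto_compose[OF this q(2)[OF \<open>t \<notin> N\<close>]] have "(%k. radial_clamp M (q k t)) ----> radial_clamp M (G t)" .
      then have "(%k. radial_clamp M (q k t) - radial_clamp M (G t)) ----> 0" by (rule LIM_zero)
      from tendsto_power[OF tendsto_norm_zero[OF this], of 2] show "t \<in> {0..T} --> (%k. ?b k t) ----> 0" by simp
    qed
    show "SI (?b k)" "(%k. LI (?b k)) ----> 0" using SI_dominated[OF m SI_const(1) bd l] by auto
  qed
  obtain k where k: "LI (?b k) < eps / 4" using null_seq_less[OF b(2) e4] by blast
  let ?h = "%t. radial_clamp M (q k t)"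
  let ?c = "%t. 2 * ?b k t + 2 * ?a n t"
  have ci: "SI ?c" using a(1)[of n] b(1)[of k] by (intro set_integral_add set_integrable_mult_right)
  have "LI ?c = 2 * LI (?b k) + 2 * LI (?a n)" using a(1)[of n] b(1)[of k] by (subst set_integral_add, simp, simp)+ simp
  then have cl: "LI ?c < eps" using n k by simp
  have le: "(norm (?h t - G t))^2 <= ?c t" for t
  proof -
    have "norm (?h t - G t) <= norm (?h t - radial_clamp M (G t)) + norm (radial_clamp M (G t) - G t)"
      using norm_triangle_ineq[of "?h t - radial_clamp M (G t)" "radial_clamp M (G t) - G t"] by simp
    then have "(norm (?h t - G t))^2 <= (norm (?h t - radial_clamp M (G t)) + norm (radial_clamp M (G t) - G t))^2" by (intro power_mono) auto
    also have "... <= 2 * (norm (?h t - radial_clamp M (G t)))^2 + 2 * (norm (radial_clamp M (G t) - G t))^2"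
      using zero_le_power2[of "norm (?h t - radial_clamp M (G t)) - norm (radial_clamp M (G t) - G t)"] by (simp add: power2_eq_square algebra_simps)
    finally show ?thesis by (simp add: M_def)
  qed
  have hm: "?h \<in> borel_measurable lebesgue" using borel_measurable_continuous_onI[OF trq] by (simp add: measurable_completion)
  have si: "SI (%t. (norm (?h t - G t))^2)"
  proof (rule set_integrable_bound[OF ci])
    show "set_borel_measurable lebesgue {0..T} (%t. (norm (?h t - G t))^2)"
      unfolding set_borel_measurable_def
    proof (intro borel_measurable_scaleR borel_measurable_indicator)
      show "(%t. (norm (?h t - G t))^2) \<in> borel_measurable lebesgue" using hm Gm by measurable
    qed simp
    show "AE t in lebesgue. t \<in> {0..T} --> norm ((norm (?h t - G t))^2) <= norm (?c t)" using le by (auto intro: order_trans)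
  qed
  have "LI (%t. (norm (?h t - G t))^2) <= LI ?c" by (rule set_integral_mono[OF si ci le])
  then have "LI (%t. (norm (?h t - G t))^2) < eps" using cl by simp
  moreover have "SI (%t. (norm (?h t - G t))^2) = SI (%t. (norm (?h t - g t))^2)" by (intro set_integrable_cong) (auto simp: Gg)
  moreover have "LI (%t. (norm (?h t - G t))^2) = LI (%t. (norm (?h t - g t))^2)" by (intro set_lebesgue_integral_cong) (auto simp: Gg)
  ultimately show ?thesis using si trq by (intro exI[of _ ?h]) simp
qed

lemma ld_emb_const: "ld 2 (emb 2 (%w. x)) (emb 2 (%w. y)) = norm (x - y)"
  by (simp add: ld_emb[OF p12_2 cyl_const cyl_const] nE_const)

lemma continuous_MG_bar:
  assumes "continuous_on UNIV h" shows "(%t. emb 2 (%w. h t)) \<in> MG_bar E T 2"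
proof (rule continuous_adapted_approximable[OF p12_2 emb_in(1)[OF p12_2 cyl_const]])
  show "adapted t (emb 2 (%w. h t))" for t
    unfolding adapted_def by (rule bexI[OF _ emb_in(2)[OF p12_2 cyl_const]]) (simp add: cyl_const)
  fix eps :: real assume e: "eps > 0"
  have "uniformly_continuous_on {0..T} h"
    by (rule compact_uniformly_continuous[OF continuous_on_subset[OF assms]]) auto
  then obtain \<delta> where "\<delta> > 0" "!!s t. s \<in> {0..T} ==> t \<in> {0..T} ==> dist t s < \<delta> ==> dist (h t) (h s) < eps"
    using e unfolding uniformly_continuous_on_def by blast
  then show "\<exists>\<delta>>0. \<forall>s\<in>{0..T}. \<forall>t\<in>{0..T}. s <= t --> t - s < \<delta> --> ld 2 (emb 2 (%w. h s)) (emb 2 (%w. h t)) < eps"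
    unfolding ld_emb_const by (intro exI[of _ \<delta>]) (auto simp: dist_norm norm_minus_commute)
qed

lemma L2_MG_bar:
  fixes g :: "real => 'v::euclidean_space"
  assumes g: "g \<in> L2_fun T" shows "(%t. emb 2 (%w. g t)) \<in> MG_bar E T 2"
proof (rule MG_bar_closed[OF emb_in(1)[OF p12_2 cyl_const]])
  fix eps :: real assume "eps > 0"
  from L2_dense_continuous[OF g this] obtain h where h: "continuous_on UNIV h" "SI (%t. (norm (h t - g t))^2)"
    "LI (%t. (norm (h t - g t))^2) < eps" by blast
  show "\<exists>Y\<in>MG_bar E T 2. \<exists>G. SI G \<and> LI G < eps \<and> (\<forall>t. 0 <= t --> t < T --> (ld 2 (Y t) (emb 2 (%w. g t)))^2 <= G t)"
    using h(2,3) by (intro bexI[OF _ continuous_MG_bar[OF h(1)]] exI[of _ "%t. (norm (h t - g t))^2"]) (simp add: ld_emb_const)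
qed

lemma SI_sum:
  fixes f :: "'j => real => real"
  assumes "finite J" "!!j. j \<in> J ==> SI (f j)"
  shows "SI (%t. \<Sum>j\<in>J. f j t)" "LI (%t. \<Sum>j\<in>J. f j t) = (\<Sum>j\<in>J. LI (f j))"
proof -
  have eq: "(%t. indicator {0..T} t *\<^sub>R (\<Sum>j\<in>J. f j t)) = (%t. \<Sum>j\<in>J. indicator {0..T} t *\<^sub>R f j t)" by (simp only: scaleR_sum_right)
  show "SI (%t. \<Sum>j\<in>J. f j t)" unfolding set_integrable_def eq
    by (intro Bochner_Integration.integrable_sum) (use assms(2) in \<open>simp add: set_integrable_def\<close>)
  show "LI (%t. \<Sum>j\<in>J. f j t) = (\<Sum>j\<in>J. LI (f j))" unfolding set_lebesgue_integral_def eq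
    by (intro Bochner_Integration.integral_sum) (use assms(2) in \<open>simp add: set_integrable_def\<close>)
qed

text \<open>The weights at \<open>x\<close> sum to \<open>1\<close> and vanish beyond distance
  \<open>2 * \<delta>\<close>, so a weighted mean of the \<open>f j\<close> misses
  \<open>f x\<close> by at most \<open>2 * K * \<delta>\<close>. Each \<open>y j\<close> stands for
  an approximation of \<open>f j\<close>, and its error enters with weight at most
  \<open>1\<close>.\<close>

lemma pou_average_bound:
  fixes f :: "'v::real_normed_vector => 'w::real_normed_vector"
  assumes \<delta>: "0 < \<delta>" "finite J" and x: "i \<in> J" "norm (x - i) < \<delta>"
    and f: "0 <= K" "!!y. norm (f y - f x) <= K * norm (y - x)"
  shows "norm ((\<Sum>j\<in>J. pou \<delta> J j x *\<^sub>R y j) - f x) <= (\<Sum>j\<in>J. norm (y j - f j)) + 2 * K * \<delta>"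
proof -
  have s1: "(\<Sum>j\<in>J. pou \<delta> J j x) = 1" by (rule pou_sum[OF \<delta> x])
  have "(\<Sum>j\<in>J. pou \<delta> J j x *\<^sub>R y j) - f x = (\<Sum>j\<in>J. pou \<delta> J j x *\<^sub>R (y j - f x))"
    by (simp add: scaleR_diff_right sum_subtractf scaleR_sum_left[symmetric] s1)
  also have "norm ... <= (\<Sum>j\<in>J. norm (y j - f j) + pou \<delta> J j x * (2 * K * \<delta>))"
  proof (rule sum_norm_le)
    fix j assume j: "j \<in> J"
    let ?p = "pou \<delta> J j x"
    have p: "0 <= ?p" "?p <= 1" using pou_nonneg[OF \<delta>(1)] pou_le_1[OF \<delta> j] by auto
    have "?p * norm (f j - f x) <= ?p * (2 * K * \<delta>)"
    proof (cases "?p = 0")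
      case False
      have "norm (f j - f x) <= K * norm (j - x)" by (rule f(2))
      also have "... <= K * (2 * \<delta>)" using pou_support[OF \<delta>(1) False] f(1) by (intro mult_left_mono) (simp_all add: norm_minus_commute)
      finally show ?thesis using p(1) by (intro mult_left_mono) (auto simp: mult_ac)
    qed simp
    moreover have "?p * norm (y j - f j) <= 1 * norm (y j - f j)" using p by (intro mult_right_mono) auto
    moreover have "?p * norm (y j - f x) <= ?p * (norm (y j - f j) + norm (f j - f x))"
      using p(1) norm_triangle_ineq[of "y j - f j" "f j - f x"] by (intro mult_left_mono) auto
    ultimately show "norm (?p *\<^sub>R (y j - f x)) <= norm (y j - f j) + ?p * (2 * K * \<delta>)" using p(1) by (simp add: distrib_left)
  qed
  also have "... = (\<Sum>j\<in>J. norm (y j - f j)) + 2 * K * \<delta>" by (simp add: sum.distrib sum_distrib_right[symmetric] s1)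
  finally show ?thesis .
qed

text \<open>In time \<open>f\<close> is only square integrable for each fixed \<open>x\<close>; in
  \<open>x\<close> it is Lipschitz. A simple process stays in a ball, so finitely many centres
  \<open>j\<close> suffice: each \<open>f t j\<close> is approximated by a simple process, and the
  partition of unity evaluated at \<open>\<eta>\<close> glues these into one simple process.\<close>

lemma simple_coeff_MG_bar:
  fixes f :: "real => 'v::euclidean_space => 'w::euclidean_space" and \<eta> :: "('d, 'v) simple_process"
  assumes K: "0 <= K" "!!t x y. t \<in> {0..T} ==> norm (f t x - f t y) <= K * norm (x - y)"
    and f: "!!x. (%t. f t x) \<in> L2_fun T" and \<eta>: "\<eta> \<in> SP"
  shows "(%t. emb 2 (%w. f t (process_at \<eta> t w))) \<in> MG_bar E T 2"
proof (rule approximable_MG_bar[OF p12_2])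
  have fc: "(%w. f t (process_at \<eta> t w)) \<in> cyl {0..T}" if "t \<in> {0..T}" for t
    by (rule fadmD(3)[OF fadm_lipschitz[OF K(1) K(2)[OF that]] pa_T[OF \<eta>]])
  show "emb 2 (%w. f t (process_at \<eta> t w)) \<in> LGs 2" if "t \<in> {0..T}" for t
    by (rule emb_in(1)[OF p12_2 fc[OF that]])
  obtain R where R: "!!t w. norm (process_at \<eta> t w) <= R"
  proof -
    obtain N \<tau> \<xi> where d: "\<eta> = (N, \<tau>, \<xi>)" using prod_cases3 by blast
    have "\<forall>i. \<exists>C. i < N --> (\<forall>w. norm (\<xi> i w) <= C)"
      using sp_xi_cyl[OF \<eta>[unfolded d]] unfolding cyl_def by blast
    from choice[OF this] obtain C where C: "!!i w. i < N ==> norm (\<xi> i w) <= C i" by blast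
    have "norm (process_at \<eta> t w) <= (\<Sum>i<N. \<bar>C i\<bar>)" for t w
      unfolding d process_at_def prod.case
      using C by (intro sum_norm_le) (force simp: indicator_def intro: order_trans[OF _ abs_ge_self])
    then show thesis using that by blast
  qed
  show "approximable 2 (%t. emb 2 (%w. f t (process_at \<eta> t w)))" unfolding approximable_def
  proof (intro allI impI)
    fix eps :: real assume e: "eps > 0"
    \<comment> \<open>Chosen so that the spatial error \<open>2 * K * \<delta>\<close>, squared,
      doubled and integrated over \<open>[0,T]\<close>, is at most \<open>eps / 2\<close>;
      \<open>K + 1\<close> keeps the divisor positive.\<close>
    define \<delta> where "\<delta> = sqrt (eps / (16 * (K + 1)^2 * T))"
    have K1: "K + 1 > 0" using K(1) by linarith
    have \<delta>: "\<delta> > 0" "\<delta>\<^sup>2 = eps / (16 * (K + 1)^2 * T)" using e T0 K1 by (auto simp: \<delta>_def)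
    have "K\<^sup>2 <= (K + 1)^2" using K(1) by (intro power_mono) auto
    then have "8 * \<delta>\<^sup>2 * T * K\<^sup>2 <= 8 * \<delta>\<^sup>2 * T * (K + 1)^2" using T0 by (intro mult_left_mono) auto
    also have "... = eps / 2" unfolding \<delta>(2) using K1 T0 by (simp add: field_simps)
    finally have \<delta>K: "2 * (2 * K * \<delta>)^2 * T <= eps / 2" by (simp add: power_mult_distrib mult_ac)
    obtain J :: "'v set" where J: "finite J" "cball 0 R \<subseteq> (\<Union>x\<in>J. ball x \<delta>)"
      using compact_cball[of "0::'v" R] \<delta>(1) unfolding compact_eq_totally_bounded by blast
    have near: "\<exists>i\<in>J. norm (x - i) < \<delta>" if "norm x <= R" for x
      using J(2) that by (force simp: dist_norm norm_minus_commute)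
    let ?m = "real (card J)"
    \<comment> \<open>The other half of \<open>eps\<close>: the square of a sum of \<open>?m\<close>
      errors costs a factor \<open>?m\<close>, and \<open>2 * (?m + 1)^2 * c\<close> equals
      \<open>eps / 2\<close>.\<close>
    define c where "c = eps / (4 * (?m + 1)^2)"
    have c: "c > 0" using e by (simp add: c_def add_nonneg_pos)
    have "\<forall>j. \<exists>\<theta>. \<theta> \<in> SP \<and> SI (%t. ld 2 (pem 2 \<theta> t) (emb 2 (%w. f t j)) powr 2) \<and> LI (%t. ld 2 (pem 2 \<theta> t) (emb 2 (%w. f t j)) powr 2) < c"
    proof
      fix j
      obtain \<zeta> where \<zeta>: "mg_bar_approx E T 2 \<zeta> (%t. emb 2 (%w. f t j))" using L2_MG_bar[OF f[of j]] by (auto simp: MG_bar_def)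
      from null_seq_less[OF mg_bar_approxD(3)[OF \<zeta>] c] obtain k where "LI (%t. ld 2 (pem 2 (\<zeta> k) t) (emb 2 (%w. f t j)) powr 2) < c" by blast
      then show "\<exists>\<theta>. \<theta> \<in> SP \<and> SI (%t. ld 2 (pem 2 \<theta> t) (emb 2 (%w. f t j)) powr 2) \<and> LI (%t. ld 2 (pem 2 \<theta> t) (emb 2 (%w. f t j)) powr 2) < c"
        using mg_bar_approxD(1,2)[OF \<zeta>] by blast
    qed
    from choice[OF this] obtain \<theta> where \<theta>: "!!j. \<theta> j \<in> SP" "!!j. SI (%t. ld 2 (pem 2 (\<theta> j) t) (emb 2 (%w. f t j)) powr 2)"
      "!!j. LI (%t. ld 2 (pem 2 (\<theta> j) t) (emb 2 (%w. f t j)) powr 2) < c" by blast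
    obtain \<zeta> where \<zeta>: "\<zeta> \<in> SP" "!!t w. process_at \<zeta> t w = (\<Sum>j\<in>J. pou \<delta> J j (process_at \<eta> t w) *\<^sub>R process_at (\<theta> j) t w)"
      using sp_weighted_sum[where \<rho>="pou \<delta> J" and \<theta>=\<theta>, OF \<eta> T0 pou_cyl[OF \<delta>(1)] J(1) \<theta>(1)] by blast
    let ?D = "%j t. ld 2 (pem 2 (\<theta> j) t) (emb 2 (%w. f t j))"
    let ?G = "%t. 2 * ?m * (\<Sum>j\<in>J. ?D j t powr 2) + 2 * (2 * K * \<delta>)^2"
    note S = SI_sum[where f="%j t. ?D j t powr 2", OF J(1) \<theta>(2)]
    have Si: "SI (%t. 2 * ?m * (\<Sum>j\<in>J. ?D j t powr 2))" using S(1) by (intro set_integrable_mult_right)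
    have G: "SI ?G" by (rule set_integral_add(1)[OF Si SI_const(1)])
    have "LI ?G = LI (%t. 2 * ?m * (\<Sum>j\<in>J. ?D j t powr 2)) + LI (%t. 2 * (2 * K * \<delta>)^2)" by (rule set_integral_add(2)[OF Si SI_const(1)])
    also have "... = 2 * ?m * (\<Sum>j\<in>J. LI (%t. ?D j t powr 2)) + 2 * (2 * K * \<delta>)^2 * T" using S(2) SI_const(2) by simp
    also have "(\<Sum>j\<in>J. LI (%t. ?D j t powr 2)) <= (\<Sum>j\<in>J. c)" by (intro sum_mono less_imp_le[OF \<theta>(3)])
    also have "(\<Sum>j\<in>J. c) = ?m * c" by simp
    finally have "LI ?G <= 2 * ?m * (?m * c) + eps / 2" using \<delta>K by (simp add: mult_left_mono)
    also have "2 * ?m * (?m * c) < 2 * (?m + 1) * ((?m + 1) * c)" 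
    proof -
      have "0 <= c * ?m" using c by simp
      then have "0 < 2 * c + 4 * (c * ?m)" using c by linarith
      moreover have "2 * (?m + 1) * ((?m + 1) * c) = 2 * ?m * (?m * c) + (2 * c + 4 * (c * ?m))" by (simp add: algebra_simps)
      ultimately show ?thesis by linarith
    qed
    also have "2 * (?m + 1) * ((?m + 1) * c) = eps / 2"
    proof -
      have eq1: "(?m + 1)^2 * c = eps / 4" using add_nonneg_pos[of ?m 1] by (simp add: c_def)
      have eq2: "2 * (?m + 1) * ((?m + 1) * c) = 2 * ((?m + 1)^2 * c)" by (simp only: power2_eq_square mult.assoc)
      show ?thesis unfolding eq2 eq1 by simp
    qed
    finally have Gl: "LI ?G < eps" by simp
    have "ld 2 (pem 2 \<zeta> t) (emb 2 (%w. f t (process_at \<eta> t w))) powr 2 <= ?G t" if t: "0 <= t" "t < T" for t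
    proof -
      have tT: "t \<in> {0..T}" using t by simp
      note L = cyl_LA[OF pa_T[OF \<zeta>(1), of t]] cyl_LA[OF fc[OF tT]]
      have dL: "(%w. norm (process_at (\<theta> j) t w - f t j)) \<in> LA" for j by (intro cyl_norm cyl_diff cyl_LA[OF pa_T[OF \<theta>(1)]] cyl_const)
      have sL: "(%w. \<Sum>j\<in>J. norm (process_at (\<theta> j) t w - f t j)) \<in> LA" by (intro cyl_sum dL)
      have "ld 2 (pem 2 \<zeta> t) (emb 2 (%w. f t (process_at \<eta> t w))) = nE E 2 (%w. process_at \<zeta> t w - f t (process_at \<eta> t w))"
        by (rule ld_emb[OF p12_2 pa_T[OF \<zeta>(1)] fc[OF tT]])
      also have "... <= nE E 2 (%w. (\<Sum>j\<in>J. norm (process_at (\<theta> j) t w - f t j)) + 2 * K * \<delta>)"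
      proof (rule nE_mono'[OF p12_2 cyl_diff[OF L] cyl_add[OF sL cyl_const]])
        fix w
        obtain i where i: "i \<in> J" "norm (process_at \<eta> t w - i) < \<delta>" using near[OF R] by blast
        have "norm (process_at \<zeta> t w - f t (process_at \<eta> t w)) <= (\<Sum>j\<in>J. norm (process_at (\<theta> j) t w - f t j)) + 2 * K * \<delta>"
          unfolding \<zeta>(2) by (rule pou_average_bound[OF \<delta>(1) J(1) i K(1) K(2)[OF tT]])
        then show "norm (process_at \<zeta> t w - f t (process_at \<eta> t w)) <= norm ((\<Sum>j\<in>J. norm (process_at (\<theta> j) t w - f t j)) + 2 * K * \<delta>)" by simp
      qed
      also have "... <= nE E 2 (%w. \<Sum>j\<in>J. norm (process_at (\<theta> j) t w - f t j)) + nE E 2 (%w. 2 * K * \<delta>)"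
        by (rule nE_triangle[OF p12_2 sL cyl_const])
      also have "nE E 2 (%w. \<Sum>j\<in>J. norm (process_at (\<theta> j) t w - f t j)) <= (\<Sum>j\<in>J. nE E 2 (%w. norm (process_at (\<theta> j) t w - f t j)))"
        by (rule nE_sum[OF p12_2 J(1) dL])
      also have "... = (\<Sum>j\<in>J. ?D j t)" by (simp add: nE_norm ld_emb[OF p12_2 pa_T[OF \<theta>(1)] cyl_const])
      also have "nE E 2 (%w. 2 * K * \<delta>) = 2 * K * \<delta>" using K(1) \<delta>(1) by (simp add: nE_const)
      finally have "ld 2 (pem 2 \<zeta> t) (emb 2 (%w. f t (process_at \<eta> t w))) <= (\<Sum>j\<in>J. ?D j t) + 2 * K * \<delta>" by simp
      moreover have n: "0 <= ld 2 (pem 2 \<zeta> t) (emb 2 (%w. f t (process_at \<eta> t w)))"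
        by (intro ld_nonneg p12_simps emb_in pa_T \<zeta> fc tT)
      ultimately have "(ld 2 (pem 2 \<zeta> t) (emb 2 (%w. f t (process_at \<eta> t w))))^2 <= ((\<Sum>j\<in>J. ?D j t) + 2 * K * \<delta>)^2" by (intro power_mono)
      also have "... <= 2 * (\<Sum>j\<in>J. ?D j t)^2 + 2 * (2 * K * \<delta>)^2"
        using zero_le_power2[of "(\<Sum>j\<in>J. ?D j t) - 2 * K * \<delta>"] by (simp add: power2_eq_square algebra_simps)
      also have "(\<Sum>j\<in>J. ?D j t)^2 <= (\<Sum>j\<in>J. (?D j t)^2) * ?m" by (rule sum_squared_le_sum_of_squares)
      also have "(\<Sum>j\<in>J. (?D j t)^2) = (\<Sum>j\<in>J. ?D j t powr 2)"
      proof (rule sum.cong[OF refl])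
        fix j
        have "0 <= ?D j t" by (intro ld_nonneg p12_simps emb_in pa_T \<theta> cyl_const)
        then show "(?D j t)^2 = ?D j t powr 2" by simp
      qed
      finally show ?thesis using n by (simp add: mult_ac)
    qed
    then show "\<exists>\<zeta>\<in>SP. \<exists>g. SI g \<and> LI g < eps \<and> (\<forall>t. 0 <= t --> t < T --> ld 2 (pem 2 \<zeta> t) (emb 2 (%w. f t (process_at \<eta> t w))) powr 2 <= g t)"
      using G Gl \<zeta>(1) by blast
  qed
qed

text \<open>The law is frozen to that of \<open>X\<close> while only the spatial argument is
  replaced by a simple process. The square integrability assumption is thus applied to the single
  flow \<open>law E T X\<close>, and the error is a multiple of the distance between the
  processes.\<close>

lemma coeff_MG_bar:
  assumes c: "lip_coeff K c" and H2: "!!x F. F \<in> distr_flow T ==> (%t. c t x (F t)) \<in> L2_fun T"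
    and X: "X \<in> MG_bar E T 2" and F: "law E T X \<in> distr_flow T"
  shows "coeff_process E T 2 c X \<in> MG_bar E T 2"
proof (rule MG_bar_closed)
  have le: "(2::real) <= 2" by simp
  have D: "law E T X t \<in> \<D>" if "t \<in> {0..T}" for t using F that by (simp add: distr_flow_def)
  show "coeff_process E T 2 c X t \<in> LGs 2" if t: "t \<in> {0..T}" for t
  proof -
    obtain u where "u \<in> X t" using LG_ne[OF p12_2 MG_barD[OF X t]] by blast
    from coeff_rep(1)[where X=X and t=t and u=u, OF c p12_2 le t MG_barD[OF X t] this] show ?thesis .
  qed
  fix eps :: real assume e: "eps > 0"
  obtain \<eta> where \<eta>: "mg_bar_approx E T 2 \<eta> X" using X by (auto simp: MG_bar_def)
  have "(%k. K\<^sup>2 * LI (%t. ld 2 (pem 2 (\<eta> k) t) (X t) powr 2)) ----> 0" by (rule tendsto_mult_right_zero[OF mg_bar_approxD(3)[OF \<eta>]])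
  from null_seq_less[OF this e] obtain k where k: "K\<^sup>2 * LI (%t. ld 2 (pem 2 (\<eta> k) t) (X t) powr 2) < eps" by blast
  note sp = mg_bar_approxD(1)[OF \<eta>, of k]
  let ?Y = "%t. emb 2 (%w. c t (process_at (\<eta> k) t w) (law E T X t))"
  let ?g = "%t. K\<^sup>2 * ld 2 (pem 2 (\<eta> k) t) (X t) powr 2"
  have Y: "?Y \<in> MG_bar E T 2"
    by (rule simple_coeff_MG_bar[where f="%t x. c t x (law E T X t)", OF lip_coeffD(1)[OF c] lip_coeffD(3)[OF c _ D] H2[OF F] sp])
  have g: "SI ?g" "LI ?g < eps" using mg_bar_approxD(2)[OF \<eta>, of k] k by (auto intro!: set_integrable_mult_right)
  have "(ld 2 (?Y t) (coeff_process E T 2 c X t))^2 <= ?g t" if t: "0 <= t" "t < T" for t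
  proof -
    have tT: "t \<in> {0..T}" using t by simp
    have f: "fadm (%w x. c t x (law E T X t)) K" by (intro fadm_lipschitz lip_coeffD[OF c] tT D)
    note L = pem_in[OF p12_2 sp, of t] MG_barD[OF X tT]
    have "ld 2 (?Y t) (coeff_process E T 2 c X t) <= K * ld 2 (pem 2 (\<eta> k) t) (X t)"
      using ld_lg_map[OF f p12_2 p12_2 le L] unfolding coeff_process_def lg_map_pem[OF f p12_2 p12_2 le sp] .
    moreover have "0 <= ld 2 (?Y t) (coeff_process E T 2 c X t)"
      using lg_map_pem[OF f p12_2 p12_2 le sp] lg_map_rep(1)[OF f p12_2 p12_2 le L(2)] LG_ne[OF p12_2 L(2)]
        MG_barD[OF Y tT] unfolding coeff_process_def by (blast intro: ld_nonneg p12_simps)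
    ultimately have "(ld 2 (?Y t) (coeff_process E T 2 c X t))^2 <= (K * ld 2 (pem 2 (\<eta> k) t) (X t))^2" by (intro power_mono)
    then show ?thesis using ld_nonneg[OF p12_2 L] by (simp add: power_mult_distrib)
  qed
  then show "\<exists>Y\<in>MG_bar E T 2. \<exists>g. SI g \<and> LI g < eps \<and> (\<forall>t. 0 <= t --> t < T --> (ld 2 (Y t) (coeff_process E T 2 c X t))^2 <= g t)"
    by (intro bexI[OF _ Y] exI[of _ ?g] conjI g allI impI)
qed

end

section \<open>The fixed point\<close>

text \<open>Integrating the weight \<open>exp (4 * L * t)\<close> and multiplying by
  \<open>L\<close> returns at most a quarter of it. This quarter is the contraction factor for
  squared distances.\<close>

lemma gronwall_step:
  fixes f :: "real => real"
  assumes f: "set_integrable lebesgue {0..t} f" and t: "0 <= t" and L: "0 < L" and M: "0 <= M"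
    and le: "!!r. r \<in> {0..t} ==> f r <= M * exp (4 * L * r)"
  shows "L * (LINT r:{0..t}|lebesgue. f r) <= M * exp (4 * L * t) / 4"
proof -
  have hi: "((%r. M * exp (4 * L * r)) has_integral (M * exp (4 * L * t) / (4 * L) - M * exp (4 * L * 0) / (4 * L))) {0..t}"
  proof (rule fundamental_theorem_of_calculus[OF t])
    fix r assume "r \<in> {0..t}"
    show "((%r. M * exp (4 * L * r) / (4 * L)) has_vector_derivative M * exp (4 * L * r)) (at r within {0..t})"
      unfolding has_real_derivative_iff_has_vector_derivative[symmetric]
      using L by (auto intro!: derivative_eq_intros)
  qed
  note fi = set_lebesgue_integral_eq_integral[OF f]
  have "(LINT r:{0..t}|lebesgue. f r) <= M * exp (4 * L * t) / (4 * L) - M * exp (4 * L * 0) / (4 * L)"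
    unfolding fi(2) by (rule has_integral_le[OF integrable_integral[OF fi(1)] hi le])
  moreover have "0 <= M * exp (4 * L * 0) / (4 * L)" using M L by simp
  ultimately have "(LINT r:{0..t}|lebesgue. f r) <= M * exp (4 * L * t) / (4 * L)" by linarith
  then have "L * (LINT r:{0..t}|lebesgue. f r) <= L * (M * exp (4 * L * t) / (4 * L))" using L by (intro mult_left_mono) auto
  then show ?thesis using L by simp
qed

text \<open>Absolute continuity of the integral, read off the uniform continuity of the indefinite
  integral on a compact interval.\<close>

lemma small_integral:
  fixes f :: "real => real"
  assumes f: "set_integrable lebesgue {0..T} f" and e: "eps > 0"
  shows "\<exists>\<delta>>0. \<forall>s t. 0 <= s --> s <= t --> t <= T --> t - s < \<delta> --> (LINT r:{s..t}|lebesgue. f r) < eps"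
proof -
  have fi: "f integrable_on {0..T}" by (rule set_lebesgue_integral_eq_integral(1)[OF f])
  have "uniformly_continuous_on {0..T} (%x. integral {0..x} f)"
    by (rule compact_uniformly_continuous[OF indefinite_integral_continuous_1[OF fi]]) simp
  then obtain \<delta> where \<delta>: "\<delta> > 0" "!!s t. s \<in> {0..T} ==> t \<in> {0..T} ==> dist t s < \<delta> ==> dist (integral {0..t} f) (integral {0..s} f) < eps"
    using e unfolding uniformly_continuous_on_def by blast
  have "(LINT r:{s..t}|lebesgue. f r) < eps" if st: "0 <= s" "s <= t" "t <= T" "t - s < \<delta>" for s t
  proof -
    have "set_integrable lebesgue {s..t} f" by (rule set_integrable_subset[OF f]) (use st in auto)
    then have 1: "(LINT r:{s..t}|lebesgue. f r) = integral {s..t} f" by (rule set_lebesgue_integral_eq_integral(2))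
    have "f integrable_on {0..t}" by (rule integrable_subinterval_real[OF fi]) (use st in auto)
    from Henstock_Kurzweil_Integration.integral_combine[OF st(1,2) this]
    have 2: "integral {s..t} f = integral {0..t} f - integral {0..s} f" by simp
    have "dist (integral {0..t} f) (integral {0..s} f) < eps" using st by (intro \<delta>(2)) (auto simp: dist_real_def)
    then show ?thesis unfolding 1 2 by (simp add: dist_real_def)
  qed
  then show ?thesis using \<delta>(1) by blast
qed

text \<open>All integrals of the equation form one family, each index with its own integrator,
  exponent and coefficient. The fixed point argument sees them only through
  \<open>good_integrator\<close>, so \<open>dt\<close>, \<open>d<B>\<close> and \<open>dB\<close>
  need not be distinguished.\<close>

locale integral_equation = sublinear_T E T for E :: "('d::finite path => real) => real" and T +
  fixes I :: "'i set" and A :: "'i => real => (nat => 'd path => real) set" and p :: "'i => real"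
    and J :: "'i => ('d, real^'n) simple_process => real => (nat => 'd path => real^'n) set" and C :: "'i => real"
    and c :: "'i => real => real^'n => ((real^'n => real) => real) => real^'n" and K :: real and x\<^sub>0 :: "real^'n"
  assumes finI: "finite I"
    and good: "i \<in> I ==> good_integrator (p i) (A i) (J i) (C i)"
    and pI: "i \<in> I ==> p12 (p i)"
    and lipc: "i \<in> I ==> lip_coeff K (c i)"
    and H2: "i \<in> I ==> F \<in> distr_flow T ==> (%t. c i t x (F t)) \<in> L2_fun T"
begin

lemma C_nonneg: "i \<in> I ==> 0 <= C i" using good by (auto simp: good_integrator_def)

definition comb :: "real => ('i => (nat => 'd path => real^'n) set) => (nat => 'd path => real^'n) set" where
  "comb q U = lg_add E T q (emb q (%w. x\<^sub>0)) (lg_sum E T q U I)"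

lemma comb_rep:
  assumes q: "p12 q" and U: "!!i. i \<in> I ==> U i \<in> LGs q" "!!i. i \<in> I ==> u i \<in> U i"
  shows "comb q U \<in> LGs q" "(%k w. x\<^sub>0 + (\<Sum>i\<in>I. u i k w)) \<in> comb q U"
proof -
  note s = lg_sum_rep[where U=U and u=u, OF q finI U]
  note a = lg_add_rep[OF q emb_in(1)[OF q cyl_const] s(1) emb_in(2)[OF q cyl_const] s(2), of x\<^sub>0]
  show "comb q U \<in> LGs q" unfolding comb_def by (rule a(1))
  show "(%k w. x\<^sub>0 + (\<Sum>i\<in>I. u i k w)) \<in> comb q U" unfolding comb_def by (rule a(2))
qed

lemma comb_in: assumes q: "p12 q" and U: "!!i. i \<in> I ==> U i \<in> LGs q" shows "comb q U \<in> LGs q"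
proof -
  have "\<forall>i\<in>I. \<exists>u. u \<in> U i" using LG_ne[OF q U] by blast
  from bchoice[OF this] obtain u where "!!i. i \<in> I ==> u i \<in> U i" by blast
  from comb_rep(1)[where U=U and u=u, OF q U this] show ?thesis .
qed

lemma inc_comb:
  assumes U: "!!i. i \<in> I ==> U i \<in> LGs 2" shows "inc (comb 2 U) = comb 1 (%i. inc (U i))"
proof -
  have "\<forall>i\<in>I. \<exists>u. u \<in> U i" using LG_ne[OF p12_2 U] by blast
  from bchoice[OF this] obtain u where u: "!!i. i \<in> I ==> u i \<in> U i" by blast
  note a = comb_rep[where U=U and u=u, OF p12_2 U u]
  note b = inc_rep(1)[OF p12_2 a(1)] inc_rep(2)[OF p12_2 a]
  have "comb 1 (%i. inc (U i)) \<in> LGs 1" "(%k w. x\<^sub>0 + (\<Sum>i\<in>I. u i k w)) \<in> comb 1 (%i. inc (U i))"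
    using comb_rep[where U="%i. inc (U i)" and u=u, OF p12_1 inc_rep(1)[OF p12_2 U] inc_rep(2)[OF p12_2 U u]] by auto
  from LG_D(2)[OF p12_1 this] LG_D(2)[OF p12_1 b] show ?thesis by simp
qed

lemma comb_ld:
  assumes q: "p12 q" and U: "!!i. i \<in> I ==> U i \<in> LGs q" and V: "!!i. i \<in> I ==> V i \<in> LGs q"
  shows "ld q (comb q U) (comb q V) <= (\<Sum>i\<in>I. ld q (U i) (V i))"
proof -
  have "\<forall>i\<in>I. \<exists>u. u \<in> U i" "\<forall>i\<in>I. \<exists>u. u \<in> V i" using LG_ne[OF q U] LG_ne[OF q V] by blast+
  from this[THEN bchoice] obtain u v where u: "!!i. i \<in> I ==> u i \<in> U i" and v: "!!i. i \<in> I ==> v i \<in> V i" by blast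
  note a = comb_rep[where U=U and u=u, OF q U u] comb_rep[where U=V and u=v, OF q V v]
  have L: "u i k \<in> LA" "v i k \<in> LA" if "i \<in> I" for i k
    using LG_D(1)[OF q U[OF that] u[OF that]] LG_D(1)[OF q V[OF that] v[OF that]] CS_LA by blast+
  show ?thesis
  proof (rule LIMSEQ_le)
    show "(%k. nE E q (%w. (x\<^sub>0 + (\<Sum>i\<in>I. u i k w)) - (x\<^sub>0 + (\<Sum>i\<in>I. v i k w)))) ----> ld q (comb q U) (comb q V)"
      by (rule ld_lim[OF q a(1,3,2,4)])
    show "(%k. \<Sum>i\<in>I. nE E q (%w. u i k w - v i k w)) ----> (\<Sum>i\<in>I. ld q (U i) (V i))"
      by (intro tendsto_sum ld_lim[OF q U V u v])
    have "nE E q (%w. \<Sum>i\<in>I. u i k w - v i k w) <= (\<Sum>i\<in>I. nE E q (%w. u i k w - v i k w))" for k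
      by (intro nE_sum q finI cyl_diff L)
    then show "\<exists>N. \<forall>n\<ge>N. nE E q (%w. (x\<^sub>0 + (\<Sum>i\<in>I. u i n w)) - (x\<^sub>0 + (\<Sum>i\<in>I. v i n w))) <= (\<Sum>i\<in>I. nE E q (%w. u i n w - v i n w))"
      by (simp add: sum_subtractf)
  qed
qed

abbreviation "zero1 \<equiv> emb 1 (%w. 0 :: real^'n)"

lemma zero1_in: "zero1 \<in> LGs 1" by (rule emb_in(1)[OF p12_1 cyl_const])

lemma comb_bounded:
  assumes U: "!!i. i \<in> I ==> U i \<in> LGs 1" shows "ld 1 (comb 1 U) zero1 <= (\<Sum>i\<in>I. ld 1 (U i) zero1) + norm x\<^sub>0"
proof -
  have "comb 1 (%i. zero1) \<in> LGs 1" "(%k w. x\<^sub>0) \<in> comb 1 (%i. zero1)"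
    using comb_rep[where U="%i. zero1" and u="%i k w. 0", OF p12_1 zero1_in emb_in(2)[OF p12_1 cyl_const]] by auto
  from LG_D(2)[OF p12_1 this] have e: "comb 1 (%i. zero1) = emb 1 (%w. x\<^sub>0)" by (simp add: lg_embed_def)
  have "ld 1 (comb 1 U) zero1 <= ld 1 (comb 1 U) (comb 1 (%i. zero1)) + ld 1 (comb 1 (%i. zero1)) zero1"
    by (intro ld_tri p12_simps comb_in U zero1_in)
  also have "ld 1 (comb 1 (%i. zero1)) zero1 = norm x\<^sub>0"
    unfolding e by (simp add: ld_emb[OF p12_1 cyl_const cyl_const] nE_const)
  also have "ld 1 (comb 1 U) (comb 1 (%i. zero1)) <= (\<Sum>i\<in>I. ld 1 (U i) zero1)" by (intro comb_ld p12_simps U zero1_in)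
  finally show ?thesis by simp
qed

definition admissible :: "(real => (nat => 'd path => real^'n) set) => bool" where
  "admissible X \<longleftrightarrow> X \<in> MG_bar E T 2 \<and> law E T X \<in> distr_flow T"

text \<open>Elements of \<open>MG_bar\<close> are functions of time, fixed at every
  \<open>t\<close>. The properties collected here are produced by \<open>\<Phi>\<close> and survive
  uniform limits; they imply \<open>admissible\<close>, which is what \<open>\<Phi>\<close> needs of
  its argument.\<close>

definition cont_adapted :: "(real => (nat => 'd path => real^'n) set) => bool" where
  "cont_adapted X \<longleftrightarrow> (\<forall>t\<in>{0..T}. X t \<in> LGs 2 \<and> adapted t (X t)) \<and>
     (\<forall>eps>0. \<exists>\<delta>>0. \<forall>s\<in>{0..T}. \<forall>t\<in>{0..T}. s <= t --> t - s < \<delta> --> ld 2 (X s) (X t) < eps)"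

lemma inc_zero2: "inc zero2 = zero1"
  using lg_map_emb[OF fadm_id p12_1 p12_2 _ cyl_const] by simp

lemma ld_inc_zero: assumes "U \<in> LGs 2" shows "ld 1 (inc U) zero1 <= ld 2 U (zero2 :: (nat => 'd path => real^'n) set)"
  unfolding inc_zero2[symmetric] using ld_lg_map[OF fadm_id p12_1 p12_2 _ assms zero2_in] by simp

lemma cont_adapted_bounded:
  assumes X: "cont_adapted X" shows "\<exists>M. \<forall>t\<in>{0..T}. ld 2 (X t) zero2 <= M"
proof -
  have L: "X t \<in> LGs 2" if "t \<in> {0..T}" for t using X that by (simp add: cont_adapted_def)
  have "continuous_on {0..T} (%t. ld 2 (X t) zero2)"
    unfolding continuous_on_iff
  proof (intro ballI allI impI)
    fix s eps :: real assume s: "s \<in> {0..T}" and e: "eps > 0"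
    obtain \<delta> where \<delta>: "\<delta> > 0" "!!s t. s \<in> {0..T} ==> t \<in> {0..T} ==> s <= t ==> t - s < \<delta> ==> ld 2 (X s) (X t) < eps"
      using X e unfolding cont_adapted_def by blast
    have "dist (ld 2 (X t) zero2) (ld 2 (X s) zero2) < eps" if t: "t \<in> {0..T}" "dist t s < \<delta>" for t
    proof -
      have "\<bar>ld 2 (X t) zero2 - ld 2 (X s) zero2\<bar> <= ld 2 (X t) (X s) + ld 2 zero2 (zero2 :: (nat => 'd path => real^'n) set)"
        by (intro ld_diff_le p12_simps L s t zero2_in)
      also have "... = ld 2 (X t) (X s)" by (simp add: ld_refl[OF p12_2 zero2_in])
      also have "... < eps"
      proof (cases "t <= s")
        case True then show ?thesis using \<delta>(2)[OF t(1) s] t(2) by (simp add: dist_real_def)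
      next
        case False then show ?thesis using \<delta>(2)[OF s t(1)] t(2) ld_sym[OF p12_2 L[OF t(1)] L[OF s]] by (simp add: dist_real_def)
      qed
      finally show ?thesis by (simp add: dist_real_def)
    qed
    then show "\<exists>d>0. \<forall>t\<in>{0..T}. dist t s < d --> dist (ld 2 (X t) zero2) (ld 2 (X s) zero2) < eps" using \<delta>(1) by blast
  qed
  from compact_imp_bounded[OF compact_continuous_image[OF this compact_Icc]]
  obtain M where "!!t. t \<in> {0..T} ==> norm (ld 2 (X t) zero2) <= M" unfolding bounded_iff by blast
  then show ?thesis by (intro exI[of _ M]) (fastforce simp: abs_le_iff)
qed

lemma cont_adapted_admissible: assumes X: "cont_adapted X" shows "admissible X"
proof -
  have L: "X t \<in> LGs 2" "adapted t (X t)" if "t \<in> {0..T}" for t using X that by (auto simp: cont_adapted_def)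
  obtain M where M: "!!t. t \<in> {0..T} ==> ld 2 (X t) zero2 <= M" using cont_adapted_bounded[OF X] by blast
  have "X \<in> MG_bar E T 2"
    by (rule continuous_adapted_approximable[OF p12_2 L]) (use X in \<open>auto simp: cont_adapted_def\<close>)
  moreover have "law E T X \<in> distr_flow T"
    by (rule law_flow[OF p12_2 L(1) order_trans[OF ld_inc_zero[OF L(1)] M]])
  ultimately show ?thesis by (simp add: admissible_def)
qed

abbreviation cf :: "'i => (real => (nat => 'd path => real^'n) set) => real => (nat => 'd path => real^'n) set" where
  "cf i X \<equiv> coeff_process E T 2 (c i) X"

lemma cf_MG: "admissible X ==> i \<in> I ==> cf i X \<in> MG_bar E T 2"
  unfolding admissible_def by (elim conjE) (rule coeff_MG_bar[OF lipc H2])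

definition \<Phi> :: "(real => (nat => 'd path => real^'n) set) => real => (nat => 'd path => real^'n) set" where
  "\<Phi> X t = comb 2 (%i. L2int (J i) (cf i X) t)"

text \<open>\<open>card I\<close> comes from Cauchy-Schwarz for the sum of the integrals,
  \<open>3 * C i\<close> from \<open>L2int_diff\<close> and \<open>(2 * K)^2\<close> from
  \<open>coeff_ld\<close>; adding \<open>1\<close> makes the constant positive in any case.\<close>

definition Lc :: real where "Lc = real (card I) * (\<Sum>i\<in>I. 3 * C i * (2 * K)^2) + 1"

lemma Lc: "0 < Lc" unfolding Lc_def using C_nonneg by (intro add_nonneg_pos mult_nonneg_nonneg sum_nonneg) auto

lemma sum_ld_sq:
  assumes U: "!!i. i \<in> I ==> U i \<in> LGs 2" and V: "!!i. i \<in> I ==> V i \<in> LGs 2"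
    and le: "!!i. i \<in> I ==> (ld 2 (U i) (V i))^2 <= m i"
  shows "(ld 2 (comb 2 U) (comb 2 V))^2 <= real (card I) * (\<Sum>i\<in>I. m i)"
proof -
  have "(ld 2 (comb 2 U) (comb 2 V))^2 <= (\<Sum>i\<in>I. ld 2 (U i) (V i))^2"
    by (intro power_mono comb_ld ld_nonneg comb_in p12_simps U V)
  also have "... <= (\<Sum>i\<in>I. (ld 2 (U i) (V i))^2) * real (card I)" by (rule sum_squared_le_sum_of_squares)
  also have "... <= (\<Sum>i\<in>I. m i) * real (card I)" by (intro mult_right_mono sum_mono le) auto
  finally show ?thesis by (simp add: mult.commute)
qed

lemma \<Phi>_diff:
  assumes X: "admissible X" "admissible Y" and t: "t \<in> {0..T}"
  shows "(ld 2 (\<Phi> X t) (\<Phi> Y t))^2 <= Lc * (LINT r:{0..t}|lebesgue. (ld 2 (X r) (Y r))^2)"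
proof -
  have MG: "X \<in> MG_bar E T 2" "Y \<in> MG_bar E T 2" using X by (auto simp: admissible_def)
  let ?d = "LINT r:{0..t}|lebesgue. (ld 2 (X r) (Y r))^2"
  have t': "0 <= (0::real)" "t <= T" using t by auto
  note si = SI_subinterval[OF MG_bar_sq_integrable[OF MG] t']
  have d0: "0 <= ?d" by (rule LI_nonneg) simp
  have "(ld 2 (\<Phi> X t) (\<Phi> Y t))^2 <= real (card I) * (\<Sum>i\<in>I. 3 * C i * ((2 * K)^2 * ?d))"
    unfolding \<Phi>_def
  proof (rule sum_ld_sq)
    fix i assume i: "i \<in> I"
    show "L2int (J i) (cf i X) t \<in> LGs 2" by (rule L2int(1)[OF good[OF i] cf_MG[OF X(1) i] t])
    show "L2int (J i) (cf i Y) t \<in> LGs 2" by (rule L2int(1)[OF good[OF i] cf_MG[OF X(2) i] t])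
    have "(ld 2 (L2int (J i) (cf i X) t) (L2int (J i) (cf i Y) t))^2 <= 3 * C i * (LINT r:{0..t}|lebesgue. (ld 2 (cf i X r) (cf i Y r))^2)"
      by (rule L2int_diff[OF good[OF i] cf_MG[OF X(1) i] cf_MG[OF X(2) i] t])
    also have "... <= 3 * C i * (LINT r:{0..t}|lebesgue. (2 * K)^2 * (ld 2 (X r) (Y r))^2)"
    proof (intro mult_left_mono set_integral_mono)
      show "set_integrable lebesgue {0..t} (%r. (ld 2 (cf i X r) (cf i Y r))^2)"
        by (rule SI_subinterval[OF MG_bar_sq_integrable[OF cf_MG[OF X(1) i] cf_MG[OF X(2) i]] t'])
      show "set_integrable lebesgue {0..t} (%r. (2 * K)^2 * (ld 2 (X r) (Y r))^2)" using si by (intro set_integrable_mult_right)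
      fix r assume "r \<in> {0..t}"
      then have r: "r \<in> {0..T}" using t by auto
      have "ld 2 (cf i X r) (cf i Y r) <= 2 * K * ld 2 (X r) (Y r)" by (rule coeff_ld[where X=X and Y=Y and t=r, OF lipc[OF i] r MG_barD[OF MG(1) r] MG_barD[OF MG(2) r]])
      then have "(ld 2 (cf i X r) (cf i Y r))^2 <= (2 * K * ld 2 (X r) (Y r))^2"
        by (intro power_mono ld_nonneg p12_simps MG_barD[OF cf_MG[OF X(1) i] r] MG_barD[OF cf_MG[OF X(2) i] r])
      then show "(ld 2 (cf i X r) (cf i Y r))^2 <= (2 * K)^2 * (ld 2 (X r) (Y r))^2" by (simp only: power_mult_distrib)
    qed (use C_nonneg[OF i] in simp)
    finally show "(ld 2 (L2int (J i) (cf i X) t) (L2int (J i) (cf i Y) t))^2 <= 3 * C i * ((2 * K)^2 * ?d)" by simp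
  qed
  also have "... = (Lc - 1) * ?d" by (simp add: Lc_def sum_distrib_right mult.assoc)
  also have "... <= Lc * ?d" using d0 by (intro mult_right_mono) auto
  finally show ?thesis .
qed

lemma \<Phi>_adapted:
  assumes X: "admissible X" and t: "t \<in> {0..T}" shows "\<Phi> X t \<in> LGs 2" "adapted t (\<Phi> X t)"
proof -
  have L: "L2int (J i) (cf i X) t \<in> LGs 2" "adapted t (L2int (J i) (cf i X) t)" if "i \<in> I" for i
    using L2int(1,2)[OF good[OF that] cf_MG[OF X that] t] by auto
  have "\<forall>i\<in>I. \<exists>u. u \<in> L2int (J i) (cf i X) t \<and> (\<forall>k. u k \<in> cyl {0..t})" using L(2) unfolding adapted_def by blast
  from bchoice[OF this] obtain u where u: "!!i. i \<in> I ==> u i \<in> L2int (J i) (cf i X) t" "!!i k. i \<in> I ==> u i k \<in> cyl {0..t}" by blast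
  note r = comb_rep[where U="%i. L2int (J i) (cf i X) t" and u=u, OF p12_2 L(1) u(1)]
  show "\<Phi> X t \<in> LGs 2" unfolding \<Phi>_def by (rule r(1))
  show "adapted t (\<Phi> X t)" unfolding \<Phi>_def adapted_def
    by (rule bexI[OF _ r(2)]) (intro allI cyl_add cyl_const cyl_sum u(2))
qed

text \<open>Increments are bounded by integrals of squared coefficient norms over
  \<open>[s,t]\<close>. These are small on short intervals by integrability alone, without a bound
  on the coefficients.\<close>

lemma \<Phi>_cadm: assumes X: "admissible X" shows "cont_adapted (\<Phi> X)"
  unfolding cont_adapted_def
proof (intro conjI ballI allI impI)
  fix t assume "t \<in> {0..T}"
  then show "\<Phi> X t \<in> LGs 2" "adapted t (\<Phi> X t)" using \<Phi>_adapted[OF X] by auto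
next
  fix eps :: real assume e: "eps > 0"
  let ?f = "%r. real (card I) * (\<Sum>i\<in>I. 2 * C i * (ld 2 (cf i X r) zero2)^2)"
  have si: "SI (%r. 2 * C i * (ld 2 (cf i X r) zero2)^2)" if "i \<in> I" for i
    using MG_bar_sq_integrable[OF cf_MG[OF X that] zero_MG_bar] by (intro set_integrable_mult_right)
  have fi: "SI ?f" using SI_sum(1)[OF finI si] by (intro set_integrable_mult_right)
  have "eps\<^sup>2 > 0" using e by simp
  from small_integral[OF fi this] obtain \<delta> where \<delta>: "\<delta> > 0"
    "!!s t. 0 <= s ==> s <= t ==> t <= T ==> t - s < \<delta> ==> (LINT r:{s..t}|lebesgue. ?f r) < eps\<^sup>2" by blast
  have "ld 2 (\<Phi> X s) (\<Phi> X t) < eps" if st: "s \<in> {0..T}" "t \<in> {0..T}" "s <= t" "t - s < \<delta>" for s t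
  proof (rule power2_less_imp_less)
    have st': "0 <= s" "t <= T" using st by auto
    have "(ld 2 (\<Phi> X s) (\<Phi> X t))^2 <= real (card I) * (\<Sum>i\<in>I. 2 * C i * (LINT r:{s..t}|lebesgue. (ld 2 (cf i X r) zero2)^2))"
      unfolding \<Phi>_def
    proof (rule sum_ld_sq)
      fix i assume i: "i \<in> I"
      show "L2int (J i) (cf i X) s \<in> LGs 2" by (rule L2int(1)[OF good[OF i] cf_MG[OF X i] st(1)])
      show "L2int (J i) (cf i X) t \<in> LGs 2" by (rule L2int(1)[OF good[OF i] cf_MG[OF X i] st(2)])
      show "(ld 2 (L2int (J i) (cf i X) s) (L2int (J i) (cf i X) t))^2 <= 2 * C i * (LINT r:{s..t}|lebesgue. (ld 2 (cf i X r) zero2)^2)"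
        by (rule L2int_cont[OF good[OF i] cf_MG[OF X i] st'(1) st(3) st'(2)])
    qed
    also have "... = (LINT r:{s..t}|lebesgue. ?f r)"
    proof -
      have i: "set_integrable lebesgue {s..t} (%r. 2 * C i * (ld 2 (cf i X r) zero2)^2)" if "i \<in> I" for i
        by (rule SI_subinterval[OF si[OF that] st'])
      have eq: "(%r. indicator {s..t} r *\<^sub>R (\<Sum>i\<in>I. 2 * C i * (ld 2 (cf i X r) zero2)^2)) = (%r. \<Sum>i\<in>I. indicator {s..t} r *\<^sub>R (2 * C i * (ld 2 (cf i X r) zero2)^2))"
        by (simp only: scaleR_sum_right)
      have "(LINT r:{s..t}|lebesgue. (\<Sum>i\<in>I. 2 * C i * (ld 2 (cf i X r) zero2)^2)) = (\<Sum>i\<in>I. (LINT r:{s..t}|lebesgue. 2 * C i * (ld 2 (cf i X r) zero2)^2))"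
        unfolding set_lebesgue_integral_def eq
        by (intro Bochner_Integration.integral_sum) (use i in \<open>simp add: set_integrable_def\<close>)
      then show ?thesis by simp
    qed
    also have "... < eps\<^sup>2" by (rule \<delta>(2)[OF st'(1) st(3) st'(2) st(4)])
    finally show "(ld 2 (\<Phi> X s) (\<Phi> X t))^2 < eps\<^sup>2" .
  qed (use e in simp)
  then show "\<exists>\<delta>>0. \<forall>s\<in>{0..T}. \<forall>t\<in>{0..T}. s <= t --> t - s < \<delta> --> ld 2 (\<Phi> X s) (\<Phi> X t) < eps" using \<delta>(1) by blast
qed

text \<open>Iterating the Lipschitz estimate in the norm weighted by \<open>exp (- 4 * Lc * t)\<close>, in which \<open>\<Phi>\<close> is a contraction.\<close>

lemma \<Phi>_contraction:
  assumes X: "admissible X" "admissible Y" and M: "0 <= M" "!!t. t \<in> {0..T} ==> (ld 2 (X t) (Y t))^2 <= M * exp (4 * Lc * t)" and t: "t \<in> {0..T}"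
  shows "(ld 2 (\<Phi> X t) (\<Phi> Y t))^2 <= M / 4 * exp (4 * Lc * t)"
proof -
  have MG: "X \<in> MG_bar E T 2" "Y \<in> MG_bar E T 2" using X by (auto simp: admissible_def)
  have t': "0 <= (0::real)" "t <= T" "0 <= t" using t by auto
  have "Lc * (LINT r:{0..t}|lebesgue. (ld 2 (X r) (Y r))^2) <= M * exp (4 * Lc * t) / 4"
    by (rule gronwall_step[OF SI_subinterval[OF MG_bar_sq_integrable[OF MG] t'(1,2)] t'(3) Lc M(1)]) (use M(2) t in auto)
  then show ?thesis using \<Phi>_diff[OF X t] by simp
qed

lemma fixed_point_unique:
  assumes X: "admissible X" "admissible Y" and fX: "!!t. t \<in> {0..T} ==> X t = \<Phi> X t" and fY: "!!t. t \<in> {0..T} ==> Y t = \<Phi> Y t" and t: "t \<in> {0..T}"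
  shows "X t = Y t"
proof -
  have MG: "X \<in> MG_bar E T 2" "Y \<in> MG_bar E T 2" using X by (auto simp: admissible_def)
  \<comment> \<open>The distance of the two processes is known to be square integrable in time only.
    One application of \<open>\<Phi>_diff\<close> turns this into a bound at every time, from which
    the iteration starts.\<close>
  define M where "M = Lc * LI (%r. (ld 2 (X r) (Y r))^2)"
  have M0: "0 <= M" unfolding M_def using Lc by (intro mult_nonneg_nonneg LI_nonneg) auto
  have b: "(ld 2 (X t) (Y t))^2 <= M / 4 ^ m * exp (4 * Lc * t)" if "t \<in> {0..T}" for m t using that
  proof (induction m arbitrary: t)
    case 0
    have "(ld 2 (X t) (Y t))^2 <= Lc * (LINT r:{0..t}|lebesgue. (ld 2 (X r) (Y r))^2)" using \<Phi>_diff[OF X 0] fX[OF 0] fY[OF 0] by simp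
    also have "... <= M" unfolding M_def using 0 Lc by (intro mult_left_mono LI_subinterval_le MG_bar_sq_integrable MG) auto
    also have "... <= M * exp (4 * Lc * t)" using M0 0 Lc by (simp add: mult_left_mono mult_le_cancel_left1)
    finally show ?case by simp
  next
    case (Suc m)
    have "0 <= M / 4 ^ m" using M0 by simp
    from \<Phi>_contraction[OF X this Suc.IH Suc.prems] show ?case using fX[OF Suc.prems] fY[OF Suc.prems] by (simp add: mult.commute)
  qed
  have "(%m. M * exp (4 * Lc * t) * (1 / 4) ^ m) ----> M * exp (4 * Lc * t) * 0" by (intro tendsto_mult tendsto_const LIMSEQ_realpow_zero) auto
  moreover have "(ld 2 (X t) (Y t))^2 <= M * exp (4 * Lc * t) * (1 / 4) ^ m" for m using b[OF t, of m] by (simp add: power_one_over field_simps)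
  ultimately have "(ld 2 (X t) (Y t))^2 <= M * exp (4 * Lc * t) * 0" by (intro LIMSEQ_le_const) auto
  then have "ld 2 (X t) (Y t) = 0" by simp
  then show ?thesis by (rule ld_zero[OF p12_2 MG_barD[OF MG(1) t] MG_barD[OF MG(2) t]])
qed

lemma geometric_Cauchy:
  fixes W :: "nat => (nat => 'd path => real^'n) set"
  assumes W: "!!m. W m \<in> LGs 2" and r: "0 <= r" "!!m. ld 2 (W (Suc m)) (W m) <= r / 2 ^ m" and mn: "m <= n"
  shows "ld 2 (W n) (W m) <= 2 * r / 2 ^ m"
proof -
  \<comment> \<open>The subtracted term strengthens the claim by the tail of the geometric series,
    so that the induction closes.\<close>
  have "ld 2 (W n) (W m) <= 2 * r / 2 ^ m - 2 * r / 2 ^ n" using mn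
  proof (induction n rule: dec_induct)
    case base show ?case by (simp add: ld_refl[OF p12_2 W])
  next
    case (step n)
    have "ld 2 (W (Suc n)) (W m) <= ld 2 (W (Suc n)) (W n) + ld 2 (W n) (W m)" by (rule ld_tri[OF p12_2 W W W])
    also have "... <= r / 2 ^ n + (2 * r / 2 ^ m - 2 * r / 2 ^ n)" using r(2)[of n] step.IH by linarith
    also have "... = 2 * r / 2 ^ m - 2 * r / 2 ^ Suc n" by simp
    finally show ?case .
  qed
  moreover have "0 <= 2 * r / 2 ^ n" using r(1) by simp
  ultimately show ?thesis by linarith
qed

lemma fixed_point_exists: "\<exists>X. cont_adapted X \<and> (\<forall>t\<in>{0..T}. X t = \<Phi> X t)"
proof -
  define W where "W m = (\<Phi> ^^ m) (%t. emb 2 (%w. x\<^sub>0))" for m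
  have WS: "W (Suc m) = \<Phi> (W m)" for m by (simp add: W_def)
  have x0: "emb 2 (%w. x\<^sub>0) \<in> LGs 2" by (rule emb_in(1)[OF p12_2 cyl_const])
  have Wc: "cont_adapted (W m)" for m
  proof (induction m)
    case 0
    have "adapted t (emb 2 (%w. x\<^sub>0))" for t
      unfolding adapted_def by (rule bexI[OF _ emb_in(2)[OF p12_2 cyl_const]]) (simp add: cyl_const)
    then show ?case using x0 by (auto simp: W_def cont_adapted_def ld_refl[OF p12_2 x0] intro!: exI[of _ 1])
  next
    case (Suc m) then show ?case unfolding WS by (intro \<Phi>_cadm cont_adapted_admissible)
  qed
  have Wa: "admissible (W m)" for m by (rule cont_adapted_admissible[OF Wc])
  have WL: "W m t \<in> LGs 2" "adapted t (W m t)" if "t \<in> {0..T}" for m t using Wc[of m] that by (auto simp: cont_adapted_def)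
  obtain M1 where M1: "!!t. t \<in> {0..T} ==> ld 2 (W 1 t) zero2 <= M1" using cont_adapted_bounded[OF Wc] by blast
  obtain M2 where M2: "!!t. t \<in> {0..T} ==> ld 2 (W 0 t) zero2 <= M2" using cont_adapted_bounded[OF Wc] by blast
  define M where "M = (M1 + M2)^2"
  have M0: "0 <= M" by (simp add: M_def)
  have b: "(ld 2 (W (Suc m) t) (W m t))^2 <= M / 4 ^ m * exp (4 * Lc * t)" if "t \<in> {0..T}" for m t using that
  proof (induction m arbitrary: t)
    case 0
    have "ld 2 (W 1 t) (W 0 t) <= ld 2 (W 1 t) zero2 + ld 2 (W 0 t) zero2"
      using ld_tri[OF p12_2 WL(1)[OF 0] zero2_in WL(1)[OF 0], of 1 0] ld_sym[OF p12_2 WL(1)[OF 0] zero2_in, of 0] by simp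
    then have "ld 2 (W 1 t) (W 0 t) <= M1 + M2" using M1[OF 0] M2[OF 0] by linarith
    then have "(ld 2 (W 1 t) (W 0 t))^2 <= M" unfolding M_def by (intro power_mono ld_nonneg p12_simps WL 0)
    also have "... <= M * exp (4 * Lc * t)" using M0 0 Lc by (simp add: mult_left_mono mult_le_cancel_left1)
    finally show ?case by simp
  next
    case (Suc m)
    have "0 <= M / 4 ^ m" using M0 by simp
    from \<Phi>_contraction[OF Wa Wa this Suc.IH Suc.prems] show ?case by (simp add: WS mult.commute)
  qed
  \<comment> \<open>Squared distances shrink by \<open>1/4\<close> in the weighted norm, hence
    distances by \<open>1/2\<close>; the weight is estimated by its value at
    \<open>T\<close>.\<close>
  define r where "r = sqrt (M * exp (4 * Lc * T))"
  have r0: "0 <= r" using M0 by (simp add: r_def)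
  have step: "ld 2 (W (Suc m) t) (W m t) <= r / 2 ^ m" if t: "t \<in> {0..T}" for m t
  proof (rule power2_le_imp_le)
    have "(ld 2 (W (Suc m) t) (W m t))^2 <= M / 4 ^ m * exp (4 * Lc * t)" by (rule b[OF t])
    also have "... <= M / 4 ^ m * exp (4 * Lc * T)" using M0 t Lc by (intro mult_left_mono) auto
    also have "... = (r / 2 ^ m)^2"
    proof -
      have "((2::real) ^ m)^2 = (2\<^sup>2) ^ m" by (simp only: power_mult[symmetric] mult.commute)
      then show ?thesis using M0 by (simp add: r_def power_divide)
    qed
    finally show "(ld 2 (W (Suc m) t) (W m t))^2 <= (r / 2 ^ m)^2" .
  qed (use r0 in simp)
  have rl: "(%m. 2 * r / 2 ^ m) ----> 0"
  proof -
    have eq: "(%m. 2 * r / 2 ^ m) = (%m. 2 * r * (1 / 2) ^ m)" by (simp add: power_divide)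
    show ?thesis unfolding eq by (rule tendsto_mult_right_zero[OF LIMSEQ_realpow_zero]) auto
  qed
  \<comment> \<open>The rate is kept together with the limit. It does not depend on
    \<open>t\<close>, and so the pointwise limits inherit continuity in time from the
    iterates.\<close>
  have "\<exists>V. V \<in> LGs 2 \<and> adapted t V \<and> (\<forall>m. ld 2 (W m t) V <= 2 * r / 2 ^ m)" if t: "t \<in> {0..T}" for t
  proof -
    note geo = geometric_Cauchy[where W="%m. W m t", OF WL(1)[OF t] r0 step[OF t]]
    have cau: "\<exists>M. \<forall>k\<ge>M. \<forall>l\<ge>M. ld 2 (W k t) (W l t) < eps" if e: "eps > 0" for eps
    proof -
      obtain N where N: "!!k. k \<ge> N ==> 2 * r / 2 ^ k < eps" using null_seq_less[OF rl e] by blast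
      have "ld 2 (W k t) (W l t) < eps" if "k \<ge> N" "l \<ge> N" for k l
      proof (cases "l <= k")
        case True then show ?thesis using geo[of l k] N[OF that(2)] by linarith
      next
        case False then show ?thesis using geo[of k l] N[OF that(1)] ld_sym[OF p12_2 WL(1)[OF t] WL(1)[OF t], of k l] by linarith
      qed
      then show ?thesis by blast
    qed
    obtain V where V: "V \<in> LGs 2" "adapted t V" "(%m. ld 2 (W m t) V) ----> 0"
      using LG_complete[OF p12_2 WL(1)[OF t] cau t WL(2)[OF t]] by blast
    have "ld 2 (W m t) V <= 2 * r / 2 ^ m" for m
    proof -
      have c0: "(%n. ld 2 (W m t) (W m t)) ----> 0" by (simp add: ld_refl[OF p12_2 WL(1)[OF t]])
      have "(%n. ld 2 (W m t) (W n t)) ----> ld 2 (W m t) V"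
        by (rule ld_tendsto[where U="%n. W m t" and V="%n. W n t", OF p12_2 WL(1)[OF t] WL(1)[OF t] WL(1)[OF t] V(1) c0 V(3)])
      then show ?thesis
      proof (rule LIMSEQ_le_const2)
        have "ld 2 (W m t) (W n t) <= 2 * r / 2 ^ m" if "n \<ge> m" for n
          using geo[OF that] ld_sym[OF p12_2 WL(1)[OF t] WL(1)[OF t], of m n] by simp
        then show "\<exists>N. \<forall>n\<ge>N. ld 2 (W m t) (W n t) <= 2 * r / 2 ^ m" by blast
      qed
    qed
    then show ?thesis using V by blast
  qed
  then have "\<forall>t\<in>{0..T}. \<exists>V. V \<in> LGs 2 \<and> adapted t V \<and> (\<forall>m. ld 2 (W m t) V <= 2 * r / 2 ^ m)" by blast
  from bchoice[OF this] obtain X where X: "!!t. t \<in> {0..T} ==> X t \<in> LGs 2" "!!t. t \<in> {0..T} ==> adapted t (X t)"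
    "!!t m. t \<in> {0..T} ==> ld 2 (W m t) (X t) <= 2 * r / 2 ^ m" by blast
  have Xc: "cont_adapted X" unfolding cont_adapted_def
  proof (intro conjI ballI allI impI)
    fix eps :: real assume e: "eps > 0"
    then have e3: "eps / 3 > 0" by simp
    obtain m where m: "2 * r / 2 ^ m < eps / 3" using null_seq_less[OF rl e3] by blast
    obtain \<delta> where \<delta>: "\<delta> > 0" "!!s t. s \<in> {0..T} ==> t \<in> {0..T} ==> s <= t ==> t - s < \<delta> ==> ld 2 (W m s) (W m t) < eps / 3"
      using Wc[of m] e3 unfolding cont_adapted_def by blast
    have "ld 2 (X s) (X t) < eps" if st: "s \<in> {0..T}" "t \<in> {0..T}" "s <= t" "t - s < \<delta>" for s t
    proof -
      have "ld 2 (X s) (X t) <= ld 2 (W m s) (X s) + (ld 2 (W m s) (W m t) + ld 2 (W m t) (X t))"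
        using ld_tri[OF p12_2 X(1)[OF st(1)] WL(1)[OF st(1)] X(1)[OF st(2)], of m] ld_sym[OF p12_2 X(1)[OF st(1)] WL(1)[OF st(1)], of m]
          ld_tri[OF p12_2 WL(1)[OF st(1)] WL(1)[OF st(2)] X(1)[OF st(2)], of m m] by linarith
      then show ?thesis using X(3)[OF st(1), of m] X(3)[OF st(2), of m] \<delta>(2)[OF st] m by linarith
    qed
    then show "\<exists>\<delta>>0. \<forall>s\<in>{0..T}. \<forall>t\<in>{0..T}. s <= t --> t - s < \<delta> --> ld 2 (X s) (X t) < eps" using \<delta>(1) by blast
  qed (use X in auto)
  have Xa: "admissible X" by (rule cont_adapted_admissible[OF Xc])
  have "X t = \<Phi> X t" if t: "t \<in> {0..T}" for t
  proof (rule LG_limit_unique[OF p12_2 WL(1)[OF t] X(1)[OF t] \<Phi>_adapted(1)[OF Xa t]])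
    have WX: "(ld 2 (W m s) (X s))^2 <= (2 * r / 2 ^ m)^2 * exp (4 * Lc * s)" if s: "s \<in> {0..T}" for m s
    proof -
      have "(ld 2 (W m s) (X s))^2 <= (2 * r / 2 ^ m)^2" by (intro power_mono X(3) ld_nonneg p12_simps WL X(1) s)
      also have "... <= (2 * r / 2 ^ m)^2 * exp (4 * Lc * s)" using s Lc mult_left_mono[of 1 "exp (4 * Lc * s)" "(2 * r / 2 ^ m)^2"] by simp
      finally show ?thesis .
    qed
    have le: "(ld 2 (W (Suc m) t) (\<Phi> X t))^2 <= (2 * r / 2 ^ m)^2 / 4 * exp (4 * Lc * t)" for m
      unfolding WS by (rule \<Phi>_contraction[OF Wa Xa zero_le_power2 WX t])
    have "(%m. (2 * r / 2 ^ m)^2 / 4 * exp (4 * Lc * t)) ----> 0\<^sup>2 / 4 * exp (4 * Lc * t)"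
      by (intro tendsto_mult tendsto_divide tendsto_power tendsto_const rl) simp
    then have lim: "(%m. (2 * r / 2 ^ m)^2 / 4 * exp (4 * Lc * t)) ----> 0" by simp
    have "(%m. ld 2 (W (Suc m) t) (\<Phi> X t)) ----> 0" by (rule sq_null, rule null_le[OF lim le zero_le_power2])
    then show "(%m. ld 2 (W m t) (\<Phi> X t)) ----> 0" by (rule LIMSEQ_imp_Suc)
    show "(%m. ld 2 (W m t) (X t)) ----> 0" by (rule null_le[OF rl X(3)[OF t] ld_nonneg[OF p12_2 WL(1)[OF t] X(1)[OF t]]])
  qed
  then show ?thesis using Xc by blast
qed

section \<open>Solutions of the equation in \<open>L_G^1\<close> and fixed points in
  \<open>L_G^2\<close>\<close>

abbreviation cfp :: "'i => (real => (nat => 'd path => real^'n) set) => real => (nat => 'd path => real^'n) set" where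
  "cfp i X \<equiv> coeff_process E T (p i) (c i) X"

definition rhs :: "(real => (nat => 'd path => real^'n) set) => real => (nat => 'd path => real^'n) set" where
  "rhs X t = comb 1 (%i. inc (integral_upto E T (p i) (A i) t (mg_incl E T (p i) (cfp i X))))"

definition solves :: "(real => (nat => 'd path => real^'n) set) => bool" where
  "solves X \<longleftrightarrow> X \<in> MG_bar E T 2 \<and> (\<forall>i\<in>I. cfp i X \<in> MG_bar E T (p i)) \<and> (\<forall>t\<in>{0..T}. inc (X t) = rhs X t)"

lemma cfp_eq: assumes "i \<in> I" "X \<in> MG_bar E T 2" "t \<in> {0..T}" shows "cfp i X t = (if p i = 1 then inc (cf i X t) else cf i X t)"
  using coeff_inc[where X=X and t=t, OF lipc[OF assms(1)] assms(3) MG_barD[OF assms(2,3)]] pI[OF assms(1)] by (auto simp: p12_def)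

lemma inc_\<Phi>: assumes X: "admissible X" and t: "t \<in> {0..T}" shows "inc (\<Phi> X t) = rhs X t"
proof -
  have MG: "X \<in> MG_bar E T 2" using X by (simp add: admissible_def)
  have L: "L2int (J i) (cf i X) t \<in> LGs 2" if "i \<in> I" for i by (rule L2int(1)[OF good[OF that] cf_MG[OF X that] t])
  have eq: "inc (L2int (J i) (cf i X) t) = inc (integral_upto E T (p i) (A i) t (mg_incl E T (p i) (cfp i X)))" if i: "i \<in> I" for i
    by (rule inc_L2int[OF good[OF i] pI[OF i] cf_MG[OF X i] t cfp_eq[OF i MG]])
  have "inc (\<Phi> X t) = comb 1 (%i. inc (L2int (J i) (cf i X) t))" unfolding \<Phi>_def by (rule inc_comb[OF L])
  also have "... = rhs X t" unfolding rhs_def comb_def lg_sum_def using eq by (simp cong: ball_cong)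
  finally show ?thesis .
qed

lemma admissible_cfp: assumes X: "admissible X" and i: "i \<in> I" shows "cfp i X \<in> MG_bar E T (p i)"
proof -
  have MG: "X \<in> MG_bar E T 2" using X by (simp add: admissible_def)
  note cX = cf_MG[OF X i]
  show ?thesis
  proof (cases "p i = 1")
    case True
    obtain \<eta> where \<eta>: "mg_bar_approx E T 2 \<eta> (cf i X)" using cX by (auto simp: MG_bar_def)
    have e: "cfp i X t = inc (cf i X t)" if "t \<in> {0..T}" for t using cfp_eq[OF i MG that] True by simp
    have "mg_bar_approx E T 1 \<eta> (%t. inc (cf i X t))" by (rule mg_bar_approx_2_1[OF \<eta> MG_barD[OF cX]])
    then have "mg_bar_approx E T 1 \<eta> (cfp i X)" using mg_bar_approx_cong[of "cfp i X" "%t. inc (cf i X t)" 1 \<eta>] e by simp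
    moreover have "cfp i X t \<in> LGs 1" if "t \<in> {0..T}" for t unfolding e[OF that] by (rule inc_rep(1)[OF p12_2 MG_barD[OF cX that]])
    ultimately show ?thesis unfolding MG_bar_def True by blast
  next
    case False
    then have "p i = 2" using pI[OF i] by (simp add: p12_def)
    then show ?thesis using cX by simp
  qed
qed

text \<open>Membership in \<open>MG_bar 2\<close> bounds moments only on average over time, whereas
  \<open>distr_flow\<close> asks for a bound at every time. Since integrals are bounded in
  \<open>L_G^1\<close> uniformly in time, the equation supplies it.\<close>

lemma solves_admissible: assumes Y: "solves Y" shows "admissible Y"
proof -
  have MG: "Y \<in> MG_bar E T 2" and cY: "!!i. i \<in> I ==> cfp i Y \<in> MG_bar E T (p i)" and eq: "!!t. t \<in> {0..T} ==> inc (Y t) = rhs Y t"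
    using Y by (auto simp: solves_def)
  let ?U = "%t i. inc (integral_upto E T (p i) (A i) t (mg_incl E T (p i) (cfp i Y)))"
  have "\<forall>i\<in>I. \<exists>M. \<forall>t\<in>{0..T}. ld 1 (?U t i) zero1 <= M" using integral_upto_bounded[OF good pI cY] by blast
  from bchoice[OF this] obtain M where M: "!!i t. i \<in> I ==> t \<in> {0..T} ==> ld 1 (?U t i) zero1 <= M i" by blast
  have bound: "ld 1 (inc (Y t)) zero1 <= (\<Sum>i\<in>I. M i) + norm x\<^sub>0" if t: "t \<in> {0..T}" for t
  proof -
    have "?U t i \<in> LGs 1" if i: "i \<in> I" for i
    proof -
      obtain \<eta> where \<eta>: "mg_bar_approx E T (p i) \<eta> (cfp i Y)" using cY[OF i] by (auto simp: MG_bar_def)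
      show ?thesis by (rule inc_rep(1)[OF pI[OF i] integral_upto_limit(1)[OF good[OF i] pI[OF i] MG_barD[OF cY[OF i]] \<eta> t]])
    qed
    from comb_bounded[OF this] have "ld 1 (inc (Y t)) zero1 <= (\<Sum>i\<in>I. ld 1 (?U t i) zero1) + norm x\<^sub>0" unfolding eq[OF t] rhs_def .
    also have "... <= (\<Sum>i\<in>I. M i) + norm x\<^sub>0" by (intro add_right_mono sum_mono M t)
    finally show ?thesis .
  qed
  have "law E T Y \<in> distr_flow T" by (rule law_flow[OF p12_2 MG_barD[OF MG] bound])
  then show ?thesis using MG by (simp add: admissible_def)
qed

theorem unique_solution: "\<exists>X. solves X \<and> (\<forall>Y. solves Y --> (\<forall>t\<in>{0..T}. Y t = X t))"
proof -
  obtain X where Xc: "cont_adapted X" and fX: "!!t. t \<in> {0..T} ==> X t = \<Phi> X t" using fixed_point_exists by blast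
  have X: "admissible X" by (rule cont_adapted_admissible[OF Xc])
  have "solves X" unfolding solves_def
    using X admissible_cfp[OF X] inc_\<Phi>[OF X] fX by (auto simp: admissible_def)
  moreover have "Y t = X t" if Y: "solves Y" and t: "t \<in> {0..T}" for Y t
  proof -
    have a: "admissible Y" by (rule solves_admissible[OF Y])
    \<comment> \<open>The equation is an identity after inclusion into \<open>L_G^1\<close>;
      injectivity lifts it to \<open>L_G^2\<close>, where the uniqueness argument works.\<close>
    have "Y t = \<Phi> Y t" if "t \<in> {0..T}" for t
    proof (rule inc_inj)
      show "Y t \<in> LGs 2" using a that MG_barD by (auto simp: admissible_def)
      show "\<Phi> Y t \<in> LGs 2" by (rule \<Phi>_adapted(1)[OF a that])
      show "inc (Y t) = inc (\<Phi> Y t)" using Y inc_\<Phi>[OF a that] that by (simp add: solves_def)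
    qed
    then show ?thesis by (intro fixed_point_unique[OF a X _ fX t])
  qed
  ultimately show ?thesis by blast
qed

end

section \<open>The equation in the \<open>G\<close>-framework as an instance of the abstract
  one\<close>

lemma G_expectation_brownian:
  fixes E :: "('d::finite path => real) => real"
  assumes "G_expectation E G" "0 < T" shows "brownian E T"
proof -
  interpret G_expectation E G by fact
  have L: "(Lip_all :: ('d path => real) set) = LA" by (rule Lip_all_eq_cyl)
  \<comment> \<open>The quadratic form of the identity matrix is \<open>|B_1|^2\<close>, the source
    of uniform integrability.\<close>
  have "transpose (mat 1 :: real^'d^'d) = mat 1" by (rule transpose_mat)
  from G_eq[OF this] have q: "quad_form_B\<^sub>1 E (mat 1) \<in> LG E 1 1" by blast
  show ?thesis
    by unfold_locales
      (use assms(2) q increments_distributed increments_independent in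
        \<open>auto simp: constant_preserving intro: monotone[unfolded L] sub_additive[unfolded L] positively_homogeneous[unfolded L]\<close>)
qed

lemma sum_UNIV_Plus:
  fixes g :: "'a::finite + 'b::finite => 'c::comm_monoid_add"
  shows "sum g UNIV = (\<Sum>x\<in>UNIV. g (Inl x)) + (\<Sum>y\<in>UNIV. g (Inr y))"
proof -
  have "sum g UNIV = sum g (UNIV <+> UNIV)" by simp
  also have "... = (\<Sum>x\<in>UNIV. g (Inl x)) + (\<Sum>y\<in>UNIV. g (Inr y))" by (subst sum.Plus) (simp_all add: o_def)
  finally show ?thesis .
qed

theorem theorem4p1:
  fixes E :: "(('d::finite) path \<Rightarrow> real) \<Rightarrow> real"
    and G :: "real^'d^'d \<Rightarrow> real"
    and e :: "'d \<Rightarrow> real^'d"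
    and T :: real
    and x\<^sub>0 :: "real^'n"
    and b :: "real \<Rightarrow> real^'n \<Rightarrow> ((real^'n \<Rightarrow> real) \<Rightarrow> real) \<Rightarrow> real^'n"
    and h :: "'d \<Rightarrow> 'd \<Rightarrow> real \<Rightarrow> real^'n \<Rightarrow> ((real^'n \<Rightarrow> real) \<Rightarrow> real) \<Rightarrow> real^'n"
    and \<sigma> :: "'d \<Rightarrow> real \<Rightarrow> real^'n \<Rightarrow> ((real^'n \<Rightarrow> real) \<Rightarrow> real) \<Rightarrow> real^'n"
  assumes G_exp: "G_expectation E G"
    and orthonormal: "\<And>i j. e i \<bullet> e j = (if i = j then 1 else 0)"
    and T_pos: "T > 0"
    and H1: "\<exists>K>0. \<forall>t\<in>{0..T}. \<forall>x y. \<forall>f\<in>\<D>. \<forall>g\<in>\<D>. \<forall>i j.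
        norm (b t x f - b t y g) + norm (h i j t x f - h i j t y g) + norm (\<sigma> j t x f - \<sigma> j t y g)
          \<le> K * (norm (x - y) + d\<^sub>1 f g)"
    and H2: "\<And>x F i j. F \<in> distr_flow T \<Longrightarrow>
        (\<lambda>t. b t x (F t)) \<in> L2_fun T \<and>
        (\<lambda>t. h i j t x (F t)) \<in> L2_fun T \<and>
        (\<lambda>t. \<sigma> j t x (F t)) \<in> L2_fun T"
  shows "\<exists>X. is_solution E T e x\<^sub>0 b h \<sigma> X \<and>
           (\<forall>Y. is_solution E T e x\<^sub>0 b h \<sigma> Y \<longrightarrow> (\<forall>t\<in>{0..T}. Y t = X t))"
proof -
  interpret brownian E T by (rule G_expectation_brownian[OF G_exp T_pos])
  obtain K where K: "K > 0" and Kle: "!!t x y f g i j. t \<in> {0..T} ==> f \<in> \<D> ==> g \<in> \<D> ==>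
      norm (b t x f - b t y g) + norm (h i j t x f - h i j t y g) + norm (\<sigma> j t x f - \<sigma> j t y g) <= K * (norm (x - y) + d\<^sub>1 f g)"
    using H1 by blast
  have lip: "norm (b t x f - b t y g) <= K * (norm (x - y) + d\<^sub>1 f g)"
    "norm (h i j t x f - h i j t y g) <= K * (norm (x - y) + d\<^sub>1 f g)"
    "norm (\<sigma> j t x f - \<sigma> j t y g) <= K * (norm (x - y) + d\<^sub>1 f g)"
    if "t \<in> {0..T}" "f \<in> \<D>" "g \<in> \<D>" for t x y f g i j
    using Kle[OF that, of x y i j] norm_ge_zero[of "b t x f - b t y g"] norm_ge_zero[of "h i j t x f - h i j t y g"]
      norm_ge_zero[of "\<sigma> j t x f - \<sigma> j t y g"] by linarith+
  \<comment> \<open>The exponent attached to each index is that of the space in which the equation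
    forms the integral, so that \<open>rhs\<close> is built from the prescribed integrals.\<close>
  define A where "A = case_sum (%_ :: unit. time E T) (case_sum (%ij. mutual_var E T (e (fst ij)) (e (snd ij))) (%j. B_dir E T (e j)))"
  define p where "p = case_sum (%_ :: unit. 1 :: real) (case_sum (%_ :: 'd \<times> 'd. 1) (%_ :: 'd. 2))"
  define c where "c = case_sum (%_ :: unit. b) (case_sum (%ij. h (fst ij) (snd ij)) \<sigma>)"
  have ex: "\<exists>J C. good_integrator (p i) (A i) (J :: ('d, real^'n) simple_process => _) C" for i
  proof (cases i)
    case (Inl u)
    then show ?thesis using lip_good[OF time_lip, where 'v="real^'n"] by (auto simp: A_def p_def)
  next
    case (Inr k)
    show ?thesis
    proof (cases k)
      case (Inl ij)
      then show ?thesis using lip_good[OF mutual_var_lip, of "e (fst ij)" "e (snd ij)", where 'v="real^'n"] Inr by (auto simp: A_def p_def)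
    next
      case (Inr j)
      then show ?thesis using bt_good[of "e j", where 'v="real^'n"] \<open>i = Inr k\<close> by (auto simp: A_def p_def)
    qed
  qed
  then obtain J :: "_ => ('d, real^'n) simple_process => _" and C where J: "!!i. good_integrator (p i) (A i) (J i) (C i)" by metis
  have pP: "p12 (p i)" for i by (simp add: p_def split: sum.split)
  interpret eq: integral_equation E T UNIV A p J C c K x\<^sub>0
  proof
    show "lip_coeff K (c i)" for i
      unfolding lip_coeff_def c_def using K lip by (auto split: sum.split)
    show "(%t. c i t x (F t)) \<in> L2_fun T" if "F \<in> distr_flow T" for i F x
      using H2[OF that] by (auto simp: c_def split: sum.split)
  qed (auto simp: J pP)
  have "eq.solves X \<longleftrightarrow> is_solution E T e x\<^sub>0 b h \<sigma> X" for X
  proof -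
    have mem: "(\<forall>i\<in>UNIV. eq.cfp i X \<in> MG_bar E T (p i)) \<longleftrightarrow> coeff_process E T 1 b X \<in> MG_bar E T 1 \<and>
      (\<forall>i j. coeff_process E T 1 (h i j) X \<in> MG_bar E T 1) \<and> (\<forall>j. coeff_process E T 2 (\<sigma> j) X \<in> MG_bar E T 2)"
      by (auto simp: p_def c_def split: sum.split)
    \<comment> \<open>The sum over the index type and the nested sums of the equation contain a
      common representing sequence, hence are the same class. Representatives of the integrals are
      available once the integrands lie in their spaces, which is the assumption
      \<open>cX\<close>.\<close>
    have rhs: "eq.rhs X t = lg_add E T 1 (emb 1 (%w. x\<^sub>0))
        (lg_add E T 1 (integral_upto E T 1 (time E T) t (mg_incl E T 1 (coeff_process E T 1 b X)))
        (lg_add E T 1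
          (lg_sum E T 1 (%(i, j). integral_upto E T 1 (mutual_var E T (e i) (e j)) t
                       (mg_incl E T 1 (coeff_process E T 1 (h i j) X))) UNIV)
          (lg_sum E T 1 (%j. inc (integral_upto E T 2 (B_dir E T (e j)) t
                         (mg_incl E T 2 (coeff_process E T 2 (\<sigma> j) X)))) UNIV)))"
      if cX: "!!i. eq.cfp i X \<in> MG_bar E T (p i)" and t: "t \<in> {0..T}" for t
    proof -
      let ?V = "%i. integral_upto E T (p i) (A i) t (mg_incl E T (p i) (eq.cfp i X))"
      have V: "?V i \<in> LGs (p i)" for i
      proof -
        obtain \<eta> where "mg_bar_approx E T (p i) \<eta> (eq.cfp i X)" using cX[of i] by (auto simp: MG_bar_def)
        from integral_upto_limit(1)[OF J pP MG_barD[OF cX] this t] show ?thesis .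
      qed
      have "\<forall>i. \<exists>v. v \<in> ?V i" using LG_ne[OF pP V] by blast
      from choice[OF this] obtain v where v: "!!i. v i \<in> ?V i" by blast
      note l = eq.comb_rep[where U="%i. inc (?V i)" and u=v, OF p12_1 inc_rep(1)[OF pP V] inc_rep(2)[OF pP V v]]
      let ?I = "%ij. Inr (Inl ij) :: unit + ('d \<times> 'd) + 'd" and ?S = "%j. Inr (Inr j) :: unit + ('d \<times> 'd) + 'd"
      have V1: "?V (Inl ()) \<in> LGs 1" "?V (?I ij) \<in> LGs 1" "?V (?S j) \<in> LGs 2" for ij j
        using V[of "Inl ()"] V[of "?I ij"] V[of "?S j"] by (simp_all add: p_def)
      note s1 = lg_sum_rep[where U="%ij. ?V (?I ij)" and u="%ij. v (?I ij)", OF p12_1 finite_class.finite_UNIV V1(2) v]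
      note s2 = lg_sum_rep[where U="%j. inc (?V (?S j))" and u="%j. v (?S j)", OF p12_1 finite_class.finite_UNIV
          inc_rep(1)[OF p12_2 V1(3)] inc_rep(2)[OF p12_2 V1(3) v]]
      note s3 = lg_add_rep[OF p12_1 s1(1) s2(1) s1(2) s2(2)]
      note s4 = lg_add_rep[OF p12_1 V1(1) s3(1) v s3(2)]
      note s5 = lg_add_rep[OF p12_1 emb_in(1)[OF p12_1 cyl_const] s4(1) emb_in(2)[OF p12_1 cyl_const] s4(2), of x\<^sub>0]
      have split: "(\<Sum>i\<in>UNIV. v i k w) = v (Inl ()) k w + ((\<Sum>ij\<in>UNIV. v (?I ij) k w) + (\<Sum>j\<in>UNIV. v (?S j) k w))" for k w
        by (simp add: sum_UNIV_Plus UNIV_unit)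
      have "eq.rhs X t = cls 1 (%k w. x\<^sub>0 + (\<Sum>i\<in>UNIV. v i k w))"
        unfolding eq.rhs_def by (rule LG_D(2)[OF p12_1 l])
      then show ?thesis unfolding split using LG_D(2)[OF p12_1 s5]
        by (simp add: p_def A_def c_def case_prod_unfold)
    qed
    show ?thesis unfolding eq.solves_def is_solution_def mem using rhs mem by (auto simp: time_def)
  qed
  then show ?thesis using eq.unique_solution by simp
qed

end
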